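(* Let $r\ge1$ and let $m_1,\dots,m_r\ge1$ and $d\ge 2$ be integers. The generating function $F^{\pi1}_{\vec m,d}(x_1,\dots,x_r,u)=\sum_{\vec s,t\ge0}\chi\bigl(\mathcal E^{\vec m,d}_{\pi1,\vec s,t}\bigr)x_1^{s_1}\cdots x_r^{s_r}u^t$ of the Euler characteristics of the Hodge splitting of the complex $\mathcal E^{\vec m,d}_{\pi1}$ of hairy graphs of genus one is $$F^{\pi1}_{\vec m,d}(x_1,\dots,x_r,u)=-\frac12\sum_{l\ge1}\frac{\varphi(l)\ln\bigl(1-(-1)^du^l\sum_{i=1}^r(-1)^{m_i}x_i^l\bigr)}l$$ $$+(-1)^{d+1}\,\frac{u^2\bigl(\sum_{i=1}^r(-1)^{m_i}x_i\bigr)^2+(-1)^du^2\sum_{i=1}^r(-1)^{m_i}x_i^2-2(-1)^du\sum_{i=1}^r(-1)^{m_i}x_i}{4\bigl(1-(-1)^du^2\sum_{i=1}^r(-1)^{m_i}x_i^2\bigr)}.$$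
   Context: $\varphi$ is Euler's totient function; logarithms and fractions are expanded as formal power series in $u$. Hairy graph-complex $\mathcal E_\pi^{\vec m,d}$: the graded $\mathbb Q$-vector space spanned by hairy graphs, i.e. finite connected graphs with a non-empty finite set of external vertices (hairs), which have valence $1$ and are colored by $\{1,\dots,r\}$, and a finite (possibly empty) set of non-labeled internal vertices of valence $\ge3$; multiple edges and tadpoles (self-loops) are allowed. Every edge is oriented, and each graph comes with an ordering of its orientation set, which consists of the edges (each of degree $d-1$), the internal vertices (each of degree $-d$) and the external vertices (of degree $-m_i$ if colored by $i$). Isomorphic such graphs are identified, changing the orientation of an edge produces the sign $(-1)^d$, and reordering the orientation set produces the Koszul sign of the permutation. The homological degree of a graph is the sum of degrees of the elements of its orientation set. The differential (of degree $-1$) is the sum over internal vertices of all their expansions into two internal vertices of valence $\ge3$ connected by a new edge. The Hodge multi-degree of a graph is $\vec s=(s_1,\dots,s_r)$, with $s_i$ the number of external vertices of color $i$; its complexity $t$ is the first Betti number of the graph obtained by gluing together all external vertices; its genus $g$ is its first Betti number. The differential preserves all three, and $\mathcal E^{\vec m,d}_{\pi g,\vec s,t}$ denotes the (finite-dimensional) subcomplex spanned by graphs of genus $g$, Hodge multi-degree $\vec s$ and complexity $t$; $\mathcal E^{\vec m,d}_{\pi g}=\bigoplus_{\vec s,t}\mathcal E^{\vec m,d}_{\pi g,\vec s,t}$ is the Hodge splitting. $\chi$ is the Euler characteristic $\sum_j(-1)^j\dim$ with respect to homological degree. *)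

theory Defs
  imports
    "HOL-Library.Poly_Mapping"
    "HOL-Computational_Algebra.Formal_Power_Series"
    "HOL-Number_Theory.Totient"
    "Graph_Theory.Digraph_Isomorphism"
begin

section \<open>Rational vector spaces with a given basis, and their quotients\<close>

text \<open>The free rational vector space on a type is the type of finitely supported functions to
  \<^typ>\<open>rat\<close>.\<close>

definition qscale :: "rat \<Rightarrow> ('a \<Rightarrow>\<^sub>0 rat) \<Rightarrow> ('a \<Rightarrow>\<^sub>0 rat)" where
  "qscale c f = Poly_Mapping.map (\<lambda>x. c * x) f"

lemma lookup_qscale [simp]: "Poly_Mapping.lookup (qscale c f) k = c * Poly_Mapping.lookup f k"
  by (simp add: qscale_def Poly_Mapping.map.rep_eq when_def)

interpretation qvec: vector_space "qscale :: rat \<Rightarrow> ('a \<Rightarrow>\<^sub>0 rat) \<Rightarrow> ('a \<Rightarrow>\<^sub>0 rat)"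
  by unfold_locales
    (auto intro!: poly_mapping_eqI simp: lookup_add algebra_simps)

text \<open>\<open>B\<close> is a finite set of vectors of \<open>V\<close> whose classes modulo the subspace \<open>W\<close> form a basis of
  the image of \<open>V\<close> in the quotient of the free vector space by \<open>W\<close> (and are pairwise distinct).
  It is not assumed that \<open>W\<close> is contained in \<open>V\<close>.\<close>

definition basis_mod :: "('a \<Rightarrow>\<^sub>0 rat) set \<Rightarrow> ('a \<Rightarrow>\<^sub>0 rat) set \<Rightarrow> ('a \<Rightarrow>\<^sub>0 rat) set \<Rightarrow> bool" where
  "basis_mod W V B \<longleftrightarrow> finite B \<and> B \<subseteq> V \<and>
     (\<forall>c. (\<Sum>b\<in>B. qscale (c b) b) \<in> W \<longrightarrow> (\<forall>b\<in>B. c b = 0)) \<and>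
     V \<subseteq> qvec.span (B \<union> W)"

text \<open>The dimension of the image of \<open>V\<close> in the quotient by \<open>W\<close>. As for the library's \<open>dim\<close>, the
  value is \<open>0\<close> if there is no finite basis.\<close>

definition dim_mod :: "('a \<Rightarrow>\<^sub>0 rat) set \<Rightarrow> ('a \<Rightarrow>\<^sub>0 rat) set \<Rightarrow> nat" where
  "dim_mod W V = (if \<exists>B. basis_mod W V B then card (SOME B. basis_mod W V B) else 0)"


section \<open>The first Betti number of a finite directed multigraph\<close>

text \<open>A graph is a one-dimensional complex, so its first rational homology is the kernel of the
  boundary map on the arc chains. (The directions of the arcs only affect signs.)\<close>

definition boundary :: "('v, 'e) pre_digraph \<Rightarrow> ('e \<Rightarrow>\<^sub>0 rat) \<Rightarrow> ('v \<Rightarrow>\<^sub>0 rat)" where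
  "boundary G c = (\<Sum>e\<in>Poly_Mapping.keys c.
     Poly_Mapping.single (head G e) (Poly_Mapping.lookup c e)
     - Poly_Mapping.single (tail G e) (Poly_Mapping.lookup c e))"

definition betti1 :: "('v, 'e) pre_digraph \<Rightarrow> nat" where
  "betti1 G = qvec.dim {c. Poly_Mapping.keys c \<subseteq> arcs G \<and> boundary G c = 0}"


section \<open>Hairy graphs\<close>

text \<open>The arcs of \<open>shape\<close> are the oriented edges; several arcs may join the same vertices, and loops
  are allowed. \<open>color\<close> is \<open>None\<close> on the internal vertices and \<open>Some i\<close> on the
  external vertices of color \<open>i\<close>. \<open>ordering\<close> enumerates the orientation set, which is the disjoint
  union of the vertices and the edges.\<close>

record hairy_graph =
  shape :: "(nat, nat) pre_digraph"
  color :: "nat \<Rightarrow> nat option"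
  ordering :: "(nat + nat) list"

definition external :: "hairy_graph \<Rightarrow> nat set" where
  "external \<Gamma> = {v \<in> verts (shape \<Gamma>). color \<Gamma> v \<noteq> None}"

definition internal :: "hairy_graph \<Rightarrow> nat set" where
  "internal \<Gamma> = {v \<in> verts (shape \<Gamma>). color \<Gamma> v = None}"

text \<open>A loop contributes 2 to the valence of its vertex.\<close>

definition valence :: "hairy_graph \<Rightarrow> nat \<Rightarrow> nat" where
  "valence \<Gamma> v = in_degree (shape \<Gamma>) v + out_degree (shape \<Gamma>) v"

definition is_hairy_graph :: "nat \<Rightarrow> hairy_graph \<Rightarrow> bool" where
  "is_hairy_graph r \<Gamma> \<longleftrightarrow>
     fin_digraph (shape \<Gamma>) \<and> connected (shape \<Gamma>) \<and>
     external \<Gamma> \<noteq> {} \<and>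
     (\<forall>v\<in>external \<Gamma>. valence \<Gamma> v = 1 \<and> (\<exists>i\<in>{1..r}. color \<Gamma> v = Some i)) \<and>
     (\<forall>v\<in>internal \<Gamma>. valence \<Gamma> v \<ge> 3) \<and>
     distinct (ordering \<Gamma>) \<and> set (ordering \<Gamma>) = verts (shape \<Gamma>) <+> arcs (shape \<Gamma>)"

fun elt_deg :: "(nat \<Rightarrow> nat) \<Rightarrow> nat \<Rightarrow> hairy_graph \<Rightarrow> nat + nat \<Rightarrow> int" where
  "elt_deg m d \<Gamma> (Inr e) = int d - 1"
| "elt_deg m d \<Gamma> (Inl v) = (case color \<Gamma> v of None \<Rightarrow> - int d | Some i \<Rightarrow> - int (m i))"

definition hdegree :: "(nat \<Rightarrow> nat) \<Rightarrow> nat \<Rightarrow> hairy_graph \<Rightarrow> int" where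
  "hdegree m d \<Gamma> = (\<Sum>x\<in>verts (shape \<Gamma>) <+> arcs (shape \<Gamma>). elt_deg m d \<Gamma> x)"

definition genus :: "hairy_graph \<Rightarrow> nat" where
  "genus \<Gamma> = betti1 (shape \<Gamma>)"

text \<open>The graph in which all external vertices are glued to one vertex, here called \<open>None\<close>.\<close>

definition glued :: "hairy_graph \<Rightarrow> (nat option, nat) pre_digraph" where
  "glued \<Gamma> = (let q = (\<lambda>v. if v \<in> external \<Gamma> then None else Some v) in
     \<lparr>verts = q ` verts (shape \<Gamma>), arcs = arcs (shape \<Gamma>),
      tail = (\<lambda>e. q (tail (shape \<Gamma>) e)), head = (\<lambda>e. q (head (shape \<Gamma>) e))\<rparr>)"

definition complexity :: "hairy_graph \<Rightarrow> nat" where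
  "complexity \<Gamma> = betti1 (glued \<Gamma>)"

definition hodge_degree :: "hairy_graph \<Rightarrow> nat \<Rightarrow> nat" where
  "hodge_degree \<Gamma> i = card {v \<in> verts (shape \<Gamma>). color \<Gamma> v = Some i}"


section \<open>The hairy graph-complex\<close>

definition hairy_iso :: "hairy_graph \<Rightarrow> hairy_graph \<Rightarrow> bool" where
  "hairy_iso \<Gamma> \<Gamma>' \<longleftrightarrow> (\<exists>f. pre_digraph.digraph_isomorphism (shape \<Gamma>) f \<and>
     shape \<Gamma>' = app_iso f (shape \<Gamma>) \<and>
     (\<forall>v\<in>verts (shape \<Gamma>). color \<Gamma>' (iso_verts f v) = color \<Gamma> v) \<and>
     ordering \<Gamma>' = map (map_sum (iso_verts f) (iso_arcs f)) (ordering \<Gamma>))"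

definition reverse_edge :: "nat \<Rightarrow> hairy_graph \<Rightarrow> hairy_graph" where
  "reverse_edge e \<Gamma> = \<Gamma>\<lparr>shape := (shape \<Gamma>)
     \<lparr>tail := (tail (shape \<Gamma>))(e := head (shape \<Gamma>) e),
      head := (head (shape \<Gamma>))(e := tail (shape \<Gamma>) e)\<rparr>\<rparr>"

definition precedes :: "'a list \<Rightarrow> 'a \<Rightarrow> 'a \<Rightarrow> bool" where
  "precedes xs a b \<longleftrightarrow> (\<exists>i j. i < j \<and> j < length xs \<and> xs ! i = a \<and> xs ! j = b)"

text \<open>The sign of passing from the order \<open>xs\<close> to the order \<open>ys\<close> of the same elements: every pair
  that changes its order contributes \<open>-1\<close> to the power of the product of the two degrees.\<close>

definition koszul_sign :: "('a \<Rightarrow> int) \<Rightarrow> 'a list \<Rightarrow> 'a list \<Rightarrow> rat" where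
  "koszul_sign deg xs ys = (\<Prod>(a, b)\<in>{(a, b). precedes xs a b \<and> precedes ys b a}.
     if odd (deg a * deg b) then - 1 else 1)"

abbreviation gvec :: "hairy_graph \<Rightarrow> (hairy_graph \<Rightarrow>\<^sub>0 rat)" where
  "gvec \<Gamma> \<equiv> Poly_Mapping.single \<Gamma> 1"

text \<open>The subspace of the free vector space on hairy graphs that is divided out.\<close>

definition hairy_relations :: "nat \<Rightarrow> (nat \<Rightarrow> nat) \<Rightarrow> nat \<Rightarrow> (hairy_graph \<Rightarrow>\<^sub>0 rat) set" where
  "hairy_relations r m d = qvec.span
     ({gvec \<Gamma>' - gvec \<Gamma> | \<Gamma> \<Gamma>'. is_hairy_graph r \<Gamma> \<and> hairy_iso \<Gamma> \<Gamma>'} \<union>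
      {gvec (reverse_edge e \<Gamma>) - qscale ((- 1) ^ d) (gvec \<Gamma>) | \<Gamma> e.
         is_hairy_graph r \<Gamma> \<and> e \<in> arcs (shape \<Gamma>)} \<union>
      {gvec (\<Gamma>\<lparr>ordering := ys\<rparr>) -
         qscale (koszul_sign (elt_deg m d \<Gamma>) (ordering \<Gamma>) ys) (gvec \<Gamma>) | \<Gamma> ys.
         is_hairy_graph r \<Gamma> \<and> distinct ys \<and> set ys = set (ordering \<Gamma>)})"

text \<open>The dimension of the part of homological degree \<open>j\<close> of the summand of genus \<open>g\<close>, Hodge
  multi-degree \<open>s\<close> and complexity \<open>t\<close> of the hairy graph-complex.\<close>

definition hairy_dim ::
  "nat \<Rightarrow> (nat \<Rightarrow> nat) \<Rightarrow> nat \<Rightarrow> nat \<Rightarrow> (nat \<Rightarrow> nat) \<Rightarrow> nat \<Rightarrow> int \<Rightarrow> nat" where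
  "hairy_dim r m d g s t j = dim_mod (hairy_relations r m d)
     (qvec.span {gvec \<Gamma> | \<Gamma>. is_hairy_graph r \<Gamma> \<and> genus \<Gamma> = g \<and> hodge_degree \<Gamma> = s \<and>
        complexity \<Gamma> = t \<and> hdegree m d \<Gamma> = j})"

text \<open>The Euler characteristic of the finite-dimensional complex of that genus, Hodge multi-degree
  and complexity. As an alternating sum of the dimensions of the terms, it does not depend on the
  differential, which is therefore not defined here.\<close>

definition hairy_euler ::
  "nat \<Rightarrow> (nat \<Rightarrow> nat) \<Rightarrow> nat \<Rightarrow> nat \<Rightarrow> (nat \<Rightarrow> nat) \<Rightarrow> nat \<Rightarrow> int" where
  "hairy_euler r m d g s t =
     (\<Sum>j | hairy_dim r m d g s t j \<noteq> 0. (- 1) ^ nat \<bar>j\<bar> * int (hairy_dim r m d g s t j))"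


section \<open>Formal power series in \<open>u\<close> over the polynomials in \<open>x\<^sub>1, x\<^sub>2, \<dots>\<close>\<close>

text \<open>Polynomials are finitely supported functions on the exponents, with the convolution product
  of the library; the variable \<open>u\<close> is \<^const>\<open>fps_X\<close>.\<close>

type_synonym qpoly = "(nat \<Rightarrow>\<^sub>0 nat) \<Rightarrow>\<^sub>0 rat"

definition xvar :: "nat \<Rightarrow> qpoly" where
  "xvar i = Poly_Mapping.single (Poly_Mapping.single i 1) 1"

definition qconst :: "rat \<Rightarrow> qpoly fps" where
  "qconst c = fps_const (Poly_Mapping.single 0 c)"

text \<open>The coefficient of \<open>x\<^sup>s u\<^sup>t\<close> in \<open>F\<close> is \<open>a s t\<close>.\<close>

definition is_gen_fun :: "((nat \<Rightarrow> nat) \<Rightarrow> nat \<Rightarrow> int) \<Rightarrow> qpoly fps \<Rightarrow> bool" where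
  "is_gen_fun a F \<longleftrightarrow>
     (\<forall>s t. Poly_Mapping.lookup (fps_nth F t) s = of_int (a (Poly_Mapping.lookup s) t))"

text \<open>The series of \<open>ln (1 - w)\<close> and \<open>1 / (1 - w)\<close>, for \<open>w\<close> without constant term. The rational
  coefficients of \<open>ln (1 + X)\<close> are those of the library's series \<^term>\<open>fps_ln 1\<close>.\<close>

definition fps_ln_1_minus :: "qpoly fps \<Rightarrow> qpoly fps" where
  "fps_ln_1_minus w = Abs_fps (\<lambda>k. Poly_Mapping.single 0 (fps_nth (fps_ln 1) k)) oo (- w)"

definition fps_geom :: "qpoly fps \<Rightarrow> qpoly fps" where
  "fps_geom w = Abs_fps (\<lambda>_. 1) oo w"

lemma fps_geom_inverse:
  assumes "fps_nth w 0 = 0"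
  shows "(1 - w) * fps_geom w = 1"
proof -
  have "(1 - fps_X) * Abs_fps (\<lambda>_. 1 :: qpoly) = 1"
    by (rule fps_ext) (auto simp: left_diff_distrib)
  hence "((1 - fps_X) * Abs_fps (\<lambda>_. 1 :: qpoly)) oo w = 1"
    by (simp add: fps_compose_1)
  thus ?thesis
    by (simp add: fps_compose_mult_distrib[OF assms] fps_compose_sub_distrib
        fps_X_fps_compose_startby0[OF assms] fps_geom_def)
qed

text \<open>An infinite sum of power series converges coefficientwise if each coefficient is
  eventually unaffected.\<close>

lemma fps_sums_subdegree:
  fixes T :: "nat \<Rightarrow> 'a :: comm_ring_1 fps"
  assumes "\<And>l n. n < l \<Longrightarrow> fps_nth (T l) n = 0"
  shows "T sums Abs_fps (\<lambda>n. \<Sum>l\<le>n. fps_nth (T l) n)"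
  unfolding sums_def
proof (rule tendsto_fpsI)
  fix n
  have "fps_nth (\<Sum>l<N. T l) n = (\<Sum>l\<le>n. fps_nth (T l) n)" if "N > n" for N
    unfolding fps_sum_nth by (rule sum.mono_neutral_right) (use that assms in auto)
  thus "eventually (\<lambda>N. fps_nth (\<Sum>l<N. T l) n =
          fps_nth (Abs_fps (\<lambda>n. \<Sum>l\<le>n. fps_nth (T l) n)) n) sequentially"
    by (auto intro: eventually_mono[OF eventually_gt_at_top[of n]])
qed

text \<open>The power sums \<open>\<Sum>\<^sub>i (-1)\<^bsup>m\<^sub>i\<^esup> x\<^sub>i\<^bsup>l\<^esup>\<close>.\<close>

definition psum :: "nat \<Rightarrow> (nat \<Rightarrow> nat) \<Rightarrow> nat \<Rightarrow> qpoly fps" where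
  "psum r m l = fps_const (\<Sum>i=1..r. (- 1) ^ m i * xvar i ^ l)"

end

theory Submission
  imports Defs
    "HOL-Combinatorics.Permutations"
    "HOL-Library.Nat_Bijection"
begin

text \<open>A graph of genus one has as many edges as vertices, so directing its edges towards the cycle makes
  it the graph of a self-map of its vertices, and labelling the \<open>n\<close> hairs leaves at most the reversal
  of the cycle as an automorphism: a vertex is determined by the set of labels behind it. The complex is
  therefore the space of coinvariants of a finite group, label permutations that respect the colours
  and cycle reversal, acting with signs on finitely many graphs, and its Euler characteristic is the
  average over the group of the signed numbers of fixed graphs. For a cycle vertex with at least two
  labels behind it, contracting or inserting an edge that carries all of them pairs off the fixed
  graphs with opposite signs. Only the hedgehogs survive, cycles with one hair at each vertex, and they
  leave a sum over the words of length \<open>n\<close> in the colours that are fixed by an element of the dihedral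
  group. The generating function of the words constant on the orbits of a permutation is a product of
  power sums over these orbits; the rotations give the logarithms and the reflections the rational
  part.\<close>

section \<open>Koszul signs of permutations\<close>

text \<open>In genus one the complexity equals the number of hairs, so the coefficient of u^t
  involves exactly t labels, and one colouring \<open>col\<close> of them can be fixed for all
  graphs of a given Hodge multi-degree.

  The obstacle is the signs. The Koszul sign of an automorphism looks global, but multiplied by the
  parity of the homological degree it becomes a product over the orbits of vertices and edges, with
  one factor (-1)^q for an orbit of elements of degree q. An internal vertex off the cycle and its
  outgoing edge then contribute (-1)^d (-1)^(d-1) = -1 for each orbit, whatever d is. This is why
  inserting one orbit of edges reverses the sign, and why all orders, cycles and trees can be
  treated separately.

  The 1/2 in front of the logarithms is left from 1/(2n), the inverse of the order of the dihedral
  group; the totient counts the rotations of a given order. The 1/4 arises because for even n the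
  reflections are of two kinds, half of them fixing two cycle vertices and half fixing none.\<close>

lemma precedes_Nil [simp]: "\<not> precedes [] a b"
  by (simp add: precedes_def)

lemma precedes_Cons:
  "precedes (x # xs) a b \<longleftrightarrow> (a = x \<and> b \<in> set xs) \<or> precedes xs a b"
proof
  assume "precedes (x # xs) a b"
  then obtain i j where ij: "i < j" "j < length (x # xs)" "(x # xs) ! i = a" "(x # xs) ! j = b"
    unfolding precedes_def by blast
  then obtain j' where j': "j = Suc j'" by (cases j) auto
  show "(a = x \<and> b \<in> set xs) \<or> precedes xs a b"
  proof (cases i)
    case 0
    then show ?thesis using ij j' by auto
  next
    case (Suc i')
    then show ?thesis using ij j' unfolding precedes_def by auto
  qed
next
  assume "(a = x \<and> b \<in> set xs) \<or> precedes xs a b"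
  then show "precedes (x # xs) a b"
  proof
    assume "a = x \<and> b \<in> set xs"
    then obtain j where "j < length xs" "xs ! j = b" "a = x" by (auto simp: in_set_conv_nth)
    then show ?thesis unfolding precedes_def
      by (intro exI[of _ 0] exI[of _ "Suc j"]) auto
  next
    assume "precedes xs a b"
    then obtain i j where "i < j" "j < length xs" "xs ! i = a" "xs ! j = b"
      unfolding precedes_def by blast
    then show ?thesis unfolding precedes_def
      by (intro exI[of _ "Suc i"] exI[of _ "Suc j"]) auto
  qed
qed

lemma precedes_set: "precedes xs a b \<Longrightarrow> a \<in> set xs \<and> b \<in> set xs"
  by (induction xs) (auto simp: precedes_Cons)

lemma precedes_append:
  "precedes (xs @ ys) a b \<longleftrightarrow> precedes xs a b \<or> precedes ys a b \<or> (a \<in> set xs \<and> b \<in> set ys)"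
  by (induction xs) (auto simp: precedes_Cons)

lemma precedes_neq: "distinct xs \<Longrightarrow> precedes xs a b \<Longrightarrow> a \<noteq> b"
  by (induction xs) (auto simp: precedes_Cons)

lemma precedes_asym: "distinct xs \<Longrightarrow> precedes xs a b \<Longrightarrow> \<not> precedes xs b a"
  by (induction xs) (auto simp: precedes_Cons dest: precedes_set)

lemma precedes_total:
  "a \<in> set xs \<Longrightarrow> b \<in> set xs \<Longrightarrow> a \<noteq> b \<Longrightarrow> precedes xs a b \<or> precedes xs b a"
  by (induction xs) (auto simp: precedes_Cons)

text \<open>Injectivity is asked for at \<open>a\<close> and \<open>b\<close> as well, because these
  need not occur in \<open>xs\<close> and \<open>h\<close> could otherwise move them onto its
  entries.\<close>

lemma precedes_map:
  assumes "inj_on h (insert a (insert b (set xs)))"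
  shows "precedes (map h xs) (h a) (h b) \<longleftrightarrow> precedes xs a b"
  using assms
proof (induction xs)
  case Nil
  then show ?case by simp
next
  case (Cons x xs)
  have "inj_on h (insert a (insert b (set xs)))"
    by (rule inj_on_subset[OF Cons.prems]) auto
  moreover have "h a = h x \<longleftrightarrow> a = x" by (rule inj_on_eq_iff[OF Cons.prems]) auto
  moreover have "h b \<in> h ` set xs \<longleftrightarrow> b \<in> set xs"
    by (rule inj_on_image_mem_iff[OF Cons.prems]) auto
  ultimately show ?case using Cons.IH by (simp add: precedes_Cons)
qed

definition kfac :: "('a \<Rightarrow> int) \<Rightarrow> 'a \<times> 'a \<Rightarrow> rat" where
  "kfac deg p = (if odd (deg (fst p) * deg (snd p)) then - 1 else 1)"

text \<open>Degrees are integers and may be negative, so the sign is read from the parity instead of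
  being written as a power.\<close>

definition psign :: "int \<Rightarrow> rat" where
  "psign k = (if odd k then - 1 else 1)"

lemma psign_add: "psign (a + b) = psign a * psign b"
  by (auto simp: psign_def)

lemma psign_square [simp]: "psign k * psign k = 1"
  by (auto simp: psign_def)

lemma psign_cases: "psign k = 1 \<or> psign k = - 1"
  by (auto simp: psign_def)

lemma kfac_square [simp]: "kfac deg p * kfac deg p = 1"
  by (auto simp: kfac_def)

lemma koszul_sign_kfac:
  "koszul_sign deg xs ys = prod (kfac deg) {(a, b). precedes xs a b \<and> precedes ys b a}"
  unfolding koszul_sign_def kfac_def by (intro prod.cong) auto

lemma finite_precedes: "finite {(a, b). precedes xs a b}"
  by (rule finite_subset[of _ "set xs \<times> set xs"]) (auto dest: precedes_set)

text \<open>A third order serves to pick one of the two ordered pairs for each unordered pair.\<close>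

lemma koszul_sign_reference:
  assumes "distinct xs" "distinct ys" "distinct zs" "set ys = set xs" "set zs = set xs"
  shows "koszul_sign deg ys zs =
    (\<Prod>p\<in>{(a, b). precedes xs a b}.
       if precedes ys (fst p) (snd p) \<noteq> precedes zs (fst p) (snd p) then kfac deg p else 1)"
proof -
  let ?I = "{(a, b). precedes ys a b \<and> precedes zs b a}"
  let ?J = "{(a, b). precedes xs a b \<and> precedes ys a b \<noteq> precedes zs a b}"
  have flip: "precedes ws b a \<longleftrightarrow> \<not> precedes ws a b"
    if "distinct ws" "set ws = set xs" "precedes xs a b \<or> precedes xs b a" for ws a b
    using that precedes_total[of a ws b] precedes_asym[of ws] precedes_neq[OF assms(1)]
      precedes_set[of xs] by metis
  \<comment> \<open>\<open>?I\<close> lists every inverted pair as ordered by \<open>ys\<close> and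
    \<open>?J\<close> lists it as ordered by \<open>xs\<close>; turning a pair around does not
    change its factor.\<close>
  have "prod (kfac deg) ?I = prod (kfac deg) ?J"
  proof (rule prod.reindex_bij_witness[where
        i = "\<lambda>(a, b). if precedes ys a b then (a, b) else (b, a)"
        and j = "\<lambda>(a, b). if precedes xs a b then (a, b) else (b, a)"])
    fix p assume p: "p \<in> ?I"
    obtain a b where ab: "p = (a, b)" by force
    have y: "precedes ys a b" "precedes zs b a" using p ab by auto
    have x: "precedes xs a b \<or> precedes xs b a"
      using y precedes_set[OF y(1)] precedes_neq[OF assms(2) y(1)] assms(4) precedes_total by metis
    note f = flip[OF assms(2,4), of a b] flip[OF assms(3,5), of a b] flip[OF assms(1) refl, of a b]
    show "(case (case p of (a, b) \<Rightarrow> if precedes xs a b then (a, b) else (b, a)) of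
        (a, b) \<Rightarrow> if precedes ys a b then (a, b) else (b, a)) = p"
      using x y f ab by auto
    show "(case p of (a, b) \<Rightarrow> if precedes xs a b then (a, b) else (b, a)) \<in> ?J"
      using x y f ab by auto
    show "kfac deg (case p of (a, b) \<Rightarrow> if precedes xs a b then (a, b) else (b, a)) = kfac deg p"
      using ab by (auto simp: kfac_def)
  next
    fix p assume p: "p \<in> ?J"
    obtain a b where ab: "p = (a, b)" by force
    have x: "precedes xs a b" "precedes ys a b \<noteq> precedes zs a b" using p ab by auto
    note f = flip[OF assms(2,4), of a b] flip[OF assms(3,5), of a b] flip[OF assms(1) refl, of a b]
    show "(case (case p of (a, b) \<Rightarrow> if precedes ys a b then (a, b) else (b, a)) of
        (a, b) \<Rightarrow> if precedes xs a b then (a, b) else (b, a)) = p"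
      using x f ab by auto
    show "(case p of (a, b) \<Rightarrow> if precedes ys a b then (a, b) else (b, a)) \<in> ?I"
      using x f ab by auto
  qed
  also have "\<dots> = (\<Prod>p\<in>{(a, b). precedes xs a b}.
       if precedes ys (fst p) (snd p) \<noteq> precedes zs (fst p) (snd p) then kfac deg p else 1)"
    by (subst prod.inter_filter[OF finite_precedes, symmetric], rule prod.cong) auto
  finally show ?thesis by (simp add: koszul_sign_kfac)
qed

text \<open>Written over the pairs ordered by \<open>xs\<close>, all three signs become products
  over one index set. A pair inverted in both steps contributes a square, which is 1.\<close>

lemma koszul_sign_trans:
  assumes "distinct xs" "distinct ys" "distinct zs" "set ys = set xs" "set zs = set xs"
  shows "koszul_sign deg xs ys * koszul_sign deg ys zs = koszul_sign deg xs zs"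
  unfolding koszul_sign_reference[OF assms(1) assms(1,2) refl assms(4)]
    koszul_sign_reference[OF assms] koszul_sign_reference[OF assms(1) assms(1,3) refl assms(5)]
    prod.distrib[symmetric]
  by (rule prod.cong) auto

lemma koszul_sign_refl: "distinct xs \<Longrightarrow> koszul_sign deg xs xs = 1"
  unfolding koszul_sign_kfac using precedes_asym[of xs] by (intro prod.neutral) blast

lemma koszul_sign_swap:
  assumes "distinct xs" "distinct ys" "set ys = set xs"
  shows "koszul_sign deg xs ys = koszul_sign deg ys xs"
  using koszul_sign_reference[OF assms(1) assms(1,2) refl assms(3), of deg]
    koszul_sign_reference[OF assms(1) assms(2,1) assms(3) refl, of deg]
  by (simp add: eq_commute)

lemma koszul_sign_cases: "koszul_sign deg xs ys = 1 \<or> koszul_sign deg xs ys = - 1"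
proof -
  have "finite A \<Longrightarrow> prod (kfac deg) A = 1 \<or> prod (kfac deg) A = - 1" for A
    by (induction A rule: finite_induct) (auto simp: kfac_def)
  moreover have "finite {(a, b). precedes xs a b \<and> precedes ys b a}"
    by (rule finite_subset[OF _ finite_precedes[of xs]]) auto
  ultimately show ?thesis unfolding koszul_sign_kfac by blast
qed

lemma koszul_sign_square [simp]: "koszul_sign deg xs ys * koszul_sign deg xs ys = 1"
  using koszul_sign_cases[of deg xs ys] by auto

lemma koszul_sign_cong:
  assumes "\<And>a. a \<in> set xs \<Longrightarrow> deg a = deg' a"
  shows "koszul_sign deg xs ys = koszul_sign deg' xs ys"
  unfolding koszul_sign_kfac
  by (rule prod.cong) (use assms in \<open>auto simp: kfac_def dest!: precedes_set\<close>)

lemma koszul_sign_map: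
  assumes "inj_on h (set xs)" "set ys = set xs"
  shows "koszul_sign deg (map h xs) (map h ys) = koszul_sign (deg \<circ> h) xs ys"
  unfolding koszul_sign_kfac
proof (rule prod.reindex_cong[where l = "map_prod h h"])
  show "inj_on (map_prod h h) {(a, b). precedes xs a b \<and> precedes ys b a}"
    by (rule inj_on_subset[OF map_prod_inj_on[OF assms(1,1)]]) (auto dest: precedes_set)
  show "{(a, b). precedes (map h xs) a b \<and> precedes (map h ys) b a} =
      map_prod h h ` {(a, b). precedes xs a b \<and> precedes ys b a}"
  proof -
    have pm: "precedes (map h xs) (h a) (h b) = precedes xs a b"
      "precedes (map h ys) (h a) (h b) = precedes ys a b" if "a \<in> set xs" "b \<in> set xs" for a b
      using that assms by (simp_all add: precedes_map insert_absorb)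
    show ?thesis
    proof (intro set_eqI iffI)
      fix p assume "p \<in> {(a, b). precedes (map h xs) a b \<and> precedes (map h ys) b a}"
      then obtain a b where p: "p = (a, b)" "precedes (map h xs) a b" "precedes (map h ys) b a"
        by auto
      then obtain a' b' where "a = h a'" "b = h b'" "a' \<in> set xs" "b' \<in> set xs"
        using precedes_set[OF p(2)] by auto
      then show "p \<in> map_prod h h ` {(a, b). precedes xs a b \<and> precedes ys b a}"
        using p pm by (intro image_eqI[of _ _ "(a', b')"]) auto
    next
      fix p assume "p \<in> map_prod h h ` {(a, b). precedes xs a b \<and> precedes ys b a}"
      then obtain a b where "p = (h a, h b)" "precedes xs a b" "precedes ys b a" by auto
      then show "p \<in> {(a, b). precedes (map h xs) a b \<and> precedes (map h ys) b a}"
        using pm precedes_set[of xs a b] by auto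
    qed
  qed
qed (auto simp: kfac_def)

text \<open>A pair with one entry in each block keeps its order, so every inversion happens inside a
  block.\<close>

lemma koszul_sign_append:
  assumes "distinct (xs @ ys)" "set xs' = set xs" "set ys' = set ys"
  shows "koszul_sign deg (xs @ ys) (xs' @ ys') = koszul_sign deg xs xs' * koszul_sign deg ys ys'"
proof -
  have eq: "{(a, b). precedes (xs @ ys) a b \<and> precedes (xs' @ ys') b a} =
     {(a, b). precedes xs a b \<and> precedes xs' b a} \<union> {(a, b). precedes ys a b \<and> precedes ys' b a}"
    using assms by (auto simp: precedes_append dest: precedes_set)
  have dj: "{(a, b). precedes xs a b \<and> precedes xs' b a} \<inter>
      {(a, b). precedes ys a b \<and> precedes ys' b a} = {}"
    using assms by (auto dest: precedes_set)
  have fin: "finite {(a, b). precedes us a b \<and> precedes us' b a}" for us us' :: "'a list"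
    by (rule finite_subset[OF _ finite_precedes[of us]]) auto
  show ?thesis unfolding koszul_sign_kfac eq by (rule prod.union_disjoint[OF fin fin dj])
qed

text \<open>Only the pairs of \<open>y\<close> with an entry of \<open>ys\<close> change their
  order. As the parities agree, the product of the two degrees is odd exactly when the degree of
  \<open>y\<close> is.\<close>

lemma koszul_sign_rotate1:
  assumes "distinct (y # ys)" "\<And>a. a \<in> set ys \<Longrightarrow> odd (deg a) = odd (deg y)"
  shows "koszul_sign deg (ys @ [y]) (y # ys) = psign (deg y) ^ length ys"
proof -
  have "{(a, b). precedes (ys @ [y]) a b \<and> precedes (y # ys) b a} = (\<lambda>a. (a, y)) ` set ys"
    using assms(1) precedes_asym[of ys]
    by (auto simp: precedes_append precedes_Cons dest: precedes_set)
  then have "koszul_sign deg (ys @ [y]) (y # ys) = (\<Prod>a\<in>set ys. kfac deg (a, y))"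
    unfolding koszul_sign_kfac by (simp add: prod.reindex inj_on_def)
  also have "\<dots> = (\<Prod>a\<in>set ys. psign (deg y))"
    using assms(2) by (intro prod.cong) (auto simp: kfac_def psign_def)
  also have "\<dots> = psign (deg y) ^ length ys" using assms(1) by (simp add: distinct_card)
  finally show ?thesis .
qed

section \<open>Orbits of a permutation of a finite set and products over the orbits\<close>

definition forb :: "('a \<Rightarrow> 'a) \<Rightarrow> 'a \<Rightarrow> 'a set" where
  "forb p a = range (\<lambda>k. (p ^^ k) a)"

lemma forb_self: "a \<in> forb p a"
  unfolding forb_def by (metis funpow_0 rangeI)

lemma forb_step:
  assumes "b \<in> forb p a"
  shows "p b \<in> forb p a"
proof -
  obtain k where "b = (p ^^ k) a" using assms unfolding forb_def by blast
  then have "p b = (p ^^ Suc k) a" by simp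
  then show ?thesis unfolding forb_def by (rule range_eqI)
qed

lemma forb_subset:
  assumes "p ` A \<subseteq> A" "a \<in> A"
  shows "forb p a \<subseteq> A"
proof -
  have "(p ^^ k) a \<in> A" for k by (induction k) (use assms in auto)
  then show ?thesis unfolding forb_def by auto
qed

lemma forb_cyclic:
  assumes "finite A" "bij_betw p A A" "a \<in> A"
  obtains k where "k > 0" "(p ^^ k) a = a" "inj_on (\<lambda>i. (p ^^ i) a) {..<k}"
    "forb p a = (\<lambda>i. (p ^^ i) a) ` {..<k}"
proof -
  have inA: "(p ^^ k) a \<in> A" for k
    by (induction k) (use assms in \<open>auto simp: bij_betw_def\<close>)
  \<comment> \<open>Injectivity strips common iterates, so the first repetition happens at
    \<open>a\<close> itself: the forward orbit has no tail leading into a cycle.\<close>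
  have cancel: "(p ^^ (j - i)) a = a" if "i \<le> j" "(p ^^ i) a = (p ^^ j) a" for i j
    using that
  proof (induction i arbitrary: j)
    case (Suc i)
    then obtain j' where j': "j = Suc j'" by (cases j) auto
    have "p ((p ^^ i) a) = p ((p ^^ j') a)" using Suc.prems j' by simp
    then have "(p ^^ i) a = (p ^^ j') a"
      using inA assms(2) by (auto simp: bij_betw_def dest: inj_onD)
    then show ?case using Suc.IH[of j'] Suc.prems j' by simp
  qed auto
  have "finite (range (\<lambda>i. (p ^^ i) a))"
    using inA assms(1) by (auto intro: finite_subset[of _ A])
  then have "\<not> inj (\<lambda>i. (p ^^ i) a)"
    using finite_imageD[of "\<lambda>i. (p ^^ i) a" UNIV] by auto
  then obtain i j where "i \<noteq> j" "(p ^^ i) a = (p ^^ j) a"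
    unfolding inj_def by blast
  then obtain i j where "i < j" "(p ^^ i) a = (p ^^ j) a"
    using linorder_neqE_nat[of i j] by metis
  then have ex: "\<exists>k>0. (p ^^ k) a = a" using cancel[of i j] by (intro exI[of _ "j - i"]) auto
  define k where "k = (LEAST k. k > 0 \<and> (p ^^ k) a = a)"
  have k: "k > 0" "(p ^^ k) a = a" using LeastI_ex[OF ex] unfolding k_def by auto
  have least: "k \<le> l" if "l > 0" "(p ^^ l) a = a" for l
    unfolding k_def using that by (intro Least_le) auto
  have "inj_on (\<lambda>i. (p ^^ i) a) {..<k}"
  proof (rule linorder_inj_onI)
    fix i j assume "i < j" "i \<in> {..<k}" "j \<in> {..<k}"
    then show "(p ^^ i) a \<noteq> (p ^^ j) a" using cancel[of i j] least[of "j - i"] by force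
  qed auto
  moreover have "forb p a = (\<lambda>i. (p ^^ i) a) ` {..<k}"
  proof -
    have "(p ^^ l) a \<in> (\<lambda>i. (p ^^ i) a) ` {..<k}" for l
      using funpow_mod_eq[OF k(2), of l] k by (intro image_eqI[of _ _ "l mod k"]) auto
    then show ?thesis unfolding forb_def by auto
  qed
  ultimately show thesis using that k by blast
qed

lemma forb_eq:
  assumes "finite A" "bij_betw p A A" "a \<in> A" "b \<in> forb p a"
  shows "forb p b = forb p a"
proof -
  obtain k where k: "k > 0" "(p ^^ k) a = a" "forb p a = (\<lambda>i. (p ^^ i) a) ` {..<k}"
    by (rule forb_cyclic[OF assms(1-3)])
  obtain i where i: "i < k" "b = (p ^^ i) a" using assms(4) k by auto
  have "(p ^^ l) b = (p ^^ (l + i)) a" for l by (simp add: i(2) funpow_add)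
  \<comment> \<open>From \<open>b\<close>, which is \<open>i\<close> steps after \<open>a\<close>,
    another \<open>k - i\<close> steps complete the period and lead back to
    \<open>a\<close>.\<close>
  moreover have "(p ^^ l) a = (p ^^ (l + (k - i))) b" for l
  proof -
    have "(p ^^ (l + (k - i))) b = (p ^^ (l + (k - i) + i)) a"
      unfolding i(2) by (simp only: funpow_add comp_apply)
    also have "\<dots> = (p ^^ l) ((p ^^ k) a)" using i(1) by (simp add: funpow_add)
    finally show ?thesis using k by simp
  qed
  ultimately show ?thesis unfolding forb_def by (auto intro: range_eqI)
qed

text \<open>Meant for sets on which the degree is constant, where it is (-1)^q for the common degree
  q; the quantifier reads the parity off without choosing an element.\<close>

definition osign :: "('a \<Rightarrow> int) \<Rightarrow> 'a set \<Rightarrow> rat" where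
  "osign deg C = (if \<exists>x\<in>C. odd (deg x) then - 1 else 1)"

definition orbprod :: "('a set \<Rightarrow> 'b::comm_monoid_mult) \<Rightarrow> ('a \<Rightarrow> 'a) \<Rightarrow> 'a set \<Rightarrow> 'b" where
  "orbprod h p A = (\<Prod>C\<in>forb p ` A. h C)"

lemma orbprod_Un:
  assumes "finite A" "finite B" "A \<inter> B = {}" "p ` A \<subseteq> A" "p ` B \<subseteq> B"
  shows "orbprod h p (A \<union> B) = orbprod h p A * orbprod h p B"
proof -
  have "forb p ` A \<inter> forb p ` B = {}"
    using forb_subset[OF assms(4)] forb_subset[OF assms(5)] forb_self[of _ p] assms(3) by blast
  then show ?thesis unfolding orbprod_def image_Un
    using assms by (intro prod.union_disjoint) auto
qed

text \<open>Since \<open>p\<close> preserves degrees, passing from \<open>xs\<close> to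
  \<open>ws\<close> costs the same sign before and after applying \<open>p\<close>, and the two
  costs cancel. The sign belongs to the permutation and not to the order in which it is
  measured.\<close>

lemma koszul_sign_map_cong:
  assumes "distinct xs" "distinct ws" "set ws = set xs" "bij_betw p (set xs) (set xs)"
    "\<And>a. a \<in> set xs \<Longrightarrow> deg (p a) = deg a"
  shows "koszul_sign deg (map p xs) xs = koszul_sign deg (map p ws) ws"
proof -
  have inj: "inj_on p (set xs)" and img: "p ` set xs = set xs"
    using assms(4) by (auto simp: bij_betw_def)
  have d: "distinct (map p xs)" "distinct (map p ws)"
    using assms(1-3) inj by (auto simp: distinct_map)
  have "koszul_sign deg (map p xs) (map p ws) = koszul_sign deg xs ws"
    using koszul_sign_map[OF inj assms(3)] koszul_sign_cong[of xs "deg \<circ> p" deg ws] assms(5) by simp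
  moreover have "koszul_sign deg (map p xs) (map p ws) * koszul_sign deg (map p ws) xs =
      koszul_sign deg (map p xs) xs"
    by (rule koszul_sign_trans[OF d assms(1)]) (use assms(3) img in auto)
  moreover have "koszul_sign deg (map p ws) ws * koszul_sign deg ws xs =
      koszul_sign deg (map p ws) xs"
    by (rule koszul_sign_trans[OF d(2) assms(2,1)]) (use assms(3) img in auto)
  ultimately show ?thesis
    using koszul_sign_swap[OF assms(1,2,3), of deg] koszul_sign_square[of deg xs ws]
    by (metis mult.assoc mult.commute mult.right_neutral)
qed

text \<open>A cycle of length \<open>k\<close> on elements of degree \<open>q\<close> has sign \<open>(-1)\<^bsup>(k-1)q\<^esup>\<close>, and together with
  the parity \<open>kq\<close> of the sum of the degrees this leaves \<open>(-1)\<^bsup>q\<^esup>\<close>.\<close>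

lemma koszul_sign_orbits:
  assumes "finite A" "bij_betw p A A" "\<And>a. a \<in> A \<Longrightarrow> deg (p a) = deg a"
    "distinct xs" "set xs = A"
  shows "koszul_sign deg (map p xs) xs * psign (\<Sum>a\<in>A. deg a) = orbprod (osign deg) p A"
  using assms
proof (induction "card A" arbitrary: A xs rule: less_induct)
  case less
  show ?case
  proof (cases "A = {}")
    case True
    then show ?thesis using less.prems koszul_sign_refl[of "[]" deg]
      by (simp add: orbprod_def psign_def)
  next
    case False
    then obtain a where a: "a \<in> A" by blast
    obtain k where k: "k > 0" "(p ^^ k) a = a" "inj_on (\<lambda>i. (p ^^ i) a) {..<k}"
      "forb p a = (\<lambda>i. (p ^^ i) a) ` {..<k}"
      by (rule forb_cyclic[OF less.prems(1,2) a])
    let ?O = "forb p a" and ?B = "A - forb p a"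
    have OA: "?O \<subseteq> A" using less.prems(2) a by (intro forb_subset) (auto simp: bij_betw_def)
    have finO: "finite ?O" using k(4) by simp
    obtain k' where k': "k = Suc k'" using k(1) by (cases k) auto
    define ys where "ys = map (\<lambda>i. (p ^^ i) a) [1..<k]"
    have ay: "a # ys = map (\<lambda>i. (p ^^ i) a) [0..<k]"
      unfolding ys_def using k(1) by (simp add: upt_conv_Cons)
    have set_ay: "set (a # ys) = ?O" unfolding ay k(4) by (auto simp: atLeast0LessThan)
    have dist_ay: "distinct (a # ys)" unfolding ay distinct_map
      using k(3) by (auto simp: atLeast0LessThan)
    have map_ay: "map p (a # ys) = ys @ [a]"
    proof -
      have "map p (a # ys) = map (\<lambda>i. (p ^^ i) a) [1..<Suc k]"
        unfolding ay by (simp add: map_Suc_upt[symmetric] o_def del: upt_Suc)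
      also have "\<dots> = ys @ [a]" unfolding ys_def using k by (simp)
      finally show ?thesis .
    qed
    have inA: "(p ^^ i) a \<in> A" for i using OA unfolding forb_def by auto
    have degk: "deg ((p ^^ i) a) = deg a" for i
      by (induction i) (simp_all add: less.prems(3)[OF inA])
    have degO: "deg b = deg a" if "b \<in> ?O" for b
      using that degk unfolding forb_def by fastforce
    have bijO: "bij_betw p ?O ?O"
    proof -
      have "p ` ?O \<subseteq> ?O" using forb_step by fastforce
      moreover have "inj_on p ?O" using less.prems(2) OA by (auto simp: bij_betw_def inj_on_subset)
      ultimately show ?thesis using finO by (simp add: bij_betw_def endo_inj_surj)
    qed
    have bijB: "bij_betw p ?B ?B"
      using bij_betw_DiffI[OF less.prems(2) bijO OA OA] by simp
    obtain zs where zs: "set zs = ?B" "distinct zs"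
      using finite_distinct_list[of ?B] less.prems(1) by auto
    \<comment> \<open>The order is chosen to suit \<open>p\<close>: the cycle of \<open>a\<close> in
      cyclic order, then everything else. On the first block \<open>p\<close> is a rotation by one
      place.\<close>
    have "koszul_sign deg (map p xs) xs = koszul_sign deg (map p ((a # ys) @ zs)) ((a # ys) @ zs)"
    proof (rule koszul_sign_map_cong)
      show "distinct ((a # ys) @ zs)" unfolding distinct_append set_ay zs(1) using dist_ay zs(2) by blast
      show "set ((a # ys) @ zs) = set xs"
        unfolding set_append set_ay zs less.prems(5) using OA by blast
    qed (use less.prems in auto)
    also have "\<dots> = koszul_sign deg ((ys @ [a]) @ map p zs) ((a # ys) @ zs)"
      unfolding map_append map_ay ..
    also have "\<dots> = koszul_sign deg (ys @ [a]) (a # ys) * koszul_sign deg (map p zs) zs"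
    proof (rule koszul_sign_append)
      have "set (map p zs) = ?B" using bijB zs by (simp add: bij_betw_def)
      moreover have "distinct (map p zs)" using bijB zs by (simp add: bij_betw_def distinct_map)
      moreover have "set (ys @ [a]) = ?O" using set_ay by auto
      moreover have "distinct (ys @ [a])" using dist_ay by auto
      ultimately show "distinct ((ys @ [a]) @ map p zs)"
        unfolding distinct_append[of "ys @ [a]"] by blast
      show "set zs = set (map p zs)" using bijB zs by (simp add: bij_betw_def)
    qed auto
    also have "koszul_sign deg (ys @ [a]) (a # ys) = psign (deg a) ^ length ys"
      by (rule koszul_sign_rotate1[OF dist_ay]) (metis degO set_ay list.set_intros(2))
    finally have K: "koszul_sign deg (map p xs) xs =
        psign (deg a) ^ length ys * koszul_sign deg (map p zs) zs" .
    have IH: "koszul_sign deg (map p zs) zs * psign (\<Sum>a\<in>?B. deg a) = orbprod (osign deg) p ?B"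
    proof (rule less.hyps)
      have "?B \<subset> A" using a forb_self[of a p] by blast
      then show "card ?B < card A" using less.prems(1) by (rule psubset_card_mono[rotated])
      show "finite ?B" using less.prems(1) by simp
      show "deg (p b) = deg b" if "b \<in> ?B" for b using that less.prems(3) by simp
    qed (fact bijB zs)+
    have "(\<Sum>a\<in>A. deg a) = (\<Sum>a\<in>?B. deg a) + (\<Sum>a\<in>?O. deg a)"
      using less.prems(1) OA by (simp add: sum.subset_diff)
    moreover have "(\<Sum>a\<in>?O. deg a) = of_nat (card ?O) * deg a" using degO by simp
    moreover have "card ?O = Suc (length ys)"
      unfolding set_ay[symmetric] distinct_card[OF dist_ay] by simp
    moreover have "psign (of_nat (Suc l) * deg a) * psign (deg a) ^ l = psign (deg a)" for l
      by (cases "odd (deg a)"; cases "odd l") (auto simp: psign_def)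
    ultimately have sumA: "psign (\<Sum>a\<in>A. deg a) * psign (deg a) ^ length ys =
        psign (\<Sum>a\<in>?B. deg a) * psign (deg a)"
      by (simp only: psign_add mult.assoc)
    have "koszul_sign deg (map p xs) xs * psign (\<Sum>a\<in>A. deg a) =
        koszul_sign deg (map p zs) zs * (psign (\<Sum>a\<in>A. deg a) * psign (deg a) ^ length ys)"
      unfolding K by (simp only: ac_simps)
    also have "\<dots> = psign (deg a) * orbprod (osign deg) p ?B"
      unfolding sumA IH[symmetric] by (simp only: ac_simps)
    also have "psign (deg a) = orbprod (osign deg) p ?O"
    proof -
      have "forb p ` ?O = {?O}"
        using forb_eq[OF less.prems(1,2) a] forb_self[of a p] by blast
      moreover have "(\<exists>x\<in>?O. odd (deg x)) \<longleftrightarrow> odd (deg a)"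
        using degO forb_self[of a p] by metis
      ultimately show ?thesis by (simp add: orbprod_def osign_def psign_def)
    qed
    also have "orbprod (osign deg) p ?O * orbprod (osign deg) p ?B = orbprod (osign deg) p A"
    proof -
      have "orbprod (osign deg) p (?O \<union> ?B) = orbprod (osign deg) p ?O * orbprod (osign deg) p ?B"
        by (rule orbprod_Un) (use finO less.prems(1) bijO bijB in \<open>auto simp: bij_betw_def\<close>)
      moreover have "?O \<union> ?B = A" using OA by blast
      ultimately show ?thesis by simp
    qed
    finally show ?thesis .
  qed
qed

section \<open>Quotients by signed equivalence relations\<close>

text \<open>The linear functional on the free vector space with prescribed values \<open>f\<close>
  on the basis. Such functionals detect that a combination does not lie in the subspace of
  relations.\<close>

definition pairing :: "('a \<Rightarrow> rat) \<Rightarrow> ('a \<Rightarrow>\<^sub>0 rat) \<Rightarrow> rat" where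
  "pairing f v = (\<Sum>x\<in>Poly_Mapping.keys v. Poly_Mapping.lookup v x * f x)"

lemma pairing_superset:
  assumes "finite S" "Poly_Mapping.keys v \<subseteq> S"
  shows "pairing f v = (\<Sum>x\<in>S. Poly_Mapping.lookup v x * f x)"
  unfolding pairing_def using assms by (intro sum.mono_neutral_left) (auto simp: in_keys_iff)

lemma pairing_add: "pairing f (v + w) = pairing f v + pairing f w"
proof -
  let ?S = "Poly_Mapping.keys v \<union> Poly_Mapping.keys w"
  have "pairing f (v + w) = (\<Sum>x\<in>?S. Poly_Mapping.lookup (v + w) x * f x)"
    by (rule pairing_superset) (use Poly_Mapping.keys_add[of v w] in auto)
  also have "\<dots> = (\<Sum>x\<in>?S. Poly_Mapping.lookup v x * f x) + (\<Sum>x\<in>?S. Poly_Mapping.lookup w x * f x)"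
    by (simp add: lookup_add algebra_simps sum.distrib)
  also have "\<dots> = pairing f v + pairing f w"
    using pairing_superset[of ?S v f] pairing_superset[of ?S w f] by simp
  finally show ?thesis .
qed

lemma pairing_qscale: "pairing f (qscale c v) = c * pairing f v"
proof -
  have "pairing f (qscale c v) = (\<Sum>x\<in>Poly_Mapping.keys v. Poly_Mapping.lookup (qscale c v) x * f x)"
    by (rule pairing_superset) (auto simp: in_keys_iff)
  then show ?thesis by (simp add: pairing_def sum_distrib_left mult.assoc)
qed

lemma pairing_zero [simp]: "pairing f 0 = 0"
  by (simp add: pairing_def)

lemma pairing_single [simp]: "pairing f (Poly_Mapping.single x 1) = f x"
  by (simp add: pairing_def)

lemma qscale_uminus: "- v = qscale (- 1) v"
  by (rule poly_mapping_eqI) simp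

lemma pairing_diff: "pairing f (v - w) = pairing f v - pairing f w"
proof -
  have "pairing f (- w) = - pairing f w" by (subst qscale_uminus) (simp only: pairing_qscale mult_minus1)
  then show ?thesis using pairing_add[of f v "- w"] by simp
qed

lemma pairing_span:
  assumes "v \<in> qvec.span S" "\<And>x. x \<in> S \<Longrightarrow> pairing f x = 0"
  shows "pairing f v = 0"
  using assms(1)
  by (induction rule: qvec.span_induct_alt) (simp_all add: pairing_add pairing_qscale assms(2))

lemma pairing_sum: "pairing f (\<Sum>i\<in>I. v i) = (\<Sum>i\<in>I. pairing f (v i))"
  by (induction I rule: infinite_finite_induct) (simp_all add: pairing_add)

text \<open>\<open>R x y e\<close> stands for: in the quotient, \<open>y\<close> is \<open>e\<close>
  times \<open>x\<close>. The last assumption says that \<open>W\<close> imposes nothing beyond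
  \<open>R\<close>, since every functional compatible with \<open>R\<close> vanishes on
  \<open>W\<close>. If \<open>x\<close> is related to itself with sign -1, its class is zero; this
  is how graphs with an odd automorphism disappear.\<close>

locale signed_relation =
  fixes R :: "'a \<Rightarrow> 'a \<Rightarrow> rat \<Rightarrow> bool" and W :: "('a \<Rightarrow>\<^sub>0 rat) set"
  assumes sym: "R x y e \<Longrightarrow> R y x e"
    and trans: "R x y e \<Longrightarrow> R y z e' \<Longrightarrow> R x z (e * e')"
    and sign: "R x y e \<Longrightarrow> e = 1 \<or> e = - 1"
    and subspace: "qvec.subspace W"
    and rel_in: "R x y e \<Longrightarrow> Poly_Mapping.single y 1 - qscale e (Poly_Mapping.single x 1) \<in> W"
    and pairing_rel: "(\<And>x y e. R x y e \<Longrightarrow> f y = e * f x) \<Longrightarrow> w \<in> W \<Longrightarrow> pairing f w = 0"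
begin

lemma sign_unique:
  assumes "\<not> R p p (- 1)" "R p x e" "R p x f"
  shows "e = f"
  using sign[OF assms(2)] sign[OF assms(3)] trans[OF assms(2) sym[OF assms(3)]] assms(1) by auto

text \<open>The coordinate dual to the class of \<open>p\<close>. The sign is unique, and the
  description therefore well defined, as soon as \<open>p\<close> is not related to itself with sign
  -1.\<close>

definition functional :: "'a \<Rightarrow> 'a \<Rightarrow> rat" where
  "functional p x = (if \<exists>e. R p x e then THE e. R p x e else 0)"

lemma functional_eq: "\<not> R p p (- 1) \<Longrightarrow> R p x e \<Longrightarrow> functional p x = e"
  unfolding functional_def using sign_unique by (metis (no_types, lifting) theI)

lemma functional_rel:
  assumes "\<not> R p p (- 1)" "R x y e"
  shows "functional p y = e * functional p x"
proof (cases "\<exists>f. R p x f")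
  case True
  then obtain f where "R p x f" by blast
  then show ?thesis using functional_eq[OF assms(1)] trans assms(2) by (metis mult.commute)
next
  case False
  then have "\<not> (\<exists>f. R p y f)" using trans sym assms(2) by blast
  then show ?thesis using False by (simp add: functional_def)
qed

lemma pairing_functional: "\<not> R p p (- 1) \<Longrightarrow> w \<in> W \<Longrightarrow> pairing (functional p) w = 0"
  using pairing_rel functional_rel by blast

text \<open>Modulo \<open>W\<close> every basis vector from \<open>D\<close> either vanishes or is
  plus or minus one of the representatives. The functionals of the representatives vanish on
  \<open>W\<close> and are dual to the representatives, so the latter stay independent in the
  quotient. The map \<open>L\<close> collects these coordinates: it kills \<open>W\<close>, fixes
  \<open>P\<close> and moves each vector of the span only by an element of \<open>W\<close>.\<close>

lemma dim_mod_reps: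
  assumes fin: "finite P" and PD: "P \<subseteq> D"
    and good: "\<And>p. p \<in> P \<Longrightarrow> R p p 1 \<and> \<not> R p p (- 1)"
    and sep: "\<And>p q e. p \<in> P \<Longrightarrow> q \<in> P \<Longrightarrow> R p q e \<Longrightarrow> p = q"
    and cov: "\<And>x. x \<in> D \<Longrightarrow> R x x (- 1) \<or> (\<exists>p\<in>P. \<exists>e. R p x e)"
  shows "dim_mod W (qvec.span ((\<lambda>x. Poly_Mapping.single x 1) ` D)) = card P"
proof -
  let ?s = "\<lambda>x. Poly_Mapping.single x (1::rat)"
  let ?V = "qvec.span (?s ` D)"
  have inj: "inj_on ?s P" by (rule inj_onI) (metis lookup_single_eq lookup_single_not_eq zero_neq_one)
  have funP: "functional p q = (if p = q then 1 else 0)" if "p \<in> P" "q \<in> P" for p q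
  proof (cases "p = q")
    case True
    then show ?thesis using functional_eq[of p q 1] good[OF that(1)] by simp
  next
    case False
    then show ?thesis using sep[OF that] by (auto simp: functional_def)
  qed
  define L where "L v = (\<Sum>p\<in>P. qscale (pairing (functional p) v) (?s p))" for v
  interpret L: Vector_Spaces.linear qscale qscale L
  proof unfold_locales
    fix v w :: "'a \<Rightarrow>\<^sub>0 rat" and c :: rat
    show "L (v + w) = L v + L w"
      by (simp add: L_def pairing_add qvec.scale_left_distrib sum.distrib)
    show "L (qscale c v) = qscale c (L v)"
      by (simp add: L_def pairing_qscale qvec.scale_sum_right)
  qed
  have LP: "L v \<in> qvec.span (?s ` P)" for v
    unfolding L_def by (rule qvec.span_sum, rule qvec.span_scale, rule qvec.span_base) simp
  have LW: "L w = 0" if "w \<in> W" for w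
    unfolding L_def using pairing_functional good that by (intro sum.neutral) auto
  have Ls: "L (?s p) = ?s p" if "p \<in> P" for p
  proof -
    have "L (?s p) = (\<Sum>q\<in>P. if q = p then ?s p else 0)"
      unfolding L_def using funP[OF _ that] by (intro sum.cong) auto
    then show ?thesis using fin that by simp
  qed
  have VL: "v - L v \<in> W" if "v \<in> ?V" for v
    using that
  proof (induction rule: qvec.span_induct_alt)
    case base
    then show ?case using qvec.subspace_0[OF subspace] by (simp add: L.zero)
  next
    case (step c x y)
    obtain d where d: "d \<in> D" "x = ?s d" using step.hyps by auto
    have "x - L x \<in> W"
    proof (cases "R d d (- 1)")
      case True
      \<comment> \<open>The relation says that twice the vector lies in \<open>W\<close>; rational
        coefficients permit halving.\<close>
      have "qscale (1 / 2) (?s d - qscale (- 1) (?s d)) \<in> W"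
        by (rule qvec.subspace_scale[OF subspace rel_in[OF True]])
      moreover have "qscale (1 / 2) (?s d - qscale (- 1) (?s d)) = ?s d"
        by (rule poly_mapping_eqI) (simp add: lookup_minus lookup_add)
      ultimately have "x \<in> W" using d by simp
      then show ?thesis using LW by simp
    next
      case False
      then obtain p e where p: "p \<in> P" "R p d e" using cov d by blast
      have w: "x - qscale e (?s p) \<in> W" using rel_in[OF p(2)] d by simp
      then have "L x = qscale e (?s p)" using LW[OF w] Ls[OF p(1)] by (simp add: L.diff L.scale)
      then show ?thesis using w by simp
    qed
    then have "qscale c (x - L x) + (y - L y) \<in> W"
      using step.IH by (intro qvec.subspace_add[OF subspace] qvec.subspace_scale[OF subspace])
    then show ?case by (simp add: L.add L.scale qvec.scale_right_diff_distrib algebra_simps)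
  qed
  \<comment> \<open>\<open>dim_mod\<close> selects some basis by choice, so all of them must have
    the same size. \<open>L\<close> carries any of them bijectively onto a basis of the span of
    \<open>P\<close>.\<close>
  have unique: "card B = card P" if B: "basis_mod W ?V B" for B
  proof -
    have fB: "finite B" and BV: "B \<subseteq> ?V" and VB: "?V \<subseteq> qvec.span (B \<union> W)"
      and ind: "\<And>c. (\<Sum>b\<in>B. qscale (c b) b) \<in> W \<Longrightarrow> \<forall>b\<in>B. c b = 0"
      using B unfolding basis_mod_def by blast+
    have ker: "v \<in> W" if "v \<in> ?V" "L v = 0" for v using VL[OF that(1)] that(2) by simp
    have comb: "c b = 0" if "(\<Sum>b\<in>B. qscale (c b) (L b)) = 0" "b \<in> B" for c b
    proof -
      have "L (\<Sum>b\<in>B. qscale (c b) b) = 0" using that(1) by (simp add: L.sum L.scale)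
      moreover have "(\<Sum>b\<in>B. qscale (c b) b) \<in> ?V"
        using BV by (intro qvec.span_sum qvec.span_scale) auto
      ultimately show ?thesis using ind ker that(2) by blast
    qed
    have injL: "inj_on L B"
    proof (rule inj_onI, rule ccontr)
      fix b b' assume b: "b \<in> B" "b' \<in> B" "L b = L b'" "b \<noteq> b'"
      \<comment> \<open>If \<open>L\<close> identified \<open>b\<close> and \<open>b'\<close>, their
        difference would be a non-trivial combination in the kernel of \<open>L\<close>, hence in
        \<open>W\<close>.\<close>
      let ?c = "\<lambda>x. if x = b then 1 else if x = b' then - 1 else (0::rat)"
      have "(\<Sum>x\<in>B. qscale (?c x) (L x)) = (\<Sum>x\<in>{b, b'}. qscale (?c x) (L x))"
        using b fB by (intro sum.mono_neutral_right) auto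
      also have "\<dots> = 0" using b by (simp add: qscale_uminus[symmetric])
      finally show False using comb[of ?c b] b by simp
    qed
    have indL: "qvec.independent (L ` B)"
    proof (rule qvec.independent_if_scalars_zero)
      fix f x assume s: "(\<Sum>x\<in>L ` B. qscale (f x) x) = 0" and x: "x \<in> L ` B"
      have "(\<Sum>b\<in>B. qscale (f (L b)) (L b)) = 0" using s injL by (simp add: sum.reindex)
      then show "f x = 0" using comb[of "\<lambda>b. f (L b)"] x by auto
    qed (use fB in simp)
    have "qvec.span (L ` B) = qvec.span (?s ` P)"
    proof (rule antisym; rule qvec.span_minimal)
      show "L ` B \<subseteq> qvec.span (?s ` P)"
        using LP by blast
      show "?s ` P \<subseteq> qvec.span (L ` B)"
      proof clarify
        fix p assume p: "p \<in> P"
        then have "?s p \<in> ?V" using PD by (auto intro: qvec.span_base)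
        then have "?s p \<in> qvec.span (B \<union> W)" using VB by blast
        then have "L (?s p) \<in> qvec.span (L ` (B \<union> W))" using L.span_image by blast
        moreover have "L ` (B \<union> W) \<subseteq> qvec.span (L ` B)"
          using LW by (auto simp: qvec.span_zero intro: qvec.span_base)
        ultimately have "L (?s p) \<in> qvec.span (L ` B)"
          by (metis qvec.span_minimal qvec.subspace_span subsetD)
        then show "?s p \<in> qvec.span (L ` B)" using Ls[OF p] by simp
      qed
    qed (rule qvec.subspace_span)+
    then have "card (L ` B) = qvec.dim (?s ` P)" using qvec.dim_eq_card[OF _ indL] by metis
    moreover have "qvec.independent (?s ` P)"
    proof (rule qvec.independent_if_scalars_zero)
      fix f x assume s: "(\<Sum>x\<in>?s ` P. qscale (f x) x) = 0" and x: "x \<in> ?s ` P"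
      obtain p where p: "p \<in> P" "x = ?s p" using x by blast
      have "0 = pairing (functional p) (\<Sum>x\<in>?s ` P. qscale (f x) x)" by (simp add: s)
      also have "\<dots> = (\<Sum>q\<in>P. f (?s q) * functional p q)"
        using inj by (simp add: pairing_sum pairing_qscale sum.reindex)
      also have "\<dots> = (\<Sum>q\<in>P. if q = p then f x else 0)"
        using p funP by (intro sum.cong) auto
      finally show "f x = 0" using p fin by simp
    qed (use fin in simp)
    ultimately show ?thesis
      using qvec.dim_eq_card[OF refl] card_image[OF injL] card_image[OF inj] by metis
  qed
  have "basis_mod W ?V (?s ` P)"
    unfolding basis_mod_def
  proof (intro conjI allI impI)
    show "?s ` P \<subseteq> ?V" using PD by (auto intro: qvec.span_base)
    show "\<forall>b\<in>?s ` P. c b = 0" if "(\<Sum>b\<in>?s ` P. qscale (c b) b) \<in> W" for c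
    proof clarify
      fix p assume p: "p \<in> P"
      have "0 = pairing (functional p) (\<Sum>x\<in>?s ` P. qscale (c x) x)"
        using pairing_functional that good[OF p] by simp
      also have "\<dots> = (\<Sum>q\<in>P. c (?s q) * functional p q)"
        using inj by (simp add: pairing_sum pairing_qscale sum.reindex)
      also have "\<dots> = (\<Sum>q\<in>P. if q = p then c (?s p) else 0)"
        using p funP by (intro sum.cong) auto
      finally show "c (?s p) = 0" using p fin by simp
    qed
    show "?V \<subseteq> qvec.span (?s ` P \<union> W)"
    proof
      fix v assume v: "v \<in> ?V"
      have "L v \<in> qvec.span (?s ` P \<union> W)"
        using LP[of v] qvec.span_mono[of "?s ` P" "?s ` P \<union> W"] by blast
      moreover have "v - L v \<in> qvec.span (?s ` P \<union> W)"
        using VL[OF v] by (auto intro: qvec.span_base)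
      ultimately have "(v - L v) + L v \<in> qvec.span (?s ` P \<union> W)" by (intro qvec.span_add)
      then show "v \<in> qvec.span (?s ` P \<union> W)" by simp
    qed
  qed (use fin in simp)
  then show ?thesis unfolding dim_mod_def using unique someI_ex by (metis (mono_tags, lifting))
qed

end

section \<open>A signed orbit count\<close>

text \<open>The sign is a cocycle: it depends on the point as well as on the group element. On the
  stabilizer of a point the rule \<open>sg_mult\<close> makes it multiplicative, hence a character
  with values 1 and -1.\<close>

locale signed_action =
  fixes G :: "'g set" and gmul :: "'g \<Rightarrow> 'g \<Rightarrow> 'g" and X :: "'x set"
    and act :: "'g \<Rightarrow> 'x \<Rightarrow> 'x" and sg :: "'g \<Rightarrow> 'x \<Rightarrow> rat"
  assumes finG: "finite G" and neG: "G \<noteq> {}" and finX: "finite X"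
    and bij_mult: "g \<in> G \<Longrightarrow> bij_betw (gmul g) G G"
    and act_in: "g \<in> G \<Longrightarrow> x \<in> X \<Longrightarrow> act g x \<in> X"
    and act_inj: "g \<in> G \<Longrightarrow> x \<in> X \<Longrightarrow> y \<in> X \<Longrightarrow> act g x = act g y \<Longrightarrow> x = y"
    and act_mult: "g \<in> G \<Longrightarrow> h \<in> G \<Longrightarrow> x \<in> X \<Longrightarrow> act (gmul g h) x = act g (act h x)"
    and sg_mult: "g \<in> G \<Longrightarrow> h \<in> G \<Longrightarrow> x \<in> X \<Longrightarrow> sg (gmul g h) x = sg g (act h x) * sg h x"
    and sg_sign: "g \<in> G \<Longrightarrow> x \<in> X \<Longrightarrow> sg g x = 1 \<or> sg g x = - 1"
begin

definition stab :: "'x \<Rightarrow> 'g set" where "stab x = {g \<in> G. act g x = x}"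

definition orbit_of :: "'x \<Rightarrow> 'x set" where "orbit_of x = (\<lambda>g. act g x) ` G"

definition is_even :: "'x \<Rightarrow> bool" where "is_even x \<longleftrightarrow> (\<forall>g\<in>stab x. sg g x = 1)"

lemma mult_in: "g \<in> G \<Longrightarrow> h \<in> G \<Longrightarrow> gmul g h \<in> G"
  using bij_mult by (auto simp: bij_betw_def)

lemma card_fibre:
  assumes "x \<in> X" "g0 \<in> G"
  shows "card {g \<in> G. act g x = act g0 x} = card (stab x)"
proof -
  have "bij_betw (gmul g0) (stab x) {g \<in> G. act g x = act g0 x}"
    unfolding bij_betw_def
  proof
    show "inj_on (gmul g0) (stab x)"
      using bij_mult[OF assms(2)] by (auto simp: stab_def bij_betw_def intro: inj_on_subset)
    show "gmul g0 ` stab x = {g \<in> G. act g x = act g0 x}"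
    proof (intro antisym subsetI)
      fix g assume "g \<in> gmul g0 ` stab x"
      then show "g \<in> {g \<in> G. act g x = act g0 x}"
        using assms by (auto simp: stab_def mult_in act_mult)
    next
      fix g assume g: "g \<in> {g \<in> G. act g x = act g0 x}"
      then obtain h where h: "h \<in> G" "g = gmul g0 h"
        using bij_mult[OF assms(2)] by (auto simp: bij_betw_def)
      then have "act h x = x"
        using g assms act_inj[OF assms(2) act_in[OF h(1) assms(1)] assms(1)] by (simp add: act_mult)
      then show "g \<in> gmul g0 ` stab x" using h by (auto simp: stab_def)
    qed
  qed
  then show ?thesis by (simp add: bij_betw_same_card)
qed

lemma orbit_stabilizer:
  assumes "x \<in> X"
  shows "card G = card (orbit_of x) * card (stab x)"
proof -
  have "card G = (\<Sum>y\<in>orbit_of x. card {g \<in> G. act g x = y})"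
    unfolding orbit_of_def using finG by (subst card_eq_sum, subst sum.image_gen[OF finG, of _ "\<lambda>g. act g x"]) simp
  also have "\<dots> = (\<Sum>y\<in>orbit_of x. card (stab x))"
    using card_fibre[OF assms] by (intro sum.cong) (auto simp: orbit_of_def)
  finally show ?thesis by simp
qed

text \<open>The sum of a character over a group: translating by an element \<open>g0\<close> of sign
  -1 permutes the stabilizer and negates the sum.\<close>

lemma stab_sum:
  assumes "x \<in> X"
  shows "(\<Sum>g\<in>stab x. sg g x) = (if is_even x then of_nat (card (stab x)) else 0)"
proof (cases "is_even x")
  case True
  then show ?thesis by (simp add: is_even_def)
next
  case False
  then obtain g0 where g0: "g0 \<in> G" "act g0 x = x" "sg g0 x \<noteq> 1"
    by (auto simp: is_even_def stab_def)
  then have m1: "sg g0 x = - 1" using sg_sign assms by blast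
  have fs: "finite (stab x)" using finG by (simp add: stab_def)
  have inj: "inj_on (gmul g0) (stab x)"
    using bij_mult[OF g0(1)] by (auto simp: stab_def bij_betw_def intro: inj_on_subset)
  moreover have "gmul g0 ` stab x \<subseteq> stab x"
    using g0 assms by (auto simp: stab_def mult_in act_mult)
  ultimately have img: "gmul g0 ` stab x = stab x" using fs by (simp add: endo_inj_surj)
  have "(\<Sum>g\<in>stab x. sg g x) = (\<Sum>g\<in>gmul g0 ` stab x. sg g x)" using img by simp
  also have "\<dots> = (\<Sum>g\<in>stab x. sg (gmul g0 g) x)" using inj by (simp add: sum.reindex)
  also have "\<dots> = (\<Sum>g\<in>stab x. - sg g x)"
    using g0 assms m1 by (intro sum.cong) (auto simp: stab_def sg_mult)
  finally show ?thesis using False by (simp add: sum_negf)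
qed

definition conn :: "'x \<Rightarrow> 'x \<Rightarrow> rat \<Rightarrow> bool" where
  "conn x y e \<longleftrightarrow> x \<in> X \<and> y \<in> X \<and> (\<exists>g\<in>G. act g x = y \<and> sg g x = e)"

text \<open>Symmetry of \<open>conn\<close> takes the place of inverses: it supplies a way back from
  \<open>y\<close> to \<open>x\<close> with the same sign. Conjugating a stabilizer element by these
  two steps uses that sign twice, so evenness is constant along an orbit.\<close>

lemma orbit_eq:
  assumes sym: "\<forall>x y e. conn x y e \<longrightarrow> conn y x e" and "x \<in> X" "y \<in> orbit_of x"
  shows "orbit_of y = orbit_of x" "is_even y = is_even x"
proof -
  obtain g where g: "g \<in> G" "y = act g x" using assms(3) by (auto simp: orbit_of_def)
  have y: "y \<in> X" using g assms act_in by simp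
  have "conn x y (sg g x)" using g y assms by (auto simp: conn_def)
  then have "conn y x (sg g x)" using sym by blast
  then obtain h where h: "h \<in> G" "act h y = x" "sg h y = sg g x" by (auto simp: conn_def)
  show "orbit_of y = orbit_of x"
  proof (intro antisym subsetI)
    fix z assume "z \<in> orbit_of y"
    then obtain k where "k \<in> G" "z = act k y" by (auto simp: orbit_of_def)
    then have "z = act (gmul k g) x" using g assms by (simp add: act_mult)
    then show "z \<in> orbit_of x" using mult_in[OF \<open>k \<in> G\<close> g(1)] by (auto simp: orbit_of_def)
  next
    fix z assume "z \<in> orbit_of x"
    then obtain k where "k \<in> G" "z = act k x" by (auto simp: orbit_of_def)
    then have "z = act (gmul k h) y" using h y by (simp add: act_mult)
    then show "z \<in> orbit_of y" using mult_in[OF \<open>k \<in> G\<close> h(1)] by (auto simp: orbit_of_def)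
  qed
  have ev: "is_even b" if "is_even a" "a \<in> X" "b \<in> X" "u \<in> G" "v \<in> G" "act u a = b" "act v b = a"
      "sg v b = sg u a" for a b u v
    unfolding is_even_def
  proof
    fix k assume "k \<in> stab b"
    then have k: "k \<in> G" "act k b = b" by (auto simp: stab_def)
    have "gmul v (gmul k u) \<in> stab a"
      using that k by (simp add: stab_def mult_in act_mult)
    then have "sg (gmul v (gmul k u)) a = 1" using that(1) by (simp add: is_even_def)
    then have "sg v b * (sg k b * sg u a) = 1"
      using that k by (simp add: mult_in act_mult sg_mult)
    then show "sg k b = 1" using sg_sign[of u a] that by auto
  qed
  show "is_even y = is_even x"
  proof
    show "is_even y" if "is_even x"
      by (rule ev[OF that assms(2) y g(1) h(1) g(2)[symmetric] h(2)]) (use g h in simp)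
    show "is_even x" if "is_even y"
      by (rule ev[OF that y assms(2) h(1) g(1) h(2) g(2)[symmetric]]) (use g h in simp)
  qed
qed

text \<open>The orbit-counting lemma with signs. After exchanging the sums, a point contributes the
  sum of the signs over its stabilizer, which is zero on odd orbits, while the contributions of an
  even orbit add up to the order of \<open>G\<close>.\<close>

lemma signed_orbit_count:
  assumes sym: "\<forall>x y e. conn x y e \<longrightarrow> conn y x e" and self: "\<And>x. x \<in> X \<Longrightarrow> x \<in> orbit_of x"
    and YX: "Y \<subseteq> X" and closed: "\<And>g y. g \<in> G \<Longrightarrow> y \<in> Y \<Longrightarrow> act g y \<in> Y"
  shows "of_nat (card (orbit_of ` {x \<in> Y. is_even x})) =
    (\<Sum>g\<in>G. \<Sum>x\<in>{x \<in> Y. act g x = x}. sg g x) / of_nat (card G)"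
proof -
  have finY: "finite Y" using YX finX by (rule finite_subset)
  have cG: "of_nat (card G) \<noteq> (0::rat)" using finG neG by simp
  let ?E = "{x \<in> Y. is_even x}"
  have "(\<Sum>g\<in>G. \<Sum>x\<in>{x \<in> Y. act g x = x}. sg g x) =
      (\<Sum>g\<in>G. \<Sum>x\<in>Y. if act g x = x then sg g x else 0)"
    using finY by (simp add: sum.inter_filter)
  also have "\<dots> = (\<Sum>x\<in>Y. \<Sum>g\<in>G. if act g x = x then sg g x else 0)" by (rule sum.swap)
  also have "\<dots> = (\<Sum>x\<in>Y. \<Sum>g\<in>stab x. sg g x)"
    using finG by (simp add: stab_def sum.inter_filter)
  also have "\<dots> = (\<Sum>x\<in>Y. if is_even x then of_nat (card (stab x)) else 0)"
    using stab_sum YX by (intro sum.cong) auto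
  also have "\<dots> = (\<Sum>x\<in>?E. of_nat (card (stab x)))" using finY by (simp add: sum.inter_filter)
  also have "\<dots> = (\<Sum>C\<in>orbit_of ` ?E. \<Sum>x\<in>{x \<in> ?E. orbit_of x = C}. of_nat (card (stab x)))"
    by (rule sum.image_gen) (use finY in simp)
  also have "\<dots> = (\<Sum>C\<in>orbit_of ` ?E. of_nat (card G))"
  proof (rule sum.cong[OF refl])
    fix C assume "C \<in> orbit_of ` ?E"
    then obtain x where x: "x \<in> Y" "is_even x" "C = orbit_of x" by auto
    have xX: "x \<in> X" using x YX by auto
    have CY: "C \<subseteq> Y" using x closed by (auto simp: orbit_of_def)
    have finC: "finite C" using CY finY by (rule finite_subset)
    have cC: "card C > 0" using self[OF xX] x finC by (auto simp: card_gt_0_iff)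
    have "{y \<in> ?E. orbit_of y = C} = C"
      using orbit_eq[OF sym xX] x CY self YX by blast
    then have "(\<Sum>y\<in>{y \<in> ?E. orbit_of y = C}. of_nat (card (stab y)) :: rat) =
        (\<Sum>y\<in>C. of_nat (card (stab y)))" by simp
    also have "\<dots> = (\<Sum>y\<in>C. of_nat (card G) / of_nat (card C))"
    proof (rule sum.cong[OF refl])
      fix y assume "y \<in> C"
      then have "orbit_of y = C" "y \<in> X" using orbit_eq[OF sym xX] x CY YX by auto
      then have "card G = card C * card (stab y)" using orbit_stabilizer by metis
      then show "of_nat (card (stab y)) = (of_nat (card G) / of_nat (card C) :: rat)"
        using cC by simp
    qed
    also have "\<dots> = of_nat (card G)" using cC by simp
    finally show "(\<Sum>y\<in>{y \<in> ?E. orbit_of y = C}. of_nat (card (stab y)) :: rat) = of_nat (card G)" .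
  qed
  finally show ?thesis using cG by simp
qed

end

text \<open>The link between linear algebra and counting: points of \<open>X\<close> in odd orbits
  have class zero, and one point from each even orbit inside \<open>D\<close> gives a basis of the
  quotient.\<close>

lemma (in signed_relation) dim_mod_action:
  fixes real :: "'x \<Rightarrow> 'a" and gmul :: "'g \<Rightarrow> 'g \<Rightarrow> 'g"
  assumes act: "signed_action G gmul X act sg"
    and rel: "\<And>x y e. x \<in> X \<Longrightarrow> y \<in> X \<Longrightarrow>
      R (real x) (real y) e \<longleftrightarrow> (\<exists>g\<in>G. act g x = y \<and> sg g x = e)"
    and refl: "\<And>x. x \<in> X \<Longrightarrow> R (real x) (real x) 1"
    and closed: "\<And>x y e. x \<in> D \<Longrightarrow> R x y e \<Longrightarrow> y \<in> D"
    and cov: "\<And>x. x \<in> D \<Longrightarrow> \<exists>\<xi>\<in>X. \<exists>e. R (real \<xi>) x e"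
  shows "of_nat (dim_mod W (qvec.span ((\<lambda>x. Poly_Mapping.single x 1) ` D))) =
    (\<Sum>g\<in>G. \<Sum>x\<in>{x \<in> X. real x \<in> D \<and> act g x = x}. sg g x) / of_nat (card G)"
proof -
  interpret A: signed_action G gmul X act sg by (rule act)
  have conn: "A.conn x y e \<longleftrightarrow> x \<in> X \<and> y \<in> X \<and> R (real x) (real y) e" for x y e
    unfolding A.conn_def using rel by blast
  have csym: "\<forall>x y e. A.conn x y e \<longrightarrow> A.conn y x e" using sym conn by blast
  have self: "x \<in> A.orbit_of x" if "x \<in> X" for x
    using refl[OF that] rel[OF that that] unfolding A.orbit_of_def by (metis image_eqI)
  have orb: "y \<in> A.orbit_of x \<longleftrightarrow> (\<exists>e. R (real x) (real y) e)" if "x \<in> X" "y \<in> X" for x y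
    using rel[OF that] unfolding A.orbit_of_def by (metis (no_types, lifting) image_iff)
  have ev: "A.is_even x \<longleftrightarrow> \<not> R (real x) (real x) (- 1)" if "x \<in> X" for x
    using rel[OF that that] A.sg_sign[OF _ that] by (force simp: A.is_even_def A.stab_def)
  define Y where "Y = {x \<in> X. real x \<in> D}"
  have Ycl: "act g y \<in> Y" if "g \<in> G" "y \<in> Y" for g y
    using that closed[of "real y"] rel[of y "act g y"] A.act_in by (auto simp: Y_def)
  let ?E = "{x \<in> Y. A.is_even x}"
  define pick where "pick C = (SOME x. x \<in> C \<and> x \<in> ?E)" for C
  define P where "P = real ` pick ` A.orbit_of ` ?E"
  have pick: "pick (A.orbit_of x) \<in> A.orbit_of x \<and> pick (A.orbit_of x) \<in> ?E" if "x \<in> ?E" for x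
    unfolding pick_def using self[of x] that by (intro someI_ex[of "\<lambda>z. z \<in> _ \<and> z \<in> _"]) (auto simp: Y_def)
  have po: "A.orbit_of (pick (A.orbit_of x)) = A.orbit_of x" if "x \<in> ?E" for x
    using A.orbit_eq(1)[OF csym] pick[OF that] that by (auto simp: Y_def)
  have same: "A.orbit_of x = A.orbit_of y" if "x \<in> ?E" "y \<in> ?E"
      "R (real (pick (A.orbit_of x))) (real (pick (A.orbit_of y))) e" for x y e
  proof -
    have X: "pick (A.orbit_of x) \<in> X" "pick (A.orbit_of y) \<in> X"
      using pick[OF that(1)] pick[OF that(2)] by (auto simp: Y_def)
    have "pick (A.orbit_of y) \<in> A.orbit_of (pick (A.orbit_of x))" using orb[OF X] that(3) by blast
    then have "A.orbit_of (pick (A.orbit_of y)) = A.orbit_of (pick (A.orbit_of x))"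
      by (rule A.orbit_eq(1)[OF csym X(1)])
    then show ?thesis using po that by simp
  qed
  have finY: "finite Y" using A.finX by (simp add: Y_def)
  have refl': "R (real (pick (A.orbit_of x))) (real (pick (A.orbit_of x))) 1" if "x \<in> ?E" for x
    using pick[OF that] refl by (auto simp: Y_def)
  have "dim_mod W (qvec.span ((\<lambda>x. Poly_Mapping.single x 1) ` D)) = card P"
  proof (rule dim_mod_reps)
    show "finite P" using finY by (simp add: P_def)
    show "P \<subseteq> D" using pick by (auto simp: P_def Y_def)
    show "R p p 1 \<and> \<not> R p p (- 1)" if pP: "p \<in> P" for p
    proof -
      obtain x where x: "x \<in> ?E" "p = real (pick (A.orbit_of x))"
        using pP unfolding P_def image_image by blast
      then show ?thesis using refl' pick[OF x(1)] ev[of "pick (A.orbit_of x)"] by (auto simp: Y_def)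
    qed
    show "p = q" if pq: "p \<in> P" "q \<in> P" "R p q e" for p q e
    proof -
      obtain x y where xy: "x \<in> ?E" "p = real (pick (A.orbit_of x))"
          "y \<in> ?E" "q = real (pick (A.orbit_of y))"
        using pq(1,2) unfolding P_def image_image by blast
      have "A.orbit_of x = A.orbit_of y" by (rule same[OF xy(1,3)]) (use pq(3) xy in simp)
      then show ?thesis using xy by simp
    qed
    show "R x x (- 1) \<or> (\<exists>p\<in>P. \<exists>e. R p x e)" if xD: "x \<in> D" for x
    proof -
      obtain \<xi> e where \<xi>: "\<xi> \<in> X" "R (real \<xi>) x e" using cov xD by blast
      have Y: "\<xi> \<in> Y" using closed[OF xD sym[OF \<xi>(2)]] \<xi> by (simp add: Y_def)
      show ?thesis
      proof (cases "A.is_even \<xi>")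
        case True
        then have E: "\<xi> \<in> ?E" using Y by simp
        then have "\<exists>e. R (real \<xi>) (real (pick (A.orbit_of \<xi>))) e"
          using pick[OF E] orb[OF \<xi>(1)] by (auto simp: Y_def)
        then obtain f where "R (real \<xi>) (real (pick (A.orbit_of \<xi>))) f" by blast
        then have "R (real (pick (A.orbit_of \<xi>))) x (f * e)" using sym trans \<xi>(2) by blast
        then show ?thesis using E unfolding P_def by blast
      next
        case False
        then have "R (real \<xi>) (real \<xi>) (- 1)" using ev \<xi> by simp
        then have "R x x (e * (- 1 * e))" using trans sym \<xi>(2) by blast
        moreover have "e * (- 1 * e) = - 1" using sign[OF \<xi>(2)] by auto
        ultimately show ?thesis by simp
      qed
    qed
  qed
  also have "card P = card (A.orbit_of ` ?E)"
  proof -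
    have "inj_on (\<lambda>C. real (pick C)) (A.orbit_of ` ?E)"
    proof (rule inj_onI)
      fix C C' assume C: "C \<in> A.orbit_of ` ?E" "C' \<in> A.orbit_of ` ?E" "real (pick C) = real (pick C')"
      obtain x y where "x \<in> ?E" "C = A.orbit_of x" "y \<in> ?E" "C' = A.orbit_of y"
        using C(1,2) by blast
      then show "C = C'" using same[of x y 1] refl'[of x] C(3) by simp
    qed
    moreover have "P = (\<lambda>C. real (pick C)) ` A.orbit_of ` ?E" by (auto simp: P_def image_image)
    ultimately show ?thesis by (simp add: card_image)
  qed
  also have "of_nat (card (A.orbit_of ` ?E)) =
      (\<Sum>g\<in>G. \<Sum>x\<in>{x \<in> Y. act g x = x}. sg g x) / (of_nat (card G) :: rat)"
    by (rule A.signed_orbit_count[OF csym self _ Ycl]) (auto simp: Y_def)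
  also have "(\<lambda>g. {x \<in> Y. act g x = x}) = (\<lambda>g. {x \<in> X. real x \<in> D \<and> act g x = x})"
    by (auto simp: Y_def)
  finally show ?thesis .
qed

section \<open>Isomorphisms up to edge reversal\<close>

text \<open>Connectedness as the absence of a proper set of vertices closed under adjacency. Unlike
  paths, this form passes immediately through isomorphisms, edge reversals and the gluing of
  vertices.\<close>

lemma connected_iff_closed:
  assumes "wf_digraph G"
  shows "connected G \<longleftrightarrow> verts G \<noteq> {} \<and>
    (\<forall>S\<subseteq>verts G. S \<noteq> {} \<and> (\<forall>e\<in>arcs G. tail G e \<in> S \<longleftrightarrow> head G e \<in> S) \<longrightarrow> S = verts G)"
    (is "_ \<longleftrightarrow> ?R")
proof -
  interpret wf_digraph G by (rule assms)
  let ?S = "with_proj (mk_symmetric G)"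
  have ends: "arcs_ends ?S = (\<Union>e\<in>arcs G. {(tail G e, head G e), (head G e, tail G e)})"
    by (simp add: arcs_ends_def arc_to_ends_def parcs_mk_symmetric)
  show ?thesis
  proof
    assume conn: "connected G"
    then have ne: "verts G \<noteq> {}" and
      reach: "\<And>u v. u \<in> verts G \<Longrightarrow> v \<in> verts G \<Longrightarrow> u \<rightarrow>\<^sup>*\<^bsub>?S\<^esub> v"
      by (auto simp: connected_def strongly_connected_def)
    have "S = verts G" if S: "S \<subseteq> verts G" "S \<noteq> {}"
      "\<forall>e\<in>arcs G. tail G e \<in> S \<longleftrightarrow> head G e \<in> S" for S
    proof -
      obtain u where u: "u \<in> S" using S by blast
      have "v \<in> S" if "v \<in> verts G" for v
      proof -
        have "u \<rightarrow>\<^sup>*\<^bsub>?S\<^esub> v" using reach u S that by blast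
        then have "(u, v) \<in> rtrancl_on (verts ?S) (arcs_ends ?S)" by (simp add: reachable_def)
        then have "(u, v) \<in> (arcs_ends ?S)\<^sup>*" by (rule rtrancl_on_rtranclI)
        then show ?thesis
        proof (induction rule: rtrancl_induct)
          case base
          then show ?case by (rule u)
        next
          case (step y z)
          then show ?case using S(3) step.hyps(2)[unfolded ends] by auto
        qed
      qed
      then show ?thesis using S by blast
    qed
    then show ?R using ne by blast
  next
    assume R: ?R
    have "u \<rightarrow>\<^sup>*\<^bsub>?S\<^esub> v" if u: "u \<in> verts G" "v \<in> verts G" for u v
    proof -
      let ?T = "{v \<in> verts G. (u, v) \<in> rtrancl_on (verts G) (arcs_ends ?S)}"
      have step: "y \<in> ?T" if "x \<in> ?T" "(x, y) \<in> arcs_ends ?S" "y \<in> verts G" for x y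
        using that rtrancl_on_into_rtrancl_on[of u x "verts G" "arcs_ends ?S" y] by auto
      have "u \<in> ?T" using u by simp
      moreover have "tail G e \<in> ?T \<longleftrightarrow> head G e \<in> ?T" if e: "e \<in> arcs G" for e
      proof -
        have "(tail G e, head G e) \<in> arcs_ends ?S" "(head G e, tail G e) \<in> arcs_ends ?S"
          unfolding ends using e by auto
        then show ?thesis using step e head_in_verts tail_in_verts by blast
      qed
      ultimately have "?T = verts G" using R by blast
      then show ?thesis using u by (auto simp: reachable_def)
    qed
    then show "connected G" using R by (auto simp: connected_def strongly_connected_def)
  qed
qed

lemma connected_closed:
  assumes "wf_digraph G" "connected G" "S \<subseteq> verts G" "S \<noteq> {}"
    "\<And>e. e \<in> arcs G \<Longrightarrow> tail G e \<in> S \<longleftrightarrow> head G e \<in> S"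
  shows "S = verts G"
proof -
  have "\<forall>S\<subseteq>verts G. S \<noteq> {} \<and> (\<forall>e\<in>arcs G. tail G e \<in> S \<longleftrightarrow> head G e \<in> S) \<longrightarrow> S = verts G"
    using assms(2) unfolding connected_iff_closed[OF assms(1)] by (rule conjunct2)
  from this[rule_format, OF assms(3)] show ?thesis using assms(4,5) by simp
qed

lemma valence_sum:
  assumes "finite (arcs (shape \<Gamma>))"
  shows "valence \<Gamma> v =
    (\<Sum>e\<in>arcs (shape \<Gamma>). of_bool (tail (shape \<Gamma>) e = v) + of_bool (head (shape \<Gamma>) e = v))"
  using assms unfolding valence_def in_degree_def out_degree_def in_arcs_def out_arcs_def
  by (simp add: sum.distrib Int_def)

text \<open>\<open>\<phi>\<close> is the set of edges whose direction is reversed. Nothing is asked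
  about the orderings; how far they are from matching is measured by \<open>gsign\<close>.\<close>

definition giso :: "hairy_graph \<Rightarrow> hairy_graph \<Rightarrow> (nat \<Rightarrow> nat) \<Rightarrow> (nat \<Rightarrow> nat) \<Rightarrow> nat set \<Rightarrow> bool" where
  "giso \<Gamma> \<Gamma>' \<alpha> \<beta> \<phi> \<longleftrightarrow>
     bij_betw \<alpha> (verts (shape \<Gamma>)) (verts (shape \<Gamma>')) \<and>
     bij_betw \<beta> (arcs (shape \<Gamma>)) (arcs (shape \<Gamma>')) \<and> \<phi> \<subseteq> arcs (shape \<Gamma>) \<and>
     (\<forall>e\<in>arcs (shape \<Gamma>).
        tail (shape \<Gamma>') (\<beta> e) = \<alpha> (if e \<in> \<phi> then head (shape \<Gamma>) e else tail (shape \<Gamma>) e) \<and>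
        head (shape \<Gamma>') (\<beta> e) = \<alpha> (if e \<in> \<phi> then tail (shape \<Gamma>) e else head (shape \<Gamma>) e)) \<and>
     (\<forall>v\<in>verts (shape \<Gamma>). color \<Gamma>' (\<alpha> v) = color \<Gamma> v)"

definition gsign :: "(nat \<Rightarrow> nat) \<Rightarrow> nat \<Rightarrow> hairy_graph \<Rightarrow> hairy_graph \<Rightarrow>
    (nat \<Rightarrow> nat) \<Rightarrow> (nat \<Rightarrow> nat) \<Rightarrow> nat set \<Rightarrow> rat" where
  "gsign m d \<Gamma> \<Gamma>' \<alpha> \<beta> \<phi> =
     koszul_sign (elt_deg m d \<Gamma>') (map (map_sum \<alpha> \<beta>) (ordering \<Gamma>)) (ordering \<Gamma>') *
     psign (int d * int (card \<phi>))"

lemma is_hairy_graphD: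
  assumes "is_hairy_graph r \<Gamma>"
  shows "wf_digraph (shape \<Gamma>)" "finite (verts (shape \<Gamma>))" "finite (arcs (shape \<Gamma>))"
    "distinct (ordering \<Gamma>)" "set (ordering \<Gamma>) = verts (shape \<Gamma>) <+> arcs (shape \<Gamma>)"
    "connected (shape \<Gamma>)"
  using assms unfolding is_hairy_graph_def fin_digraph_def fin_digraph_axioms_def by auto

lemma inj_on_map_sum:
  assumes "inj_on f A" "inj_on g B"
  shows "inj_on (map_sum f g) (A <+> B)"
proof (rule inj_onI)
  fix x y assume "x \<in> A <+> B" "y \<in> A <+> B" "map_sum f g x = map_sum f g y"
  then show "x = y" by (cases x; cases y) (auto dest: inj_onD[OF assms(1)] inj_onD[OF assms(2)])
qed

lemma giso_inj:
  assumes "giso \<Gamma> \<Gamma>' \<alpha> \<beta> \<phi>"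
  shows "inj_on (map_sum \<alpha> \<beta>) (verts (shape \<Gamma>) <+> arcs (shape \<Gamma>))"
  using assms unfolding giso_def bij_betw_def by (intro inj_on_map_sum) auto

lemma giso_image:
  assumes "giso \<Gamma> \<Gamma>' \<alpha> \<beta> \<phi>"
  shows "map_sum \<alpha> \<beta> ` (verts (shape \<Gamma>) <+> arcs (shape \<Gamma>)) = verts (shape \<Gamma>') <+> arcs (shape \<Gamma>')"
proof -
  have "\<alpha> ` verts (shape \<Gamma>) = verts (shape \<Gamma>')" "\<beta> ` arcs (shape \<Gamma>) = arcs (shape \<Gamma>')"
    using assms unfolding giso_def bij_betw_def by auto
  then show ?thesis by (auto simp: Plus_def image_Un image_image)
qed

lemma giso_elt_deg:
  assumes "giso \<Gamma> \<Gamma>' \<alpha> \<beta> \<phi>" "x \<in> verts (shape \<Gamma>) <+> arcs (shape \<Gamma>)"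
  shows "elt_deg m d \<Gamma>' (map_sum \<alpha> \<beta> x) = elt_deg m d \<Gamma> x"
  using assms unfolding giso_def by (cases x) auto

lemma giso_valence:
  assumes "giso \<Gamma> \<Gamma>' \<alpha> \<beta> \<phi>" "is_hairy_graph r \<Gamma>" "v \<in> verts (shape \<Gamma>)"
  shows "valence \<Gamma>' (\<alpha> v) = valence \<Gamma> v"
proof -
  note h = is_hairy_graphD[OF assms(2)]
  have fin': "finite (arcs (shape \<Gamma>'))"
    using assms(1) h(3) unfolding giso_def by (metis bij_betw_finite)
  have inj: "\<alpha> u = \<alpha> v \<longleftrightarrow> u = v" if "u \<in> verts (shape \<Gamma>)" for u
    using assms(1,3) that unfolding giso_def bij_betw_def by (auto dest: inj_onD)
  interpret wf_digraph "shape \<Gamma>" by (rule h)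
  have "valence \<Gamma>' (\<alpha> v) = (\<Sum>e\<in>arcs (shape \<Gamma>).
      of_bool (tail (shape \<Gamma>') (\<beta> e) = \<alpha> v) + of_bool (head (shape \<Gamma>') (\<beta> e) = \<alpha> v))"
    unfolding valence_sum[OF fin']
    by (rule sum.reindex_bij_betw[symmetric]) (use assms(1) in \<open>simp add: giso_def\<close>)
  also have "\<dots> = valence \<Gamma> v"
    unfolding valence_sum[OF h(3)]
    by (rule sum.cong) (use assms(1) in \<open>auto simp: giso_def inj\<close>)
  finally show ?thesis .
qed

lemma giso_hairy:
  assumes "giso \<Gamma> \<Gamma>' \<alpha> \<beta> \<phi>" "is_hairy_graph r \<Gamma>"
    "distinct (ordering \<Gamma>')" "set (ordering \<Gamma>') = verts (shape \<Gamma>') <+> arcs (shape \<Gamma>')"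
  shows "is_hairy_graph r \<Gamma>'"
proof -
  note h = is_hairy_graphD[OF assms(2)]
  note g = assms(1)[unfolded giso_def]
  interpret wf_digraph "shape \<Gamma>" by (rule h)
  have V: "verts (shape \<Gamma>') = \<alpha> ` verts (shape \<Gamma>)" and E: "arcs (shape \<Gamma>') = \<beta> ` arcs (shape \<Gamma>)"
    and injV: "inj_on \<alpha> (verts (shape \<Gamma>))"
    using g by (auto simp: bij_betw_def)
  have fin: "fin_digraph (shape \<Gamma>')"
    by unfold_locales (use g h V E in auto)
  then have wf: "wf_digraph (shape \<Gamma>')" by (simp add: fin_digraph_def)
  have "S' = verts (shape \<Gamma>')" if S': "S' \<subseteq> verts (shape \<Gamma>')" "S' \<noteq> {}"
    "\<forall>e\<in>arcs (shape \<Gamma>'). tail (shape \<Gamma>') e \<in> S' \<longleftrightarrow> head (shape \<Gamma>') e \<in> S'" for S'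
  proof -
    let ?S = "{v \<in> verts (shape \<Gamma>). \<alpha> v \<in> S'}"
    have img: "S' \<subseteq> \<alpha> ` verts (shape \<Gamma>)" using S'(1) unfolding V .
    then have "?S \<noteq> {}" using S'(2) by auto
    moreover have "tail (shape \<Gamma>) e \<in> ?S \<longleftrightarrow> head (shape \<Gamma>) e \<in> ?S" if e: "e \<in> arcs (shape \<Gamma>)" for e
    proof -
      have "\<beta> e \<in> arcs (shape \<Gamma>')" using e E by simp
      then have "tail (shape \<Gamma>') (\<beta> e) \<in> S' \<longleftrightarrow> head (shape \<Gamma>') (\<beta> e) \<in> S'" using S'(3) by blast
      then show ?thesis using g e by (cases "e \<in> \<phi>") simp_all
    qed
    ultimately have "?S = verts (shape \<Gamma>)"
      by (intro connected_closed[OF h(1,6)]) auto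
    then have "\<alpha> ` verts (shape \<Gamma>) \<subseteq> S'" by auto
    then show ?thesis using img unfolding V by (rule antisym[rotated])
  qed
  moreover have "verts (shape \<Gamma>') \<noteq> {}"
    using h(6) V connected_iff_closed[OF h(1)] by simp
  ultimately have conn: "connected (shape \<Gamma>')"
    unfolding connected_iff_closed[OF wf] by simp
  have ext: "external \<Gamma>' = \<alpha> ` external \<Gamma>" and int: "internal \<Gamma>' = \<alpha> ` internal \<Gamma>"
    using g V unfolding external_def internal_def by auto
  have val: "valence \<Gamma>' (\<alpha> v) = valence \<Gamma> v" if "v \<in> external \<Gamma> \<or> v \<in> internal \<Gamma>" for v
    using giso_valence[OF assms(1,2)] that unfolding external_def internal_def by auto
  have col: "color \<Gamma>' (\<alpha> v) = color \<Gamma> v" if "v \<in> external \<Gamma>" for v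
    using g that unfolding external_def by auto
  show ?thesis
    using assms(2) fin conn assms(3,4) val col unfolding is_hairy_graph_def ext int by auto
qed

lemma giso_id: "giso \<Gamma> \<Gamma> id id {}"
  by (simp add: giso_def)

text \<open>The set that is counted is the symmetric difference, and its size agrees with the sum of
  the two sizes modulo 2.\<close>

lemma psign_mult_card:
  assumes "finite A" "finite B"
  shows "psign (int d * int (card {x \<in> A \<union> B. (x \<in> A) \<noteq> (x \<in> B)})) =
    psign (int d * int (card A)) * psign (int d * int (card B))"
proof -
  have "{x \<in> A \<union> B. (x \<in> A) \<noteq> (x \<in> B)} = (A - A \<inter> B) \<union> (B - A \<inter> B)" by blast
  moreover have "card ((A - A \<inter> B) \<union> (B - A \<inter> B)) = card (A - A \<inter> B) + card (B - A \<inter> B)"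
    using assms by (intro card_Un_disjoint) auto
  moreover have "card (A - A \<inter> B) = card A - card (A \<inter> B)" "card (B - A \<inter> B) = card B - card (A \<inter> B)"
    using assms by (auto intro!: card_Diff_subset)
  moreover have "card (A \<inter> B) \<le> card A" "card (A \<inter> B) \<le> card B"
    using assms by (auto intro!: card_mono)
  ultimately have "int (card A) + int (card B) =
      int (card {x \<in> A \<union> B. (x \<in> A) \<noteq> (x \<in> B)}) + 2 * int (card (A \<inter> B))" by simp
  then have "psign (int d * (int (card A) + int (card B))) =
      psign (int d * int (card {x \<in> A \<union> B. (x \<in> A) \<noteq> (x \<in> B)}))"
    by (simp add: psign_def)
  then show ?thesis by (simp add: psign_add algebra_simps)
qed

text \<open>An edge reversed by both isomorphisms keeps its direction, so the reversed edges form
  the symmetric difference of \<open>\<phi>\<close> and the preimage of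
  \<open>\<phi>'\<close>.\<close>

lemma giso_comp:
  assumes "giso \<Gamma> \<Gamma>' \<alpha> \<beta> \<phi>" "giso \<Gamma>' \<Gamma>'' \<alpha>' \<beta>' \<phi>'" "is_hairy_graph r \<Gamma>"
  shows "giso \<Gamma> \<Gamma>'' (\<alpha>' \<circ> \<alpha>) (\<beta>' \<circ> \<beta>) {e \<in> arcs (shape \<Gamma>). (e \<in> \<phi>) \<noteq> (\<beta> e \<in> \<phi>')}"
proof -
  interpret wf_digraph "shape \<Gamma>" by (rule is_hairy_graphD[OF assms(3)])
  note g = assms(1,2)[unfolded giso_def]
  show ?thesis unfolding giso_def
  proof (intro conjI ballI)
    show "bij_betw (\<alpha>' \<circ> \<alpha>) (verts (shape \<Gamma>)) (verts (shape \<Gamma>''))"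
      "bij_betw (\<beta>' \<circ> \<beta>) (arcs (shape \<Gamma>)) (arcs (shape \<Gamma>''))"
      using g by (auto intro: bij_betw_trans)
    fix e assume e: "e \<in> arcs (shape \<Gamma>)"
    then have e': "\<beta> e \<in> arcs (shape \<Gamma>')" using g(1) by (auto simp: bij_betw_def)
    show "tail (shape \<Gamma>'') ((\<beta>' \<circ> \<beta>) e) = (\<alpha>' \<circ> \<alpha>) (if e \<in> {e \<in> arcs (shape \<Gamma>). (e \<in> \<phi>) \<noteq> (\<beta> e \<in> \<phi>')}
        then head (shape \<Gamma>) e else tail (shape \<Gamma>) e)"
      "head (shape \<Gamma>'') ((\<beta>' \<circ> \<beta>) e) = (\<alpha>' \<circ> \<alpha>) (if e \<in> {e \<in> arcs (shape \<Gamma>). (e \<in> \<phi>) \<noteq> (\<beta> e \<in> \<phi>')}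
        then tail (shape \<Gamma>) e else head (shape \<Gamma>) e)"
      using g e e' by auto
  next
    fix v assume "v \<in> verts (shape \<Gamma>)"
    moreover from this have "\<alpha> v \<in> verts (shape \<Gamma>')" using g(1) by (auto simp: bij_betw_def)
    ultimately show "color \<Gamma>'' ((\<alpha>' \<circ> \<alpha>) v) = color \<Gamma> v" using g by simp
  qed auto
qed

text \<open>Between the twice transported ordering and the final one, the ordering of the middle
  graph, transported once, is inserted. The first part of the way is then the image of a comparison
  made in the middle graph, and isomorphisms preserve degrees.\<close>

lemma gsign_comp:
  assumes "giso \<Gamma> \<Gamma>' \<alpha> \<beta> \<phi>" "giso \<Gamma>' \<Gamma>'' \<alpha>' \<beta>' \<phi>'"
    "is_hairy_graph r \<Gamma>" "is_hairy_graph r \<Gamma>'" "is_hairy_graph r \<Gamma>''"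
  shows "gsign m d \<Gamma> \<Gamma>'' (\<alpha>' \<circ> \<alpha>) (\<beta>' \<circ> \<beta>) {e \<in> arcs (shape \<Gamma>). (e \<in> \<phi>) \<noteq> (\<beta> e \<in> \<phi>')} =
    gsign m d \<Gamma> \<Gamma>' \<alpha> \<beta> \<phi> * gsign m d \<Gamma>' \<Gamma>'' \<alpha>' \<beta>' \<phi>'"
proof -
  note h = is_hairy_graphD[OF assms(3)] and h' = is_hairy_graphD[OF assms(4)]
    and h'' = is_hairy_graphD[OF assms(5)]
  let ?h = "map_sum \<alpha> \<beta>" and ?h' = "map_sum \<alpha>' \<beta>'"
  have so: "set (map ?h (ordering \<Gamma>)) = set (ordering \<Gamma>')"
    using giso_image[OF assms(1)] h(5) h'(5) by simp
  have so': "set (map ?h' (ordering \<Gamma>')) = set (ordering \<Gamma>'')"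
    using giso_image[OF assms(2)] h'(5) h''(5) by simp
  have inj': "inj_on ?h' (set (ordering \<Gamma>'))" using giso_inj[OF assms(2)] h'(5) by simp
  have d1: "distinct (map ?h (ordering \<Gamma>))"
    using giso_inj[OF assms(1)] h(4,5) by (simp add: distinct_map)
  have d2: "distinct (map ?h' (map ?h (ordering \<Gamma>)))"
    using d1 inj' so unfolding distinct_map[of ?h'] by simp
  have d3: "distinct (map ?h' (ordering \<Gamma>'))"
    using h'(4) inj' by (simp add: distinct_map)
  have s2: "set (map ?h' (map ?h (ordering \<Gamma>))) = set (ordering \<Gamma>'')"
    unfolding set_map[of ?h'] so using so' by simp
  have "koszul_sign (elt_deg m d \<Gamma>'') (map ?h' (map ?h (ordering \<Gamma>))) (ordering \<Gamma>'') =
      koszul_sign (elt_deg m d \<Gamma>'') (map ?h' (map ?h (ordering \<Gamma>))) (map ?h' (ordering \<Gamma>')) *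
      koszul_sign (elt_deg m d \<Gamma>'') (map ?h' (ordering \<Gamma>')) (ordering \<Gamma>'')"
    by (rule koszul_sign_trans[symmetric, OF d2 d3 h''(4)]) (simp_all only: s2 so')
  also have "koszul_sign (elt_deg m d \<Gamma>'') (map ?h' (map ?h (ordering \<Gamma>))) (map ?h' (ordering \<Gamma>')) =
      koszul_sign (elt_deg m d \<Gamma>'' \<circ> ?h') (map ?h (ordering \<Gamma>)) (ordering \<Gamma>')"
    by (rule koszul_sign_map) (simp_all only: so inj')
  also have "\<dots> = koszul_sign (elt_deg m d \<Gamma>') (map ?h (ordering \<Gamma>)) (ordering \<Gamma>')"
    by (rule koszul_sign_cong) (unfold so h'(5) comp_apply, rule giso_elt_deg[OF assms(2)])
  finally have K: "koszul_sign (elt_deg m d \<Gamma>'') (map (map_sum (\<alpha>' \<circ> \<alpha>) (\<beta>' \<circ> \<beta>)) (ordering \<Gamma>)) (ordering \<Gamma>'') =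
      koszul_sign (elt_deg m d \<Gamma>') (map ?h (ordering \<Gamma>)) (ordering \<Gamma>') *
      koszul_sign (elt_deg m d \<Gamma>'') (map ?h' (ordering \<Gamma>')) (ordering \<Gamma>'')"
    by (simp add: map_sum.comp)
  define \<psi> where "\<psi> = {e \<in> arcs (shape \<Gamma>). \<beta> e \<in> \<phi>'}"
  have bij: "bij_betw \<beta> (arcs (shape \<Gamma>)) (arcs (shape \<Gamma>'))" and sub: "\<phi> \<subseteq> arcs (shape \<Gamma>)"
    "\<phi>' \<subseteq> arcs (shape \<Gamma>')" using assms(1,2) by (auto simp: giso_def)
  have "bij_betw \<beta> \<psi> \<phi>'"
  proof (rule bij_betw_subset[OF bij])
    show "\<beta> ` \<psi> = \<phi>'"
      using bij sub unfolding \<psi>_def bij_betw_def by auto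
  qed (auto simp: \<psi>_def)
  then have "card \<psi> = card \<phi>'" by (rule bij_betw_same_card)
  moreover have "{e \<in> arcs (shape \<Gamma>). (e \<in> \<phi>) \<noteq> (\<beta> e \<in> \<phi>')} = {x \<in> \<phi> \<union> \<psi>. (x \<in> \<phi>) \<noteq> (x \<in> \<psi>)}"
    using sub by (auto simp: \<psi>_def)
  moreover have "finite \<phi>" "finite \<psi>" using sub h(3) by (auto simp: \<psi>_def intro: finite_subset)
  ultimately have "psign (int d * int (card {e \<in> arcs (shape \<Gamma>). (e \<in> \<phi>) \<noteq> (\<beta> e \<in> \<phi>')})) =
      psign (int d * int (card \<phi>)) * psign (int d * int (card \<phi>'))"
    using psign_mult_card[of \<phi> \<psi> d] by simp
  then show ?thesis unfolding gsign_def K by (simp only: ac_simps)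
qed

lemma gsign_cong:
  assumes "\<And>v. v \<in> verts (shape \<Gamma>) \<Longrightarrow> \<alpha> v = \<alpha>' v" "\<And>e. e \<in> arcs (shape \<Gamma>) \<Longrightarrow> \<beta> e = \<beta>' e"
    "set (ordering \<Gamma>) = verts (shape \<Gamma>) <+> arcs (shape \<Gamma>)"
  shows "gsign m d \<Gamma> \<Gamma>' \<alpha> \<beta> \<phi> = gsign m d \<Gamma> \<Gamma>' \<alpha>' \<beta>' \<phi>"
proof -
  have "map (map_sum \<alpha> \<beta>) (ordering \<Gamma>) = map (map_sum \<alpha>' \<beta>') (ordering \<Gamma>)"
    by (rule map_cong[OF refl]) (use assms in auto)
  then show ?thesis unfolding gsign_def by (simp only:)
qed

lemma gsign_id:
  assumes "is_hairy_graph r \<Gamma>"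
  shows "gsign m d \<Gamma> \<Gamma> id id {} = 1"
  using koszul_sign_refl is_hairy_graphD(4)[OF assms] by (simp add: gsign_def map_sum.id psign_def)

lemma gsign_cases: "gsign m d \<Gamma> \<Gamma>' \<alpha> \<beta> \<phi> = 1 \<or> gsign m d \<Gamma> \<Gamma>' \<alpha> \<beta> \<phi> = - 1"
  unfolding gsign_def
  using koszul_sign_cases[of "elt_deg m d \<Gamma>'" "map (map_sum \<alpha> \<beta>) (ordering \<Gamma>)" "ordering \<Gamma>'"]
    psign_cases[of "int d * int (card \<phi>)"] by auto

lemma giso_inverse:
  assumes "giso \<Gamma> \<Gamma>' \<alpha> \<beta> \<phi>" "is_hairy_graph r \<Gamma>" "is_hairy_graph r \<Gamma>'"
  obtains \<alpha>' \<beta>' \<phi>' where "giso \<Gamma>' \<Gamma> \<alpha>' \<beta>' \<phi>'" "gsign m d \<Gamma>' \<Gamma> \<alpha>' \<beta>' \<phi>' = gsign m d \<Gamma> \<Gamma>' \<alpha> \<beta> \<phi>"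
proof -
  let ?a = "the_inv_into (verts (shape \<Gamma>)) \<alpha>" and ?b = "the_inv_into (arcs (shape \<Gamma>)) \<beta>"
  note g = assms(1)[unfolded giso_def]
  interpret wf_digraph "shape \<Gamma>" by (rule is_hairy_graphD[OF assms(2)])
  have inj: "inj_on \<alpha> (verts (shape \<Gamma>))" "inj_on \<beta> (arcs (shape \<Gamma>))"
    and img: "\<alpha> ` verts (shape \<Gamma>) = verts (shape \<Gamma>')" "\<beta> ` arcs (shape \<Gamma>) = arcs (shape \<Gamma>')"
    using g by (auto simp: bij_betw_def)
  have a: "?a (\<alpha> v) = v" if "v \<in> verts (shape \<Gamma>)" for v using the_inv_into_f_f[OF inj(1) that] .
  have b: "?b (\<beta> e) = e" if "e \<in> arcs (shape \<Gamma>)" for e using the_inv_into_f_f[OF inj(2) that] .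
  have inv: "giso \<Gamma>' \<Gamma> ?a ?b (\<beta> ` \<phi>)"
    unfolding giso_def
  proof (intro conjI ballI)
    show "bij_betw ?a (verts (shape \<Gamma>')) (verts (shape \<Gamma>))" "bij_betw ?b (arcs (shape \<Gamma>')) (arcs (shape \<Gamma>))"
      using g by (auto intro: bij_betw_the_inv_into)
    show "\<beta> ` \<phi> \<subseteq> arcs (shape \<Gamma>')" using g image_mono[of \<phi> _ \<beta>] unfolding img(2)[symmetric] by blast
    fix e' assume "e' \<in> arcs (shape \<Gamma>')"
    then obtain e where e: "e' = \<beta> e" "e \<in> arcs (shape \<Gamma>)" unfolding img(2)[symmetric] by blast
    have m: "\<beta> e \<in> \<beta> ` \<phi> \<longleftrightarrow> e \<in> \<phi>" using inj_on_image_mem_iff[OF inj(2) e(2)] g by blast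
    show "tail (shape \<Gamma>) (?b e') = ?a (if e' \<in> \<beta> ` \<phi> then head (shape \<Gamma>') e' else tail (shape \<Gamma>') e')"
      "head (shape \<Gamma>) (?b e') = ?a (if e' \<in> \<beta> ` \<phi> then tail (shape \<Gamma>') e' else head (shape \<Gamma>') e')"
      using g e m by (simp_all add: a b)
  next
    fix v' assume "v' \<in> verts (shape \<Gamma>')"
    then obtain v where "v' = \<alpha> v" "v \<in> verts (shape \<Gamma>)" unfolding img(1)[symmetric] by blast
    then show "color \<Gamma> (?a v') = color \<Gamma>' v'" using g by (simp add: a)
  qed
  have em: "{e \<in> arcs (shape \<Gamma>). (e \<in> \<phi>) \<noteq> (\<beta> e \<in> \<beta> ` \<phi>)} = {}"
    using inj_on_image_mem_iff[OF inj(2)] g by blast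
  have "gsign m d \<Gamma> \<Gamma>' \<alpha> \<beta> \<phi> * gsign m d \<Gamma>' \<Gamma> ?a ?b (\<beta> ` \<phi>) =
      gsign m d \<Gamma> \<Gamma> (?a \<circ> \<alpha>) (?b \<circ> \<beta>) {}"
    using gsign_comp[OF assms(1) inv assms(2,3,2), of m d] unfolding em by (rule HOL.sym)
  also have "\<dots> = gsign m d \<Gamma> \<Gamma> id id {}"
    by (rule gsign_cong) (use a b is_hairy_graphD(5)[OF assms(2)] in auto)
  finally have "gsign m d \<Gamma>' \<Gamma> ?a ?b (\<beta> ` \<phi>) = gsign m d \<Gamma> \<Gamma>' \<alpha> \<beta> \<phi>"
    using gsign_id[OF assms(2), of m d] gsign_cases[of m d \<Gamma> \<Gamma>' \<alpha> \<beta> \<phi>] by auto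
  then show thesis using that inv by blast
qed

section \<open>The signed relation between graphs behind the defining relations of the
  complex\<close>

definition grel :: "nat \<Rightarrow> (nat \<Rightarrow> nat) \<Rightarrow> nat \<Rightarrow> hairy_graph \<Rightarrow> hairy_graph \<Rightarrow> rat \<Rightarrow> bool" where
  "grel r m d \<Gamma> \<Gamma>' e \<longleftrightarrow> is_hairy_graph r \<Gamma> \<and> is_hairy_graph r \<Gamma>' \<and>
     (\<exists>\<alpha> \<beta> \<phi>. giso \<Gamma> \<Gamma>' \<alpha> \<beta> \<phi> \<and> e = gsign m d \<Gamma> \<Gamma>' \<alpha> \<beta> \<phi>)"

definition reverse_edges :: "nat set \<Rightarrow> hairy_graph \<Rightarrow> hairy_graph" where
  "reverse_edges \<psi> \<Gamma> = \<Gamma>\<lparr>shape := (shape \<Gamma>)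
     \<lparr>tail := (\<lambda>e. if e \<in> \<psi> then head (shape \<Gamma>) e else tail (shape \<Gamma>) e),
      head := (\<lambda>e. if e \<in> \<psi> then tail (shape \<Gamma>) e else head (shape \<Gamma>) e)\<rparr>\<rparr>"

lemma giso_reverse_edges:
  assumes "\<psi> \<subseteq> arcs (shape \<Gamma>)"
  shows "giso \<Gamma> (reverse_edges \<psi> \<Gamma>) id id \<psi>"
  using assms by (auto simp: giso_def reverse_edges_def)

lemma reverse_edge_eq: "reverse_edge e \<Gamma> = reverse_edges {e} \<Gamma>"
  by (auto simp: reverse_edge_def reverse_edges_def fun_eq_iff intro!: hairy_graph.equality pre_digraph.equality)

lemma reverse_edges_insert:
  "e \<notin> \<psi> \<Longrightarrow> reverse_edges (insert e \<psi>) \<Gamma> = reverse_edge e (reverse_edges \<psi> \<Gamma>)"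
  by (auto simp: reverse_edge_def reverse_edges_def fun_eq_iff intro!: hairy_graph.equality pre_digraph.equality)

lemma reverse_edges_hairy:
  assumes "is_hairy_graph r \<Gamma>" "\<psi> \<subseteq> arcs (shape \<Gamma>)"
  shows "is_hairy_graph r (reverse_edges \<psi> \<Gamma>)"
  by (rule giso_hairy[OF giso_reverse_edges[OF assms(2)] assms(1)])
    (use is_hairy_graphD[OF assms(1)] in \<open>auto simp: reverse_edges_def\<close>)

lemma reverse_edges_relation:
  assumes "is_hairy_graph r \<Gamma>" "finite \<psi>" "\<psi> \<subseteq> arcs (shape \<Gamma>)"
  shows "gvec (reverse_edges \<psi> \<Gamma>) - qscale (psign (int d * int (card \<psi>))) (gvec \<Gamma>) \<in> hairy_relations r m d"
  using assms(2,3)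
proof (induction \<psi> rule: finite_induct)
  case empty
  have "reverse_edges {} \<Gamma> = \<Gamma>" by (simp add: reverse_edges_def)
  then show ?case by (simp add: psign_def hairy_relations_def qvec.span_zero)
next
  case (insert e \<psi>)
  let ?\<Delta> = "reverse_edges \<psi> \<Gamma>" and ?k = "psign (int d * int (card \<psi>))"
  have "is_hairy_graph r ?\<Delta>" using reverse_edges_hairy[OF assms(1)] insert.prems by auto
  moreover have "e \<in> arcs (shape ?\<Delta>)" using insert.prems by (simp add: reverse_edges_def)
  ultimately have "gvec (reverse_edge e ?\<Delta>) - qscale ((- 1) ^ d) (gvec ?\<Delta>) \<in> hairy_relations r m d"
    unfolding hairy_relations_def by (intro qvec.span_base UnI1 UnI2) blast
  moreover have "qscale ((- 1) ^ d) (gvec ?\<Delta> - qscale ?k (gvec \<Gamma>)) \<in> hairy_relations r m d"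
    using insert unfolding hairy_relations_def by (intro qvec.span_scale) auto
  ultimately have "(gvec (reverse_edge e ?\<Delta>) - qscale ((- 1) ^ d) (gvec ?\<Delta>)) +
      qscale ((- 1) ^ d) (gvec ?\<Delta> - qscale ?k (gvec \<Gamma>)) \<in> hairy_relations r m d"
    unfolding hairy_relations_def by (rule qvec.span_add)
  moreover have "((- 1) ^ d) * ?k = psign (int d * int (card (insert e \<psi>)))"
  proof -
    have "(- 1) ^ d = psign (int d)" by (cases "even d") (auto simp: psign_def)
    then show ?thesis using insert by (simp add: psign_add[symmetric] algebra_simps)
  qed
  ultimately show ?case
    using reverse_edges_insert[OF insert.hyps(2)] by (simp add: qvec.scale_right_diff_distrib)
qed

lemma grel_relation:
  assumes "grel r m d \<Gamma> \<Gamma>' e"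
  shows "gvec \<Gamma>' - qscale e (gvec \<Gamma>) \<in> hairy_relations r m d"
proof -
  let ?W = "hairy_relations r m d"
  obtain \<alpha> \<beta> \<phi> where g: "giso \<Gamma> \<Gamma>' \<alpha> \<beta> \<phi>" and e: "e = gsign m d \<Gamma> \<Gamma>' \<alpha> \<beta> \<phi>"
    and h: "is_hairy_graph r \<Gamma>" "is_hairy_graph r \<Gamma>'"
    using assms by (auto simp: grel_def)
  note g' = g[unfolded giso_def]
  note hh = is_hairy_graphD[OF h(1)] and hh' = is_hairy_graphD[OF h(2)]
  let ?o = "map (map_sum \<alpha> \<beta>) (ordering \<Gamma>)"
  \<comment> \<open>\<open>\<Delta>\<close> is the target with the transported ordering, and
    reversing the edges in \<open>\<psi>\<close> makes it an isomorphic copy of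
    \<open>\<Gamma>\<close> in the strict sense. The way from \<open>\<Gamma>\<close> to
    \<open>\<Gamma>'\<close> thus consists of a relabelling, some edge reversals and a reordering,
    one for each kind of generator.\<close>
  define \<Delta> where "\<Delta> = \<Gamma>'\<lparr>ordering := ?o\<rparr>"
  define \<psi> where "\<psi> = \<beta> ` \<phi>"
  have so: "set ?o = verts (shape \<Gamma>') <+> arcs (shape \<Gamma>')"
    using giso_image[OF g] hh(5) by simp
  have dd: "distinct ?o" using giso_inj[OF g] hh(4,5) by (simp add: distinct_map)
  have "giso \<Gamma>' \<Delta> id id {}" by (simp add: giso_def \<Delta>_def)
  then have h\<Delta>: "is_hairy_graph r \<Delta>"
    by (rule giso_hairy[OF _ h(2)]) (use so dd in \<open>simp_all add: \<Delta>_def\<close>)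
  have \<psi>: "\<psi> \<subseteq> arcs (shape \<Delta>)" "finite \<psi>" "card \<psi> = card \<phi>"
  proof -
    have "\<beta> ` \<phi> \<subseteq> \<beta> ` arcs (shape \<Gamma>)" using g' by (intro image_mono) blast
    moreover have "\<beta> ` arcs (shape \<Gamma>) = arcs (shape \<Gamma>')" using g' by (simp add: bij_betw_def)
    ultimately show "\<psi> \<subseteq> arcs (shape \<Delta>)" by (simp add: \<psi>_def \<Delta>_def)
    have "finite \<phi>" using g' hh(3) by (auto intro: finite_subset)
    then show "finite \<psi>" by (simp add: \<psi>_def)
    have "inj_on \<beta> \<phi>" using g' inj_on_subset unfolding bij_betw_def by blast
    then show "card \<psi> = card \<phi>" unfolding \<psi>_def by (rule card_image)
  qed
  have mem: "\<beta> e \<in> \<psi> \<longleftrightarrow> e \<in> \<phi>" if "e \<in> arcs (shape \<Gamma>)" for e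
    using g' that inj_on_image_mem_iff[of \<beta> "arcs (shape \<Gamma>)" e \<phi>] by (auto simp: \<psi>_def bij_betw_def)
  let ?\<Theta> = "reverse_edges \<psi> \<Delta>"
  have "hairy_iso \<Gamma> ?\<Theta>"
    unfolding hairy_iso_def
  proof (intro exI conjI)
    let ?f = "\<lparr>iso_verts = \<alpha>, iso_arcs = \<beta>, iso_head = head (shape ?\<Theta>), iso_tail = tail (shape ?\<Theta>)\<rparr>"
    show "pre_digraph.digraph_isomorphism (shape \<Gamma>) ?f"
      unfolding pre_digraph.digraph_isomorphism_def
      using hh(1) g' mem by (auto simp: bij_betw_def reverse_edges_def \<Delta>_def)
    show "shape ?\<Theta> = app_iso ?f (shape \<Gamma>)"
      using g' by (auto simp: app_iso_def reverse_edges_def \<Delta>_def bij_betw_def)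
    show "\<forall>v\<in>verts (shape \<Gamma>). color ?\<Theta> (iso_verts ?f v) = color \<Gamma> v"
      using g' by (simp add: reverse_edges_def \<Delta>_def)
    show "ordering ?\<Theta> = map (map_sum (iso_verts ?f) (iso_arcs ?f)) (ordering \<Gamma>)"
      by (simp add: reverse_edges_def \<Delta>_def)
  qed
  then have 1: "gvec ?\<Theta> - gvec \<Gamma> \<in> ?W"
    using h unfolding hairy_relations_def by (intro qvec.span_base UnI1) blast
  let ?k = "psign (int d * int (card \<phi>))"
  have 2: "gvec ?\<Theta> - qscale ?k (gvec \<Delta>) \<in> ?W"
    using reverse_edges_relation[OF h\<Delta> \<psi>(2,1)] \<psi>(3) by simp
  let ?s = "koszul_sign (elt_deg m d \<Gamma>') ?o (ordering \<Gamma>')"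
  have \<Gamma>': "\<Gamma>' = \<Delta>\<lparr>ordering := ordering \<Gamma>'\<rparr>" by (simp add: \<Delta>_def)
  have deg: "elt_deg m d \<Delta> = elt_deg m d \<Gamma>'"
  proof
    fix x show "elt_deg m d \<Delta> x = elt_deg m d \<Gamma>' x" by (cases x) (simp_all add: \<Delta>_def)
  qed
  have "gvec (\<Delta>\<lparr>ordering := ordering \<Gamma>'\<rparr>) -
      qscale (koszul_sign (elt_deg m d \<Delta>) (ordering \<Delta>) (ordering \<Gamma>')) (gvec \<Delta>) \<in> ?W"
  proof -
    have "distinct (ordering \<Gamma>') \<and> set (ordering \<Gamma>') = set (ordering \<Delta>)"
      using hh' so by (simp add: \<Delta>_def)
    then show ?thesis
      using h\<Delta> unfolding hairy_relations_def by (intro qvec.span_base UnI2) blast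
  qed
  then have 3: "gvec \<Gamma>' - qscale ?s (gvec \<Delta>) \<in> ?W"
    unfolding deg \<Gamma>'[symmetric] by (simp add: \<Delta>_def)
  have W: "qvec.subspace ?W" by (simp add: hairy_relations_def qvec.subspace_span)
  have "(gvec ?\<Theta> - gvec \<Gamma>) - (gvec ?\<Theta> - qscale ?k (gvec \<Delta>)) \<in> ?W"
    by (rule qvec.subspace_diff[OF W 1 2])
  then have "qscale ?k (gvec \<Delta>) - gvec \<Gamma> \<in> ?W" by simp
  from qvec.subspace_scale[OF W this, of "?s * ?k"]
  have 4: "qscale ?s (gvec \<Delta>) - qscale (?s * ?k) (gvec \<Gamma>) \<in> ?W"
    by (simp add: qvec.scale_right_diff_distrib mult.assoc)
  from qvec.subspace_add[OF W 3 4] show ?thesis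
    unfolding e gsign_def by simp
qed

text \<open>Besides being an equivalence with signs, \<open>grel\<close> must account for all
  relations. Each of the three kinds of generators is an instance of \<open>grel\<close> with the
  matching sign, so a functional that respects \<open>grel\<close> vanishes on their span.\<close>

lemma signed_relation_grel: "signed_relation (grel r m d) (hairy_relations r m d)"
proof
  show "grel r m d y x e" if g: "grel r m d x y e" for x y e
  proof -
    obtain \<alpha> \<beta> \<phi> where "giso x y \<alpha> \<beta> \<phi>" "e = gsign m d x y \<alpha> \<beta> \<phi>" "is_hairy_graph r x" "is_hairy_graph r y"
      using g by (auto simp: grel_def)
    then show ?thesis using giso_inverse[of x y \<alpha> \<beta> \<phi> r m d] unfolding grel_def by metis
  qed
  show "grel r m d x z (e * f)" if ef: "grel r m d x y e" "grel r m d y z f" for x y z e f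
  proof -
    obtain \<alpha> \<beta> \<phi> \<alpha>' \<beta>' \<phi>' where g: "giso x y \<alpha> \<beta> \<phi>" "giso y z \<alpha>' \<beta>' \<phi>'"
      and e: "e = gsign m d x y \<alpha> \<beta> \<phi>" "f = gsign m d y z \<alpha>' \<beta>' \<phi>'"
      and h: "is_hairy_graph r x" "is_hairy_graph r y" "is_hairy_graph r z"
      using ef unfolding grel_def by blast
    show ?thesis
      unfolding grel_def using h giso_comp[OF g h(1)] gsign_comp[OF g h, of m d] e by force
  qed
  show "e = 1 \<or> e = - 1" if "grel r m d x y e" for x y e
    using that gsign_cases unfolding grel_def by blast
  show "qvec.subspace (hairy_relations r m d)"
    by (simp add: hairy_relations_def qvec.subspace_span)
  show "gvec y - qscale e (gvec x) \<in> hairy_relations r m d" if "grel r m d x y e" for x y e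
    using that by (rule grel_relation)
  fix f w assume f: "\<And>x y e. grel r m d x y e \<Longrightarrow> f y = e * f x" and w: "w \<in> hairy_relations r m d"
  have iso: "f \<Gamma>' = f \<Gamma>" if hi: "is_hairy_graph r \<Gamma>" "hairy_iso \<Gamma> \<Gamma>'" for \<Gamma> \<Gamma>'
  proof -
    note h = is_hairy_graphD[OF hi(1)]
    obtain k where k: "pre_digraph.digraph_isomorphism (shape \<Gamma>) k" "shape \<Gamma>' = app_iso k (shape \<Gamma>)"
      "\<forall>v\<in>verts (shape \<Gamma>). color \<Gamma>' (iso_verts k v) = color \<Gamma> v"
      "ordering \<Gamma>' = map (map_sum (iso_verts k) (iso_arcs k)) (ordering \<Gamma>)"
      using hi(2) unfolding hairy_iso_def by blast
    have g: "giso \<Gamma> \<Gamma>' (iso_verts k) (iso_arcs k) {}"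
      using k unfolding giso_def pre_digraph.digraph_isomorphism_def by (auto simp: bij_betw_def)
    have d: "distinct (ordering \<Gamma>')"
      using giso_inj[OF g] h(4,5) by (simp add: k(4) distinct_map)
    have "is_hairy_graph r \<Gamma>'"
      by (rule giso_hairy[OF g hi(1) d]) (use giso_image[OF g] h(5) in \<open>simp add: k(4)\<close>)
    moreover have "gsign m d \<Gamma> \<Gamma>' (iso_verts k) (iso_arcs k) {} = 1"
      unfolding gsign_def k(4)[symmetric] using koszul_sign_refl[OF d] by (simp add: psign_def)
    ultimately show ?thesis using f[of \<Gamma> \<Gamma>' 1] hi(1) g unfolding grel_def by force
  qed
  have rev: "f (reverse_edge e \<Gamma>) = (- 1) ^ d * f \<Gamma>" if "is_hairy_graph r \<Gamma>" "e \<in> arcs (shape \<Gamma>)" for \<Gamma> e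
  proof -
    have g: "giso \<Gamma> (reverse_edges {e} \<Gamma>) id id {e}" using giso_reverse_edges that by simp
    have "ordering (reverse_edges {e} \<Gamma>) = ordering \<Gamma>" by (simp add: reverse_edges_def)
    then have "gsign m d \<Gamma> (reverse_edges {e} \<Gamma>) id id {e} = (- 1) ^ d"
      unfolding gsign_def using koszul_sign_refl is_hairy_graphD(4)[OF that(1)]
      by (cases "even d") (simp_all add: psign_def map_sum.id)
    then have "grel r m d \<Gamma> (reverse_edges {e} \<Gamma>) ((- 1) ^ d)"
      using g that reverse_edges_hairy[of r \<Gamma> "{e}"] unfolding grel_def by force
    then show ?thesis using f unfolding reverse_edge_eq by blast
  qed
  have ord: "f (\<Gamma>\<lparr>ordering := ys\<rparr>) = koszul_sign (elt_deg m d \<Gamma>) (ordering \<Gamma>) ys * f \<Gamma>"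
    if "is_hairy_graph r \<Gamma>" "distinct ys" "set ys = set (ordering \<Gamma>)" for \<Gamma> ys
  proof -
    let ?\<Gamma> = "\<Gamma>\<lparr>ordering := ys\<rparr>"
    have g: "giso \<Gamma> ?\<Gamma> id id {}" by (simp add: giso_def)
    have h: "is_hairy_graph r ?\<Gamma>"
      by (rule giso_hairy[OF g that(1)]) (use that is_hairy_graphD[OF that(1)] in simp_all)
    have "elt_deg m d ?\<Gamma> x = elt_deg m d \<Gamma> x" for x by (cases x) simp_all
    then have "elt_deg m d ?\<Gamma> = elt_deg m d \<Gamma>" ..
    then have "gsign m d \<Gamma> ?\<Gamma> id id {} = koszul_sign (elt_deg m d \<Gamma>) (ordering \<Gamma>) ys"
      by (simp add: gsign_def map_sum.id psign_def)
    then have "grel r m d \<Gamma> ?\<Gamma> (koszul_sign (elt_deg m d \<Gamma>) (ordering \<Gamma>) ys)"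
      using g h that(1) unfolding grel_def by force
    then show ?thesis by (rule f)
  qed
  show "pairing f w = 0"
    using w unfolding hairy_relations_def
    by (rule pairing_span) (auto simp: pairing_diff pairing_qscale iso rev ord)
qed

section \<open>Betti numbers and functional graphs\<close>

definition gconn :: "('v, 'e) pre_digraph \<Rightarrow> bool" where
  "gconn G \<longleftrightarrow> (\<forall>S\<subseteq>verts G. S \<noteq> {} \<longrightarrow>
     (\<forall>e\<in>arcs G. tail G e \<in> S \<longleftrightarrow> head G e \<in> S) \<longrightarrow> S = verts G)"

definition joins :: "('v, 'e) pre_digraph \<Rightarrow> 'e \<Rightarrow> 'v \<Rightarrow> 'v \<Rightarrow> bool" where
  "joins G e u v \<longleftrightarrow> (tail G e = u \<and> head G e = v) \<or> (tail G e = v \<and> head G e = u)"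

lemma connected_gconn:
  assumes "wf_digraph G"
  shows "connected G \<longleftrightarrow> verts G \<noteq> {} \<and> gconn G"
  unfolding connected_iff_closed[OF assms] gconn_def by (simp only: imp_conjL)

lemma gconnD:
  assumes "gconn G" "S \<subseteq> verts G" "S \<noteq> {}"
    "\<And>e. e \<in> arcs G \<Longrightarrow> tail G e \<in> S \<longleftrightarrow> head G e \<in> S"
  shows "S = verts G"
  using assms(1)[unfolded gconn_def, rule_format, OF assms(2,3)] assms(4) by simp

text \<open>A spanning tree rooted at \<open>a\<close>, given by the parent edge, the parent and a
  height. The strict decrease of the height expresses that there are no cycles and later serves as
  an induction measure.\<close>

lemma breadth_first:
  assumes "fin_digraph G" "gconn G" "a \<in> verts G"
  obtains ht :: "'v \<Rightarrow> nat" and pe :: "'v \<Rightarrow> 'e" and par :: "'v \<Rightarrow> 'v" where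
    "\<And>v. v \<in> verts G \<Longrightarrow> v \<noteq> a \<Longrightarrow>
      pe v \<in> arcs G \<and> par v \<in> verts G \<and> ht (par v) < ht v \<and> joins G (pe v) v (par v)"
proof -
  interpret fin_digraph G by (rule assms)
  \<comment> \<open>\<open>R k\<close> is the ball of radius k around \<open>a\<close>; the height
    of a vertex is the first radius that reaches it.\<close>
  define R where "R = rec_nat {a} (\<lambda>_ S. S \<union> {v \<in> verts G. \<exists>e\<in>arcs G. \<exists>u\<in>S. joins G e v u})"
  have R0: "R 0 = {a}" and RS: "R (Suc k) = R k \<union> {v \<in> verts G. \<exists>e\<in>arcs G. \<exists>u\<in>R k. joins G e v u}" for k
    by (simp_all add: R_def)
  have RV: "R k \<subseteq> verts G" for k
    by (induction k) (use assms(3) in \<open>auto simp: R0 RS\<close>)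
  have step: "v \<in> (\<Union>k. R k)" if uv: "u \<in> (\<Union>k. R k)" "joins G e v u" "e \<in> arcs G" "v \<in> verts G" for u v e
  proof -
    obtain k where "u \<in> R k" using uv by blast
    then have "v \<in> R (Suc k)" using uv by (auto simp: RS)
    then show ?thesis by blast
  qed
  have all: "(\<Union>k. R k) = verts G"
  proof (rule gconnD[OF assms(2)])
    show "(\<Union>k. R k) \<subseteq> verts G" using RV by blast
    show "(\<Union>k. R k) \<noteq> {}" using R0 by blast
    show "tail G e \<in> (\<Union>k. R k) \<longleftrightarrow> head G e \<in> (\<Union>k. R k)" if "e \<in> arcs G" for e
      using step[OF _ _ that, of "tail G e" "head G e"] step[OF _ _ that, of "head G e" "tail G e"]
        that by (auto simp: joins_def)
  qed
  define ht where "ht v = (LEAST k. v \<in> R k)" for v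
  have "\<exists>e u. e \<in> arcs G \<and> u \<in> verts G \<and> ht u < ht v \<and> joins G e v u"
    if v: "v \<in> verts G" "v \<noteq> a" for v
  proof -
    have "v \<in> (\<Union>k. R k)" unfolding all by (rule v)
    then obtain k where "v \<in> R k" by blast
    then have hv: "v \<in> R (ht v)" unfolding ht_def by (rule LeastI)
    obtain k where k: "ht v = Suc k" using hv v R0 by (cases "ht v") auto
    have "v \<notin> R k" using not_less_Least[of k "\<lambda>k. v \<in> R k"] k unfolding ht_def by auto
    then obtain e u where eu: "e \<in> arcs G" "u \<in> R k" "joins G e v u" using hv k RS by auto
    have "ht u \<le> k" unfolding ht_def by (rule Least_le) (rule eu)
    then show ?thesis using eu k RV by (intro exI[of _ e] exI[of _ u]) auto
  qed
  then obtain pe par where "\<And>v. v \<in> verts G \<Longrightarrow> v \<noteq> a \<Longrightarrow>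
      pe v \<in> arcs G \<and> par v \<in> verts G \<and> ht (par v) < ht v \<and> joins G (pe v) v (par v)" by metis
  then show thesis by (rule that)
qed

text \<open>If two vertices shared a parent edge, each would be the parent of the other, and both
  heights would have to decrease.\<close>

lemma parent_edge_inj:
  fixes ht :: "'v \<Rightarrow> nat"
  assumes "\<And>v. v \<in> verts G \<Longrightarrow> v \<noteq> a \<Longrightarrow>
      pe v \<in> arcs G \<and> par v \<in> verts G \<and> ht (par v) < ht v \<and> joins G (pe v) v (par v)"
  shows "inj_on pe (verts G - {a})"
proof (rule inj_onI)
  fix u v assume u: "u \<in> verts G - {a}" "v \<in> verts G - {a}" "pe u = pe v"
  then have "joins G (pe u) u (par u)" "ht (par u) < ht u" "joins G (pe u) v (par v)" "ht (par v) < ht v"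
    using assms[of u] assms[of v] by auto
  then show "u = v" by (auto simp: joins_def)
qed

lemma parent_edge_gconn:
  fixes ht :: "'v \<Rightarrow> nat"
  assumes "\<And>v. v \<in> verts G \<Longrightarrow> v \<noteq> a \<Longrightarrow>
      pe v \<in> arcs G \<and> par v \<in> verts G \<and> ht (par v) < ht v \<and> joins G (pe v) v (par v)"
    and a: "a \<in> verts G"
  shows "gconn (G\<lparr>arcs := pe ` (verts G - {a})\<rparr>)"
  unfolding gconn_def
proof (intro allI impI)
  let ?H = "G\<lparr>arcs := pe ` (verts G - {a})\<rparr>"
  have all: "v \<in> S" if "a \<in> S" "\<forall>e\<in>arcs ?H. tail ?H e \<in> S \<longleftrightarrow> head ?H e \<in> S" "v \<in> verts G" for S v
    using that(3)
  proof (induction "ht v" arbitrary: v rule: less_induct)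
    case less
    show ?case
    proof (cases "v = a")
      case False
      note p = assms(1)[OF less.prems False]
      have "par v \<in> S" using less.hyps p by blast
      moreover have "pe v \<in> arcs ?H" using less.prems False by simp
      ultimately show ?thesis using that(2) p by (fastforce simp: joins_def)
    qed (use that in simp)
  qed
  fix S assume S: "S \<subseteq> verts ?H" "S \<noteq> {}" "\<forall>e\<in>arcs ?H. tail ?H e \<in> S \<longleftrightarrow> head ?H e \<in> S"
  have "a \<in> S"
  proof (rule ccontr)
    assume "a \<notin> S"
    have "v \<in> - S" if "v \<in> verts G" for v by (rule all[OF _ _ that]) (use \<open>a \<notin> S\<close> S(3) in auto)
    then show False using S(1,2) by auto
  qed
  then have "verts G \<subseteq> S" using all[OF _ S(3)] by blast
  then show "S = verts ?H" using S(1) by simp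
qed

section \<open>The boundary map and the cycles of a connected graph\<close>

lemma lookup_boundary:
  assumes "finite E" "Poly_Mapping.keys c \<subseteq> E"
  shows "Poly_Mapping.lookup (boundary G c) v =
    (\<Sum>e\<in>E. Poly_Mapping.lookup c e * (of_bool (head G e = v) - of_bool (tail G e = v)))"
proof -
  have "Poly_Mapping.lookup (boundary G c) v =
      (\<Sum>e\<in>Poly_Mapping.keys c. Poly_Mapping.lookup c e * (of_bool (head G e = v) - of_bool (tail G e = v)))"
    unfolding boundary_def lookup_sum
    by (rule sum.cong) (auto simp: lookup_minus lookup_single when_def)
  also have "\<dots> = (\<Sum>e\<in>E. Poly_Mapping.lookup c e * (of_bool (head G e = v) - of_bool (tail G e = v)))"
    by (rule sum.mono_neutral_left) (use assms in \<open>auto simp: in_keys_iff\<close>)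
  finally show ?thesis .
qed

lemma boundary_add: "boundary G (c + c') = boundary G c + boundary G c'"
proof (rule poly_mapping_eqI)
  fix v
  let ?E = "Poly_Mapping.keys c \<union> Poly_Mapping.keys c'"
  have "Poly_Mapping.keys (c + c') \<subseteq> ?E" by (rule Poly_Mapping.keys_add)
  then show "Poly_Mapping.lookup (boundary G (c + c')) v =
      Poly_Mapping.lookup (boundary G c + boundary G c') v"
    using lookup_boundary[of ?E "c + c'" G v] lookup_boundary[of ?E c G v] lookup_boundary[of ?E c' G v]
    by (simp add: lookup_add sum.distrib distrib_right)
qed

lemma boundary_qscale: "boundary G (qscale k c) = qscale k (boundary G c)"
proof (rule poly_mapping_eqI)
  fix v
  have "Poly_Mapping.keys (qscale k c) \<subseteq> Poly_Mapping.keys c" by (auto simp: in_keys_iff)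
  then show "Poly_Mapping.lookup (boundary G (qscale k c)) v =
      Poly_Mapping.lookup (qscale k (boundary G c)) v"
    using lookup_boundary[of "Poly_Mapping.keys c" "qscale k c" G v]
      lookup_boundary[of "Poly_Mapping.keys c" c G v]
    by (simp add: sum_distrib_left mult.assoc)
qed

interpretation boundary: Vector_Spaces.linear qscale qscale "boundary G"
  by unfold_locales (simp_all add: boundary_add boundary_qscale)

lemma boundary_single: "boundary G (Poly_Mapping.single e 1) =
    Poly_Mapping.single (head G e) 1 - Poly_Mapping.single (tail G e) 1"
  by (simp add: boundary_def)

lemma keys_diff_subset: "Poly_Mapping.keys (c - c') \<subseteq> Poly_Mapping.keys c \<union> Poly_Mapping.keys c'"
  by (auto simp: in_keys_iff lookup_minus)

lemma keys_subset_iff: "Poly_Mapping.keys c \<subseteq> E \<longleftrightarrow> (\<forall>e. e \<notin> E \<longrightarrow> Poly_Mapping.lookup c e = 0)"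
  by (auto simp: in_keys_iff)

text \<open>At a vertex of greatest height among those whose parent edge is used by
  \<open>c\<close>, no other used edge ends: such an edge would make this vertex a parent of a still
  higher one. The boundary is therefore non-zero there.\<close>

lemma tree_kernel:
  fixes ht :: "'v \<Rightarrow> nat"
  assumes "\<And>v. v \<in> verts G \<Longrightarrow> v \<noteq> a \<Longrightarrow>
      pe v \<in> arcs G \<and> par v \<in> verts G \<and> ht (par v) < ht v \<and> joins G (pe v) v (par v)"
    and c: "Poly_Mapping.keys c \<subseteq> pe ` (verts G - {a})" "boundary G c = 0"
  shows "c = 0"
proof (rule ccontr)
  assume "c \<noteq> 0"
  define U where "U = {v \<in> verts G - {a}. pe v \<in> Poly_Mapping.keys c}"
  have inj: "inj_on pe (verts G - {a})" by (rule parent_edge_inj[OF assms(1)])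
  have keys: "Poly_Mapping.keys c = pe ` U" using c(1) by (auto simp: U_def)
  have finU: "finite U"
    by (rule finite_imageD[of pe]) (use keys inj in \<open>auto simp: U_def keys[symmetric] intro: inj_on_subset\<close>)
  have "U \<noteq> {}" using \<open>c \<noteq> 0\<close> keys by auto
  then have "Max (ht ` U) \<in> ht ` U" using finU by (intro Max_in) auto
  then obtain v where v0: "v \<in> U" "ht v = Max (ht ` U)" by auto
  have v: "v \<in> U" "\<And>u. u \<in> U \<Longrightarrow> ht u \<le> ht v" using v0 finU by auto
  have p: "pe v \<in> arcs G" "par v \<in> verts G" "ht (par v) < ht v" "joins G (pe v) v (par v)"
    using assms(1)[of v] v(1) by (auto simp: U_def)
  have "0 = Poly_Mapping.lookup (boundary G c) v" by (simp add: c(2))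
  also have "\<dots> = (\<Sum>e\<in>Poly_Mapping.keys c. Poly_Mapping.lookup c e *
      (of_bool (head G e = v) - of_bool (tail G e = v)))"
    by (rule lookup_boundary) auto
  also have "\<dots> = (\<Sum>e\<in>{pe v}. Poly_Mapping.lookup c e *
      (of_bool (head G e = v) - of_bool (tail G e = v)))"
  proof (rule sum.mono_neutral_right)
    show "\<forall>e\<in>Poly_Mapping.keys c - {pe v}.
        Poly_Mapping.lookup c e * (of_bool (head G e = v) - of_bool (tail G e = v)) = 0"
    proof
      fix e assume "e \<in> Poly_Mapping.keys c - {pe v}"
      then obtain u where u: "u \<in> U" "e = pe u" "u \<noteq> v" using keys by auto
      have "joins G e u (par u)" "ht (par u) < ht u" using assms(1)[of u] u by (auto simp: U_def)
      then have "head G e \<noteq> v \<and> tail G e \<noteq> v" using v(2)[OF u(1)] u(3) by (auto simp: joins_def)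
      then show "Poly_Mapping.lookup c e * (of_bool (head G e = v) - of_bool (tail G e = v)) = 0" by simp
    qed
  qed (use v finU keys in auto)
  also have "\<dots> \<noteq> 0"
    using p(3,4) v(1) by (auto simp: joins_def U_def in_keys_iff)
  finally show False by simp
qed

lemma tree_path:
  fixes G :: "('v, 'e) pre_digraph" and ht :: "'v \<Rightarrow> nat"
  assumes "\<And>v. v \<in> verts G \<Longrightarrow> v \<noteq> a \<Longrightarrow>
      pe v \<in> arcs G \<and> par v \<in> verts G \<and> ht (par v) < ht v \<and> joins G (pe v) v (par v)"
    and "v \<in> verts G"
  shows "\<exists>c. Poly_Mapping.keys c \<subseteq> pe ` (verts G - {a}) \<and>
    boundary G c = Poly_Mapping.single v 1 - Poly_Mapping.single a 1"
  using assms(2)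
proof (induction "ht v" arbitrary: v rule: less_induct)
  case less
  show ?case
  proof (cases "v = a")
    case True
    then show ?thesis by (intro exI[of _ 0]) (simp add: boundary.zero)
  next
    case False
    note p = assms(1)[OF less.prems False]
    obtain c where c: "Poly_Mapping.keys c \<subseteq> pe ` (verts G - {a})"
      "boundary G c = Poly_Mapping.single (par v) 1 - Poly_Mapping.single a 1"
      using less.hyps[of "par v"] p by blast
    let ?s = "Poly_Mapping.single (pe v) 1 :: 'e \<Rightarrow>\<^sub>0 rat"
    have s: "Poly_Mapping.keys ?s \<subseteq> pe ` (verts G - {a})" using less.prems False by simp
    from p consider "tail G (pe v) = par v \<and> head G (pe v) = v" | "tail G (pe v) = v \<and> head G (pe v) = par v"
      by (auto simp: joins_def)
    then show ?thesis
    proof cases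
      case 1
      then show ?thesis using c s Poly_Mapping.keys_add[of c ?s]
        by (intro exI[of _ "c + ?s"]) (auto simp: boundary_add boundary_single)
    next
      case 2
      then show ?thesis using c s keys_diff_subset[of c ?s]
        by (intro exI[of _ "c - ?s"]) (auto simp: boundary.diff boundary_single)
    qed
  qed
qed

text \<open>A spanning tree has V - 1 edges, and each remaining edge closes up through the tree to a
  fundamental cycle; these cycles form a basis of the first homology. The formula is written with
  sums to avoid truncated subtraction.\<close>

theorem betti1_connected:
  fixes G :: "('v, 'e) pre_digraph"
  assumes "fin_digraph G" "gconn G" "verts G \<noteq> {}"
  shows "betti1 G + card (verts G) = card (arcs G) + 1"
proof -
  interpret fin_digraph G by (rule assms)
  obtain a where a: "a \<in> verts G" using assms(3) by blast
  obtain ht :: "'v \<Rightarrow> nat" and pe par where tree: "\<And>v. v \<in> verts G \<Longrightarrow> v \<noteq> a \<Longrightarrow>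
      pe v \<in> arcs G \<and> par v \<in> verts G \<and> ht (par v) < ht v \<and> joins G (pe v) v (par v)"
    by (rule breadth_first[OF assms(1,2) a]) blast
  let ?T = "pe ` (verts G - {a})"
  have TE: "?T \<subseteq> arcs G" using tree by auto
  have cardT: "card ?T + 1 = card (verts G)"
  proof -
    have "card (verts G) > 0" using a by (auto simp: card_gt_0_iff)
    then show ?thesis using card_image[OF parent_edge_inj[OF tree]] a by (simp add: card_Diff_singleton_if)
  qed
  obtain P where P: "\<And>v. v \<in> verts G \<Longrightarrow> Poly_Mapping.keys (P v) \<subseteq> ?T \<and>
    boundary G (P v) = Poly_Mapping.single v 1 - Poly_Mapping.single a 1"
    using tree_path[OF tree] by metis
  \<comment> \<open>The chains from the two ends of \<open>e\<close> to the root cancel the boundary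
    of \<open>e\<close>. Outside the tree the only coefficient is the 1 at \<open>e\<close>, which
    makes these cycles independent.\<close>
  define z where "z e = Poly_Mapping.single e 1 + P (tail G e) - P (head G e)" for e
  let ?F = "arcs G - ?T"
  let ?K = "{c. Poly_Mapping.keys c \<subseteq> arcs G \<and> boundary G c = 0}"
  have zlook: "Poly_Mapping.lookup (z e) f = (if e = f then 1 else 0)" if "e \<in> ?F" "f \<in> ?F" for e f
  proof -
    have "Poly_Mapping.lookup (P v) f = 0" if "v \<in> verts G" for v
      using P[OF that] \<open>f \<in> ?F\<close> by (auto simp: in_keys_iff)
    then show ?thesis using that(1) by (simp add: z_def lookup_add lookup_minus lookup_single when_def)
  qed
  have zK: "z e \<in> ?K" if e: "e \<in> ?F" for e
  proof -
    have PT: "Poly_Mapping.keys (P (tail G e)) \<subseteq> ?T" "Poly_Mapping.keys (P (head G e)) \<subseteq> ?T"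
      using P[of "tail G e"] P[of "head G e"] e by simp_all
    have "Poly_Mapping.keys (Poly_Mapping.single e 1 + P (tail G e)) \<subseteq> {e} \<union> ?T"
      by (rule order_trans[OF Poly_Mapping.keys_add]) (use PT(1) in auto)
    then have "Poly_Mapping.keys (z e) \<subseteq> {e} \<union> ?T"
      unfolding z_def by (intro order_trans[OF keys_diff_subset] Un_least) (use PT(2) in auto)
    moreover have "boundary G (z e) = 0"
      unfolding z_def using P[of "tail G e"] P[of "head G e"] e
      by (simp add: boundary.diff boundary_add boundary_single)
    ultimately show ?thesis using e TE by auto
  qed
  have subK: "qvec.subspace ?K"
    unfolding qvec.subspace_def keys_subset_iff
    by (auto simp: boundary.zero boundary_add boundary_qscale lookup_add)
  have finF: "finite ?F" using finite_arcs by simp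
  have injz: "inj_on z ?F"
  proof (rule inj_onI)
    fix e f assume ef: "e \<in> ?F" "f \<in> ?F" "z e = z f"
    then show "e = f" using zlook[OF ef(1,1)] zlook[OF ef(2,1)] by (metis zero_neq_one)
  qed
  have ind: "qvec.independent (z ` ?F)"
  proof (rule qvec.independent_if_scalars_zero)
    fix k x assume s: "(\<Sum>x\<in>z ` ?F. qscale (k x) x) = 0" and x: "x \<in> z ` ?F"
    obtain f where f: "f \<in> ?F" "x = z f" using x by blast
    have "0 = Poly_Mapping.lookup (\<Sum>x\<in>z ` ?F. qscale (k x) x) f" by (simp add: s)
    also have "\<dots> = (\<Sum>e\<in>?F. k (z e) * Poly_Mapping.lookup (z e) f)"
      using injz by (simp add: sum.reindex lookup_sum)
    also have "\<dots> = (\<Sum>e\<in>?F. if e = f then k x else 0)"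
      by (rule sum.cong) (use zlook f in auto)
    finally show "k x = 0" using f finF by simp
  qed (use finF in simp)
  have "qvec.span (z ` ?F) = qvec.span ?K"
  proof
    show "qvec.span (z ` ?F) \<subseteq> qvec.span ?K" using zK by (intro qvec.span_mono) blast
    have "?K \<subseteq> qvec.span (z ` ?F)"
    proof
      fix c assume c: "c \<in> ?K"
      \<comment> \<open>Subtracting the fundamental cycles with the coefficients of \<open>c\<close>
        at the non-tree edges leaves a cycle supported on the tree, and such a cycle is
        zero.\<close>
      define w where "w = (\<Sum>e\<in>?F. qscale (Poly_Mapping.lookup c e) (z e))"
      have wsp: "w \<in> qvec.span (z ` ?F)"
        unfolding w_def by (rule qvec.span_sum, rule qvec.span_scale, rule qvec.span_base) simp
      have "w \<in> ?K"
        unfolding w_def using zK by (intro qvec.subspace_sum[OF subK] qvec.subspace_scale[OF subK])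
      then have cw: "c - w \<in> ?K" using c subK by (metis qvec.subspace_diff)
      have "Poly_Mapping.lookup (c - w) f = 0" if f: "f \<in> ?F" for f
      proof -
        have "Poly_Mapping.lookup w f = (\<Sum>e\<in>?F. Poly_Mapping.lookup c e * Poly_Mapping.lookup (z e) f)"
          by (simp add: w_def lookup_sum)
        also have "\<dots> = (\<Sum>e\<in>?F. if e = f then Poly_Mapping.lookup c f else 0)"
          by (rule sum.cong) (use zlook f in auto)
        also have "\<dots> = Poly_Mapping.lookup c f" using f finF by simp
        finally show ?thesis by (simp add: lookup_minus)
      qed
      then have k1: "Poly_Mapping.keys (c - w) \<subseteq> ?T" using cw by (auto simp: in_keys_iff)
      have k2: "boundary G (c - w) = 0" using cw by simp
      have "c - w = 0" by (rule tree_kernel[OF _ k1 k2]) (rule tree)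
      then show "c \<in> qvec.span (z ` ?F)" using wsp by simp
    qed
    then show "qvec.span ?K \<subseteq> qvec.span (z ` ?F)" by (intro qvec.span_minimal) auto
  qed
  then have "qvec.dim ?K = card (z ` ?F)" using ind by (rule qvec.dim_eq_card)
  also have "\<dots> = card ?F" by (rule card_image[OF injz])
  also have "\<dots> = card (arcs G) - card ?T" using TE finite_arcs by (intro card_Diff_subset) (auto intro: finite_subset)
  finally have "betti1 G = card (arcs G) - card ?T" by (simp add: betti1_def)
  moreover have "card ?T \<le> card (arcs G)" using TE finite_arcs by (rule card_mono[rotated])
  ultimately show ?thesis using cardT by simp
qed

text \<open>A connected graph with as many edges as vertices is a spanning tree and one more edge; rooting
  the tree at an end of that edge and directing it towards the root gives every vertex exactly one
  outgoing edge.\<close>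

lemma functional_orientation:
  fixes G :: "('v, 'e) pre_digraph"
  assumes "fin_digraph G" "gconn G" "verts G \<noteq> {}" "card (arcs G) = card (verts G)"
  obtains f :: "'v \<Rightarrow> 'v" and e :: "'v \<Rightarrow> 'e" where "bij_betw e (verts G) (arcs G)"
    "f ` verts G \<subseteq> verts G" "\<And>v. v \<in> verts G \<Longrightarrow> joins G (e v) v (f v)"
proof -
  interpret fin_digraph G by (rule assms)
  obtain a where a: "a \<in> verts G" using assms(3) by blast
  obtain ht :: "'v \<Rightarrow> nat" and pe par where tree: "\<And>v. v \<in> verts G \<Longrightarrow> v \<noteq> a \<Longrightarrow>
      pe v \<in> arcs G \<and> par v \<in> verts G \<and> ht (par v) < ht v \<and> joins G (pe v) v (par v)"
    by (rule breadth_first[OF assms(1,2) a]) blast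
  let ?T = "pe ` (verts G - {a})"
  have TE: "?T \<subseteq> arcs G" using tree by auto
  have cardT: "card ?T = card (verts G) - 1"
    using card_image[OF parent_edge_inj[OF tree]] a by (simp add: card_Diff_singleton_if)
  have pos: "card (verts G) > 0" using a by (auto simp: card_gt_0_iff)
  have "card (arcs G - ?T) = 1"
    using TE cardT pos assms(4) finite_arcs by (subst card_Diff_subset) (auto intro: finite_subset)
  then obtain e0 where e0: "arcs G - ?T = {e0}" by (auto simp: card_1_singleton_iff)
  let ?p = "tail G e0"
  let ?H = "G\<lparr>arcs := ?T\<rparr>"
  have "e0 \<in> arcs G" using e0 by blast
  then have p: "?p \<in> verts G" "head G e0 \<in> verts G" by simp_all
  have finH: "fin_digraph ?H" by unfold_locales (use TE in auto)
  \<comment> \<open>The search is repeated inside the tree itself, now starting from an end of the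
    extra edge. It finds as many parent edges as the tree has edges, so it uses all of them.\<close>
  obtain ht' :: "'v \<Rightarrow> nat" and pe' par' where tree': "\<And>v. v \<in> verts ?H \<Longrightarrow> v \<noteq> ?p \<Longrightarrow>
      pe' v \<in> arcs ?H \<and> par' v \<in> verts ?H \<and> ht' (par' v) < ht' v \<and> joins ?H (pe' v) v (par' v)"
    by (rule breadth_first[OF finH parent_edge_gconn[OF tree a], of ?p]) (use p in auto)
  have inj': "inj_on pe' (verts G - {?p})" using parent_edge_inj[OF tree'] by simp
  have sub': "pe' ` (verts G - {?p}) \<subseteq> ?T" using tree' by auto
  have "card (pe' ` (verts G - {?p})) = card ?T"
    using card_image[OF inj'] p cardT by (simp add: card_Diff_singleton_if)
  then have img': "pe' ` (verts G - {?p}) = ?T"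
    using sub' finite_arcs by (intro card_subset_eq) auto
  define e where "e v = (if v = ?p then e0 else pe' v)" for v
  define f where "f v = (if v = ?p then head G e0 else par' v)" for v
  show thesis
  proof (rule that[of e f])
    have "e ` verts G = insert e0 (pe' ` (verts G - {?p}))" using p(1) by (auto simp: e_def)
    also have "\<dots> = arcs G" unfolding img' using e0 TE by blast
    finally have img: "e ` verts G = arcs G" .
    moreover have "inj_on e (verts G)"
    proof (rule eq_card_imp_inj_on)
      show "card (e ` verts G) = card (verts G)" unfolding img by (rule assms(4))
    qed simp
    ultimately show "bij_betw e (verts G) (arcs G)" by (simp add: bij_betw_def)
    show "f ` verts G \<subseteq> verts G" using tree' p by (auto simp: f_def)
    show "joins G (e v) v (f v)" if "v \<in> verts G" for v
      using tree'[of v] that by (auto simp: e_def f_def joins_def)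
  qed
qed

section \<open>Genus and complexity by counting vertices and edges\<close>

lemma hairy_gconn:
  assumes "is_hairy_graph r \<Gamma>"
  shows "gconn (shape \<Gamma>)" "verts (shape \<Gamma>) \<noteq> {}"
  using is_hairy_graphD(6)[OF assms] connected_gconn[OF is_hairy_graphD(1)[OF assms]] by auto

lemma hairy_fin_digraph:
  assumes "is_hairy_graph r \<Gamma>"
  shows "fin_digraph (shape \<Gamma>)"
  using assms by (simp add: is_hairy_graph_def)

lemma genus_card:
  assumes "is_hairy_graph r \<Gamma>"
  shows "genus \<Gamma> + card (verts (shape \<Gamma>)) = card (arcs (shape \<Gamma>)) + 1"
  unfolding genus_def by (rule betti1_connected[OF hairy_fin_digraph[OF assms] hairy_gconn[OF assms]])

text \<open>Gluing keeps all edges and leaves the internal vertices and one more, and it does not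
  destroy connectedness; the Euler formula does the rest.\<close>

lemma complexity_card:
  assumes "is_hairy_graph r \<Gamma>"
  shows "complexity \<Gamma> + card (internal \<Gamma>) = card (arcs (shape \<Gamma>))"
proof -
  interpret fin_digraph "shape \<Gamma>" by (rule hairy_fin_digraph[OF assms])
  define q where "q v = (if v \<in> external \<Gamma> then None else Some v)" for v
  have gl: "verts (glued \<Gamma>) = q ` verts (shape \<Gamma>)" "arcs (glued \<Gamma>) = arcs (shape \<Gamma>)"
    "tail (glued \<Gamma>) = (\<lambda>e. q (tail (shape \<Gamma>) e))" "head (glued \<Gamma>) = (\<lambda>e. q (head (shape \<Gamma>) e))"
    by (simp_all add: glued_def q_def Let_def)
  have fin: "fin_digraph (glued \<Gamma>)" by unfold_locales (auto simp: gl)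
  have conn: "gconn (glued \<Gamma>)"
    unfolding gconn_def
  proof (intro allI impI)
    fix S assume S: "S \<subseteq> verts (glued \<Gamma>)" "S \<noteq> {}"
      "\<forall>e\<in>arcs (glued \<Gamma>). tail (glued \<Gamma>) e \<in> S \<longleftrightarrow> head (glued \<Gamma>) e \<in> S"
    let ?S = "{v \<in> verts (shape \<Gamma>). q v \<in> S}"
    have img: "S \<subseteq> q ` verts (shape \<Gamma>)" using S(1) by (simp add: gl)
    have "?S = verts (shape \<Gamma>)"
    proof (rule gconnD[OF hairy_gconn(1)[OF assms]])
      show "?S \<noteq> {}" using img S(2) by auto
      show "tail (shape \<Gamma>) e \<in> ?S \<longleftrightarrow> head (shape \<Gamma>) e \<in> ?S" if "e \<in> arcs (shape \<Gamma>)" for e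
        using S(3) that by (simp add: gl)
    qed auto
    then have "q ` verts (shape \<Gamma>) \<subseteq> S" by auto
    then show "S = verts (glued \<Gamma>)" using img by (simp add: gl)
  qed
  have ext: "external \<Gamma> \<noteq> {}" "external \<Gamma> \<subseteq> verts (shape \<Gamma>)"
    using assms by (auto simp: is_hairy_graph_def external_def)
  have int: "internal \<Gamma> = verts (shape \<Gamma>) - external \<Gamma>"
    by (auto simp: internal_def external_def)
  have "verts (glued \<Gamma>) = insert None (Some ` internal \<Gamma>)"
    using ext unfolding gl int q_def by auto
  then have "card (verts (glued \<Gamma>)) = card (internal \<Gamma>) + 1"
    using finite_verts int by (simp add: card_image)
  moreover have "betti1 (glued \<Gamma>) + card (verts (glued \<Gamma>)) = card (arcs (glued \<Gamma>)) + 1"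
    by (rule betti1_connected[OF fin conn]) (use hairy_gconn[OF assms] gl in auto)
  ultimately show ?thesis by (simp add: complexity_def gl)
qed

lemma card_verts_split:
  assumes "is_hairy_graph r \<Gamma>"
  shows "card (verts (shape \<Gamma>)) = card (external \<Gamma>) + card (internal \<Gamma>)"
proof -
  have "verts (shape \<Gamma>) = external \<Gamma> \<union> internal \<Gamma>" by (auto simp: external_def internal_def)
  moreover have "external \<Gamma> \<inter> internal \<Gamma> = {}" by (auto simp: external_def internal_def)
  ultimately show ?thesis using is_hairy_graphD(2)[OF assms] by (simp add: card_Un_disjoint)
qed

lemma genus_one_iff:
  assumes "is_hairy_graph r \<Gamma>"
  shows "genus \<Gamma> = 1 \<longleftrightarrow> card (arcs (shape \<Gamma>)) = card (verts (shape \<Gamma>))"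
  using genus_card[OF assms] by auto

text \<open>Genus one means that there are as many edges as vertices, so edges minus internal
  vertices are the hairs. This is what ties the exponent of u to the number of labels.\<close>

lemma genus_one_complexity:
  assumes "is_hairy_graph r \<Gamma>" "genus \<Gamma> = 1"
  shows "complexity \<Gamma> = card (external \<Gamma>)"
  using genus_card[OF assms(1)] complexity_card[OF assms(1)] card_verts_split[OF assms(1)] assms(2) by simp

lemma giso_cards:
  assumes "giso \<Gamma> \<Gamma>' \<alpha> \<beta> \<phi>"
  shows "card (verts (shape \<Gamma>')) = card (verts (shape \<Gamma>))" "card (arcs (shape \<Gamma>')) = card (arcs (shape \<Gamma>))"
    "external \<Gamma>' = \<alpha> ` external \<Gamma>" "card (external \<Gamma>') = card (external \<Gamma>)"
    "hodge_degree \<Gamma>' = hodge_degree \<Gamma>" "hdegree m d \<Gamma>' = hdegree m d \<Gamma>"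
proof -
  note g = assms[unfolded giso_def]
  have V: "verts (shape \<Gamma>') = \<alpha> ` verts (shape \<Gamma>)" and inj: "inj_on \<alpha> (verts (shape \<Gamma>))"
    using g by (auto simp: bij_betw_def)
  show "card (verts (shape \<Gamma>')) = card (verts (shape \<Gamma>))" "card (arcs (shape \<Gamma>')) = card (arcs (shape \<Gamma>))"
    using g by (metis bij_betw_same_card)+
  show e: "external \<Gamma>' = \<alpha> ` external \<Gamma>" using g V by (auto simp: external_def)
  have "inj_on \<alpha> (external \<Gamma>)" using inj by (rule inj_on_subset) (auto simp: external_def)
  then show "card (external \<Gamma>') = card (external \<Gamma>)" unfolding e by (rule card_image)
  show "hodge_degree \<Gamma>' = hodge_degree \<Gamma>"
  proof
    fix i
    have "{v \<in> verts (shape \<Gamma>'). color \<Gamma>' v = Some i} = \<alpha> ` {v \<in> verts (shape \<Gamma>). color \<Gamma> v = Some i}"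
      using g V by auto
    moreover have "inj_on \<alpha> {v \<in> verts (shape \<Gamma>). color \<Gamma> v = Some i}"
      using inj by (rule inj_on_subset) auto
    ultimately show "hodge_degree \<Gamma>' i = hodge_degree \<Gamma> i"
      unfolding hodge_degree_def by (simp add: card_image)
  qed
  show "hdegree m d \<Gamma>' = hdegree m d \<Gamma>"
    unfolding hdegree_def giso_image[OF assms, symmetric]
    by (subst sum.reindex[OF giso_inj[OF assms]]) (rule sum.cong[OF refl], simp add: giso_elt_deg[OF assms])
qed

section \<open>Canonical graphs of genus one with labelled hairs\<close>

text \<open>A natural number encodes a finite set of labels together with a flag. A vertex on the cycle has
  flag \<^const>\<open>True\<close> and the set of the labels of all hairs whose path to the cycle ends there; any
  other vertex has flag \<^const>\<open>False\<close> and the set of the labels of the hairs behind it.\<close>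

definition nd :: "nat set \<Rightarrow> bool \<Rightarrow> nat" where
  "nd S b = 2 * set_encode S + of_bool b"

definition nset :: "nat \<Rightarrow> nat set" where "nset v = set_decode (v div 2)"

definition ncyc :: "nat \<Rightarrow> bool" where "ncyc v \<longleftrightarrow> odd v"

abbreviation leaf :: "nat \<Rightarrow> nat" where "leaf i \<equiv> nd {i} False"

lemma ncyc_nd [simp]: "ncyc (nd S b) = b"
  by (simp add: ncyc_def nd_def)

lemma nset_nd [simp]: "finite S \<Longrightarrow> nset (nd S b) = S"
  by (simp add: nset_def nd_def)

lemma finite_nset [simp]: "finite (nset v)"
  by (simp add: nset_def)

lemma nd_nset [simp]: "nd (nset v) (ncyc v) = v"
  by (cases "odd v") (auto simp: nd_def nset_def ncyc_def elim: oddE)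

lemma node_eqI:
  assumes "nset v = nset w" "ncyc v = ncyc w"
  shows "v = w"
proof -
  have "nd (nset v) (ncyc v) = nd (nset w) (ncyc w)" by (simp only: assms)
  then show ?thesis by (simp only: nd_nset)
qed

lemma leaf_eq_iff [simp]: "leaf i = leaf j \<longleftrightarrow> i = j"
  by (metis finite.emptyI finite.insertI nset_nd singleton_inject)

text \<open>Only the subtrees hanging at \<open>v\<close> are meant: for a vertex on the cycle its
  predecessor along the cycle is left out.\<close>

definition chl :: "nat set \<Rightarrow> (nat \<Rightarrow> nat) \<Rightarrow> nat \<Rightarrow> nat set" where
  "chl V f v = {u \<in> V. \<not> ncyc u \<and> f u = v}"

text \<open>The axioms make the names truthful: by \<open>f_cyc\<close> and \<open>one_cycle\<close>
  the flagged vertices form a single cycle of \<open>f\<close>, and apart from the leaves a label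
  set is the disjoint union of those of the children. Two children off the cycle amount to valence
  at least three; on the cycle one child is enough, and it exists because label sets are non-empty.
  A loop is a cycle of length one and a double edge a cycle of length two. \<open>f_out\<close>
  fixes \<open>f\<close> outside \<open>V\<close>, so that pairs \<open>(V, f)\<close> are equal
  exactly when the structures are.\<close>

locale canon =
  fixes n :: nat and V :: "nat set" and f :: "nat \<Rightarrow> nat"
  assumes nset_ne: "v \<in> V \<Longrightarrow> nset v \<noteq> {}"
    and nset_sub: "v \<in> V \<Longrightarrow> nset v \<subseteq> {..<n}"
    and leaf_in: "i < n \<Longrightarrow> leaf i \<in> V"
    and f_in: "v \<in> V \<Longrightarrow> f v \<in> V"
    and f_out: "v \<notin> V \<Longrightarrow> f v = v"
    and f_cyc: "v \<in> V \<Longrightarrow> ncyc v \<Longrightarrow> ncyc (f v)"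
    and one_cycle: "v \<in> V \<Longrightarrow> w \<in> V \<Longrightarrow> ncyc v \<Longrightarrow> ncyc w \<Longrightarrow> \<exists>k. (f ^^ k) v = w"
    and f_leaf: "v \<in> V \<Longrightarrow> f v \<noteq> leaf i"
    and nset_chl: "v \<in> V \<Longrightarrow> (\<And>i. v \<noteq> leaf i) \<Longrightarrow> nset v = (\<Union>u\<in>chl V f v. nset u)"
    and chl_disj: "v \<in> V \<Longrightarrow> (\<And>i. v \<noteq> leaf i) \<Longrightarrow> u \<in> chl V f v \<Longrightarrow> w \<in> chl V f v \<Longrightarrow> u \<noteq> w \<Longrightarrow>
      nset u \<inter> nset w = {}"
    and chl_two: "v \<in> V \<Longrightarrow> (\<And>i. v \<noteq> leaf i) \<Longrightarrow> \<not> ncyc v \<Longrightarrow> 2 \<le> card (chl V f v)"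
begin

definition C :: "nat set" where "C = {v \<in> V. ncyc v}"

lemma finite_V [simp]: "finite V"
proof (rule finite_subset)
  show "V \<subseteq> (\<lambda>(S, b). nd S b) ` (Pow {..<n} \<times> UNIV)"
  proof
    fix v assume "v \<in> V"
    then show "v \<in> (\<lambda>(S, b). nd S b) ` (Pow {..<n} \<times> UNIV)"
      using nset_sub by (intro image_eqI[of _ _ "(nset v, ncyc v)"]) auto
  qed
qed simp

lemma finite_chl [simp]: "finite (chl V f v)"
  by (simp add: chl_def)

lemma leaf_nset: "leaf i \<in> V \<Longrightarrow> i < n"
  using nset_sub[of "leaf i"] by simp

lemma nset_mono: "u \<in> V \<Longrightarrow> \<not> ncyc u \<Longrightarrow> nset u \<subseteq> nset (f u)"
  using nset_chl[of "f u"] f_in[of u] f_leaf[of u] by (auto simp: chl_def)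

text \<open>A vertex off the cycle has a second child, whose labels are non-empty and disjoint from
  those of the first.\<close>

lemma nset_strict:
  assumes "u \<in> V" "\<not> ncyc u" "\<not> ncyc (f u)"
  shows "nset u \<subset> nset (f u)"
proof -
  have fu: "f u \<in> V" "\<And>i. f u \<noteq> leaf i" using f_in f_leaf assms by auto
  have u: "u \<in> chl V f (f u)" using assms by (simp add: chl_def)
  have "chl V f (f u) \<noteq> {u}" using chl_two[OF fu assms(3)] by auto
  then obtain w where w: "w \<in> chl V f (f u)" "w \<noteq> u" using u by blast
  have "nset w \<inter> nset u = {}" by (rule chl_disj[OF fu w(1) u w(2)])
  moreover have "nset w \<noteq> {}" using nset_ne w by (simp add: chl_def)
  moreover have "nset w \<subseteq> nset (f u)" using nset_chl[OF fu] w by auto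
  ultimately show ?thesis using nset_mono[OF assms(1,2)] by blast
qed

lemma iter_in: "v \<in> V \<Longrightarrow> (f ^^ k) v \<in> V"
  by (induction k) (auto simp: f_in)

lemma iter_C: "v \<in> C \<Longrightarrow> (f ^^ k) v \<in> C"
  by (induction k) (auto simp: C_def f_in f_cyc)

text \<open>Off the cycle the label sets grow strictly along \<open>f\<close>, and they are bounded
  by the set of all \<open>n\<close> labels.\<close>

lemma reach_cycle: "v \<in> V \<Longrightarrow> \<exists>k. (f ^^ k) v \<in> C"
proof (induction "n - card (nset v)" arbitrary: v rule: less_induct)
  case less
  show ?case
  proof (cases "ncyc v")
    case True
    then show ?thesis using less.prems by (intro exI[of _ 0]) (simp add: C_def)
  next
    case nv: False
    show ?thesis
    proof (cases "ncyc (f v)")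
      case True
      then show ?thesis using less.prems f_in by (intro exI[of _ 1]) (simp add: C_def)
    next
      case False
      have "card (nset v) < card (nset (f v))"
        by (rule psubset_card_mono[OF _ nset_strict[OF less.prems nv False]]) simp
      moreover have "card (nset (f v)) \<le> n"
        using card_mono[OF _ nset_sub[OF f_in[OF less.prems]]] by simp
      ultimately have "n - card (nset (f v)) < n - card (nset v)" by simp
      then obtain k where "(f ^^ k) (f v) \<in> C" using less.hyps f_in less.prems by blast
      then show ?thesis by (intro exI[of _ "Suc k"]) (simp add: funpow_swap1)
    qed
  qed
qed

lemma C_sub: "C \<subseteq> V" by (auto simp: C_def)

lemma finite_C [simp]: "finite C" using C_sub finite_V by (rule finite_subset)

lemma f_C_image: "f ` C = C"
proof (intro antisym subsetI)
  fix w assume w: "w \<in> C"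
  then have "f w \<in> C" using iter_C[of w 1] by simp
  then obtain k where "(f ^^ k) (f w) = w" using one_cycle[of "f w" w] w by (auto simp: C_def)
  then have "f ((f ^^ k) w) = w" by (simp add: funpow_swap1)
  then show "w \<in> f ` C" using iter_C[OF w, of k] by (metis imageI)
qed (use iter_C[of _ 1] in auto)

lemma bij_C: "bij_betw f C C"
  unfolding bij_betw_def using f_C_image by (simp add: eq_card_imp_inj_on)

lemma cyc_not_leaf: "ncyc v \<Longrightarrow> v \<noteq> leaf i" by auto

lemma chl_C: "v \<in> C \<Longrightarrow> chl V f v \<noteq> {}"
  using nset_chl[of v] nset_ne[of v] cyc_not_leaf by (auto simp: C_def)

lemma fibre_two:
  assumes "v \<in> V" "\<And>i. v \<noteq> leaf i"
  shows "2 \<le> card {u \<in> V. f u = v}"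
proof (cases "ncyc v")
  case True
  then have vC: "v \<in> C" using assms by (simp add: C_def)
  have "v \<in> f ` C" unfolding f_C_image by (rule vC)
  then obtain u where u: "u \<in> C" "f u = v" by blast
  obtain w where w: "w \<in> chl V f v" using chl_C[OF vC] by blast
  have "card {u, w} \<le> card {u \<in> V. f u = v}"
    by (rule card_mono) (use u w in \<open>auto simp: C_def chl_def\<close>)
  moreover have "u \<noteq> w" using u w by (auto simp: C_def chl_def)
  ultimately show ?thesis by simp
next
  case False
  have "card (chl V f v) \<le> card {u \<in> V. f u = v}" by (rule card_mono) (auto simp: chl_def)
  then show ?thesis using chl_two[OF assms False] by simp
qed

lemma fibre_leaf: "{u \<in> V. f u = leaf i} = {}"
  using f_leaf by blast

text \<open>Every forward path ends in the cycle, so a vertex that returns to itself lies on it. The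
  flag is thus determined by \<open>f\<close> alone, and every bijection that commutes with the
  self-maps preserves it.\<close>

lemma periodic_iff: "v \<in> V \<Longrightarrow> ncyc v \<longleftrightarrow> (\<exists>k>0. (f ^^ k) v = v)"
proof
  assume v: "v \<in> V"
  show "\<exists>k>0. (f ^^ k) v = v" if "ncyc v"
  proof -
    obtain k where "(f ^^ k) (f v) = v" using one_cycle[OF f_in[OF v] v f_cyc[OF v]] \<open>ncyc v\<close> by auto
    then show ?thesis by (intro exI[of _ "Suc k"]) (simp add: funpow_swap1)
  qed
  show "ncyc v" if "\<exists>k>0. (f ^^ k) v = v"
  proof -
    obtain p where p: "p > 0" "(f ^^ p) v = v" using \<open>\<exists>k>0. (f ^^ k) v = v\<close> by blast
    obtain k where k: "(f ^^ k) v \<in> C" using reach_cycle[OF v] by blast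
    \<comment> \<open>\<open>p * k\<close> is a multiple of the period and at least
      \<open>k\<close>, so \<open>v\<close> is met again after the path has entered the
      cycle.\<close>
    have "(f ^^ (p * k)) v = v" by (metis (no_types) p(2) funpow_mod_eq funpow_0 mod_mult_self1_is_0)
    moreover have "k \<le> p * k" using p(1) by simp
    then have "(f ^^ (p * k)) v = (f ^^ (p * k - k)) ((f ^^ k) v)"
      by (metis funpow_add comp_apply le_add_diff_inverse2)
    ultimately have "v \<in> C" using iter_C[OF k, of "p * k - k"] by simp
    then show ?thesis by (simp add: C_def)
  qed
qed

end

text \<open>The edge leaving \<open>v\<close> is itself called \<open>v\<close>, which is possible
  because every vertex has exactly one outgoing edge. \<open>Min\<close> extracts the single label
  of a leaf, and the ordering is an arbitrary fixed choice.\<close>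

definition rgraph :: "(nat \<Rightarrow> nat) \<Rightarrow> nat set \<times> (nat \<Rightarrow> nat) \<Rightarrow> hairy_graph" where
  "rgraph col x = \<lparr>shape = \<lparr>verts = fst x, arcs = fst x, tail = id, head = snd x\<rparr>,
     color = (\<lambda>v. if \<exists>i. v = leaf i then Some (col (Min (nset v))) else None),
     ordering = map Inl (sorted_list_of_set (fst x)) @ map Inr (sorted_list_of_set (fst x))\<rparr>"

lemma rgraph_simps [simp]:
  "verts (shape (rgraph col x)) = fst x" "arcs (shape (rgraph col x)) = fst x"
  "tail (shape (rgraph col x)) = id" "head (shape (rgraph col x)) = snd x"
  "color (rgraph col x) (leaf i) = Some (col i)"
  "(\<And>i. v \<noteq> leaf i) \<Longrightarrow> color (rgraph col x) v = None"
  by (auto simp: rgraph_def)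

lemma inj_leaf: "inj_on leaf A"
  by (rule inj_onI) simp

context canon
begin

lemma external_rgraph: "external (rgraph col (V, f)) = leaf ` {..<n}"
proof -
  have "color (rgraph col (V, f)) v \<noteq> None \<longleftrightarrow> (\<exists>i. v = leaf i)" for v
    by (auto simp: rgraph_def)
  then show ?thesis using leaf_in leaf_nset by (auto simp: external_def)
qed

lemma rgraph_hairy:
  assumes "n > 0" "\<And>i. i < n \<Longrightarrow> col i \<in> {1..r}"
  shows "is_hairy_graph r (rgraph col (V, f))"
proof -
  let ?G = "rgraph col (V, f)"
  have fin: "fin_digraph (shape ?G)" by unfold_locales (auto simp: f_in)
  then have wf: "wf_digraph (shape ?G)" by (simp add: fin_digraph_def)
  have conn: "connected (shape ?G)"
    unfolding connected_gconn[OF wf]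
  proof
    show "verts (shape ?G) \<noteq> {}" using leaf_in[of 0] assms(1) by auto
    show "gconn (shape ?G)"
      unfolding gconn_def
    proof (intro allI impI)
      fix S assume S: "S \<subseteq> verts (shape ?G)" "S \<noteq> {}"
        "\<forall>e\<in>arcs (shape ?G). tail (shape ?G) e \<in> S \<longleftrightarrow> head (shape ?G) e \<in> S"
      have st: "f v \<in> S \<longleftrightarrow> v \<in> S" if "v \<in> V" for v using S(3) that by simp
      have it: "(f ^^ k) v \<in> S \<longleftrightarrow> v \<in> S" if "v \<in> V" for v k
        by (induction k) (simp_all add: st iter_in[OF that])
      obtain v where v: "v \<in> S" "v \<in> V" using S(1,2) by auto
      obtain k where k: "(f ^^ k) v \<in> C" using reach_cycle v by blast
      have kS: "(f ^^ k) v \<in> S" using it v by blast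
      have "w \<in> S" if w: "w \<in> V" for w
      proof -
        obtain l where l: "(f ^^ l) w \<in> C" using reach_cycle w by blast
        obtain j where "(f ^^ j) ((f ^^ k) v) = (f ^^ l) w"
          using one_cycle[of "(f ^^ k) v" "(f ^^ l) w"] k l by (auto simp: C_def)
        then have "(f ^^ l) w \<in> S" using it[of "(f ^^ k) v" j] kS k C_sub by auto
        then show ?thesis using it w by blast
      qed
      then show "S = verts (shape ?G)" using S(1) by auto
    qed
  qed
  have val: "valence ?G v = 1 + card {u \<in> V. f u = v}" if "v \<in> V" for v
  proof -
    have "valence ?G v = (\<Sum>e\<in>V. of_bool (e = v) + of_bool (f e = v))"
      by (subst valence_sum) simp_all
    also have "\<dots> = (\<Sum>e\<in>V. of_bool (e = v)) + (\<Sum>e\<in>V. of_bool (f e = v))" by (rule sum.distrib)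
    also have "(\<Sum>e\<in>V. of_bool (e = v)) = (1::nat)" using that by (simp add: of_bool_def)
    also have "(\<Sum>e\<in>V. of_bool (f e = v)) = card {u \<in> V. f u = v}" by (simp add: Int_def)
    finally show ?thesis .
  qed
  have int: "v \<in> V \<and> (\<forall>i. v \<noteq> leaf i)" if "v \<in> internal ?G" for v
    using that by (auto simp: internal_def rgraph_def split: if_splits)
  show ?thesis
    unfolding is_hairy_graph_def
  proof (intro conjI ballI)
    show "external ?G \<noteq> {}" using assms(1) by (auto simp: external_rgraph)
    show "valence ?G v = 1" if "v \<in> external ?G" for v
      using that val leaf_in fibre_leaf by (auto simp: external_rgraph)
    show "\<exists>i\<in>{1..r}. color ?G v = Some i" if "v \<in> external ?G" for v
      using that assms(2) by (auto simp: external_rgraph)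
    show "3 \<le> valence ?G v" if "v \<in> internal ?G" for v
      using int[OF that] fibre_two[of v] val[of v] by auto
    show "distinct (ordering ?G)" "set (ordering ?G) = verts (shape ?G) <+> arcs (shape ?G)"
      by (auto simp: rgraph_def distinct_map)
  qed (fact fin conn)+
qed

lemma rgraph_hodge_degree:
  "hodge_degree (rgraph col (V, f)) j = card {i \<in> {..<n}. col i = j}"
proof -
  have "{v \<in> V. color (rgraph col (V, f)) v = Some j} = leaf ` {i \<in> {..<n}. col i = j}"
    using leaf_in leaf_nset by (auto simp: rgraph_def split: if_splits)
  then show ?thesis by (simp add: hodge_degree_def card_image[OF inj_leaf])
qed

lemma rgraph_genus:
  assumes "n > 0" "\<And>i. i < n \<Longrightarrow> col i \<in> {1..r}"
  shows "genus (rgraph col (V, f)) = 1" "complexity (rgraph col (V, f)) = n"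
proof -
  have h: "is_hairy_graph r (rgraph col (V, f))" by (rule rgraph_hairy) (use assms in auto)
  show g: "genus (rgraph col (V, f)) = 1" using genus_one_iff[OF h] by simp
  show "complexity (rgraph col (V, f)) = n"
    using genus_one_complexity[OF h g] by (simp add: external_rgraph card_image[OF inj_leaf])
qed

end

section \<open>The action of relabelling and of cycle reversal on canonical graphs\<close>

definition ren :: "(nat \<Rightarrow> nat) \<Rightarrow> nat \<Rightarrow> nat" where
  "ren \<sigma> v = nd (\<sigma> ` nset v) (ncyc v)"

lemma ncyc_ren [simp]: "ncyc (ren \<sigma> v) = ncyc v"
  by (simp add: ren_def)

lemma nset_ren [simp]: "nset (ren \<sigma> v) = \<sigma> ` nset v"
  by (simp add: ren_def)

lemma ren_leaf [simp]: "ren \<sigma> (leaf i) = leaf (\<sigma> i)"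
  by (simp add: ren_def)

lemma ren_ren: "ren \<sigma> (ren \<tau> v) = ren (\<sigma> \<circ> \<tau>) v"
  by (rule node_eqI) (simp_all add: image_comp)

lemma ren_id: "ren id v = v"
  by (rule node_eqI) simp_all

lemma ren_inv:
  assumes "\<sigma> permutes A"
  shows "ren (inv \<sigma>) (ren \<sigma> v) = v" "ren \<sigma> (ren (inv \<sigma>) v) = v"
  using permutes_inv_o[OF assms] by (simp_all add: ren_ren ren_id)

lemma inj_ren:
  assumes "\<sigma> permutes A"
  shows "inj (ren \<sigma>)"
  by (rule injI) (metis ren_inv(1)[OF assms])

lemma ren_eq_leaf:
  assumes "\<sigma> permutes A"
  shows "ren \<sigma> v = leaf i \<longleftrightarrow> v = leaf (inv \<sigma> i)"
  using ren_inv[OF assms] ren_leaf by metis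

definition crev :: "nat set \<Rightarrow> (nat \<Rightarrow> nat) \<Rightarrow> nat \<Rightarrow> nat" where
  "crev V f v = (if v \<in> V \<and> ncyc v then inv_into {v \<in> V. ncyc v} f v else f v)"

definition cact :: "(nat \<Rightarrow> nat) \<times> bool \<Rightarrow> nat set \<times> (nat \<Rightarrow> nat) \<Rightarrow> nat set \<times> (nat \<Rightarrow> nat)" where
  "cact g x = (ren (fst g) ` fst x,
     ren (fst g) \<circ> (if snd g then crev (fst x) (snd x) else snd x) \<circ> ren (inv (fst g)))"

lemma chl_ren:
  assumes "\<sigma> permutes A"
  shows "chl (ren \<sigma> ` V) (ren \<sigma> \<circ> f \<circ> ren (inv \<sigma>)) (ren \<sigma> v) = ren \<sigma> ` chl V f v"
  unfolding chl_def using ren_inv[OF assms] inj_eq[OF inj_ren[OF assms]] by auto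

lemma canon_ren:
  assumes "canon n V f" and \<sigma>: "\<sigma> permutes {..<n}"
  shows "canon n (ren \<sigma> ` V) (ren \<sigma> \<circ> f \<circ> ren (inv \<sigma>))"
proof -
  interpret canon n V f by (rule assms)
  let ?f = "ren \<sigma> \<circ> f \<circ> ren (inv \<sigma>)"
  note inv = ren_inv[OF \<sigma>] and inj = inj_eq[OF inj_ren[OF \<sigma>]]
  have it: "(?f ^^ k) (ren \<sigma> v) = ren \<sigma> ((f ^^ k) v)" for k v
    by (induction k) (simp_all add: inv)
  show ?thesis
  proof
    show "nset v \<noteq> {}" if "v \<in> ren \<sigma> ` V" for v using that nset_ne by auto
    show "nset v \<subseteq> {..<n}" if "v \<in> ren \<sigma> ` V" for v
      using that nset_sub permutes_in_image[OF \<sigma>] by fastforce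
    show "leaf i \<in> ren \<sigma> ` V" if "i < n" for i
    proof -
      have "inv \<sigma> i < n" using permutes_in_image[OF permutes_inv[OF \<sigma>], of i] that by simp
      then have "ren \<sigma> (leaf (inv \<sigma> i)) \<in> ren \<sigma> ` V" using leaf_in by blast
      then show ?thesis using permutes_inverses(1)[OF \<sigma>] by simp
    qed
    show "?f v \<in> ren \<sigma> ` V" if "v \<in> ren \<sigma> ` V" for v using that f_in by (auto simp: inv)
    show "?f v = v" if "v \<notin> ren \<sigma> ` V" for v
    proof -
      have "ren (inv \<sigma>) v \<notin> V" using that inv by (metis imageI)
      then show ?thesis using f_out inv by simp
    qed
    show "ncyc (?f v)" if "v \<in> ren \<sigma> ` V" "ncyc v" for v using that f_cyc by (auto simp: inv)
    show "\<exists>k. (?f ^^ k) v = w" if "v \<in> ren \<sigma> ` V" "w \<in> ren \<sigma> ` V" "ncyc v" "ncyc w" for v w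
    proof -
      obtain v' w' where "v = ren \<sigma> v'" "w = ren \<sigma> w'" "v' \<in> V" "w' \<in> V"
        using \<open>v \<in> ren \<sigma> ` V\<close> \<open>w \<in> ren \<sigma> ` V\<close> by blast
      then show ?thesis using one_cycle[of v' w'] it that by auto
    qed
    show "?f v \<noteq> leaf i" if "v \<in> ren \<sigma> ` V" for v i
      using that f_leaf by (auto simp: inv ren_eq_leaf[OF \<sigma>])
    fix v assume v: "v \<in> ren \<sigma> ` V" "\<And>i. v \<noteq> leaf i"
    obtain v' where v': "v = ren \<sigma> v'" "v' \<in> V" using v(1) by blast
    have nl: "v' \<noteq> leaf i" for i using v(2)[of "\<sigma> i"] v' by auto
    have ch: "chl (ren \<sigma> ` V) ?f v = ren \<sigma> ` chl V f v'" unfolding v' by (rule chl_ren[OF \<sigma>])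
    show "nset v = (\<Union>u\<in>chl (ren \<sigma> ` V) ?f v. nset u)"
      unfolding ch using nset_chl[OF v'(2) nl] by (auto simp: v')
    show "nset u \<inter> nset w = {}" if uw: "u \<in> chl (ren \<sigma> ` V) ?f v" "w \<in> chl (ren \<sigma> ` V) ?f v" "u \<noteq> w" for u w
    proof -
      obtain u' w' where "u = ren \<sigma> u'" "w = ren \<sigma> w'" "u' \<in> chl V f v'" "w' \<in> chl V f v'"
        using uw(1,2) unfolding ch by blast
      then show ?thesis using chl_disj[OF v'(2) nl, of u' w'] uw(3)
        by (auto simp: image_Int[OF permutes_inj[OF \<sigma>], symmetric])
    qed
    show "2 \<le> card (chl (ren \<sigma> ` V) ?f v)" if "\<not> ncyc v"
      unfolding ch using chl_two[OF v'(2) nl] that v'(1)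
      by (simp add: card_image[OF inj_on_subset[OF inj_ren[OF \<sigma>]]])
  qed
qed

context canon
begin

lemma crev_C: "v \<in> C \<Longrightarrow> crev V f v \<in> C" "v \<in> C \<Longrightarrow> f (crev V f v) = v" "v \<in> C \<Longrightarrow> crev V f (f v) = v"
proof -
  have C: "{v \<in> V. ncyc v} = C" by (simp add: C_def)
  have cr: "crev V f v = inv_into C f v" if "v \<in> C" for v
  proof -
    have "v \<in> V \<and> ncyc v" using that by (simp add: C_def)
    then show ?thesis by (simp add: crev_def C)
  qed
  show "crev V f v \<in> C" if "v \<in> C" using cr that f_C_image by (metis inv_into_into)
  show "f (crev V f v) = v" if "v \<in> C" using cr that f_C_image by (metis f_inv_into_f)
  show "crev V f (f v) = v" if "v \<in> C"
    using cr[of "f v"] that bij_C f_C_image by (metis bij_betw_def imageI inv_into_f_f)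
qed

lemma crev_nC: "v \<notin> C \<Longrightarrow> crev V f v = f v"
  by (auto simp: crev_def C_def)

lemma chl_crev: "chl V (crev V f) v = chl V f v"
  unfolding chl_def using crev_nC by (auto simp: C_def)

lemma canon_crev: "canon n V (crev V f)"
proof
  have crV: "crev V f v \<in> V" if "v \<in> V" for v
    using that crev_C(1)[of v] crev_nC[of v] C_sub f_in by (cases "v \<in> C") auto
  show "crev V f v \<in> V" if "v \<in> V" for v by (rule crV[OF that])
  show "crev V f v = v" if "v \<notin> V" for v using that crev_nC[of v] C_sub f_out by auto
  show "ncyc (crev V f v)" if "v \<in> V" "ncyc v" for v using that crev_C(1)[of v] by (auto simp: C_def)
  have iter_back: "(crev V f ^^ k) ((f ^^ k) v) = v" if "v \<in> C" for k v
  proof (induction k)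
    case (Suc k)
    have "(crev V f ^^ Suc k) ((f ^^ Suc k) v) = (crev V f ^^ k) (crev V f (f ((f ^^ k) v)))"
      by (simp add: funpow_swap1)
    also have "\<dots> = v" using crev_C(3) iter_C[OF that] Suc by simp
    finally show ?case .
  qed simp
  show "\<exists>k. (crev V f ^^ k) v = w" if "v \<in> V" "w \<in> V" "ncyc v" "ncyc w" for v w
    using one_cycle[of w v] that iter_back[of w] by (auto simp: C_def)
  show "crev V f v \<noteq> leaf i" if "v \<in> V" for v i
    using that f_leaf crev_nC[of v] crev_C(1)[of v] cyc_not_leaf by (cases "v \<in> C") (auto simp: C_def)
qed (use nset_ne nset_sub leaf_in nset_chl chl_disj chl_two in \<open>simp_all add: chl_crev\<close>)

lemma crev_crev: "crev V (crev V f) = f"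
proof
  interpret r: canon n V "crev V f" by (rule canon_crev)
  have rC: "r.C = C" by (simp add: r.C_def C_def)
  fix v
  show "crev V (crev V f) v = f v"
  proof (cases "v \<in> C")
    case True
    then have "f v \<in> C" using iter_C[of v 1] by simp
    moreover have "crev V f (f v) = v" using True crev_C by simp
    ultimately show ?thesis using r.crev_C(3)[of "f v"] rC by simp
  next
    case False
    then show ?thesis using r.crev_nC[of v] rC crev_nC by simp
  qed
qed

lemma canon_cact:
  assumes "fst g permutes {..<n}"
  shows "canon n (fst (cact g (V, f))) (snd (cact g (V, f)))"
proof -
  have "canon n V (if snd g then crev V f else f)" using canon_crev canon_axioms by simp
  from canon_ren[OF this assms] show ?thesis unfolding cact_def fst_conv snd_conv .
qed

end

section \<open>Isomorphisms of canonical graphs\<close>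

definition cstr :: "nat \<Rightarrow> (nat set \<times> (nat \<Rightarrow> nat)) set" where
  "cstr n = {x. canon n (fst x) (snd x)}"

text \<open>The direct product of the colour-preserving permutations of the labels with a group of
  order two, whose generator reverses the cycle. The flag is kept even where the reversal does not
  change the underlying self-map, as on cycles of length one or two.\<close>

definition lgroup :: "nat \<Rightarrow> (nat \<Rightarrow> nat) \<Rightarrow> ((nat \<Rightarrow> nat) \<times> bool) set" where
  "lgroup n col = {\<sigma>. \<sigma> permutes {..<n} \<and> (\<forall>i<n. col (\<sigma> i) = col i)} \<times> UNIV"

definition gmul :: "(nat \<Rightarrow> nat) \<times> bool \<Rightarrow> (nat \<Rightarrow> nat) \<times> bool \<Rightarrow> (nat \<Rightarrow> nat) \<times> bool" where
  "gmul g h = (fst g \<circ> fst h, snd g \<noteq> snd h)"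

text \<open>An edge is named by its source, so when the cycle is reversed the edge of \<open>v\<close> becomes the edge of \<open>f v\<close>.\<close>

definition amap :: "(nat \<Rightarrow> nat) \<times> bool \<Rightarrow> nat set \<times> (nat \<Rightarrow> nat) \<Rightarrow> nat \<Rightarrow> nat" where
  "amap g x v = ren (fst g) (if snd g \<and> ncyc v then snd x v else v)"

definition aflip :: "(nat \<Rightarrow> nat) \<times> bool \<Rightarrow> nat set \<times> (nat \<Rightarrow> nat) \<Rightarrow> nat set" where
  "aflip g x = (if snd g then {v \<in> fst x. ncyc v} else {})"

definition csgn :: "(nat \<Rightarrow> nat) \<Rightarrow> nat \<Rightarrow> (nat \<Rightarrow> nat) \<Rightarrow> (nat \<Rightarrow> nat) \<times> bool \<Rightarrow>
    nat set \<times> (nat \<Rightarrow> nat) \<Rightarrow> rat" where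
  "csgn m d col g x =
     gsign m d (rgraph col x) (rgraph col (cact g x)) (ren (fst g)) (amap g x) (aflip g x)"

lemma lgroupD:
  assumes "g \<in> lgroup n col"
  shows "fst g permutes {..<n}" "i < n \<Longrightarrow> col (fst g i) = col i"
  using assms by (auto simp: lgroup_def)

lemma finite_lgroup: "finite (lgroup n col)"
proof -
  have "finite {\<sigma>. \<sigma> permutes {..<n} \<and> (\<forall>i<n. col (\<sigma> i) = col i)}"
    by (rule finite_subset[OF _ finite_permutations[of "{..<n}"]]) auto
  then show ?thesis by (simp add: lgroup_def)
qed

lemma id_lgroup: "(id, b) \<in> lgroup n col"
  by (simp add: lgroup_def permutes_id)

lemma gmul_in: "g \<in> lgroup n col \<Longrightarrow> h \<in> lgroup n col \<Longrightarrow> gmul g h \<in> lgroup n col"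
  using permutes_in_image[of "fst h" "{..<n}"]
  by (auto simp: lgroup_def gmul_def permutes_compose)

lemma inv_lgroup:
  assumes "g \<in> lgroup n col"
  shows "(inv (fst g), snd g) \<in> lgroup n col"
proof -
  note \<sigma> = lgroupD[OF assms]
  have "col (inv (fst g) i) = col i" if "i < n" for i
  proof -
    have "inv (fst g) i < n" using permutes_in_image[OF permutes_inv[OF \<sigma>(1)], of i] that by simp
    then show ?thesis using \<sigma>(2)[of "inv (fst g) i"] permutes_inverses(1)[OF \<sigma>(1)] by simp
  qed
  then show ?thesis using permutes_inv[OF \<sigma>(1)] by (simp add: lgroup_def)
qed

lemma gmul_inv:
  assumes "g \<in> lgroup n col"
  shows "gmul (inv (fst g), snd g) (gmul g h) = h" "gmul g (gmul (inv (fst g), snd g) h) = h"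
  using permutes_inv_o[OF lgroupD(1)[OF assms]]
  by (auto simp: gmul_def o_assoc prod_eq_iff)

lemma bij_gmul:
  assumes "g \<in> lgroup n col"
  shows "bij_betw (gmul g) (lgroup n col) (lgroup n col)"
  by (rule bij_betw_byWitness[where f' = "gmul (inv (fst g), snd g)"])
    (use gmul_inv[OF assms] gmul_in[OF assms] gmul_in[OF inv_lgroup[OF assms]] in auto)

lemma cact_in:
  assumes "x \<in> cstr n" "g \<in> lgroup n col"
  shows "cact g x \<in> cstr n"
  using canon.canon_cact[of n "fst x" "snd x" g] assms lgroupD(1)[OF assms(2)] by (simp add: cstr_def)

lemma crev_ren:
  assumes "canon n V h" and \<tau>: "\<tau> permutes {..<n}"
  shows "crev (ren \<tau> ` V) (ren \<tau> \<circ> h \<circ> ren (inv \<tau>)) = ren \<tau> \<circ> crev V h \<circ> ren (inv \<tau>)"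
proof
  let ?h = "ren \<tau> \<circ> h \<circ> ren (inv \<tau>)"
  interpret c: canon n V h by (rule assms)
  interpret r: canon n "ren \<tau> ` V" ?h by (rule canon_ren[OF assms])
  have rC: "r.C = ren \<tau> ` c.C" by (auto simp: r.C_def c.C_def)
  note inv = ren_inv[OF \<tau>]
  fix v
  show "crev (ren \<tau> ` V) ?h v = (ren \<tau> \<circ> crev V h \<circ> ren (inv \<tau>)) v"
  proof (cases "v \<in> r.C")
    case True
    then obtain v' where v': "v = ren \<tau> v'" "v' \<in> c.C" using rC by auto
    let ?u = "ren \<tau> (crev V h v')"
    have "?u \<in> r.C" using c.crev_C(1)[OF v'(2)] rC by auto
    then have "crev (ren \<tau> ` V) ?h (?h ?u) = ?u" by (rule r.crev_C(3))
    moreover have "?h ?u = v" using c.crev_C(2)[OF v'(2)] v' by (simp add: inv)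
    ultimately show ?thesis using v' by (simp add: inv)
  next
    case False
    moreover have "ren (inv \<tau>) v \<notin> c.C" using False rC inv by (metis imageI)
    ultimately show ?thesis using r.crev_nC c.crev_nC by simp
  qed
qed

lemma cact_gmul:
  assumes "x \<in> cstr n" "g \<in> lgroup n col" "h \<in> lgroup n col"
  shows "cact (gmul g h) x = cact g (cact h x)"
proof -
  obtain V f where x: "x = (V, f)" by force
  obtain \<sigma> b where g: "g = (\<sigma>, b)" by force
  obtain \<tau> c where h: "h = (\<tau>, c)" by force
  have \<sigma>: "\<sigma> permutes {..<n}" and \<tau>: "\<tau> permutes {..<n}"
    using lgroupD(1)[OF assms(2)] lgroupD(1)[OF assms(3)] g h by auto
  interpret canon n V f using assms(1) x by (simp add: cstr_def)
  let ?k = "if c then crev V f else f"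
  have k: "canon n V ?k" using canon_crev canon_axioms by simp
  have ck: "crev V ?k = (if c then f else crev V f)" using crev_crev by simp
  have inv: "inv (\<sigma> \<circ> \<tau>) = inv \<tau> \<circ> inv \<sigma>"
    using o_inv_distrib[OF permutes_bij[OF \<sigma>] permutes_bij[OF \<tau>]] .
  have "ren (\<sigma> \<circ> \<tau>) ` V = ren \<sigma> ` ren \<tau> ` V" by (simp add: image_image ren_ren)
  moreover have "ren (\<sigma> \<circ> \<tau>) \<circ> k \<circ> ren (inv \<tau> \<circ> inv \<sigma>) =
      ren \<sigma> \<circ> (ren \<tau> \<circ> k \<circ> ren (inv \<tau>)) \<circ> ren (inv \<sigma>)" for k
    by (simp add: fun_eq_iff ren_ren[symmetric])
  ultimately show ?thesis
    unfolding cact_def gmul_def x g h fst_conv snd_conv crev_ren[OF k \<tau>] ck inv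
    by (cases b; cases c) simp_all
qed

lemma bij_amap:
  assumes "x \<in> cstr n" "g \<in> lgroup n col"
  shows "bij_betw (amap g x) (fst x) (fst (cact g x))"
proof -
  interpret canon n "fst x" "snd x" using assms(1) by (simp add: cstr_def)
  let ?k = "\<lambda>v. if snd g \<and> ncyc v then snd x v else v"
  have "bij_betw ?k (C \<union> (fst x - C)) (C \<union> (fst x - C))"
  proof (rule bij_betw_combine)
    show "bij_betw ?k C C"
      using bij_C by (cases "snd g") (auto simp: C_def bij_betw_def inj_on_def cong: image_cong_simp)
    have "bij_betw id (fst x - C) (fst x - C)" by (rule bij_betw_id)
    then show "bij_betw ?k (fst x - C) (fst x - C)"
      by (rule bij_betw_cong[THEN iffD1, rotated]) (simp add: C_def)
  qed auto
  moreover have "C \<union> (fst x - C) = fst x" using C_sub by blast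
  ultimately have "bij_betw ?k (fst x) (fst x)" by simp
  moreover have "bij_betw (ren (fst g)) (fst x) (fst (cact g x))"
    using inj_on_subset[OF inj_ren[OF lgroupD(1)[OF assms(2)]]] by (auto simp: bij_betw_def cact_def)
  ultimately have "bij_betw (ren (fst g) \<circ> ?k) (fst x) (fst (cact g x))" by (rule bij_betw_trans)
  moreover have "ren (fst g) \<circ> ?k = amap g x" by (auto simp: amap_def)
  ultimately show ?thesis by (simp only:)
qed

lemma giso_cact:
  assumes "x \<in> cstr n" "g \<in> lgroup n col"
  shows "giso (rgraph col x) (rgraph col (cact g x)) (ren (fst g)) (amap g x) (aflip g x)"
proof -
  interpret canon n "fst x" "snd x" using assms(1) by (simp add: cstr_def)
  note \<sigma> = lgroupD[OF assms(2)]
  note inv = ren_inv[OF \<sigma>(1)]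
  show ?thesis
    unfolding giso_def
  proof (intro conjI ballI)
    show "bij_betw (ren (fst g)) (verts (shape (rgraph col x))) (verts (shape (rgraph col (cact g x))))"
      using inj_on_subset[OF inj_ren[OF \<sigma>(1)]] by (auto simp: bij_betw_def cact_def)
    show "bij_betw (amap g x) (arcs (shape (rgraph col x))) (arcs (shape (rgraph col (cact g x))))"
      using bij_amap[OF assms] by simp
    show "aflip g x \<subseteq> arcs (shape (rgraph col x))" by (auto simp: aflip_def)
  next
    fix e assume "e \<in> arcs (shape (rgraph col x))"
    then have e: "e \<in> fst x" by simp
    show "tail (shape (rgraph col (cact g x))) (amap g x e) =
        ren (fst g) (if e \<in> aflip g x then head (shape (rgraph col x)) e else tail (shape (rgraph col x)) e)"
      using e by (simp add: amap_def aflip_def)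
    show "head (shape (rgraph col (cact g x))) (amap g x e) =
        ren (fst g) (if e \<in> aflip g x then tail (shape (rgraph col x)) e else head (shape (rgraph col x)) e)"
    proof (cases "snd g \<and> ncyc e")
      case True
      then have "e \<in> C" using e by (simp add: C_def)
      then show ?thesis using True e crev_C(3) by (simp add: amap_def aflip_def cact_def inv)
    next
      case False
      then have "snd g \<Longrightarrow> e \<notin> C" by (simp add: C_def)
      then show ?thesis using False e crev_nC[of e] by (auto simp: amap_def aflip_def cact_def inv)
    qed
  next
    fix v assume "v \<in> verts (shape (rgraph col x))"
    then have v: "v \<in> fst x" by simp
    show "color (rgraph col (cact g x)) (ren (fst g) v) = color (rgraph col x) v"
    proof (cases "\<exists>i. v = leaf i")
      case True
      then show ?thesis using leaf_nset v \<sigma>(2) by auto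
    next
      case False
      then have "ren (fst g) v \<noteq> leaf i" for i using ren_eq_leaf[OF \<sigma>(1)] by blast
      then show ?thesis using False by (simp add: rgraph_def)
    qed
  qed
qed

locale colored =
  fixes n r :: nat and col :: "nat \<Rightarrow> nat"
  assumes n_pos: "n > 0" and col_in: "i < n \<Longrightarrow> col i \<in> {1..r}"
begin

lemma hairy: "x \<in> cstr n \<Longrightarrow> is_hairy_graph r (rgraph col x)"
  using canon.rgraph_hairy[of n "fst x" "snd x" col r] n_pos col_in by (simp add: cstr_def)

lemma csgn_gmul:
  assumes "x \<in> cstr n" "g \<in> lgroup n col" "h \<in> lgroup n col"
  shows "csgn m d col (gmul g h) x = csgn m d col g (cact h x) * csgn m d col h x"
proof -
  interpret canon n "fst x" "snd x" using assms(1) by (simp add: cstr_def)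
  note hx = cact_in[OF assms(1,3)]
  note i1 = giso_cact[OF assms(1,3)] and i2 = giso_cact[OF hx assms(2)]
  have inv: "ren (inv (fst h)) (ren (fst h) v) = v" for v using ren_inv lgroupD(1)[OF assms(3)] by blast
  have nc: "ncyc (amap h x e) = ncyc e" if "e \<in> fst x" for e
    using f_cyc[OF that] by (auto simp: amap_def)
  have am: "amap h x e \<in> fst (cact h x)" if "e \<in> fst x" for e
    using bij_amap[OF assms(1,3)] that by (auto simp: bij_betw_def)
  have fl: "{e \<in> arcs (shape (rgraph col x)). (e \<in> aflip h x) \<noteq> (amap h x e \<in> aflip g (cact h x))} =
      aflip (gmul g h) x"
    using nc am by (auto simp: aflip_def gmul_def)
  have comp: "(amap g (cact h x) \<circ> amap h x) e = amap (gmul g h) x e" if e: "e \<in> fst x" for e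
  proof (cases "ncyc e")
    case True
    then have "e \<in> C" using e by (simp add: C_def)
    then have "crev (fst x) (snd x) (snd x e) = e" by (rule crev_C(3))
    then show ?thesis using True f_cyc[OF e True]
      by (cases "snd g"; cases "snd h") (simp_all add: amap_def gmul_def cact_def inv flip: ren_ren)
  qed (simp add: amap_def gmul_def ren_ren)
  have "csgn m d col h x * csgn m d col g (cact h x) =
      gsign m d (rgraph col x) (rgraph col (cact g (cact h x))) (ren (fst g) \<circ> ren (fst h))
        (amap g (cact h x) \<circ> amap h x) (aflip (gmul g h) x)"
    unfolding csgn_def fl[symmetric]
    by (rule gsign_comp[OF i1 i2 hairy[OF assms(1)] hairy[OF hx] hairy[OF cact_in[OF hx assms(2)]], symmetric])
  also have "\<dots> = gsign m d (rgraph col x) (rgraph col (cact g (cact h x))) (ren (fst (gmul g h)))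
        (amap (gmul g h) x) (aflip (gmul g h) x)"
    by (rule gsign_cong)
      (use comp is_hairy_graphD(5)[OF hairy[OF assms(1)]] in \<open>simp_all add: gmul_def ren_ren\<close>)
  finally show ?thesis by (simp add: csgn_def cact_gmul[OF assms] mult.commute)
qed

end

lemma finite_cstr: "finite (cstr n)"
proof -
  \<comment> \<open>\<open>U\<close> contains every possible vertex name. The self-maps in question
    preserve \<open>U\<close> and are the identity outside it, so there are finitely many.\<close>
  define U where "U = (\<lambda>(S, b). nd S b) ` (Pow {..<n} \<times> (UNIV :: bool set))"
  have finU: "finite U" by (simp add: U_def)
  have sub: "V \<subseteq> U" if "canon n V f" for V f
  proof
    interpret canon n V f by (rule that)
    fix v assume "v \<in> V"
    then show "v \<in> U" unfolding U_def using nset_sub by (intro image_eqI[of _ _ "(nset v, ncyc v)"]) auto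
  qed
  have sub2: "cstr n \<subseteq> Pow U \<times> {f. \<forall>v. (v \<in> U \<longrightarrow> f v \<in> U) \<and> (v \<notin> U \<longrightarrow> f v = v)}"
  proof clarify
    fix V f assume "(V, f) \<in> cstr n"
    then have c: "canon n V f" by (simp add: cstr_def)
    interpret canon n V f by (rule c)
    have "f v \<in> U" if "v \<in> U" for v
      using that sub[OF c] f_in[of v] f_out[of v] by (cases "v \<in> V") auto
    moreover have "f v = v" if "v \<notin> U" for v using that sub[OF c] f_out by blast
    ultimately show "V \<in> Pow U \<and> f \<in> {f. \<forall>v. (v \<in> U \<longrightarrow> f v \<in> U) \<and> (v \<notin> U \<longrightarrow> f v = v)}"
      using sub[OF c] by blast
  qed
  have "finite {f. \<forall>v. (v \<in> U \<longrightarrow> f v \<in> U) \<and> (v \<notin> U \<longrightarrow> f v = v)}"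
  proof (rule finite_imageD)
    let ?F = "{f. \<forall>v. (v \<in> U \<longrightarrow> f v \<in> U) \<and> (v \<notin> U \<longrightarrow> f v = v)}"
    show "finite ((\<lambda>f. restrict f U) ` ?F)"
    proof (rule finite_subset)
      show "(\<lambda>f. restrict f U) ` ?F \<subseteq> (\<Pi>\<^sub>E v\<in>U. U)"
        by (intro image_subsetI PiE_I) simp_all
      show "finite (\<Pi>\<^sub>E v\<in>U. U)" by (intro finite_PiE finU)
    qed
    show "inj_on (\<lambda>f. restrict f U) ?F"
    proof (rule inj_onI, rule ext)
      fix f g v assume fg: "f \<in> ?F" "g \<in> ?F" "restrict f U = restrict g U"
      show "f v = g v"
      proof (cases "v \<in> U")
        case True
        then show ?thesis using fun_cong[OF fg(3), of v] by simp
      next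
        case False
        then show ?thesis using fg by simp
      qed
    qed
  qed
  with finU have "finite (Pow U \<times> {f. \<forall>v. (v \<in> U \<longrightarrow> f v \<in> U) \<and> (v \<notin> U \<longrightarrow> f v = v)})"
    by (intro finite_cartesian_product) simp_all
  then show ?thesis by (rule finite_subset[OF sub2])
qed

context colored
begin

lemma signed_action: "signed_action (lgroup n col) gmul (cstr n) cact (csgn m d col)"
proof
  show "finite (lgroup n col)" by (rule finite_lgroup)
  show "lgroup n col \<noteq> {}" using id_lgroup by blast
  show "finite (cstr n)" by (rule finite_cstr)
  show "bij_betw (gmul g) (lgroup n col) (lgroup n col)" if "g \<in> lgroup n col" for g
    using that by (rule bij_gmul)
  show "cact g x \<in> cstr n" if "g \<in> lgroup n col" "x \<in> cstr n" for g x
    using that by (intro cact_in)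
  show "cact (gmul g h) x = cact g (cact h x)" if "g \<in> lgroup n col" "h \<in> lgroup n col" "x \<in> cstr n" for g h x
    using that by (intro cact_gmul)
  show "csgn m d col (gmul g h) x = csgn m d col g (cact h x) * csgn m d col h x"
    if "g \<in> lgroup n col" "h \<in> lgroup n col" "x \<in> cstr n" for g h x
    using that by (intro csgn_gmul)
  show "csgn m d col g x = 1 \<or> csgn m d col g x = - 1" for g x
    unfolding csgn_def by (rule gsign_cases)
  fix g x y assume g: "g \<in> lgroup n col" and xy: "x \<in> cstr n" "y \<in> cstr n" "cact g x = cact g y"
  have one: "cact (id, False) z = z" for z by (simp add: cact_def ren_id fun_eq_iff prod_eq_iff)
  have "gmul (inv (fst g), snd g) g = (id, False)"
    using permutes_inv_o(2)[OF lgroupD(1)[OF g]] by (simp add: gmul_def)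
  then show "x = y"
    using cact_gmul[OF xy(1) inv_lgroup[OF g] g] cact_gmul[OF xy(2) inv_lgroup[OF g] g] xy(3) one
    by simp
qed

end

text \<open>The leaves are the vertices without preimage, so \<open>\<alpha>\<close> permutes them
  and thereby the labels. It also preserves periodicity, hence the flags and the sets of children,
  and a label set is assembled from those of the children; so \<open>\<alpha>\<close> changes every
  name by this one permutation.\<close>

lemma direct_iso:
  assumes "canon n V f" "canon n V' f'"
    and bij: "bij_betw \<alpha> V V'" and hom: "\<And>v. v \<in> V \<Longrightarrow> f' (\<alpha> v) = \<alpha> (f v)"
  obtains \<sigma> where "\<sigma> permutes {..<n}" "\<And>v. v \<in> V \<Longrightarrow> \<alpha> v = ren \<sigma> v"
    "V' = ren \<sigma> ` V" "f' = ren \<sigma> \<circ> f \<circ> ren (inv \<sigma>)"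
proof -
  interpret c: canon n V f by (rule assms)
  interpret c': canon n V' f' by (rule assms)
  have inj: "inj_on \<alpha> V" and img: "\<alpha> ` V = V'" using bij by (auto simp: bij_betw_def)
  have \<alpha>V: "\<alpha> v \<in> V'" if "v \<in> V" for v using img that by blast
  have leafish: "\<exists>j. v = leaf j" if "v \<in> V'" "{u \<in> V'. f' u = v} = {}" for v
    using c'.fibre_two[OF that(1)] that(2) by force
  have "\<exists>j. \<alpha> (leaf i) = leaf j" if i: "i < n" for i
  proof (rule leafish)
    show "\<alpha> (leaf i) \<in> V'" using \<alpha>V c.leaf_in i by blast
    have "f' u \<noteq> \<alpha> (leaf i)" if u: "u \<in> V'" for u
    proof
      assume eq: "f' u = \<alpha> (leaf i)"
      obtain w where w: "u = \<alpha> w" "w \<in> V" using u unfolding img[symmetric] by blast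
      then have "\<alpha> (f w) = \<alpha> (leaf i)" using hom eq by simp
      then have "f w = leaf i" using inj_onD[OF inj] c.f_in w(2) c.leaf_in i by blast
      then show False using c.f_leaf w(2) by blast
    qed
    then show "{u \<in> V'. f' u = \<alpha> (leaf i)} = {}" by blast
  qed
  then obtain s where s: "\<And>i. i < n \<Longrightarrow> \<alpha> (leaf i) = leaf (s i)" by metis
  define \<sigma> where "\<sigma> i = (if i < n then s i else i)" for i
  have \<sigma>_leaf: "\<alpha> (leaf i) = leaf (\<sigma> i)" if "i < n" for i using s that by (simp add: \<sigma>_def)
  have \<sigma>n: "\<sigma> i < n" if "i < n" for i
    using c'.leaf_nset[of "\<sigma> i"] \<alpha>V[OF c.leaf_in[OF that]] \<sigma>_leaf[OF that] by simp
  have \<sigma>inj: "inj_on \<sigma> {..<n}"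
  proof (rule inj_onI)
    fix i j assume ij: "i \<in> {..<n}" "j \<in> {..<n}" "\<sigma> i = \<sigma> j"
    then have "\<alpha> (leaf i) = \<alpha> (leaf j)" using \<sigma>_leaf by simp
    then have "leaf i = leaf j" using inj_onD[OF inj] c.leaf_in ij by blast
    then show "i = j" by simp
  qed
  have "\<sigma> ` {..<n} = {..<n}" using \<sigma>n by (intro endo_inj_surj \<sigma>inj) auto
  then have \<sigma>: "\<sigma> permutes {..<n}"
    using \<sigma>inj by (intro bij_imp_permutes) (auto simp: bij_betw_def \<sigma>_def)
  have it: "(f' ^^ k) (\<alpha> v) = \<alpha> ((f ^^ k) v)" if "v \<in> V" for k v
    by (induction k) (simp_all add: hom c.iter_in[OF that])
  have cyc: "ncyc (\<alpha> v) = ncyc v" if v: "v \<in> V" for v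
  proof -
    have "(f' ^^ k) (\<alpha> v) = \<alpha> v \<longleftrightarrow> (f ^^ k) v = v" for k
      using it[OF v] inj_on_eq_iff[OF inj c.iter_in[OF v] v] by simp
    then show ?thesis using c.periodic_iff[OF v] c'.periodic_iff[OF \<alpha>V[OF v]] by simp
  qed
  have key: "nset (\<alpha> v) = \<sigma> ` nset v" if "v \<in> V" for v
    using that
  \<comment> \<open>A child of a cycle vertex may carry the same labels as its parent; the flag
    breaks this tie. Off the cycle the inclusion of label sets is strict.\<close>
  proof (induction "2 * card (nset v) + of_bool (ncyc v)" arbitrary: v rule: less_induct)
    case less
    show ?case
    proof (cases "\<exists>i. v = leaf i")
      case True
      then show ?thesis using \<sigma>_leaf c.leaf_nset less.prems by auto
    next
      case False
      then have nl: "v \<noteq> leaf i" for i by blast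
      have nl': "\<alpha> v \<noteq> leaf j" for j
      proof
        assume eq: "\<alpha> v = leaf j"
        have "2 \<le> card {u \<in> V. f u = v}" by (rule c.fibre_two[OF less.prems nl])
        then have "{u \<in> V. f u = v} \<noteq> {}" by force
        then obtain u where "u \<in> V" "f u = v" by blast
        then have "f' (\<alpha> u) = leaf j" using hom eq by simp
        then show False using c'.f_leaf \<alpha>V \<open>u \<in> V\<close> by blast
      qed
      have ch: "chl V' f' (\<alpha> v) = \<alpha> ` chl V f v"
      proof (intro antisym subsetI)
        fix u' assume u': "u' \<in> chl V' f' (\<alpha> v)"
        then have "u' \<in> V'" by (simp add: chl_def)
        then obtain u where u: "u' = \<alpha> u" "u \<in> V" unfolding img[symmetric] by blast
        then have "\<alpha> (f u) = \<alpha> v" using u' hom by (simp add: chl_def)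
        then have "f u = v" using inj_onD[OF inj] c.f_in u(2) less.prems by blast
        then show "u' \<in> \<alpha> ` chl V f v" using u u' cyc by (auto simp: chl_def)
      next
        fix u' assume "u' \<in> \<alpha> ` chl V f v"
        then show "u' \<in> chl V' f' (\<alpha> v)" using cyc hom \<alpha>V by (auto simp: chl_def)
      qed
      have IH: "nset (\<alpha> u) = \<sigma> ` nset u" if u: "u \<in> chl V f v" for u
      proof (rule less.hyps)
        have u': "u \<in> V" "\<not> ncyc u" "f u = v" using u by (auto simp: chl_def)
        have "card (nset u) \<le> card (nset v)"
          using c.nset_mono[OF u'(1,2)] u'(3) by (intro card_mono) auto
        moreover have "card (nset u) < card (nset v)" if "\<not> ncyc v"
          using c.nset_strict[OF u'(1,2)] u'(3) that by (intro psubset_card_mono) auto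
        ultimately show "2 * card (nset u) + of_bool (ncyc u) < 2 * card (nset v) + of_bool (ncyc v)"
          using u'(2) by (cases "ncyc v") auto
        show "u \<in> V" by (rule u'(1))
      qed
      have "nset (\<alpha> v) = (\<Union>u\<in>chl V f v. nset (\<alpha> u))"
        using c'.nset_chl[OF \<alpha>V[OF less.prems] nl'] unfolding ch by simp
      also have "\<dots> = (\<Union>u\<in>chl V f v. \<sigma> ` nset u)" using IH by simp
      also have "\<dots> = \<sigma> ` nset v" unfolding c.nset_chl[OF less.prems nl] by blast
      finally show ?thesis .
    qed
  qed
  have \<alpha>ren: "\<alpha> v = ren \<sigma> v" if "v \<in> V" for v
    by (rule node_eqI) (simp_all add: key[OF that] cyc[OF that])
  have V': "V' = ren \<sigma> ` V" unfolding img[symmetric] using \<alpha>ren by (intro image_cong) auto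
  have "f' = ren \<sigma> \<circ> f \<circ> ren (inv \<sigma>)"
  proof
    fix w
    show "f' w = (ren \<sigma> \<circ> f \<circ> ren (inv \<sigma>)) w"
    proof (cases "w \<in> V'")
      case True
      then obtain v where v: "w = ren \<sigma> v" "v \<in> V" using V' by blast
      then have "f' w = ren \<sigma> (f v)" using hom \<alpha>ren c.f_in by metis
      then show ?thesis using v ren_inv(1)[OF \<sigma>] by simp
    next
      case False
      then have "ren (inv \<sigma>) w \<notin> V" using V' ren_inv(2)[OF \<sigma>] by (metis imageI)
      then show ?thesis using c.f_out c'.f_out[OF False] ren_inv(2)[OF \<sigma>] by simp
    qed
  qed
  then show thesis using that \<sigma> \<alpha>ren V' by blast
qed

text \<open>Edge \<open>v\<close> of a canonical graph leaves the vertex \<open>v\<close>. Reversing the edges in \<open>\<phi>\<close> must again leave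
  every vertex with exactly one outgoing edge, so \<open>\<phi>\<close> is empty or the whole cycle.\<close>

lemma flip_dichotomy:
  assumes "canon n V f" "\<phi> \<subseteq> V" and inj: "inj_on (\<lambda>v. if v \<in> \<phi> then f v else v) V"
  shows "\<phi> = {} \<or> \<phi> = {v \<in> V. ncyc v}"
proof (cases "\<phi> = {}")
  case False
  interpret canon n V f by (rule assms)
  \<comment> \<open>Once the edge of \<open>v\<close> is reversed it leaves \<open>f v\<close>, so
    the edge that \<open>f v\<close> already had must be reversed too.\<close>
  have step: "f v \<in> \<phi>" if "v \<in> \<phi>" for v
  proof (rule ccontr)
    assume nf: "f v \<notin> \<phi>"
    have "v = f v" by (rule inj_onD[OF inj]) (use nf that assms(2) f_in in auto)
    then show False using nf that by simp
  qed
  have it: "(f ^^ k) v \<in> \<phi>" if "v \<in> \<phi>" for k v by (induction k) (simp_all add: that step)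
  have inj\<phi>: "inj_on f \<phi>"
  proof (rule inj_onI)
    fix u v assume "u \<in> \<phi>" "v \<in> \<phi>" "f u = f v"
    then show "u = v" using inj_onD[OF inj, of u v] assms(2) by auto
  qed
  have fin: "finite \<phi>" using assms(2) by (rule finite_subset) simp
  have bij: "bij_betw f \<phi> \<phi>"
    using endo_inj_surj[OF fin _ inj\<phi>] step inj\<phi> by (auto simp: bij_betw_def)
  have "C \<subseteq> \<phi>"
  proof
    fix w assume w: "w \<in> C"
    obtain v where v: "v \<in> \<phi>" using False by blast
    obtain k where k: "(f ^^ k) v \<in> C" using reach_cycle v assms(2) by blast
    obtain l where "(f ^^ l) ((f ^^ k) v) = w" using one_cycle[of "(f ^^ k) v" w] k w by (auto simp: C_def)
    then show "w \<in> \<phi>" using it[OF it[OF v]] by metis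
  qed
  moreover have "v \<in> C" if v: "v \<in> \<phi>" for v
  proof -
    obtain k where "k > 0" "(f ^^ k) v = v" by (rule forb_cyclic[OF fin bij v])
    then show ?thesis using periodic_iff[of v] v assms(2) by (auto simp: C_def)
  qed
  ultimately have "\<phi> = C" by blast
  then show ?thesis by (simp add: C_def)
qed simp

context colored
begin

text \<open>An arbitrary isomorphism reverses either no edge or the whole cycle. If the cycle of the
  source is reversed beforehand in the second case, the isomorphism respects all directions and is
  therefore a relabelling, which preserves colours at the leaves. So the finite action sees every
  isomorphism with its sign.\<close>

lemma grel_rgraph_iff:
  assumes x: "x \<in> cstr n" and y: "y \<in> cstr n"
  shows "grel r m d (rgraph col x) (rgraph col y) e \<longleftrightarrow>
    (\<exists>g\<in>lgroup n col. cact g x = y \<and> csgn m d col g x = e)"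
proof
  assume "\<exists>g\<in>lgroup n col. cact g x = y \<and> csgn m d col g x = e"
  then show "grel r m d (rgraph col x) (rgraph col y) e"
    using giso_cact[OF x] hairy[OF x] hairy[OF y] unfolding grel_def csgn_def by blast
next
  assume "grel r m d (rgraph col x) (rgraph col y) e"
  then obtain \<alpha> \<beta> \<phi> where iso: "giso (rgraph col x) (rgraph col y) \<alpha> \<beta> \<phi>"
    and e: "e = gsign m d (rgraph col x) (rgraph col y) \<alpha> \<beta> \<phi>" by (auto simp: grel_def)
  obtain V f where xe: "x = (V, f)" by force
  obtain V' f' where ye: "y = (V', f')" by force
  interpret c: canon n V f using x xe by (simp add: cstr_def)
  interpret c': canon n V' f' using y ye by (simp add: cstr_def)
  note iso' = iso[unfolded giso_def xe ye rgraph_simps(1-4) fst_conv snd_conv id_apply]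
  note rest = conjunct2[OF conjunct2[OF conjunct2[OF iso']]]
  have bij: "bij_betw \<alpha> V V'" "bij_betw \<beta> V V'" and sub: "\<phi> \<subseteq> V"
    using conjunct1[OF iso'] conjunct1[OF conjunct2[OF iso']] conjunct1[OF conjunct2[OF conjunct2[OF iso']]] .
  have arc: "\<beta> v = \<alpha> (if v \<in> \<phi> then f v else v)" "f' (\<beta> v) = \<alpha> (if v \<in> \<phi> then v else f v)"
    if "v \<in> V" for v
    using conjunct1[OF bspec[OF conjunct1[OF rest] that]] conjunct2[OF bspec[OF conjunct1[OF rest] that]] .
  have colr: "color (rgraph col (V', f')) (\<alpha> v) = color (rgraph col (V, f)) v" if "v \<in> V" for v
    by (rule bspec[OF conjunct2[OF rest] that])
  have inj: "inj_on (\<lambda>v. if v \<in> \<phi> then f v else v) V"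
  proof (rule inj_onI)
    fix u v assume uv: "u \<in> V" "v \<in> V" "(if u \<in> \<phi> then f u else u) = (if v \<in> \<phi> then f v else v)"
    then have "\<beta> u = \<beta> v" using arc(1) by simp
    then show "u = v" using bij(2) uv by (auto simp: bij_betw_def dest: inj_onD)
  qed
  define b where "b \<longleftrightarrow> \<phi> \<noteq> {}"
  have \<phi>: "\<phi> = (if b then c.C else {})"
    using flip_dichotomy[OF c.canon_axioms sub inj] unfolding b_def c.C_def by auto
  let ?h = "if b then crev V f else f"
  have h: "canon n V ?h" using c.canon_crev c.canon_axioms by simp
  have hom: "f' (\<alpha> v) = \<alpha> (?h v)" if v: "v \<in> V" for v
  proof (cases "v \<in> \<phi>")
    case True
    then have b: b and vC: "v \<in> c.C" using \<phi> by (auto split: if_splits)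
    let ?u = "crev V f v"
    have u: "?u \<in> c.C" "f ?u = v" using c.crev_C[OF vC] by auto
    then have uV: "?u \<in> V" and u\<phi>: "?u \<in> \<phi>" using c.C_sub \<phi> b by auto
    \<comment> \<open>The reversed edge that now leaves the image of \<open>v\<close> is the one
      that belonged to the predecessor of \<open>v\<close> on the cycle.\<close>
    have "f' (\<alpha> v) = f' (\<beta> ?u)" using arc(1)[OF uV] u\<phi> u(2) by simp
    also have "\<dots> = \<alpha> ?u" using arc(2)[OF uV] u\<phi> by simp
    finally show ?thesis using b by simp
  next
    case False
    then have "?h v = f v" using c.crev_nC[of v] \<phi> by auto
    then show ?thesis using arc[OF v] False by simp
  qed
  have "\<exists>\<sigma>. \<sigma> permutes {..<n} \<and> (\<forall>v\<in>V. \<alpha> v = ren \<sigma> v) \<and> V' = ren \<sigma> ` V \<and>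
      f' = ren \<sigma> \<circ> ?h \<circ> ren (inv \<sigma>)"
  proof (rule direct_iso[OF h c'.canon_axioms bij(1)])
    show "f' (\<alpha> v) = \<alpha> (?h v)" if "v \<in> V" for v by (rule hom[OF that])
  next
    fix \<sigma> assume "\<sigma> permutes {..<n}" "\<And>v. v \<in> V \<Longrightarrow> \<alpha> v = ren \<sigma> v"
      "V' = ren \<sigma> ` V" "f' = ren \<sigma> \<circ> ?h \<circ> ren (inv \<sigma>)"
    then show ?thesis by (intro exI[of _ \<sigma>] conjI ballI)
  qed
  then obtain \<sigma> where \<sigma>: "\<sigma> permutes {..<n}" "\<forall>v\<in>V. \<alpha> v = ren \<sigma> v"
    "V' = ren \<sigma> ` V" "f' = ren \<sigma> \<circ> ?h \<circ> ren (inv \<sigma>)"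
    by (elim exE conjE)
  have "col (\<sigma> i) = col i" if "i < n" for i
    using colr[OF c.leaf_in[OF that]] bspec[OF \<sigma>(2) c.leaf_in[OF that]] by simp
  then have g: "(\<sigma>, b) \<in> lgroup n col" using \<sigma>(1) by (simp add: lgroup_def)
  have act: "cact (\<sigma>, b) x = y" unfolding cact_def xe ye using \<sigma>(3,4) by simp
  have "csgn m d col (\<sigma>, b) x = gsign m d (rgraph col x) (rgraph col y) (ren \<sigma>) (amap (\<sigma>, b) x) \<phi>"
    unfolding csgn_def act using \<phi> by (simp add: aflip_def xe c.C_def)
  also have "\<dots> = gsign m d (rgraph col x) (rgraph col y) \<alpha> \<beta> \<phi>"
  proof (rule gsign_cong)
    show "set (ordering (rgraph col x)) = verts (shape (rgraph col x)) <+> arcs (shape (rgraph col x))"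
      by (rule is_hairy_graphD(5)[OF hairy[OF x]])
    show "ren \<sigma> v = \<alpha> v" if "v \<in> verts (shape (rgraph col x))" for v using that \<sigma>(2) xe by simp
    show "amap (\<sigma>, b) x v = \<beta> v" if "v \<in> arcs (shape (rgraph col x))" for v
      using that arc(1)[of v] bspec[OF \<sigma>(2), of v] bspec[OF \<sigma>(2), of "f v"] c.f_in[of v] \<phi> xe
      by (auto simp: amap_def c.C_def)
  qed
  finally show "\<exists>g\<in>lgroup n col. cact g x = y \<and> csgn m d col g x = e"
    using g act e by blast
qed

end

section \<open>Existence of canonical names\<close>

text \<open>A genus-one graph presented as a self-map, before its vertices have canonical names. The
  vertices without preimage are the hairs, enumerated by \<open>lab\<close>, and
  \<open>fibre\<close> is the valence condition: one outgoing edge and at least two incoming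
  ones.\<close>

locale unicycle =
  fixes V :: "'v set" and f :: "'v \<Rightarrow> 'v" and n :: nat and lab :: "nat \<Rightarrow> 'v"
  assumes fin: "finite V" and f_in: "v \<in> V \<Longrightarrow> f v \<in> V"
    and conn: "S \<subseteq> V \<Longrightarrow> S \<noteq> {} \<Longrightarrow> (\<And>v. v \<in> V \<Longrightarrow> f v \<in> S \<longleftrightarrow> v \<in> S) \<Longrightarrow> S = V"
    and lab_inj: "inj_on lab {..<n}"
    and lab_img: "{v \<in> V. \<forall>u\<in>V. f u \<noteq> v} = lab ` {..<n}"
    and fibre: "u \<in> V \<Longrightarrow> 2 \<le> card {w \<in> V. f w = f u}"
begin

definition per :: "'v \<Rightarrow> bool" where "per v \<longleftrightarrow> (\<exists>k>0. (f ^^ k) v = v)"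

text \<open>The path of hair \<open>i\<close> is followed up to and including its first vertex on
  the cycle and stops there; if it were followed further, every cycle vertex would receive all
  labels.\<close>

definition anc :: "nat \<Rightarrow> 'v \<Rightarrow> bool" where
  "anc i v \<longleftrightarrow> (\<exists>k. (f ^^ k) (lab i) = v \<and> (\<forall>j<k. \<not> per ((f ^^ j) (lab i))))"

definition D :: "'v \<Rightarrow> nat set" where "D v = {i. i < n \<and> anc i v}"

definition N :: "'v \<Rightarrow> nat" where "N v = nd (D v) (per v)"

definition kids :: "'v \<Rightarrow> 'v set" where "kids v = {u \<in> V. \<not> per u \<and> f u = v}"

lemma finite_D [simp]: "finite (D v)"
  by (simp add: D_def)

lemma iter_in: "v \<in> V \<Longrightarrow> (f ^^ k) v \<in> V"
  by (induction k) (auto simp: f_in)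

lemma lab_in: "i < n \<Longrightarrow> lab i \<in> V" and f_lab: "i < n \<Longrightarrow> u \<in> V \<Longrightarrow> f u \<noteq> lab i"
proof -
  assume "i < n"
  then have "lab i \<in> {v \<in> V. \<forall>u\<in>V. f u \<noteq> v}" unfolding lab_img by blast
  then show "lab i \<in> V" "u \<in> V \<Longrightarrow> f u \<noteq> lab i" by blast+
qed

lemma per_f: "per v \<Longrightarrow> per (f v)"
proof -
  assume "per v"
  then obtain k where "k > 0" "(f ^^ k) v = v" by (auto simp: per_def)
  then have "(f ^^ k) (f v) = f v" using funpow_swap1[of f k v] by simp
  then show ?thesis using \<open>k > 0\<close> by (auto simp: per_def)
qed

lemma iter_mult: "(f ^^ p) v = v \<Longrightarrow> (f ^^ (p * q)) v = v"
  using funpow_mod_eq[of p f v "p * q"] by simp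

lemma per_inj:
  assumes "per u" "per w" "f u = f w"
  shows "u = w"
proof -
  obtain p q where p: "p > 0" "(f ^^ p) u = u" and q: "q > 0" "(f ^^ q) w = w"
    using assms by (auto simp: per_def)
  obtain k where k: "p * q = Suc k" using p(1) q(1) by (cases "p * q") auto
  have "u = (f ^^ Suc k) u" using iter_mult[OF p(2), of q] k by simp
  also have "\<dots> = (f ^^ k) (f u)" by (simp add: funpow_swap1)
  also have "\<dots> = (f ^^ k) (f w)" by (simp add: assms(3))
  also have "\<dots> = (f ^^ Suc k) w" by (simp add: funpow_swap1)
  also have "\<dots> = w" using iter_mult[OF q(2), of p] k by (simp add: mult.commute)
  finally show ?thesis .
qed

lemma per_return: "per v \<Longrightarrow> \<exists>l. (f ^^ l) ((f ^^ k) v) = v"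
proof -
  assume "per v"
  then obtain p where p: "p > 0" "(f ^^ p) v = v" by (auto simp: per_def)
  have "k \<le> p * k" using p(1) by simp
  then have "(f ^^ (p * k)) v = (f ^^ (p * k - k)) ((f ^^ k) v)"
    by (metis funpow_add comp_apply le_add_diff_inverse2)
  then show ?thesis using iter_mult[OF p(2), of k] by metis
qed

lemma one_cycle:
  assumes v: "v \<in> V" "per v" and w: "w \<in> V" "per w"
  shows "\<exists>k. (f ^^ k) v = w"
proof -
  \<comment> \<open>The vertices whose forward path eventually meets that of \<open>v\<close>.
    Membership of a vertex and of its image are equivalent, so connectedness makes this the whole
    vertex set.\<close>
  let ?S = "{u \<in> V. \<exists>k j. (f ^^ k) u = (f ^^ j) v}"
  have "?S = V"
  proof (rule conn)
    show "?S \<noteq> {}" using v(1) by blast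
    fix u assume u: "u \<in> V"
    show "f u \<in> ?S \<longleftrightarrow> u \<in> ?S"
    proof
      assume "f u \<in> ?S"
      then obtain k j where "(f ^^ k) (f u) = (f ^^ j) v" by blast
      then have "(f ^^ Suc k) u = (f ^^ j) v" by (simp add: funpow_swap1)
      then show "u \<in> ?S" using u by blast
    next
      assume "u \<in> ?S"
      then obtain k j where "(f ^^ k) u = (f ^^ j) v" by blast
      then have "(f ^^ k) (f u) = (f ^^ Suc j) v" by (simp add: funpow_swap1[symmetric])
      then show "f u \<in> ?S" using f_in[OF u] by blast
    qed
  qed auto
  then obtain k j where kj: "(f ^^ k) w = (f ^^ j) v" using w(1) by blast
  obtain l where "(f ^^ l) ((f ^^ k) w) = w" using per_return[OF w(2)] by blast
  then have "(f ^^ (l + j)) v = w" by (simp add: kj funpow_add)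
  then show ?thesis by blast
qed

lemma not_per_lab: "i < n \<Longrightarrow> \<not> per (lab i)"
proof
  assume i: "i < n" and "per (lab i)"
  then obtain k where "k > 0" "(f ^^ k) (lab i) = lab i" by (auto simp: per_def)
  then have "f ((f ^^ (k - 1)) (lab i)) = lab i" by (cases k) auto
  then show False using f_lab[OF i iter_in[OF lab_in[OF i]]] by blast
qed

lemma D_lab: "i < n \<Longrightarrow> D (lab i) = {i}"
proof -
  assume i: "i < n"
  have "j = i" if j: "j < n" "anc j (lab i)" for j
  proof -
    obtain k where k: "(f ^^ k) (lab j) = lab i" using j(2) by (auto simp: anc_def)
    have "k = 0"
    proof (rule ccontr)
      assume "k \<noteq> 0"
      then have "f ((f ^^ (k - 1)) (lab j)) = lab i" using k by (cases k) auto
      then show False using f_lab[OF i iter_in[OF lab_in[OF j(1)]]] by blast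
    qed
    then show ?thesis using k inj_onD[OF lab_inj] i j by auto
  qed
  moreover have "anc i (lab i)" unfolding anc_def by (intro exI[of _ 0]) simp
  ultimately show ?thesis using i by (auto simp: D_def)
qed

lemma D_kids:
  assumes "u \<in> V" "f u = v"
  shows "D v = (\<Union>u\<in>kids v. D u)"
proof (intro antisym subsetI)
  fix i assume "i \<in> D v"
  then obtain k where i: "i < n" and k: "(f ^^ k) (lab i) = v" "\<forall>j<k. \<not> per ((f ^^ j) (lab i))"
    by (auto simp: D_def anc_def)
  obtain k' where k': "k = Suc k'"
    using k(1) f_lab[OF i assms(1)] assms(2) by (cases k) auto
  let ?u = "(f ^^ k') (lab i)"
  have "?u \<in> kids v" using k k' iter_in[OF lab_in[OF i]] by (auto simp: kids_def)
  moreover have "i \<in> D ?u" using i k k' by (auto simp: D_def anc_def)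
  ultimately show "i \<in> (\<Union>u\<in>kids v. D u)" by blast
next
  fix i assume "i \<in> (\<Union>u\<in>kids v. D u)"
  then obtain u where u: "\<not> per u" "f u = v" "i < n" "anc i u" by (auto simp: kids_def D_def)
  then obtain k where k: "(f ^^ k) (lab i) = u" "\<forall>j<k. \<not> per ((f ^^ j) (lab i))" by (auto simp: anc_def)
  have "(f ^^ Suc k) (lab i) = v" "\<forall>j<Suc k. \<not> per ((f ^^ j) (lab i))"
    using k u by (auto simp: less_Suc_eq)
  then have "anc i v" unfolding anc_def by blast
  then show "i \<in> D v" using u by (simp add: D_def)
qed

text \<open>If the path of one hair visited two children of \<open>v\<close>, the step after the
  earlier visit and the step after the later visit would agree, so the former would already be
  periodic. But the path is off the cycle up to the later visit.\<close>

lemma kids_disj: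
  assumes "u \<in> kids v" "w \<in> kids v" "u \<noteq> w"
  shows "D u \<inter> D w = {}"
proof -
  have key: False if "a < b" "(f ^^ a) l = u'" "(f ^^ b) l = w'" "\<forall>j<b. \<not> per ((f ^^ j) l)" "\<not> per w'"
    "f u' = f w'" for a b l u' w'
  proof -
    have "(f ^^ Suc a) l = (f ^^ Suc b) l" using that by simp
    moreover have "(f ^^ Suc b) l = (f ^^ (b - a)) ((f ^^ Suc a) l)"
      using that(1) by (metis Suc_diff_Suc add_Suc_right diff_Suc_Suc funpow_add comp_apply le_add_diff_inverse2 less_imp_le)
    ultimately have "per ((f ^^ Suc a) l)" using that(1) by (auto simp: per_def intro!: exI[of _ "b - a"])
    moreover have "\<not> per ((f ^^ Suc a) l)"
    proof (cases "Suc a = b")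
      case True
      then show ?thesis using that(3,5) by blast
    next
      case False
      then have "Suc a < b" using that(1) by simp
      then show ?thesis using that(4) by blast
    qed
    ultimately show False by blast
  qed
  have "\<not> (anc i u \<and> anc i w)" for i
  proof
    assume "anc i u \<and> anc i w"
    then obtain a b where "(f ^^ a) (lab i) = u" "\<forall>j<a. \<not> per ((f ^^ j) (lab i))"
      "(f ^^ b) (lab i) = w" "\<forall>j<b. \<not> per ((f ^^ j) (lab i))" by (auto simp: anc_def)
    then show False using key[of a b "lab i" u w] key[of b a "lab i" w u] assms
      by (cases a b rule: linorder_cases) (auto simp: kids_def)
  qed
  then show ?thesis by (auto simp: D_def)
qed

lemma kids_two:
  assumes "u \<in> V" "f u = v" "\<not> per v"
  shows "2 \<le> card (kids v)"
proof -
  have "{w \<in> V. f w = v} = kids v" using per_f assms(3) by (auto simp: kids_def)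
  then show ?thesis using fibre[OF assms(1)] assms(2) by simp
qed

lemma per_kids:
  assumes "v \<in> V" "per v"
  shows "kids v \<noteq> {}"
proof
  assume none: "kids v = {}"
  obtain k where k: "k > 0" "(f ^^ k) v = v" using assms by (auto simp: per_def)
  then have u: "f ((f ^^ (k - 1)) v) = v" by (cases k) auto
  let ?S = "{w \<in> V. f w = v}"
  have two: "2 \<le> card ?S" using fibre[OF iter_in[OF assms(1)], of "k - 1"] u by simp
  then have "?S \<noteq> {}" by force
  then obtain w where w0: "w \<in> ?S" by blast
  have "?S \<noteq> {w}" using two by force
  then obtain w' where "w' \<in> ?S" "w \<noteq> w'" using w0 by blast
  with w0 have w: "w \<in> V" "f w = v" "w' \<in> V" "f w' = v" "w \<noteq> w'" by auto
  then have "per w" "per w'" using none by (auto simp: kids_def)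
  then show False using per_inj[of w w'] w by simp
qed

lemma D_ne_nonper: "v \<in> V \<Longrightarrow> \<not> per v \<Longrightarrow> D v \<noteq> {}"
proof (induction "card {u \<in> V. \<exists>k. (f ^^ k) u = v}" arbitrary: v rule: less_induct)
  case less
  show ?case
  proof (cases "\<exists>u\<in>V. f u = v")
    case True
    then obtain u where u: "u \<in> V" "f u = v" by blast
    have nu: "\<not> per u" using per_f u less.prems by blast
    have "{w \<in> V. \<exists>k. (f ^^ k) w = u} \<subset> {w \<in> V. \<exists>k. (f ^^ k) w = v}"
    proof
      show "{w \<in> V. \<exists>k. (f ^^ k) w = u} \<subseteq> {w \<in> V. \<exists>k. (f ^^ k) w = v}"
      proof
        fix w assume "w \<in> {w \<in> V. \<exists>k. (f ^^ k) w = u}"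
        then obtain k where "w \<in> V" "(f ^^ k) w = u" by blast
        moreover from this have "(f ^^ Suc k) w = v" using u by simp
        ultimately show "w \<in> {w \<in> V. \<exists>k. (f ^^ k) w = v}" by blast
      qed
      have "(f ^^ k) v \<noteq> u" for k
      proof
        assume "(f ^^ k) v = u"
        then have "(f ^^ Suc k) v = v" using u by simp
        then have "per v" unfolding per_def by blast
        then show False using less.prems by blast
      qed
      moreover have "v \<in> {w \<in> V. \<exists>k. (f ^^ k) w = v}" using less.prems by (auto intro!: exI[of _ 0])
      ultimately show "{w \<in> V. \<exists>k. (f ^^ k) w = u} \<noteq> {w \<in> V. \<exists>k. (f ^^ k) w = v}" by blast
    qed
    then have "D u \<noteq> {}" using fin u nu by (intro less.hyps psubset_card_mono) auto
    moreover have "u \<in> kids v" using u nu by (simp add: kids_def)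
    ultimately show ?thesis using D_kids[OF u] by blast
  next
    case False
    then have "v \<in> lab ` {..<n}" using less.prems lab_img by blast
    then show ?thesis using D_lab by auto
  qed
qed

lemma D_ne: "v \<in> V \<Longrightarrow> D v \<noteq> {}"
proof (cases "per v")
  case True
  assume v: "v \<in> V"
  obtain u where u: "u \<in> kids v" using per_kids[OF v True] by blast
  then have "D u \<noteq> {}" "u \<in> V" "f u = v" using D_ne_nonper by (auto simp: kids_def)
  then show ?thesis using D_kids u by blast
qed (rule D_ne_nonper)

lemma D_strict:
  assumes "u \<in> V" "\<not> per (f u)"
  shows "D u \<subset> D (f u)"
proof -
  have u: "u \<in> kids (f u)" using assms per_f by (auto simp: kids_def)
  have "kids (f u) \<noteq> {u}" using kids_two[OF assms(1) refl assms(2)] by auto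
  then obtain w where w: "w \<in> kids (f u)" "w \<noteq> u" using u by blast
  have "D w \<noteq> {}" using w(1) D_ne by (auto simp: kids_def)
  moreover have "D w \<inter> D u = {}" by (rule kids_disj[OF w(1) u w(2)])
  moreover have "D w \<subseteq> D (f u)" "D u \<subseteq> D (f u)" using D_kids[OF assms(1) refl] w(1) u by blast+
  ultimately show ?thesis by blast
qed

text \<open>Two vertices with the same non-empty label set both lie on the path of one hair. Along
  this path the label sets grow strictly off the cycle, and the flag tells apart the first cycle
  vertex from the vertex before it, which may carry the same labels.\<close>

lemma N_inj: "inj_on N V"
proof (rule inj_onI)
  fix v w assume vw: "v \<in> V" "w \<in> V" "N v = N w"
  have eq: "D v = D w" "per v = per w"
    using arg_cong[OF vw(3), of nset] arg_cong[OF vw(3), of ncyc] by (simp_all add: N_def)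
  obtain i where "i \<in> D v" using D_ne[OF vw(1)] by blast
  then have i: "i < n" "anc i v" "anc i w" using eq by (auto simp: D_def)
  obtain a where a: "(f ^^ a) (lab i) = v" "\<forall>j<a. \<not> per ((f ^^ j) (lab i))"
    using i(2) unfolding anc_def by blast
  obtain b where b: "(f ^^ b) (lab i) = w" "\<forall>j<b. \<not> per ((f ^^ j) (lab i))"
    using i(3) unfolding anc_def by blast
  have key: False if "a < b" "\<forall>j<b. \<not> per ((f ^^ j) (lab i))" "D ((f ^^ a) (lab i)) = D ((f ^^ b) (lab i))"
    "per ((f ^^ a) (lab i)) = per ((f ^^ b) (lab i))" for a b
  proof -
    have np: "\<not> per ((f ^^ j) (lab i))" if "j \<le> b" for j
      using that \<open>a < b\<close> \<open>\<forall>j<b. _ j\<close> \<open>per ((f ^^ a) (lab i)) = _\<close> by (cases "j = b") auto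
    have "D ((f ^^ a) (lab i)) \<subset> D ((f ^^ (a + Suc k)) (lab i))" if "a + Suc k \<le> b" for k
      using that
    proof (induction k)
      case 0
      then show ?case using D_strict[OF iter_in[OF lab_in[OF i(1)]], of a] np[of "Suc a"] by simp
    next
      case (Suc k)
      have "D ((f ^^ (a + Suc k)) (lab i)) \<subset> D ((f ^^ (a + Suc (Suc k))) (lab i))"
        using D_strict[OF iter_in[OF lab_in[OF i(1)]], of "a + Suc k"] np[of "a + Suc (Suc k)"] Suc.prems
        by simp
      moreover have "D ((f ^^ a) (lab i)) \<subset> D ((f ^^ (a + Suc k)) (lab i))" using Suc by simp
      ultimately show ?case by (rule psubset_trans[rotated])
    qed
    from this[of "b - a - 1"] \<open>a < b\<close> that(3) show False by auto
  qed
  show "v = w"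
  proof (cases a b rule: linorder_cases)
    case less
    then show ?thesis using key[of a b] a b eq by simp
  next
    case equal
    then show ?thesis using a b by simp
  next
    case greater
    then show ?thesis using key[of b a] a b eq by simp
  qed
qed

definition f' :: "nat \<Rightarrow> nat" where
  "f' w = (if w \<in> N ` V then N (f (inv_into V N w)) else w)"

lemma f'_N: "v \<in> V \<Longrightarrow> f' (N v) = N (f v)"
  using N_inj by (simp add: f'_def)

lemma N_lab: "i < n \<Longrightarrow> N (lab i) = leaf i"
  using D_lab not_per_lab by (simp add: N_def)

lemma ncyc_N [simp]: "ncyc (N v) = per v" and nset_N [simp]: "nset (N v) = D v"
  by (simp_all add: N_def)

lemma chl_N: "v \<in> V \<Longrightarrow> chl (N ` V) f' (N v) = N ` kids v"
proof -
  assume v: "v \<in> V"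
  have "N (f u) = N v \<longleftrightarrow> f u = v" if "u \<in> V" for u using inj_on_eq_iff[OF N_inj f_in[OF that] v] .
  then show ?thesis by (auto simp: chl_def kids_def f'_N)
qed

lemma N_canon: "canon n (N ` V) f'"
proof
  show "nset v \<noteq> {}" if "v \<in> N ` V" for v using that D_ne by auto
  show "nset v \<subseteq> {..<n}" if "v \<in> N ` V" for v using that by (auto simp: D_def)
  show "leaf i \<in> N ` V" if "i < n" for i using N_lab[OF that] lab_in[OF that] by (metis imageI)
  show "f' v \<in> N ` V" if "v \<in> N ` V" for v using that f_in by (auto simp: f'_N)
  show "f' v = v" if "v \<notin> N ` V" for v using that by (simp add: f'_def)
  show "ncyc (f' v)" if "v \<in> N ` V" "ncyc v" for v using that per_f by (auto simp: f'_N)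
  have it: "(f' ^^ k) (N v) = N ((f ^^ k) v)" if "v \<in> V" for k v
    by (induction k) (simp_all add: f'_N iter_in[OF that])
  show "\<exists>k. (f' ^^ k) v = w" if vw: "v \<in> N ` V" "w \<in> N ` V" "ncyc v" "ncyc w" for v w
  proof -
    obtain v' w' where v': "v = N v'" "v' \<in> V" "w = N w'" "w' \<in> V" using vw(1,2) by blast
    then obtain k where "(f ^^ k) v' = w'" using one_cycle[of v' w'] vw by auto
    then show ?thesis using it[OF v'(2)] v' by auto
  qed
  have leafN: "v \<in> lab ` {..<n}" if "v \<in> V" "N v = leaf i" for v i
  proof -
    have "D v = {i}" using arg_cong[OF that(2), of nset] by simp
    then have "i < n" by (auto simp: D_def)
    then have "N v = N (lab i)" using that N_lab by simp
    then have "v = lab i" using inj_onD[OF N_inj] that(1) lab_in[OF \<open>i < n\<close>] by blast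
    then show ?thesis using \<open>i < n\<close> by blast
  qed
  show "f' v \<noteq> leaf i" if v: "v \<in> N ` V" for v i
  proof
    assume l: "f' v = leaf i"
    obtain v' where v': "v = N v'" "v' \<in> V" using v by blast
    then have "f v' \<in> lab ` {..<n}" using l leafN[OF f_in] by (simp add: f'_N)
    then show False using f_lab v' by auto
  qed
  fix v assume v: "v \<in> N ` V" "\<And>i. v \<noteq> leaf i"
  obtain v' where v': "v = N v'" "v' \<in> V" using v(1) by blast
  have "v' \<notin> lab ` {..<n}" using v(2) v' N_lab by auto
  then have "v' \<notin> {v \<in> V. \<forall>u\<in>V. f u \<noteq> v}" using lab_img by simp
  then obtain u0 where u0: "u0 \<in> V" "f u0 = v'" using v'(2) by auto
  have ch: "chl (N ` V) f' v = N ` kids v'" unfolding v' by (rule chl_N[OF v'(2)])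
  show "nset v = (\<Union>u\<in>chl (N ` V) f' v. nset u)" unfolding ch using D_kids[OF u0] v' by simp
  show "nset u \<inter> nset w = {}" if uw: "u \<in> chl (N ` V) f' v" "w \<in> chl (N ` V) f' v" "u \<noteq> w" for u w
  proof -
    obtain u' w' where "u = N u'" "w = N w'" "u' \<in> kids v'" "w' \<in> kids v'" using uw(1,2) unfolding ch by blast
    then show ?thesis using kids_disj[of u' v' w'] uw(3) by auto
  qed
  show "2 \<le> card (chl (N ` V) f' v)" if nc: "\<not> ncyc v"
  proof -
    have "inj_on N (kids v')" using N_inj by (rule inj_on_subset) (auto simp: kids_def)
    then have "card (N ` kids v') = card (kids v')" by (rule card_image)
    then show ?thesis unfolding ch using kids_two[OF u0] nc v' by simp
  qed
qed

end

lemma color_matching: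
  assumes "finite E" "\<And>j. card {v \<in> E. c v = Some j} = card {i \<in> {..<n::nat}. col i = j}"
    "\<And>v. v \<in> E \<Longrightarrow> c v \<noteq> None"
  obtains lab where "inj_on lab {..<n}" "lab ` {..<n} = E" "\<And>i. i < n \<Longrightarrow> c (lab i) = Some (col i)"
proof -
  have "\<exists>b. bij_betw b {i \<in> {..<n}. col i = j} {v \<in> E. c v = Some j}" for j
    by (rule finite_same_card_bij) (use assms in auto)
  then obtain b where b: "\<And>j. bij_betw (b j) {i \<in> {..<n}. col i = j} {v \<in> E. c v = Some j}" by metis
  define lab where "lab i = b (col i) i" for i
  have mem: "lab i \<in> E \<and> c (lab i) = Some (col i)" if "i < n" for i
    using bij_betwE[OF b[of "col i"]] that by (auto simp: lab_def)
  have inj: "inj_on lab {..<n}"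
  proof (rule inj_onI)
    fix i j assume ij: "i \<in> {..<n}" "j \<in> {..<n}" "lab i = lab j"
    then have "col i = col j" using mem[of i] mem[of j] by auto
    then show "i = j" using bij_betw_imp_inj_on[OF b[of "col i"]] ij by (auto simp: lab_def dest: inj_onD)
  qed
  have "E \<subseteq> lab ` {..<n}"
  proof
    fix v assume v: "v \<in> E"
    then obtain j where "c v = Some j" using assms(3) by auto
    then have "v \<in> b j ` {i \<in> {..<n}. col i = j}" using b[of j] v by (auto simp: bij_betw_def)
    then show "v \<in> lab ` {..<n}" by (auto simp: lab_def)
  qed
  then have "lab ` {..<n} = E" using mem by auto
  then show thesis using that inj mem by blast
qed

context colored
begin

text \<open>The edges are directed towards the cycle and the hairs numbered so that their colours
  follow \<open>col\<close>, which is possible because the colours occur equally often. Naming the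
  vertices then yields a canonical graph; the edges whose original direction disagrees make up
  \<open>\<phi>\<close>.\<close>

lemma canonical_exists:
  assumes h: "is_hairy_graph r \<Gamma>" "genus \<Gamma> = 1"
    and deg: "\<And>j. hodge_degree \<Gamma> j = card {i \<in> {..<n}. col i = j}"
  shows "\<exists>x\<in>cstr n. \<exists>e. grel r m d (rgraph col x) \<Gamma> e"
proof -
  let ?G = "shape \<Gamma>" and ?V = "verts (shape \<Gamma>)"
  note hD = is_hairy_graphD[OF h(1)]
  have card: "card (arcs ?G) = card ?V" using genus_one_iff[OF h(1)] h(2) by simp
  obtain f e where e: "bij_betw e ?V (arcs ?G)" and f: "f ` ?V \<subseteq> ?V"
    and j: "\<And>v. v \<in> ?V \<Longrightarrow> joins ?G (e v) v (f v)"
    using functional_orientation[OF hairy_fin_digraph[OF h(1)] hairy_gconn[OF h(1)] card] by metis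
  have val: "valence \<Gamma> v = 1 + card {u \<in> ?V. f u = v}" if "v \<in> ?V" for v
  proof -
    have "valence \<Gamma> v = (\<Sum>u\<in>?V. of_bool (tail ?G (e u) = v) + of_bool (head ?G (e u) = v))"
      unfolding valence_sum[OF hD(3)] by (rule sum.reindex_bij_betw[OF e, symmetric])
    also have "\<dots> = (\<Sum>u\<in>?V. of_bool (u = v) + of_bool (f u = v))"
    proof (rule sum.cong[OF refl])
      fix u assume "u \<in> ?V"
      from j[OF this] show "of_bool (tail ?G (e u) = v) + of_bool (head ?G (e u) = v) =
          (of_bool (u = v) + of_bool (f u = v) :: nat)"
        unfolding joins_def by (elim disjE conjE) simp_all
    qed
    also have "\<dots> = (\<Sum>u\<in>?V. of_bool (u = v)) + (\<Sum>u\<in>?V. of_bool (f u = v))" by (rule sum.distrib)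
    also have "(\<Sum>u\<in>?V. of_bool (u = v)) = (1::nat)" using that hD(2) by (simp add: of_bool_def)
    also have "(\<Sum>u\<in>?V. of_bool (f u = v)) = card {u \<in> ?V. f u = v}"
      using hD(2) by (simp add: Int_def)
    finally show ?thesis .
  qed
  have ext: "valence \<Gamma> v = 1" if "v \<in> external \<Gamma>" for v
    using h(1) that by (auto simp: is_hairy_graph_def)
  have int: "valence \<Gamma> v \<ge> 3" if "v \<in> ?V" "v \<notin> external \<Gamma>" for v
    using h(1) that by (auto simp: is_hairy_graph_def internal_def external_def)
  have extV: "external \<Gamma> \<subseteq> ?V" by (auto simp: external_def)
  obtain lab where lab: "inj_on lab {..<n}" "lab ` {..<n} = external \<Gamma>"
    "\<And>i. i < n \<Longrightarrow> color \<Gamma> (lab i) = Some (col i)"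
  proof (rule color_matching[of "external \<Gamma>" "color \<Gamma>" n col])
    show "finite (external \<Gamma>)" using extV hD(2) by (rule finite_subset)
    have "{v \<in> external \<Gamma>. color \<Gamma> v = Some j} = {v \<in> ?V. color \<Gamma> v = Some j}" for j
      by (auto simp: external_def)
    then show "card {v \<in> external \<Gamma>. color \<Gamma> v = Some j} = card {i \<in> {..<n}. col i = j}" for j
      using deg[of j] by (simp add: hodge_degree_def)
    show "color \<Gamma> v \<noteq> None" if "v \<in> external \<Gamma>" for v using that by (simp add: external_def)
  qed (rule that)
  have fib: "{u \<in> ?V. f u = v} = {} \<longleftrightarrow> v \<in> external \<Gamma>" if "v \<in> ?V" for v
  proof
    assume em: "{u \<in> ?V. f u = v} = {}"
    have "valence \<Gamma> v = 1" unfolding val[OF that] em by simp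
    then show "v \<in> external \<Gamma>" using int[OF that] by linarith
  next
    assume "v \<in> external \<Gamma>"
    then have "card {u \<in> ?V. f u = v} = 0" using val[OF that] ext by simp
    then show "{u \<in> ?V. f u = v} = {}" using hD(2) by simp
  qed
  interpret u: unicycle ?V f n lab
  proof
    show "finite ?V" by (rule hD(2))
    show "f v \<in> ?V" if "v \<in> ?V" for v using f that by blast
    show "S = ?V" if S: "S \<subseteq> ?V" "S \<noteq> {}" "\<And>v. v \<in> ?V \<Longrightarrow> f v \<in> S \<longleftrightarrow> v \<in> S" for S
    proof (rule gconnD[OF hairy_gconn(1)[OF h(1)] S(1,2)])
      fix a assume "a \<in> arcs ?G"
      then obtain v where v: "v \<in> ?V" "a = e v" using e by (auto simp: bij_betw_def)
      then show "tail ?G a \<in> S \<longleftrightarrow> head ?G a \<in> S" using j[OF v(1)] S(3)[OF v(1)] by (auto simp: joins_def)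
    qed
    show "inj_on lab {..<n}" by (rule lab(1))
    show "{v \<in> ?V. \<forall>u\<in>?V. f u \<noteq> v} = lab ` {..<n}"
      unfolding lab(2) using fib extV by blast
    show "2 \<le> card {w \<in> ?V. f w = f u}" if u: "u \<in> ?V" for u
    proof -
      have fu: "f u \<in> ?V" using f u by blast
      have "f u \<notin> external \<Gamma>" using fib[OF fu] u by blast
      then show ?thesis using int[OF fu] val[OF fu] by simp
    qed
  qed
  let ?x = "(u.N ` ?V, u.f')"
  have x: "?x \<in> cstr n" using u.N_canon by (simp add: cstr_def)
  define \<alpha> where "\<alpha> = inv_into ?V u.N"
  have \<alpha>N: "\<alpha> (u.N v) = v" if "v \<in> ?V" for v using u.N_inj that by (simp add: \<alpha>_def)
  have bij\<alpha>: "bij_betw \<alpha> (u.N ` ?V) ?V"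
    unfolding \<alpha>_def by (rule bij_betw_inv_into) (simp add: bij_betw_def u.N_inj)
  define \<phi> where "\<phi> = {w \<in> u.N ` ?V. tail ?G (e (\<alpha> w)) \<noteq> \<alpha> w}"
  have "giso (rgraph col ?x) \<Gamma> \<alpha> (e \<circ> \<alpha>) \<phi>"
    unfolding giso_def
  proof (intro conjI ballI)
    show "bij_betw \<alpha> (verts (shape (rgraph col ?x))) ?V" using bij\<alpha> by simp
    show "bij_betw (e \<circ> \<alpha>) (arcs (shape (rgraph col ?x))) (arcs ?G)"
      using bij_betw_trans[OF bij\<alpha> e] by simp
    show "\<phi> \<subseteq> arcs (shape (rgraph col ?x))" by (auto simp: \<phi>_def)
  next
    fix w assume "w \<in> arcs (shape (rgraph col ?x))"
    then obtain v where v: "w = u.N v" "v \<in> ?V" by auto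
    have fv: "\<alpha> (u.f' w) = f v" using v \<alpha>N u.f'_N u.f_in by simp
    have mem: "w \<in> \<phi> \<longleftrightarrow> tail ?G (e v) \<noteq> v" using v \<alpha>N by (auto simp: \<phi>_def)
    show "tail ?G ((e \<circ> \<alpha>) w) = \<alpha> (if w \<in> \<phi> then head (shape (rgraph col ?x)) w else tail (shape (rgraph col ?x)) w)"
      "head ?G ((e \<circ> \<alpha>) w) = \<alpha> (if w \<in> \<phi> then tail (shape (rgraph col ?x)) w else head (shape (rgraph col ?x)) w)"
      using j[OF v(2)] mem fv \<alpha>N[OF v(2)] v(1) by (auto simp: joins_def)
  next
    fix w assume "w \<in> verts (shape (rgraph col ?x))"
    then obtain v where v: "w = u.N v" "v \<in> ?V" by auto
    show "color \<Gamma> (\<alpha> w) = color (rgraph col ?x) w"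
    proof (cases "v \<in> external \<Gamma>")
      case True
      then have "v \<in> lab ` {..<n}" unfolding lab(2) .
      then obtain i where i: "i < n" "v = lab i" by blast
      have "\<alpha> w = lab i" using v i \<alpha>N by simp
      moreover have "w = leaf i" using v i u.N_lab by simp
      ultimately show ?thesis using lab(3)[OF i(1)] by simp
    next
      case False
      have "w \<noteq> leaf i" for i
      proof
        assume w: "w = leaf i"
        then have "i < n" using v u.nset_N[of v] by (auto simp: u.D_def)
        then have "u.N v = u.N (lab i)" using u.N_lab w v by simp
        then have "v = lab i" using inj_onD[OF u.N_inj] v u.lab_in[OF \<open>i < n\<close>] by blast
        then show False using False lab(2) \<open>i < n\<close> by blast
      qed
      then have "color (rgraph col ?x) w = None" by simp
      moreover have "color \<Gamma> v = None" using False v by (auto simp: external_def)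
      ultimately show ?thesis using v \<alpha>N by simp
    qed
  qed
  then have "grel r m d (rgraph col ?x) \<Gamma> (gsign m d (rgraph col ?x) \<Gamma> \<alpha> (e \<circ> \<alpha>) \<phi>)"
    unfolding grel_def using hairy[OF x] h(1) by blast
  then show ?thesis using x by blast
qed

end

section \<open>Weights and the cancellation of trees\<close>

lemma forb_image:
  assumes "p ` A \<subseteq> A" "\<And>b. b \<in> A \<Longrightarrow> p' (h b) = h (p b)" "a \<in> A"
  shows "forb p' (h a) = h ` forb p a"
proof -
  have inA: "(p ^^ k) a \<in> A" for k by (induction k) (use assms in auto)
  have "(p' ^^ k) (h a) = h ((p ^^ k) a)" for k
    by (induction k) (simp_all add: assms(2)[OF inA])
  then show ?thesis by (auto simp: forb_def)
qed

lemma orbprod_image: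
  assumes "p ` A \<subseteq> A" "\<And>b. b \<in> A \<Longrightarrow> p' (h b) = h (p b)" "inj_on h A"
  shows "orbprod g p' (h ` A) = orbprod (\<lambda>C. g (h ` C)) p A"
proof -
  have "forb p' ` h ` A = (\<lambda>C. h ` C) ` forb p ` A"
    unfolding image_image by (rule image_cong[OF refl], rule forb_image[of p A]) (use assms in auto)
  moreover have "inj_on (\<lambda>C. h ` C) (forb p ` A)"
  proof (rule inj_onI)
    fix C C' assume C: "C \<in> forb p ` A" "C' \<in> forb p ` A" "h ` C = h ` C'"
    then have "C \<subseteq> A" "C' \<subseteq> A" using forb_subset[OF assms(1)] by auto
    then show "C = C'" using C(3) inj_on_image_eq_iff[OF assms(3)] by blast
  qed
  ultimately show ?thesis unfolding orbprod_def by (simp add: prod.reindex)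
qed

lemma forb_ne: "C \<in> forb p ` A \<Longrightarrow> C \<noteq> {}"
  using forb_self[of _ p] by auto

lemma forb_sub:
  assumes "p ` A \<subseteq> A" "C \<in> forb p ` A"
  shows "C \<subseteq> A"
proof -
  obtain a where "a \<in> A" "C = forb p a" using assms(2) by blast
  then show ?thesis using forb_subset[OF assms(1)] by simp
qed

lemma forb_cong:
  assumes "p ` A \<subseteq> A" "\<And>b. b \<in> A \<Longrightarrow> p' b = p b" "a \<in> A"
  shows "forb p' a = forb p a"
  using forb_image[of p A p' id a] assms by simp

lemma orbprod_cong:
  assumes "p ` A \<subseteq> A" "\<And>b. b \<in> A \<Longrightarrow> p' b = p b" "\<And>C. C \<in> forb p ` A \<Longrightarrow> g C = g' C"
  shows "orbprod g p' A = orbprod g' p A"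
proof -
  have "forb p' ` A = forb p ` A" using forb_cong[OF assms(1,2)] by (intro image_cong) auto
  then show ?thesis unfolding orbprod_def using assms(3) by (simp cong: prod.cong)
qed

lemma orbprod_mult: "orbprod g p A * orbprod g' p A = orbprod (\<lambda>C. g C * g' C) p A"
  by (simp add: orbprod_def prod.distrib)

lemma osign_const: "C \<noteq> {} \<Longrightarrow> osign (\<lambda>_. k) C = psign k"
  by (auto simp: osign_def psign_def)

lemma orbprod_Plus:
  assumes "finite A" "finite B" "p ` A \<subseteq> A" "q ` B \<subseteq> B"
  shows "orbprod g (map_sum p q) (A <+> B) =
    orbprod (\<lambda>C. g (Inl ` C)) p A * orbprod (\<lambda>C. g (Inr ` C)) q B"
proof -
  have "orbprod g (map_sum p q) (A <+> B) =
      orbprod g (map_sum p q) (Inl ` A) * orbprod g (map_sum p q) (Inr ` B)"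
    unfolding Plus_def using assms by (intro orbprod_Un) auto
  then show ?thesis
    using orbprod_image[of p A "map_sum p q" Inl g] orbprod_image[of q B "map_sum p q" Inr g] assms
    by simp
qed

section \<open>Weights of the fixed graphs as products over orbits\<close>

definition inner_nodes :: "nat set \<Rightarrow> nat set" where
  "inner_nodes V = {v \<in> V. \<not> ncyc v \<and> (\<forall>i. v \<noteq> leaf i)}"

definition cyc_nodes :: "nat set \<Rightarrow> nat set" where
  "cyc_nodes V = {v \<in> V. ncyc v}"

text \<open>The parity of the degree is included because the Euler characteristic needs it, and
  because only together with it does the Koszul sign split into a product over orbits.\<close>

definition weight :: "(nat \<Rightarrow> nat) \<Rightarrow> nat \<Rightarrow> (nat \<Rightarrow> nat) \<Rightarrow> (nat \<Rightarrow> nat) \<times> bool \<Rightarrow>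
    nat set \<times> (nat \<Rightarrow> nat) \<Rightarrow> rat" where
  "weight m d col g x = psign (hdegree m d (rgraph col x)) * csgn m d col g x"

text \<open>An orbit of hairs contributes once through its external vertices and once through their
  edges, of degree d - 1. The result depends on the labels only and not on the graph.\<close>

definition leaf_weight :: "nat \<Rightarrow> (nat \<Rightarrow> nat) \<Rightarrow> nat \<Rightarrow> (nat \<Rightarrow> nat) \<Rightarrow> (nat \<Rightarrow> nat) \<Rightarrow> rat" where
  "leaf_weight n m d col \<sigma> =
     orbprod (\<lambda>C. osign (\<lambda>i. int (m (col i))) C * psign (int d - 1)) \<sigma> {..<n}"

text \<open>The vertices of the cycle are permuted by \<open>ren\<close> and its edges by
  \<open>amap\<close>; the two permutations differ when the cycle is reversed, so they need separate
  products.\<close>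

definition cyc_weight :: "nat \<Rightarrow> (nat \<Rightarrow> nat) \<times> bool \<Rightarrow> nat set \<times> (nat \<Rightarrow> nat) \<Rightarrow> rat" where
  "cyc_weight d g x =
     orbprod (\<lambda>_. psign (int d)) (ren (fst g)) (cyc_nodes (fst x)) *
     orbprod (\<lambda>_. psign (int d - 1)) (amap g x) (cyc_nodes (fst x)) *
     psign (int d * int (card (aflip g x)))"

lemma ren_image_fixed:
  assumes "cact g x = x"
  shows "ren (fst g) ` fst x = fst x"
  using assms by (metis cact_def fst_conv)

context colored
begin

text \<open>Off the cycle a vertex and its outgoing edge are permuted alike, so their factors can be
  multiplied orbit by orbit. For an internal vertex they are (-1)^d and (-1)^(d-1), with product -1
  independently of d. The shape of the trees enters the weight only through the number of these
  orbits.\<close>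

lemma weight_formula:
  assumes x: "x \<in> cstr n" and g: "g \<in> lgroup n col" and fix_x: "cact g x = x"
  shows "weight m d col g x = orbprod (\<lambda>_. - 1) (ren (fst g)) (inner_nodes (fst x)) *
    leaf_weight n m d col (fst g) * cyc_weight d g x"
proof -
  interpret canon n "fst x" "snd x" using x by (simp add: cstr_def)
  let ?V = "fst x" and ?\<sigma> = "fst g" and ?L = "leaf ` {..<n}"
  note \<sigma> = lgroupD[OF g]
  define dg where "dg = elt_deg m d (rgraph col x)"
  define dv where "dv v = dg (Inl v)" for v
  have rV: "ren ?\<sigma> ` ?V = ?V" by (rule ren_image_fixed[OF fix_x])
  have bijV: "bij_betw (amap g x) ?V ?V" using bij_amap[OF x g] fix_x by simp
  have iso: "giso (rgraph col x) (rgraph col x) (ren ?\<sigma>) (amap g x) (aflip g x)"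
    using giso_cact[OF x g] fix_x by simp
  note h = is_hairy_graphD[OF hairy[OF x]]
  have bij: "bij_betw (map_sum (ren ?\<sigma>) (amap g x)) (?V <+> ?V) (?V <+> ?V)"
    using giso_inj[OF iso] giso_image[OF iso] by (simp add: bij_betw_def)
  have K: "koszul_sign dg (map (map_sum (ren ?\<sigma>) (amap g x)) (ordering (rgraph col x))) (ordering (rgraph col x)) *
      psign (\<Sum>a\<in>?V <+> ?V. dg a) = orbprod (osign dg) (map_sum (ren ?\<sigma>) (amap g x)) (?V <+> ?V)"
  proof (rule koszul_sign_orbits[OF _ bij])
    show "finite (?V <+> ?V)" by simp
    show "dg (map_sum (ren ?\<sigma>) (amap g x) a) = dg a" if "a \<in> ?V <+> ?V" for a
      unfolding dg_def by (rule giso_elt_deg[OF iso]) (use that in simp)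
    show "distinct (ordering (rgraph col x))" by (rule h(4))
    show "set (ordering (rgraph col x)) = ?V <+> ?V" using h(5) by simp
  qed
  have amV: "amap g x ` ?V = ?V" using bijV by (simp add: bij_betw_def)
  have "weight m d col g x = psign (\<Sum>a\<in>?V <+> ?V. dg a) *
      koszul_sign dg (map (map_sum (ren ?\<sigma>) (amap g x)) (ordering (rgraph col x))) (ordering (rgraph col x)) *
      psign (int d * int (card (aflip g x)))"
    by (simp add: weight_def csgn_def gsign_def fix_x hdegree_def dg_def)
  also have "\<dots> = orbprod (osign dg) (map_sum (ren ?\<sigma>) (amap g x)) (?V <+> ?V) *
      psign (int d * int (card (aflip g x)))"
    by (simp only: K[symmetric] ac_simps)
  also have "orbprod (osign dg) (map_sum (ren ?\<sigma>) (amap g x)) (?V <+> ?V) =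
      orbprod (\<lambda>C. osign dg (Inl ` C)) (ren ?\<sigma>) ?V * orbprod (\<lambda>C. osign dg (Inr ` C)) (amap g x) ?V"
    by (rule orbprod_Plus) (use rV amV in auto)
  also have "(\<lambda>C. osign dg (Inl ` C)) = osign dv"
    by (simp add: fun_eq_iff osign_def dv_def)
  also have "orbprod (\<lambda>C. osign dg (Inr ` C)) (amap g x) ?V = orbprod (\<lambda>_. psign (int d - 1)) (amap g x) ?V"
  proof (rule orbprod_cong)
    show "osign dg (Inr ` C) = psign (int d - 1)" if "C \<in> forb (amap g x) ` ?V" for C
    proof -
      have "C \<noteq> {}" using that by (rule forb_ne)
      then show ?thesis by (auto simp: osign_def psign_def dg_def)
    qed
  qed (use amV in auto)
  finally have w1: "weight m d col g x = orbprod (osign dv) (ren ?\<sigma>) ?V *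
      orbprod (\<lambda>_. psign (int d - 1)) (amap g x) ?V * psign (int d * int (card (aflip g x)))" .
  let ?I = "inner_nodes ?V" and ?C = "cyc_nodes ?V"
  have split: "?V = (?I \<union> ?L) \<union> ?C"
    using leaf_in leaf_nset by (auto simp: inner_nodes_def cyc_nodes_def)
  have dj: "(?I \<union> ?L) \<inter> ?C = {}" "?I \<inter> ?L = {}" by (auto simp: inner_nodes_def cyc_nodes_def)
  have fin: "finite ?I" "finite ?C" by (auto simp: inner_nodes_def cyc_nodes_def)
  have rL: "ren ?\<sigma> ` ?L \<subseteq> ?L" using permutes_in_image[OF \<sigma>(1)] by auto
  have rI: "ren ?\<sigma> ` ?I \<subseteq> ?I"
    using rV ren_eq_leaf[OF \<sigma>(1)] by (fastforce simp: inner_nodes_def)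
  have rC: "ren ?\<sigma> ` ?C \<subseteq> ?C" using rV by (fastforce simp: cyc_nodes_def)
  have aIL: "amap g x v = ren ?\<sigma> v" if "v \<in> ?I \<union> ?L" for v
    using that by (auto simp: amap_def inner_nodes_def)
  have aC: "amap g x ` ?C \<subseteq> ?C"
    using amV f_cyc by (fastforce simp: cyc_nodes_def amap_def)
  have rIL: "ren ?\<sigma> ` (?I \<union> ?L) \<subseteq> ?I \<union> ?L" using rI rL by blast
  have aIL': "amap g x ` (?I \<union> ?L) \<subseteq> ?I \<union> ?L" using rIL aIL by auto
  have "orbprod (osign dv) (ren ?\<sigma>) ((?I \<union> ?L) \<union> ?C) =
      orbprod (osign dv) (ren ?\<sigma>) (?I \<union> ?L) * orbprod (osign dv) (ren ?\<sigma>) ?C"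
    by (rule orbprod_Un) (use fin dj rIL rC in auto)
  then have e1: "orbprod (osign dv) (ren ?\<sigma>) ?V =
      orbprod (osign dv) (ren ?\<sigma>) (?I \<union> ?L) * orbprod (osign dv) (ren ?\<sigma>) ?C"
    using split by simp
  have "orbprod (\<lambda>_. psign (int d - 1)) (amap g x) ((?I \<union> ?L) \<union> ?C) =
      orbprod (\<lambda>_. psign (int d - 1)) (amap g x) (?I \<union> ?L) * orbprod (\<lambda>_. psign (int d - 1)) (amap g x) ?C"
    by (rule orbprod_Un) (use fin dj aIL' aC in auto)
  moreover have "orbprod (\<lambda>_. psign (int d - 1)) (amap g x) (?I \<union> ?L) =
      orbprod (\<lambda>_. psign (int d - 1)) (ren ?\<sigma>) (?I \<union> ?L)"
    by (rule orbprod_cong[OF rIL aIL]) auto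
  ultimately have e2: "orbprod (\<lambda>_. psign (int d - 1)) (amap g x) ?V =
      orbprod (\<lambda>_. psign (int d - 1)) (ren ?\<sigma>) (?I \<union> ?L) * orbprod (\<lambda>_. psign (int d - 1)) (amap g x) ?C"
    using split by simp
  let ?w = "\<lambda>C. osign dv C * psign (int d - 1)"
  have "orbprod ?w (ren ?\<sigma>) (?I \<union> ?L) = orbprod ?w (ren ?\<sigma>) ?I * orbprod ?w (ren ?\<sigma>) ?L"
    by (rule orbprod_Un) (use fin dj rI rL in auto)
  also have "orbprod ?w (ren ?\<sigma>) ?I = orbprod (\<lambda>_. - 1) (ren ?\<sigma>) ?I"
  proof (rule orbprod_cong[OF rI])
    fix C assume "C \<in> forb (ren ?\<sigma>) ` ?I"
    note C = forb_sub[OF rI this] forb_ne[OF this]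
    have "dv v = - int d" if "v \<in> ?I" for v
      using that by (simp add: dv_def dg_def inner_nodes_def)
    then have "osign dv C = psign (int d)" using C by (auto simp: osign_def psign_def subset_iff)
    then show "?w C = - 1" by (simp add: psign_def)
  qed simp
  also have "orbprod ?w (ren ?\<sigma>) ?L = orbprod (\<lambda>C. ?w (leaf ` C)) ?\<sigma> {..<n}"
    by (rule orbprod_image) (use permutes_in_image[OF \<sigma>(1)] inj_leaf in auto)
  also have "\<dots> = leaf_weight n m d col ?\<sigma>"
    unfolding leaf_weight_def by (simp add: osign_def dv_def dg_def)
  finally have e3: "orbprod (osign dv) (ren ?\<sigma>) (?I \<union> ?L) * orbprod (\<lambda>_. psign (int d - 1)) (ren ?\<sigma>) (?I \<union> ?L) =
      orbprod (\<lambda>_. - 1) (ren ?\<sigma>) ?I * leaf_weight n m d col ?\<sigma>"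
    by (simp add: orbprod_mult)
  have e4: "orbprod (osign dv) (ren ?\<sigma>) ?C = orbprod (\<lambda>_. psign (int d)) (ren ?\<sigma>) ?C"
  proof (rule orbprod_cong[OF rC])
    fix C assume "C \<in> forb (ren ?\<sigma>) ` ?C"
    note C = forb_sub[OF rC this] forb_ne[OF this]
    have "dv v = - int d" if "v \<in> ?C" for v
      using that cyc_not_leaf by (auto simp: dv_def dg_def cyc_nodes_def)
    then show "osign dv C = psign (int d)" using C by (auto simp: osign_def psign_def subset_iff)
  qed simp
  have "weight m d col g x = (orbprod (osign dv) (ren ?\<sigma>) (?I \<union> ?L) *
      orbprod (\<lambda>_. psign (int d - 1)) (ren ?\<sigma>) (?I \<union> ?L)) * cyc_weight d g x"
    unfolding w1 e1 e2 e4 cyc_weight_def by (simp only: ac_simps)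
  then show ?thesis unfolding e3 .
qed

end

section \<open>Contracting and inserting edges at the cycle\<close>

definition twin :: "nat \<Rightarrow> nat" where "twin v = nd (nset v) (\<not> ncyc v)"

lemma twin_simps [simp]: "nset (twin v) = nset v" "ncyc (twin v) = (\<not> ncyc v)" "twin (twin v) = v"
  by (simp_all add: twin_def)

lemma twin_ren: "twin (ren \<sigma> v) = ren \<sigma> (twin v)"
  by (rule node_eqI) simp_all

lemma twin_eq_iff: "twin v = w \<longleftrightarrow> v = twin w"
  by auto

text \<open>The bound two excludes the vertices whose twin would be a leaf, since the edge of a hair
  can be neither contracted nor inserted.\<close>

definition beads :: "nat set \<Rightarrow> nat set" where
  "beads V = {v \<in> V. ncyc v \<and> 2 \<le> card (nset v)}"

text \<open>At each cycle vertex in \<open>S\<close> the edge to a child with the same labels is contracted if there is one;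
  otherwise such a child is inserted and takes over the children.\<close>

definition tog :: "nat set \<Rightarrow> nat set \<times> (nat \<Rightarrow> nat) \<Rightarrow> nat set \<times> (nat \<Rightarrow> nat)" where
  "tog S x = (let V = fst x; f = snd x; T = twin ` S; V' = (V - T) \<union> (T - V) in
     (V', \<lambda>v. if v \<notin> V' then v else if ncyc v then f v else if v \<in> T then twin v
        else if f v \<in> S \<union> T then twin (f v) else f v))"

context canon
begin

lemma leaf_path:
  "v \<in> V \<Longrightarrow> i \<in> nset v \<Longrightarrow> \<exists>k. (f ^^ k) (leaf i) = v \<and> (\<forall>j<k. \<not> ncyc ((f ^^ j) (leaf i)))"
proof (induction "2 * card (nset v) + of_bool (ncyc v)" arbitrary: v rule: less_induct)
  case less
  show ?case
  proof (cases "\<exists>j. v = leaf j")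
    case True
    then show ?thesis using less.prems by (intro exI[of _ 0]) auto
  next
    case False
    then have nl: "v \<noteq> leaf j" for j by blast
    obtain u where u: "u \<in> chl V f v" "i \<in> nset u" using nset_chl[OF less.prems(1) nl] less.prems(2) by blast
    have u': "u \<in> V" "\<not> ncyc u" "f u = v" using u by (auto simp: chl_def)
    have "card (nset u) \<le> card (nset v)"
      using nset_mono[OF u'(1,2)] u'(3) by (intro card_mono) auto
    moreover have "card (nset u) < card (nset v)" if "\<not> ncyc v"
      using nset_strict[OF u'(1,2)] u'(3) that by (intro psubset_card_mono) auto
    ultimately have "2 * card (nset u) + of_bool (ncyc u) < 2 * card (nset v) + of_bool (ncyc v)"
      using u'(2) by (cases "ncyc v") auto
    then obtain k where "(f ^^ k) (leaf i) = u" "\<forall>j<k. \<not> ncyc ((f ^^ j) (leaf i))"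
      using less.hyps u' u by blast
    then show ?thesis using u' by (intro exI[of _ "Suc k"]) (auto simp: less_Suc_eq)
  qed
qed

text \<open>The path of a common label passes through the twin and through \<open>s\<close>. Label
  sets grow along this path, strictly off the cycle, so nothing fits between two vertices with the
  same labels. Another child of \<open>s\<close> would need labels of its own, but the twin already
  has all of them.\<close>

lemma twin_child:
  assumes s: "s \<in> V" "ncyc s" and t: "twin s \<in> V"
  shows "f (twin s) = s" "chl V f s = {twin s}"
proof -
  obtain i where i: "i \<in> nset s" using nset_ne[OF s(1)] by blast
  obtain a where a: "(f ^^ a) (leaf i) = twin s" "\<forall>j<a. \<not> ncyc ((f ^^ j) (leaf i))"
    using leaf_path[OF t] i by auto
  obtain b where b: "(f ^^ b) (leaf i) = s" "\<forall>j<b. \<not> ncyc ((f ^^ j) (leaf i))"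
    using leaf_path[OF s(1) i] by blast
  have li: "leaf i \<in> V" using i nset_sub[OF s(1)] leaf_in by auto
  have "\<not> b < a" using a(2) b(1) s(2) by auto
  moreover have "a \<noteq> b" using a(1) b(1) s(2) by (metis twin_simps(2))
  ultimately have ab: "a < b" by simp
  have mono: "nset ((f ^^ j) (leaf i)) \<subseteq> nset s" if "j \<le> b" for j
    using that
  proof (induction "b - j" arbitrary: j)
    case 0
    then show ?case using b(1) by simp
  next
    case (Suc l)
    then have "j < b" by simp
    then have "nset ((f ^^ j) (leaf i)) \<subseteq> nset (f ((f ^^ j) (leaf i)))"
      using nset_mono[OF iter_in[OF li]] b(2) by blast
    moreover have "nset ((f ^^ Suc j) (leaf i)) \<subseteq> nset s" using Suc.hyps(1)[of "Suc j"] Suc.hyps(2) \<open>j < b\<close> by simp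
    ultimately show ?case by simp
  qed
  show fs: "f (twin s) = s"
  proof (cases "Suc a = b")
    case True
    then show ?thesis using a(1) b(1) by auto
  next
    case False
    then have "Suc a < b" using ab by simp
    then have "\<not> ncyc (f (twin s))" using b(2) a(1) by (metis comp_apply funpow.simps(2))
    then have "nset (twin s) \<subset> nset (f (twin s))" using nset_strict[OF t] s(2) by simp
    moreover have "nset (f (twin s)) \<subseteq> nset s" using mono[of "Suc a"] \<open>Suc a < b\<close> a(1) by simp
    ultimately show ?thesis by auto
  qed
  have tc: "twin s \<in> chl V f s" using t fs s(2) by (simp add: chl_def)
  have "w = twin s" if w: "w \<in> chl V f s" for w
  proof (rule ccontr)
    assume ne: "w \<noteq> twin s"
    have "nset w \<inter> nset (twin s) = {}" by (rule chl_disj[OF s(1) cyc_not_leaf[OF s(2)] w tc ne])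
    moreover have "nset w \<subseteq> nset s" using nset_chl[OF s(1) cyc_not_leaf[OF s(2)]] w by blast
    moreover have "nset w \<noteq> {}" using nset_ne w by (simp add: chl_def)
    ultimately show False by auto
  qed
  then show "chl V f s = {twin s}" using tc by blast
qed

text \<open>A single child would carry all the labels of \<open>s\<close> and hence be its
  twin.\<close>

lemma bead_children:
  assumes s: "s \<in> V" "ncyc s" and t: "twin s \<notin> V"
  shows "2 \<le> card (chl V f s)"
proof (rule ccontr)
  assume "\<not> 2 \<le> card (chl V f s)"
  moreover have "card (chl V f s) \<noteq> 0" using chl_C[of s] s by (simp add: C_def)
  ultimately have "card (chl V f s) = 1" by linarith
  then obtain u where u: "chl V f s = {u}" by (auto simp: card_1_singleton_iff)
  then have "nset s = nset u" using nset_chl[OF s(1) cyc_not_leaf[OF s(2)]] by simp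
  moreover have "u \<in> V" "\<not> ncyc u" using u by (auto simp: chl_def)
  ultimately have "u = twin s" using s(2) by (intro node_eqI) simp_all
  then show False using t \<open>u \<in> V\<close> by simp
qed

end

locale toggle = canon +
  fixes S :: "nat set"
  assumes S_sub: "S \<subseteq> beads V"
begin

definition T :: "nat set" where "T = twin ` S"
definition V' :: "nat set" where "V' = (V - T) \<union> (T - V)"
definition f' :: "nat \<Rightarrow> nat" where
  "f' v = (if v \<notin> V' then v else if ncyc v then f v else if v \<in> T then twin v
     else if f v \<in> S \<union> T then twin (f v) else f v)"

lemma tog_eq: "tog S (V, f) = (V', f')"
  by (simp add: tog_def Let_def V'_def f'_def T_def fun_eq_iff)

lemma S_D: "s \<in> S \<Longrightarrow> s \<in> V" "s \<in> S \<Longrightarrow> ncyc s" "s \<in> S \<Longrightarrow> 2 \<le> card (nset s)"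
  using S_sub by (auto simp: beads_def)

lemma T_D: "t \<in> T \<Longrightarrow> \<not> ncyc t" "t \<in> T \<Longrightarrow> twin t \<in> S" "t \<in> T \<Longrightarrow> t \<noteq> leaf i"
proof -
  assume "t \<in> T"
  then obtain s where s: "s \<in> S" "t = twin s" by (auto simp: T_def)
  show "\<not> ncyc t" "twin t \<in> S" using s S_D by auto
  show "t \<noteq> leaf i"
  proof
    assume "t = leaf i"
    then have "nset s = {i}" using s by (metis finite.emptyI finite.insertI nset_nd twin_simps(1))
    then show False using S_D(3)[OF s(1)] by simp
  qed
qed

lemma T_iff: "t \<in> T \<longleftrightarrow> twin t \<in> S"
  by (auto simp: T_def image_iff twin_eq_iff) (metis twin_simps(3))

lemma cyc_V': "ncyc v \<Longrightarrow> v \<in> V' \<longleftrightarrow> v \<in> V"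
  using T_D(1) by (auto simp: V'_def)

lemma f_T: "t \<in> T \<Longrightarrow> t \<in> V \<Longrightarrow> f t = twin t"
  using twin_child(1)[of "twin t"] S_D T_D by auto

text \<open>The twin sits between a bead and its subtrees: a removed twin leaves its children to the
  bead, and an inserted one is the only child that the bead retains.\<close>

lemma chl_V'_S:
  assumes "v \<in> S"
  shows "chl V' f' v = (if twin v \<in> V then chl V f (twin v) else {twin v})"
proof (cases "twin v \<in> V")
  case True
  have "u \<in> chl V' f' v \<longleftrightarrow> u \<in> chl V f (twin v)" for u
  proof
    assume u: "u \<in> chl V' f' v"
    then have u': "u \<in> V'" "\<not> ncyc u" "f' u = v" by (auto simp: chl_def)
    have "u \<notin> T"
    proof
      assume "u \<in> T"
      then have "u = twin v" using u' by (auto simp: f'_def)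
      then show False using True u' \<open>u \<in> T\<close> by (auto simp: V'_def)
    qed
    then have "u \<in> V" using u' by (auto simp: V'_def)
    moreover have "f u = twin v"
      using u' \<open>u \<notin> T\<close> assms by (auto simp: f'_def twin_eq_iff split: if_splits)
    ultimately show "u \<in> chl V f (twin v)" using u' by (simp add: chl_def)
  next
    assume u: "u \<in> chl V f (twin v)"
    then have u': "u \<in> V" "\<not> ncyc u" "f u = twin v" by (auto simp: chl_def)
    have "u \<notin> T"
    proof
      assume "u \<in> T"
      then have "twin u = twin v" using f_T u' by simp
      then have "u = v" by (metis twin_simps(3))
      then show False using u' S_D(2)[OF assms] by simp
    qed
    moreover have "twin v \<in> T" using assms by (simp add: T_def)
    ultimately show "u \<in> chl V' f' v" using u' by (simp add: chl_def f'_def V'_def)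
  qed
  then show ?thesis using True by auto
next
  case False
  have tT: "twin v \<in> T" using assms by (simp add: T_def)
  have "u = twin v" if u: "u \<in> chl V' f' v" for u
  proof -
    have u': "u \<in> V'" "\<not> ncyc u" "f' u = v" using u by (auto simp: chl_def)
    show ?thesis
    proof (cases "u \<in> T")
      case True
      then show ?thesis using u' by (auto simp: f'_def)
    next
      case nT: False
      then have uV: "u \<in> V" using u' by (auto simp: V'_def)
      have "f u \<in> S \<union> T" using u' nT assms by (auto simp: f'_def split: if_splits)
      then have "twin (f u) = v" using u' nT by (auto simp: f'_def)
      then have "f u = twin v" by auto
      then show ?thesis using f_in[OF uV] False by simp
    qed
  qed
  moreover have "twin v \<in> chl V' f' v"
    using False tT S_D(2)[OF assms] by (simp add: chl_def f'_def V'_def)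
  ultimately have "chl V' f' v = {twin v}" by blast
  then show ?thesis using False by simp
qed

lemma chl_V'_T:
  assumes "v \<in> T" "v \<notin> V"
  shows "chl V' f' v = chl V f (twin v)"
proof (intro antisym subsetI)
  fix u assume u: "u \<in> chl V' f' v"
  then have u': "u \<in> V'" "\<not> ncyc u" "f' u = v" by (auto simp: chl_def)
  have "u \<notin> T" using u' T_D[OF assms(1)] by (auto simp: f'_def)
  moreover from this have "u \<in> V" using u' by (auto simp: V'_def)
  moreover have "f u = twin v"
    using u' \<open>u \<notin> T\<close> assms by (auto simp: f'_def split: if_splits)
  ultimately show "u \<in> chl V f (twin v)" using u' by (simp add: chl_def)
next
  fix u assume u: "u \<in> chl V f (twin v)"
  then have u': "u \<in> V" "\<not> ncyc u" "f u = twin v" by (auto simp: chl_def)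
  have "u \<notin> T"
  proof
    assume "u \<in> T"
    then have "twin u = twin v" using f_T u' by simp
    then have "u = v" by (metis twin_simps(3))
    then show False using u' assms by simp
  qed
  then show "u \<in> chl V' f' v" using u' T_D(2)[OF assms(1)] by (simp add: chl_def f'_def V'_def)
qed

lemma chl_V'_other:
  assumes "v \<in> V" "v \<notin> S" "v \<notin> T"
  shows "chl V' f' v = chl V f v"
proof (intro antisym subsetI)
  fix u assume u: "u \<in> chl V' f' v"
  then have u': "u \<in> V'" "\<not> ncyc u" "f' u = v" by (auto simp: chl_def)
  have "u \<notin> T" using u' assms(2) T_D(2)[of u] by (auto simp: f'_def)
  moreover from this have "u \<in> V" using u' by (auto simp: V'_def)
  moreover have "f u \<notin> S \<union> T"
  proof
    assume w: "f u \<in> S \<union> T"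
    then have "v = twin (f u)" using u' \<open>u \<notin> T\<close> by (auto simp: f'_def)
    then have "v \<in> S \<union> T" using w T_D(2)[of "f u"] by (auto simp: T_def)
    then show False using assms by blast
  qed
  ultimately show "u \<in> chl V f v" using u' by (auto simp: chl_def f'_def)
next
  fix u assume u: "u \<in> chl V f v"
  then have u': "u \<in> V" "\<not> ncyc u" "f u = v" by (auto simp: chl_def)
  have "u \<notin> T" using f_T[of u] u' assms(2) T_D(2)[of u] by auto
  then show "u \<in> chl V' f' v" using u' assms by (simp add: chl_def f'_def V'_def)
qed

lemma canon_tog: "canon n V' f'"
proof
  have inV: "v \<in> V \<or> v \<in> T" if "v \<in> V'" for v using that by (auto simp: V'_def)
  have tn: "nset v \<noteq> {} \<and> nset v \<subseteq> {..<n}" if "v \<in> V'" for v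
  proof (cases "v \<in> V")
    case False
    then have "twin v \<in> V" using inV[OF that] T_D(2) S_D(1) by blast
    then show ?thesis using nset_ne[of "twin v"] nset_sub[of "twin v"] by simp
  qed (use nset_ne nset_sub in auto)
  then show "nset v \<noteq> {}" "nset v \<subseteq> {..<n}" if "v \<in> V'" for v using that by blast+
  show "leaf i \<in> V'" if "i < n" for i using leaf_in[OF that] T_D(3) by (auto simp: V'_def)
  show "f' v \<in> V'" if v: "v \<in> V'" for v
  proof (cases "ncyc v")
    case True
    then have "v \<in> V" using v cyc_V' by blast
    then show ?thesis using True v f_in f_cyc cyc_V' by (simp add: f'_def)
  next
    case nc: False
    show ?thesis
    proof (cases "v \<in> T")
      case True
      then have "f' v = twin v" "twin v \<in> S" using v nc T_D by (auto simp: f'_def)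
      then show ?thesis using S_D(1)[of "twin v"] cyc_V'[of "twin v"] nc by simp
    next
      case nT: False
      then have vV: "v \<in> V" using inV v by blast
      consider "f v \<in> S" | "f v \<in> T" | "f v \<notin> S \<union> T" by blast
      then show ?thesis
      proof cases
        case 1
        have "twin (f v) \<notin> V"
        proof
          assume "twin (f v) \<in> V"
          then have "chl V f (f v) = {twin (f v)}" using twin_child(2) S_D 1 by blast
          moreover have "v \<in> chl V f (f v)" using vV nc by (simp add: chl_def)
          ultimately have "v = twin (f v)" by simp
          then have "v \<in> T" using 1 unfolding T_def by (rule image_eqI)
          then show False using nT by blast
        qed
        moreover have "twin (f v) \<in> T" using 1 by (simp add: T_def)
        ultimately show ?thesis using 1 nc nT v by (simp add: f'_def V'_def)
      next
        case 2
        then have "twin (f v) \<in> V'" using T_D(2) S_D cyc_V' by blast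
        then show ?thesis using 2 nc nT v by (simp add: f'_def)
      next
        case 3
        then show ?thesis using nc nT v f_in[OF vV] by (simp add: f'_def V'_def)
      qed
    qed
  qed
  show "f' v = v" if "v \<notin> V'" for v using that by (simp add: f'_def)
  show fc: "ncyc (f' v)" if "v \<in> V'" "ncyc v" for v
    using that f_cyc cyc_V' by (simp add: f'_def)
  have it: "(f' ^^ k) v = (f ^^ k) v" if "v \<in> C" for k v
  proof (induction k)
    case (Suc k)
    have "(f ^^ k) v \<in> C" by (rule iter_C[OF that])
    then show ?case using Suc cyc_V' by (simp add: f'_def C_def)
  qed simp
  show "\<exists>k. (f' ^^ k) v = w" if "v \<in> V'" "w \<in> V'" "ncyc v" "ncyc w" for v w
  proof -
    have "v \<in> V" "w \<in> V" using that cyc_V' by auto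
    then show ?thesis using one_cycle[of v w] that it[of v] by (auto simp: C_def)
  qed
  show "f' v \<noteq> leaf i" if v: "v \<in> V'" for v i
  proof (cases "ncyc v")
    case True
    then show ?thesis using fc[OF v True] by auto
  next
    case nc: False
    show ?thesis
    proof (cases "v \<in> T")
      case True
      then have "f' v = twin v" using v nc by (simp add: f'_def)
      moreover have "ncyc (twin v)" using nc by simp
      ultimately show ?thesis using cyc_not_leaf[of "twin v" i] by simp
    next
      case nT: False
      then have vV: "v \<in> V" using inV v by blast
      have "twin (f v) \<noteq> leaf i" if "f v \<in> S \<union> T"
      proof (cases "f v \<in> S")
        case True
        then have "twin (f v) \<in> T" by (simp add: T_def)
        then show ?thesis by (rule T_D(3))
      next
        case False
        then have "ncyc (twin (f v))" using that T_D S_D by blast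
        then show ?thesis by (rule cyc_not_leaf)
      qed
      then show ?thesis using f_leaf[OF vV] nc nT v by (simp add: f'_def)
    qed
  qed
  fix v assume v: "v \<in> V'" "\<And>i. v \<noteq> leaf i"
  consider (S1) "v \<in> S" "twin v \<in> V" | (S2) "v \<in> S" "twin v \<notin> V" | (T) "v \<in> T" "v \<notin> V"
    | (other) "v \<in> V" "v \<notin> S" "v \<notin> T" using v(1) by (auto simp: V'_def)
  note cases = this
  have tl: "twin v \<noteq> leaf i" if "v \<in> S" for i
    using T_D(3)[of "twin v"] that by (simp add: T_def)
  show "nset v = (\<Union>u\<in>chl V' f' v. nset u)"
  proof (cases rule: cases)
    case S1
    then show ?thesis using nset_chl[of "twin v"] tl by (simp add: chl_V'_S)
  next
    case S2
    then show ?thesis by (simp add: chl_V'_S)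
  next
    case T
    have "twin v \<in> V" "\<And>i. twin v \<noteq> leaf i" using T T_D(2) S_D cyc_not_leaf by blast+
    then show ?thesis using nset_chl[of "twin v"] T by (simp add: chl_V'_T)
  next
    case other
    then show ?thesis using nset_chl v(2) by (simp add: chl_V'_other)
  qed
  show "nset u \<inter> nset w = {}" if uw: "u \<in> chl V' f' v" "w \<in> chl V' f' v" "u \<noteq> w" for u w
  proof (cases rule: cases)
    case S1
    then show ?thesis using chl_disj[of "twin v" u w] tl uw by (simp add: chl_V'_S)
  next
    case S2
    then show ?thesis using uw by (simp add: chl_V'_S)
  next
    case T
    have "twin v \<in> V" "\<And>i. twin v \<noteq> leaf i" using T T_D(2) S_D cyc_not_leaf by blast+
    then show ?thesis using chl_disj[of "twin v" u w] T uw by (simp add: chl_V'_T)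
  next
    case other
    then show ?thesis using chl_disj[of v u w] v(2) uw by (simp add: chl_V'_other)
  qed
  show "2 \<le> card (chl V' f' v)" if nc: "\<not> ncyc v"
  proof (cases rule: cases)
    case T
    \<comment> \<open>An inserted twin inherits the children of its bead. There are at least two of
      them because none carries all the labels, so the new vertex has the required valence.\<close>
    then have "twin v \<in> V" "ncyc (twin v)" "twin (twin v) \<notin> V"
      using T_D(1)[of v] T_D(2)[of v] S_D(1)[of "twin v"] by auto
    then show ?thesis using bead_children[of "twin v"] T by (simp add: chl_V'_T)
  next
    case other
    then show ?thesis using chl_two v(2) nc by (simp add: chl_V'_other)
  qed (use nc S_D in auto)
qed

lemma beads_tog: "beads V' = beads V"
  using cyc_V' by (auto simp: beads_def)

lemma cyc_tog: "cyc_nodes V' = cyc_nodes V"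
  using cyc_V' by (auto simp: cyc_nodes_def)

lemma f'_cyc: "v \<in> V \<Longrightarrow> ncyc v \<Longrightarrow> f' v = f v"
  using cyc_V' by (simp add: f'_def)

lemma tog_tog: "tog S (V', f') = (V, f)"
proof -
  interpret t: toggle n V' f' S
    using canon_tog S_sub beads_tog by (intro toggle.intro toggle_axioms.intro) auto
  have tV: "t.V' = V" unfolding t.V'_def by (auto simp: V'_def)
  have "t.f' v = f v" for v
  proof (cases "v \<in> V")
    case False
    then show ?thesis using f_out by (simp add: t.f'_def tV)
  next
    case v: True
    show ?thesis
    proof (cases "ncyc v")
      case True
      then show ?thesis using v f'_cyc by (simp add: t.f'_def tV)
    next
      case nc: False
      show ?thesis
      proof (cases "v \<in> T")
        case True
        then show ?thesis using v nc f_T by (simp add: t.f'_def tV)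
      next
        case nT: False
        then have v': "v \<in> V'" using v by (simp add: V'_def)
        have sw: "twin w \<in> S \<union> T \<longleftrightarrow> w \<in> S \<union> T" for w
          using T_iff[of w] T_iff[of "twin w"] by auto
        have tf: "t.f' v = (if f' v \<in> S \<union> T then twin (f' v) else f' v)"
          using v nc nT by (simp add: t.f'_def tV)
        show ?thesis
        proof (cases "f v \<in> S \<union> T")
          case True
          then have "f' v = twin (f v)" using v' nc nT by (simp add: f'_def)
          then show ?thesis unfolding tf using sw[of "f v"] True by simp
        next
          case False
          then have "f' v = f v" using v' nc nT by (simp add: f'_def)
          then show ?thesis unfolding tf using False by simp
        qed
      qed
    qed
  qed
  then show ?thesis unfolding t.tog_eq tV by auto
qed

end

lemma inv_into_cong:
  assumes "\<And>y. y \<in> A \<Longrightarrow> f y = g y"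
  shows "inv_into A f v = inv_into A g v"
  unfolding inv_into_def using assms by (intro arg_cong[where f = Eps]) auto

context toggle
begin

lemma crev_tog: "crev V' f' v = (if ncyc v then crev V f v else f' v)"
proof (cases "ncyc v \<and> v \<in> V")
  case True
  have "{v \<in> V'. ncyc v} = {v \<in> V. ncyc v}" using cyc_V' by auto
  moreover have "inv_into {v \<in> V. ncyc v} f' v = inv_into {v \<in> V. ncyc v} f v"
    by (rule inv_into_cong) (use f'_cyc in auto)
  ultimately show ?thesis using True cyc_V' by (simp add: crev_def)
next
  case False
  then show ?thesis using cyc_V' f_out by (auto simp: crev_def f'_def)
qed

text \<open>Toggling is expressed through label sets and flags and so commutes with relabelling when
  \<open>S\<close> is stable. It leaves the self-map on the cycle unchanged, so cycle reversal is
  not affected either.\<close>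

lemma cact_tog:
  assumes \<sigma>: "fst g permutes {..<n}" and fx: "cact g (V, f) = (V, f)" and S: "ren (fst g) ` S = S"
  shows "cact g (V', f') = (V', f')"
proof -
  let ?r = "ren (fst g)"
  note inj = inj_ren[OF \<sigma>]
  have rV: "?r ` V = V" using fx by (simp add: cact_def)
  have rT: "?r ` T = T"
  proof -
    have "?r ` T = twin ` ?r ` S" by (simp add: T_def image_image twin_ren)
    then show ?thesis by (simp add: S T_def)
  qed
  have mV: "?r v \<in> V \<longleftrightarrow> v \<in> V" and mT: "?r v \<in> T \<longleftrightarrow> v \<in> T" and mS: "?r v \<in> S \<longleftrightarrow> v \<in> S" for v
    using inj_image_mem_iff[OF inj, of v V] inj_image_mem_iff[OF inj, of v T]
      inj_image_mem_iff[OF inj, of v S] rV rT S by auto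
  have mV': "?r v \<in> V' \<longleftrightarrow> v \<in> V'" for v by (simp add: V'_def mV mT)
  have rV': "?r ` V' = V'"
  proof -
    have "?r ` V' = (?r ` V - ?r ` T) \<union> (?r ` T - ?r ` V)"
      by (simp add: V'_def image_Un image_set_diff[OF inj])
    then show ?thesis by (simp add: rV rT V'_def)
  qed
  define h where "h = (if snd g then crev V f else f)"
  have "?r \<circ> h \<circ> ren (inv (fst g)) = f"
    using arg_cong[OF fx, of snd] unfolding cact_def h_def fst_conv snd_conv .
  then have fh: "f (?r v) = ?r (h v)" for v using ren_inv(1)[OF \<sigma>] by (metis comp_apply)
  have hn: "h v = f v" if "\<not> ncyc v" for v using that by (simp add: h_def crev_def)
  define h' where "h' = (if snd g then crev V' f' else f')"
  have h'n: "h' v = f' v" if "\<not> ncyc v" for v using that by (simp add: h'_def crev_def)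
  have h'c: "h' v = h v" if "ncyc v" for v
  proof (cases "v \<in> V")
    case True
    then show ?thesis using that f'_cyc by (simp add: h'_def h_def crev_tog)
  next
    case False
    then show ?thesis using that cyc_V' f_out by (simp add: h'_def h_def crev_tog f'_def)
  qed
  have key: "f' (?r v) = ?r (h' v)" for v
  proof (cases "v \<in> V'")
    case False
    then have "h' v = v"
    proof (cases "ncyc v")
      case True
      then have "v \<notin> V" using False cyc_V' by simp
      then show ?thesis using h'c[OF True] f_out by (simp add: h_def crev_def)
    next
      case nc: False
      then show ?thesis using h'n False by (simp add: f'_def)
    qed
    then show ?thesis using False mV' by (simp add: f'_def)
  next
    case v': True
    show ?thesis
    proof (cases "ncyc v")
      case True
      then have "v \<in> V" using v' cyc_V' by simp
      then show ?thesis using True h'c fh f'_cyc[of "?r v"] mV by simp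
    next
      case nc: False
      show ?thesis using nc v' h'n fh hn mV' mT mS
        by (simp add: f'_def twin_ren)
    qed
  qed
  have "?r \<circ> h' \<circ> ren (inv (fst g)) = f'"
  proof
    fix v show "(?r \<circ> h' \<circ> ren (inv (fst g))) v = f' v"
      using key[of "ren (inv (fst g)) v"] ren_inv(2)[OF \<sigma>] by simp
  qed
  then show ?thesis unfolding cact_def fst_conv snd_conv rV' h'_def[symmetric] by (simp only:)
qed

end

context colored
begin

text \<open>Toggling the whole orbit of a bead keeps the graph fixed by \<open>g\<close>. The beads are the same after
  toggling, so the same orbit is chosen again and the map is an involution.\<close>

definition btog :: "(nat \<Rightarrow> nat) \<times> bool \<Rightarrow> nat set \<times> (nat \<Rightarrow> nat) \<Rightarrow> nat set \<times> (nat \<Rightarrow> nat)" where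
  "btog g x = tog (forb (ren (fst g)) (Min (beads (fst x)))) x"

lemma btog:
  assumes x: "x \<in> cstr n" and g: "g \<in> lgroup n col" and fx: "cact g x = x" and ne: "beads (fst x) \<noteq> {}"
  shows "btog g x \<in> cstr n" "cact g (btog g x) = btog g x" "beads (fst (btog g x)) = beads (fst x)"
    "btog g (btog g x) = x" "weight m d col g (btog g x) = - weight m d col g x"
proof -
  obtain V f where xe: "x = (V, f)" by force
  interpret canon n V f using x xe by (simp add: cstr_def)
  note \<sigma> = lgroupD(1)[OF g]
  let ?r = "ren (fst g)" and ?b = "Min (beads V)"
  define S where "S = forb ?r ?b"
  have finb: "finite (beads V)" by (simp add: beads_def)
  have bb: "?b \<in> beads V" using ne xe finb by simp
  have rV: "?r ` V = V" using ren_image_fixed[OF fx] xe by simp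
  have cr: "card (nset (?r v)) = card (nset v)" for v
    by (simp add: card_image inj_on_subset[OF permutes_inj[OF \<sigma>]])
  have rB: "?r ` beads V \<subseteq> beads V" using rV cr by (fastforce simp: beads_def)
  have injB: "inj_on ?r (beads V)" using inj_ren[OF \<sigma>] by (rule inj_on_subset) simp
  have bijB: "bij_betw ?r (beads V) (beads V)"
    using endo_inj_surj[OF finb rB injB] injB by (simp add: bij_betw_def)
  have S_sub: "S \<subseteq> beads V" unfolding S_def by (rule forb_subset[OF rB bb])
  have finS: "finite S" using S_sub finb by (rule finite_subset)
  have "?r ` S \<subseteq> S" using forb_step by (fastforce simp: S_def)
  then have rS: "?r ` S = S"
    by (rule endo_inj_surj[OF finS _ inj_on_subset[OF injB S_sub]])
  interpret t: toggle n V f S by unfold_locales (rule S_sub)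
  have te: "btog g x = (t.V', t.f')" 
    unfolding t.tog_eq[symmetric] by (simp add: btog_def xe S_def)
  have te': "btog g (V, f) = (t.V', t.f')" using te unfolding xe .
  show tx: "btog g x \<in> cstr n" using t.canon_tog by (simp add: te cstr_def)
  show tf: "cact g (btog g x) = btog g x" using t.cact_tog[OF \<sigma> _ rS] fx te' by (simp add: xe)
  show tb: "beads (fst (btog g x)) = beads (fst x)" by (simp add: te' xe t.beads_tog)
  show "btog g (btog g x) = x"
  proof -
    have "Min (beads (fst (btog g x))) = ?b" using tb by (simp add: xe)
    then have "btog g (btog g x) = tog S (btog g x)" by (simp add: btog_def[of g "btog g x"] S_def)
    then show ?thesis using t.tog_tog te' by (simp add: xe)
  qed
  have leafT: "t.T \<inter> leaf ` UNIV = {}" using t.T_D(3) by auto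
  have Tnc: "\<not> ncyc v" if "v \<in> t.T" for v using t.T_D(1)[OF that] .
  have In: "inner_nodes t.V' = (inner_nodes V - t.T) \<union> (t.T - V)"
    using leafT Tnc by (auto simp: inner_nodes_def t.V'_def)
  have Tin: "t.T \<inter> V \<subseteq> inner_nodes V" using leafT Tnc by (auto simp: inner_nodes_def)
  have rT: "?r ` t.T = t.T"
  proof -
    have "?r ` t.T = twin ` ?r ` S" by (simp add: t.T_def image_image twin_ren)
    then show ?thesis by (simp add: rS t.T_def)
  qed
  have T_orb: "t.T = forb ?r (twin ?b)"
  proof -
    have "t.T = twin ` S" by (rule t.T_def)
    also have "\<dots> = forb ?r (twin ?b)"
      unfolding S_def by (rule forb_image[OF rB _ bb, symmetric]) (simp add: twin_ren)
    finally show ?thesis .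
  qed
  have finT: "finite t.T" using finS by (simp add: t.T_def)
  \<comment> \<open>The twins form a single orbit, so the inner vertices gain or lose exactly one
    factor -1, however many twins there are.\<close>
  have onT: "orbprod (\<lambda>_. - 1 :: rat) ?r t.T = - 1"
  proof -
    have bijT: "bij_betw ?r t.T t.T"
      using rT inj_on_subset[OF inj_ren[OF \<sigma>]] by (auto simp: bij_betw_def)
    have tb: "twin ?b \<in> t.T" unfolding T_orb by (rule forb_self)
    have "forb ?r ` t.T = {t.T}"
      using forb_eq[OF finT bijT tb] forb_self[of "twin ?b" ?r] unfolding T_orb[symmetric] by blast
    then show ?thesis by (simp add: orbprod_def)
  qed
  have finI: "finite (inner_nodes V)" "finite (inner_nodes t.V')"
    using finT by (simp_all add: inner_nodes_def t.V'_def)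
  have rI: "?r ` inner_nodes W \<subseteq> inner_nodes W" if "?r ` W = W" for W
    using that ren_eq_leaf[OF \<sigma>] by (fastforce simp: inner_nodes_def)
  have rV': "?r ` t.V' = t.V'" using ren_image_fixed[OF tf] te' by (simp add: xe)
  have inner: "orbprod (\<lambda>_. - 1 :: rat) ?r (inner_nodes t.V') = - orbprod (\<lambda>_. - 1) ?r (inner_nodes V)"
  \<comment> \<open>As \<open>V\<close> is stable and the twins are one orbit, \<open>V\<close>
    contains all of them or none: the toggle is a simultaneous contraction or a simultaneous
    insertion.\<close>
  proof (cases "twin ?b \<in> V")
    case True
    have TV: "t.T \<subseteq> V" unfolding T_orb by (rule forb_subset[OF _ True]) (simp add: rV)
    then have "inner_nodes V = inner_nodes t.V' \<union> t.T" "inner_nodes t.V' \<inter> t.T = {}"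
      using In Tin by auto
    then have "orbprod (\<lambda>_. - 1 :: rat) ?r (inner_nodes V) = orbprod (\<lambda>_. - 1) ?r (inner_nodes t.V') *
        orbprod (\<lambda>_. - 1) ?r t.T"
      using orbprod_Un[OF finI(2) finT, of ?r "\<lambda>_. - 1 :: rat"] rI[OF rV'] rT by simp
    then show ?thesis using onT by simp
  next
    case False
    have "t.T \<inter> V = {}"
    proof -
      have "v \<notin> V" if v: "v \<in> t.T" for v
      proof
        assume "v \<in> V"
        then have "forb ?r v \<subseteq> V" using forb_subset[of ?r V v] rV by simp
        moreover have bijT: "bij_betw ?r t.T t.T"
          using rT inj_on_subset[OF inj_ren[OF \<sigma>]] by (auto simp: bij_betw_def)
        have "twin ?b \<in> t.T" unfolding T_orb by (rule forb_self)
        then have "forb ?r v = t.T" using forb_eq[OF finT bijT] v T_orb by blast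
        ultimately show False using False \<open>twin ?b \<in> t.T\<close> by blast
      qed
      then show ?thesis by blast
    qed
    then have "inner_nodes t.V' = inner_nodes V \<union> t.T" "inner_nodes V \<inter> t.T = {}"
      using In by (auto simp: inner_nodes_def)
    then have "orbprod (\<lambda>_. - 1 :: rat) ?r (inner_nodes t.V') = orbprod (\<lambda>_. - 1) ?r (inner_nodes V) *
        orbprod (\<lambda>_. - 1) ?r t.T"
      using orbprod_Un[OF finI(1) finT, of ?r "\<lambda>_. - 1 :: rat"] rI[OF rV] rT by simp
    then show ?thesis using onT by simp
  qed
  have amc: "amap g (t.V', t.f') v = amap g (V, f) v" if "v \<in> cyc_nodes V" for v
    using that t.f'_cyc by (simp add: amap_def cyc_nodes_def)
  have amC: "amap g (V, f) ` cyc_nodes V \<subseteq> cyc_nodes V"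
  proof -
    have "bij_betw (amap g (V, f)) V V" using bij_amap[OF x g] fx xe by simp
    then show ?thesis using f_cyc by (fastforce simp: bij_betw_def cyc_nodes_def amap_def)
  qed
  have "orbprod (\<lambda>_. psign (int d - 1)) (amap g (t.V', t.f')) (cyc_nodes V) =
      orbprod (\<lambda>_. psign (int d - 1)) (amap g (V, f)) (cyc_nodes V)"
    by (rule orbprod_cong[OF amC amc]) auto
  moreover have "aflip g (t.V', t.f') = aflip g (V, f)"
    using t.cyc_tog by (simp add: aflip_def cyc_nodes_def)
  ultimately have cyc: "cyc_weight d g (t.V', t.f') = cyc_weight d g (V, f)"
    unfolding cyc_weight_def fst_conv t.cyc_tog by simp
  show "weight m d col g (btog g x) = - weight m d col g x"
    unfolding weight_formula[OF tx g tf] weight_formula[OF x g fx]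
    using inner cyc by (simp add: te' xe)
qed

lemma weight_sum_hedgehogs:
  assumes g: "g \<in> lgroup n col"
  shows "(\<Sum>x\<in>{x \<in> cstr n. cact g x = x}. weight m d col g x) =
    (\<Sum>x\<in>{x \<in> cstr n. cact g x = x \<and> beads (fst x) = {}}. weight m d col g x)"
proof -
  let ?A = "{x \<in> cstr n. cact g x = x}" and ?B = "{x \<in> cstr n. cact g x = x \<and> beads (fst x) = {}}"
    and ?N = "{x \<in> cstr n. cact g x = x \<and> beads (fst x) \<noteq> {}}"
  have "(\<Sum>x\<in>?N. weight m d col g x) = (\<Sum>x\<in>?N. - weight m d col g x)"
    by (rule sum.reindex_bij_witness[where i = "btog g" and j = "btog g"]) (use btog[OF _ g] in auto)
  then have 0: "(\<Sum>x\<in>?N. weight m d col g x) = 0" by (simp add: sum_negf)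
  have "?A = ?B \<union> ?N" "?B \<inter> ?N = {}" by auto
  then have "(\<Sum>x\<in>?A. weight m d col g x) = (\<Sum>x\<in>?B. weight m d col g x) + (\<Sum>x\<in>?N. weight m d col g x)"
    using finite_cstr[of n] by (simp add: sum.union_disjoint)
  then show ?thesis using 0 by simp
qed

end

section \<open>Hedgehogs and the dihedral group\<close>

text \<open>The reflection \<open>i \<mapsto> j - i\<close> is written with \<open>n - i\<close> because subtraction is truncated.\<close>

definition dih :: "nat \<Rightarrow> nat \<Rightarrow> bool \<Rightarrow> nat \<Rightarrow> nat" where
  "dih n j b i = (if i < n then (if b then j + (n - i) else i + j) mod n else i)"

lemma dih_lt: "i < n \<Longrightarrow> dih n j b i < n"
  by (simp add: dih_def)

lemma dih_permutes: "dih n j b permutes {..<n}"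
proof (rule bij_imp_permutes)
  have inj: "inj_on (dih n j b) {..<n}"
  proof (rule inj_onI)
    fix i i' assume i: "i \<in> {..<n}" "i' \<in> {..<n}" "dih n j b i = dih n j b i'"
    show "i = i'"
    proof (cases b)
      case False
      then have "[i + j = i' + j] (mod n)" using i by (simp add: dih_def cong_def)
      then have "[i = i'] (mod n)" by (simp add: cong_add_rcancel_nat)
      then show ?thesis using i by (simp add: cong_def)
    next
      case True
      \<comment> \<open>\<open>n - i\<close> runs from 1 to \<open>n\<close>; lowering it by one
        gives residues below \<open>n\<close>, which congruence separates.\<close>
      obtain a a' where a: "n - i = Suc a" "n - i' = Suc a'"
        using i by (metis Suc_diff_Suc lessThan_iff)
      have "[j + Suc a = j + Suc a'] (mod n)" using i True a by (simp add: dih_def cong_def)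
      then have "[Suc a = Suc a'] (mod n)" by (simp only: cong_add_lcancel_nat)
      then have "[a + 1 = a' + 1] (mod n)" by simp
      then have "[a = a'] (mod n)" by (simp only: cong_add_rcancel_nat)
      moreover have "a < n" "a' < n" using a by linarith+
      ultimately have "a = a'" by (simp add: cong_def)
      then show ?thesis using a i by simp
    qed
  qed
  have "dih n j b ` {..<n} = {..<n}"
    by (rule endo_inj_surj[OF _ _ inj]) (auto simp: dih_lt)
  then show "bij_betw (dih n j b) {..<n} {..<n}" using inj by (simp add: bij_betw_def)
qed (simp add: dih_def)

abbreviation rot :: "nat \<Rightarrow> nat \<Rightarrow> nat" where "rot n \<equiv> dih n (Suc 0) False"

lemma rot_iter: "i < n \<Longrightarrow> (rot n ^^ k) i = (i + k) mod n"
  by (induction k) (auto simp: dih_def mod_Suc_eq)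

lemma dih_rot_False: "i < n \<Longrightarrow> dih n j False (rot n i) = rot n (dih n j False i)"
  by (simp add: dih_def mod_simps add.commute)

lemma dih_rot_True: "i < n \<Longrightarrow> rot n (dih n j True (rot n i)) = dih n j True i"
proof -
  assume i: "i < n"
  show ?thesis
  proof (cases "Suc i < n")
    case True
    then have "n - i = Suc (n - Suc i)" by simp
    then show ?thesis using True i by (simp add: dih_def mod_simps)
  next
    case False
    then have n: "n = Suc i" using i by simp
    show ?thesis unfolding n
      using mod_add_self2[of "Suc j" "Suc i"] by (simp add: dih_def mod_simps)
  qed
qed

text \<open>A permutation that commutes with the rotation, or turns it into its inverse, is
  determined by its value at 0, because each further value follows from the preceding one. These are
  the elements of the dihedral group.\<close>

lemma dih_unique:
  assumes n: "n > 0" and \<rho>: "\<rho> permutes {..<n}"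
    and comm: "\<And>i. i < n \<Longrightarrow> (if b then rot n (\<rho> (rot n i)) = \<rho> i else \<rho> (rot n i) = rot n (\<rho> i))"
  shows "\<rho> = dih n (\<rho> 0) b"
proof
  fix i
  have \<rho>lt: "\<rho> i < n" if "i < n" for i using permutes_in_image[OF \<rho>, of i] that by simp
  show "\<rho> i = dih n (\<rho> 0) b i"
  proof (cases "i < n")
    case False
    then show ?thesis using permutes_not_in[OF \<rho>, of i] by (simp add: dih_def)
  next
    case True
    then show ?thesis
    proof (induction i)
      case 0
      then show ?case using \<rho>lt[of 0] by (simp add: dih_def)
    next
      case (Suc i)
      then have i: "i < n" and r: "rot n i = Suc i" by (simp_all add: dih_def)
      have IH: "\<rho> i = dih n (\<rho> 0) b i" using Suc by simp
      show ?case
      proof (cases b)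
        case False
        then show ?thesis using comm[OF i] r IH dih_rot_False[OF i, of "\<rho> 0"] by simp
      next
        case True
        then have "rot n (\<rho> (Suc i)) = rot n (dih n (\<rho> 0) b (Suc i))"
          using comm[OF i] r IH dih_rot_True[OF i, of "\<rho> 0"] by simp
        then show ?thesis by (rule injD[OF permutes_inj[OF dih_permutes]])
      qed
    qed
  qed
qed

section \<open>Hedgehogs as cyclic orders of the labels\<close>

abbreviation cn :: "nat \<Rightarrow> nat" where "cn i \<equiv> nd {i} True"

lemma cn_eq_iff [simp]: "cn i = cn j \<longleftrightarrow> i = j"
  by (metis finite.emptyI finite.insertI nset_nd singleton_inject)

lemma cn_leaf [simp]: "cn i \<noteq> leaf j" "leaf j \<noteq> cn i"
  using ncyc_nd by metis+

text \<open>\<open>c\<close> is the successor permutation of the labels around the cycle. It has to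
  be a single \<open>n\<close>-cycle for the graph to be connected.\<close>

definition hed :: "nat \<Rightarrow> (nat \<Rightarrow> nat) \<Rightarrow> nat set \<times> (nat \<Rightarrow> nat)" where
  "hed n c = (leaf ` {..<n} \<union> cn ` {..<n},
     \<lambda>v. if v \<in> leaf ` {..<n} then nd (nset v) True
       else if v \<in> cn ` {..<n} then nd (c ` nset v) True else v)"

lemma snd_hed [simp]:
  "i < n \<Longrightarrow> snd (hed n c) (leaf i) = cn i" "i < n \<Longrightarrow> snd (hed n c) (cn i) = cn (c i)"
  "v \<notin> fst (hed n c) \<Longrightarrow> snd (hed n c) v = v"
  by (auto simp: hed_def)

lemma fst_hed: "fst (hed n c) = leaf ` {..<n} \<union> cn ` {..<n}"
  by (simp add: hed_def)

lemma hed_cases: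
  assumes "v \<in> fst (hed n c)"
  obtains i where "i < n" "v = leaf i" | i where "i < n" "v = cn i"
  using assms by (auto simp: hed_def)

lemma hed_eqI:
  assumes "fst x = leaf ` {..<n} \<union> cn ` {..<n}" "\<And>v. v \<notin> fst x \<Longrightarrow> snd x v = v"
    "\<And>i. i < n \<Longrightarrow> snd x (leaf i) = cn i" "\<And>i. i < n \<Longrightarrow> snd x (cn i) = cn (c i)"
  shows "x = hed n c"
proof (rule prod_eqI)
  show "fst x = fst (hed n c)" using assms(1) by (simp add: fst_hed)
  show "snd x = snd (hed n c)"
  proof
    fix v
    show "snd x v = snd (hed n c) v"
    proof (cases "v \<in> fst (hed n c)")
      case True
      then show ?thesis by (rule hed_cases) (simp_all add: assms)
    next
      case False
      then show ?thesis using assms(1,2) by (simp add: fst_hed)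
    qed
  qed
qed

text \<open>\<open>\<pi>\<close> writes the labels around the circle, and conjugating the rotation
  by it gives the corresponding \<open>n\<close>-cycle of labels.\<close>

definition cyc :: "nat \<Rightarrow> (nat \<Rightarrow> nat) \<Rightarrow> nat \<Rightarrow> nat" where
  "cyc n \<pi> = \<pi> \<circ> rot n \<circ> inv \<pi>"

lemma cyc_permutes: "\<pi> permutes {..<n} \<Longrightarrow> cyc n \<pi> permutes {..<n}"
  unfolding cyc_def by (intro permutes_compose permutes_inv dih_permutes)

lemma cyc_apply: "\<pi> permutes {..<n} \<Longrightarrow> cyc n \<pi> (\<pi> i) = \<pi> (rot n i)"
  by (simp add: cyc_def permutes_inverses)

lemma hed_canon:
  assumes "\<pi> permutes {..<n}"
  shows "hed n (cyc n \<pi>) \<in> cstr n" "beads (fst (hed n (cyc n \<pi>))) = {}"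
proof -
  let ?c = "cyc n \<pi>" and ?V = "fst (hed n (cyc n \<pi>))" and ?f = "snd (hed n (cyc n \<pi>))"
  note c = cyc_permutes[OF assms]
  have clt: "?c i < n" if "i < n" for i using permutes_in_image[OF c, of i] that by simp
  have ch: "chl ?V ?f (cn i) = {leaf i}" if "i < n" for i
    using that by (auto simp: chl_def fst_hed)
  have "canon n ?V ?f"
  proof
    show "nset v \<noteq> {}" "nset v \<subseteq> {..<n}" if "v \<in> ?V" for v using that by (auto elim: hed_cases)
    show "leaf i \<in> ?V" if "i < n" for i using that by (simp add: fst_hed)
    show "?f v \<in> ?V" if "v \<in> ?V" for v using that by (rule hed_cases) (use clt in \<open>auto simp: fst_hed\<close>)
    show "?f v = v" if "v \<notin> ?V" for v using that by simp
    show "ncyc (?f v)" if "v \<in> ?V" "ncyc v" for v using that(1) by (rule hed_cases) (use that in auto)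
    have it: "(?f ^^ k) (cn (\<pi> i)) = cn (\<pi> ((rot n ^^ k) i))" if i: "i < n" for i k
    proof (induction k)
      case (Suc k)
      have "(rot n ^^ k) i < n" using i by (simp add: rot_iter)
      then have "\<pi> ((rot n ^^ k) i) < n" using permutes_in_image[OF assms] by simp
      then show ?case using Suc by (simp add: cyc_apply[OF assms])
    qed simp
    show "\<exists>k. (?f ^^ k) v = w" if vw: "v \<in> ?V" "w \<in> ?V" "ncyc v" "ncyc w" for v w
    proof -
      obtain a b where ab: "v = cn a" "w = cn b" "a < n" "b < n"
        using vw by (auto simp: fst_hed)
      define i j where "i = inv \<pi> a" and "j = inv \<pi> b"
      have ij: "i < n" "j < n" "\<pi> i = a" "\<pi> j = b"
        using ab permutes_in_image[OF permutes_inv[OF assms]] by (simp_all add: i_def j_def permutes_inverses[OF assms])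
      \<comment> \<open>From position \<open>i\<close>, \<open>n - i\<close> steps lead around to
        position 0 and \<open>j\<close> more to position \<open>j\<close>; this avoids a subtraction
        that might truncate.\<close>
      have "(?f ^^ (n - i + j)) v = w" using it[OF ij(1)] ij ab by (simp add: rot_iter)
      then show ?thesis by blast
    qed
    show "?f v \<noteq> leaf i" if "v \<in> ?V" for v i using that by (rule hed_cases) auto
    fix v assume v: "v \<in> ?V" "\<And>i. v \<noteq> leaf i"
    then obtain i where i: "i < n" "v = cn i" by (auto elim: hed_cases)
    show "nset v = (\<Union>u\<in>chl ?V ?f v. nset u)" using i ch by simp
    show "nset u \<inter> nset w = {}" if "u \<in> chl ?V ?f v" "w \<in> chl ?V ?f v" "u \<noteq> w" for u w
      using that i ch by simp
    show "2 \<le> card (chl ?V ?f v)" if "\<not> ncyc v" using that i by simp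
  qed
  then show "hed n ?c \<in> cstr n" by (simp add: cstr_def)
  show "beads ?V = {}" by (auto simp: beads_def fst_hed)
qed

context canon
begin

lemma below_cycle: "v \<in> V \<Longrightarrow> \<exists>c\<in>C. nset v \<subseteq> nset c"
proof (induction "n - card (nset v)" arbitrary: v rule: less_induct)
  case less
  show ?case
  proof (cases "ncyc v")
    case True
    then show ?thesis using less.prems by (auto simp: C_def)
  next
    case nv: False
    note sub = nset_mono[OF less.prems nv]
    show ?thesis
    proof (cases "ncyc (f v)")
      case True
      then have "f v \<in> C" using less.prems f_in by (simp add: C_def)
      then show ?thesis using sub by blast
    next
      case False
      have "card (nset v) < card (nset (f v))"
        by (rule psubset_card_mono[OF _ nset_strict[OF less.prems nv False]]) simp
      moreover have "card (nset (f v)) \<le> n"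
        using card_mono[OF _ nset_sub[OF f_in[OF less.prems]]] by simp
      ultimately have "n - card (nset (f v)) < n - card (nset v)" by simp
      then show ?thesis using less.hyps[of "f v"] f_in[OF less.prems] sub by blast
    qed
  qed
qed

text \<open>Without beads each cycle vertex has a single label. The labels of any other vertex are
  contained in those of a cycle vertex, so only leaves are left.\<close>

lemma hedgehog_is_hed:
  assumes n: "n > 0" and nb: "beads V = {}"
  obtains \<pi> where "\<pi> permutes {..<n}" "(V, f) = hed n (cyc n \<pi>)"
proof -
  have cyc1: "\<exists>i<n. v = cn i" if v: "v \<in> C" for v
  proof -
    have "card (nset v) < 2" using nb v by (force simp: beads_def C_def)
    moreover have "card (nset v) \<noteq> 0" using nset_ne v by (simp add: C_def)
    ultimately have "card (nset v) = 1" by linarith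
    then obtain i where i: "nset v = {i}" by (auto simp: card_1_singleton_iff)
    then have "v = cn i" using v by (intro node_eqI) (simp_all add: C_def)
    moreover have "i < n" using nset_sub[of v] v i by (auto simp: C_def)
    ultimately show ?thesis by blast
  qed
  have cnC: "cn i \<in> C" if i: "i < n" for i
  proof -
    obtain c where c: "c \<in> C" "nset (leaf i) \<subseteq> nset c" using below_cycle[OF leaf_in[OF i]] by blast
    then obtain j where "c = cn j" using cyc1 by blast
    then show ?thesis using c by simp
  qed
  have C: "C = cn ` {..<n}" using cyc1 cnC by blast
  have nonc: "\<exists>i<n. v = leaf i" if v: "v \<in> V" "\<not> ncyc v" for v
  proof -
    obtain c where c: "c \<in> C" "nset v \<subseteq> nset c" using below_cycle[OF v(1)] by blast
    then obtain i where i: "i < n" "c = cn i" using cyc1 by blast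
    then have "nset v = {i}" using c nset_ne[OF v(1)] by auto
    then have "v = leaf i" using v by (intro node_eqI) simp_all
    then show ?thesis using i by blast
  qed
  have V: "V = leaf ` {..<n} \<union> cn ` {..<n}"
  proof
    show "V \<subseteq> leaf ` {..<n} \<union> cn ` {..<n}"
      using nonc cyc1 by (auto simp: C_def)
    show "leaf ` {..<n} \<union> cn ` {..<n} \<subseteq> V" using leaf_in cnC C_sub by auto
  qed
  have fleaf: "f (leaf i) = cn i" if i: "i < n" for i
  proof -
    obtain u where u: "u \<in> chl V f (cn i)" using chl_C[OF cnC[OF i]] by blast
    then have "u \<in> V" "\<not> ncyc u" "f u = cn i" by (auto simp: chl_def)
    moreover from this obtain j where j: "u = leaf j" using nonc by blast
    moreover have "nset u \<subseteq> nset (cn i)" using nset_mono[of u] calculation by simp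
    ultimately have "j = i" by simp
    then show ?thesis using j \<open>f u = cn i\<close> by simp
  qed
  let ?a = "cn 0"
  have a: "?a \<in> C" by (rule cnC[OF n])
  obtain k where k: "k > 0" "(f ^^ k) ?a = ?a" "inj_on (\<lambda>i. (f ^^ i) ?a) {..<k}"
    "forb f ?a = (\<lambda>i. (f ^^ i) ?a) ` {..<k}"
    by (rule forb_cyclic[OF finite_C bij_C a])
  have forbC: "forb f ?a = C"
  proof
    show "forb f ?a \<subseteq> C" using iter_C[OF a] by (auto simp: forb_def)
    show "C \<subseteq> forb f ?a"
    proof
      fix w assume "w \<in> C"
      then obtain l where "(f ^^ l) ?a = w" using one_cycle[of ?a w] a by (auto simp: C_def)
      then show "w \<in> forb f ?a" by (auto simp: forb_def)
    qed
  qed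
  have "card C = k" using card_image[OF k(3)] k(4) forbC by simp
  moreover have "card C = n" unfolding C by (subst card_image) (auto simp: inj_on_def)
  ultimately have kn: "k = n" by simp
  \<comment> \<open>The labels are read off while walking around the cycle from
    \<open>cn 0\<close>.\<close>
  define \<pi> where "\<pi> i = (if i < n then the_elem (nset ((f ^^ i) ?a)) else i)" for i
  have \<pi>: "cn (\<pi> i) = (f ^^ i) ?a \<and> \<pi> i < n" if i: "i < n" for i
  proof -
    obtain j where "j < n" "(f ^^ i) ?a = cn j" using cyc1[OF iter_C[OF a]] by blast
    then show ?thesis using i by (simp add: \<pi>_def)
  qed
  have inj: "inj_on \<pi> {..<n}"
  proof (rule inj_onI)
    fix i j assume ij: "i \<in> {..<n}" "j \<in> {..<n}" "\<pi> i = \<pi> j"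
    then have "(f ^^ i) ?a = (f ^^ j) ?a" using \<pi>[of i] \<pi>[of j] by simp
    then show "i = j" using inj_onD[OF k(3)] ij kn by blast
  qed
  have "\<pi> ` {..<n} = {..<n}" by (rule endo_inj_surj[OF _ _ inj]) (use \<pi> in auto)
  then have perm: "\<pi> permutes {..<n}"
    using inj by (intro bij_imp_permutes) (auto simp: bij_betw_def \<pi>_def)
  have step: "f (cn (\<pi> i)) = cn (\<pi> (rot n i))" if i: "i < n" for i
  proof (cases "Suc i < n")
    case True
    then have "cn (\<pi> (rot n i)) = (f ^^ Suc i) ?a" using \<pi>[of "Suc i"] i by (simp add: dih_def)
    then show ?thesis using \<pi>[OF i] by simp
  next
    case False
    then have "n = Suc i" using i by simp
    then have "cn (\<pi> (rot n i)) = ?a" "f (cn (\<pi> i)) = (f ^^ n) ?a"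
      using \<pi>[of 0] \<pi>[OF i] n by (simp_all add: dih_def)
    then show ?thesis using k(2) kn by simp
  qed
  have "(V, f) = hed n (cyc n \<pi>)"
  proof (rule hed_eqI)
    show "fst (V, f) = leaf ` {..<n} \<union> cn ` {..<n}" using V by simp
    show "snd (V, f) v = v" if "v \<notin> fst (V, f)" for v using that f_out by simp
    show "snd (V, f) (leaf i) = cn i" if "i < n" for i using fleaf[OF that] by simp
    show "snd (V, f) (cn i) = cn (cyc n \<pi> i)" if "i < n" for i
    proof -
      have "inv \<pi> i < n" using permutes_in_image[OF permutes_inv[OF perm], of i] that by simp
      then show ?thesis using step[of "inv \<pi> i"] permutes_inverses(1)[OF perm] by (simp add: cyc_def)
    qed
  qed
  then show thesis using that perm by blast
qed

end

lemma hed_inj: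
  assumes "c permutes {..<n}" "c' permutes {..<n}" "hed n c = hed n c'"
  shows "c = c'"
proof
  fix i
  show "c i = c' i"
  proof (cases "i < n")
    case True
    then have "cn (c i) = cn (c' i)" using assms(3) snd_hed(2) by metis
    then show ?thesis by simp
  next
    case False
    then show ?thesis using permutes_not_in[OF assms(1), of i] permutes_not_in[OF assms(2), of i] by simp
  qed
qed

lemma crev_hed:
  assumes c: "c permutes {..<n}" and i: "i < n"
  shows "crev (fst (hed n c)) (snd (hed n c)) (cn i) = cn (inv c i)"
proof -
  have C: "{v \<in> fst (hed n c). ncyc v} = cn ` {..<n}" by (auto simp: fst_hed)
  have inv: "inv c i < n" using permutes_in_image[OF permutes_inv[OF c], of i] i by simp
  have inj: "inj_on (snd (hed n c)) (cn ` {..<n})"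
    using permutes_inj[OF c] by (auto simp: inj_on_def dest: injD)
  have "inv_into (cn ` {..<n}) (snd (hed n c)) (snd (hed n c) (cn (inv c i))) = cn (inv c i)"
    by (rule inv_into_f_f[OF inj]) (use inv in simp)
  moreover have "snd (hed n c) (cn (inv c i)) = cn i" using inv permutes_inverses(1)[OF c] by simp
  moreover have "crev (fst (hed n c)) (snd (hed n c)) (cn i) = inv_into (cn ` {..<n}) (snd (hed n c)) (cn i)"
    unfolding crev_def C using i by (simp add: fst_hed)
  ultimately show ?thesis by simp
qed

lemma cact_hed:
  assumes g: "fst g permutes {..<n}" and c: "c permutes {..<n}"
  shows "cact g (hed n c) = hed n (fst g \<circ> (if snd g then inv c else c) \<circ> inv (fst g))"
proof (rule hed_eqI)
  let ?s = "fst g" and ?c = "if snd g then inv c else c"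
  let ?h = "if snd g then crev (fst (hed n c)) (snd (hed n c)) else snd (hed n c)"
  have s: "?s ` {..<n} = {..<n}" by (rule permutes_image[OF g])
  have sn: "snd (cact g (hed n c)) v = ren ?s (?h (ren (inv ?s) v))" for v by (simp add: cact_def)
  have il: "inv ?s i < n" if "i < n" for i using permutes_in_image[OF permutes_inv[OF g], of i] that by simp
  have rcn: "ren \<tau> (cn i) = cn (\<tau> i)" for \<tau> i by (simp add: ren_def)
  have "ren ?s ` (leaf ` {..<n} \<union> cn ` {..<n}) = leaf ` ?s ` {..<n} \<union> cn ` ?s ` {..<n}"
    by (simp add: image_Un image_image rcn)
  then show fst: "fst (cact g (hed n c)) = leaf ` {..<n} \<union> cn ` {..<n}"
    unfolding s by (simp add: cact_def fst_hed)
  show "snd (cact g (hed n c)) v = v" if v: "v \<notin> fst (cact g (hed n c))" for v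
  proof -
    have "ren (inv ?s) v \<notin> fst (hed n c)" using v ren_inv(2)[OF g] by (metis cact_def fst_conv imageI)
    then have "?h (ren (inv ?s) v) = ren (inv ?s) v" by (simp add: crev_def)
    then show ?thesis unfolding sn using ren_inv(2)[OF g] by simp
  qed
  show "snd (cact g (hed n c)) (leaf i) = cn i" if "i < n" for i
  proof -
    have "?h (leaf (inv ?s i)) = cn (inv ?s i)" using il[OF that] by (simp add: crev_def)
    then show ?thesis unfolding sn using permutes_inverses(1)[OF g] by (simp add: rcn)
  qed
  show "snd (cact g (hed n c)) (cn i) = cn ((?s \<circ> ?c \<circ> inv ?s) i)" if "i < n" for i
  proof -
    have "?h (cn (inv ?s i)) = cn (?c (inv ?s i))" using il[OF that] crev_hed[OF c] by simp
    then show ?thesis unfolding sn by (simp add: rcn)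
  qed
qed

text \<open>A hair, its edge and its cycle vertex are permuted alike and together contribute \<open>-(-1)\<^bsup>m\<^esup>\<close> for
  each orbit. The second product comes from the edges of the cycle, which a reflection shifts by one
  against the vertices, and the last factor from the reversal of these edges.\<close>

definition dweight :: "nat \<Rightarrow> (nat \<Rightarrow> nat) \<Rightarrow> nat \<Rightarrow> (nat \<Rightarrow> nat) \<Rightarrow> nat \<Rightarrow> bool \<Rightarrow> rat" where
  "dweight n m d \<kappa> j b = orbprod (\<lambda>C. - osign (\<lambda>i. int (m (\<kappa> i))) C) (dih n j b) {..<n} *
     orbprod (\<lambda>_. psign (int d - 1)) (dih n j b \<circ> (if b then rot n else id)) {..<n} *
     psign (int d * (of_bool b * int n))"

text \<open>Two labellings of the circle give the same \<open>n\<close>-cycle when they differ by an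
  element of the centralizer of the rotation, which consists of the \<open>n\<close>
  rotations.\<close>

lemma cyc_eq_iff:
  assumes n: "n > 0" and \<pi>: "\<pi> permutes {..<n}" and \<pi>': "\<pi>' permutes {..<n}"
  shows "cyc n \<pi>' = cyc n \<pi> \<longleftrightarrow> (\<exists>j<n. \<pi>' = \<pi> \<circ> dih n j False)"
proof
  assume eq: "cyc n \<pi>' = cyc n \<pi>"
  let ?r = "inv \<pi> \<circ> \<pi>'"
  have r: "?r permutes {..<n}" by (intro permutes_compose permutes_inv \<pi> \<pi>')
  have rr: "?r (rot n i) = rot n (?r i)" for i
  proof -
    have "\<pi>' (rot n i) = cyc n \<pi> (\<pi>' i)" using cyc_apply[OF \<pi>', of i] eq by simp
    then show ?thesis using permutes_inverses[OF \<pi>] by (simp add: cyc_def)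
  qed
  have "?r = dih n (?r 0) False"
    by (rule dih_unique[OF n r]) (simp only: if_False rr)
  moreover have "?r 0 < n" using permutes_in_image[OF r, of 0] n by simp
  moreover have "\<pi>' = \<pi> \<circ> ?r" using permutes_inverses[OF \<pi>] by (simp add: fun_eq_iff)
  ultimately show "\<exists>j<n. \<pi>' = \<pi> \<circ> dih n j False" by metis
next
  assume "\<exists>j<n. \<pi>' = \<pi> \<circ> dih n j False"
  then obtain j where j: "\<pi>' = \<pi> \<circ> dih n j False" by blast
  have surj: "\<exists>i. k = \<pi>' i" for k using permutes_inverses(1)[OF \<pi>'] by metis
  show "cyc n \<pi>' = cyc n \<pi>"
  proof
    fix k
    obtain i where i: "k = \<pi>' i" using surj by blast
    have "dih n j False (rot n i) = rot n (dih n j False i)"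
      by (cases "i < n") (simp add: dih_rot_False, simp add: dih_def)
    then show "cyc n \<pi>' k = cyc n \<pi> k"
      unfolding i cyc_apply[OF \<pi>'] using cyc_apply[OF \<pi>, of "dih n j False i"] j by simp
  qed
qed

lemma all_less_permutes:
  assumes "\<tau> permutes {..<n::nat}"
  shows "(\<forall>k<n. P k) \<longleftrightarrow> (\<forall>i<n. P (\<tau> i))"
proof (intro iffI allI impI)
  show "P (\<tau> i)" if "\<forall>k<n. P k" "i < n" for i
    using that permutes_in_image[OF assms, of i] by simp
  show "P k" if "\<forall>i<n. P (\<tau> i)" "k < n" for k
  proof -
    have "inv \<tau> k < n" using permutes_in_image[OF permutes_inv[OF assms], of k] that(2) by simp
    then have "P (\<tau> (inv \<tau> k))" using that(1) by blast
    then show ?thesis using permutes_inverses(1)[OF assms] by simp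
  qed
qed

context colored
begin

lemma weight_hed:
  assumes \<pi>: "\<pi> permutes {..<n}" and g: "g = (\<pi> \<circ> dih n j b \<circ> inv \<pi>, b)" "g \<in> lgroup n col"
    and fx: "cact g (hed n (cyc n \<pi>)) = hed n (cyc n \<pi>)"
  shows "weight m d col g (hed n (cyc n \<pi>)) = dweight n m d (col \<circ> \<pi>) j b"
proof -
  let ?x = "hed n (cyc n \<pi>)" and ?s = "\<pi> \<circ> dih n j b \<circ> inv \<pi>"
  have inner: "inner_nodes (fst ?x) = {}" by (auto simp: inner_nodes_def fst_hed)
  have cycn: "cyc_nodes (fst ?x) = (cn \<circ> \<pi>) ` {..<n}"
    unfolding image_comp[symmetric] permutes_image[OF \<pi>] by (auto simp: cyc_nodes_def fst_hed)
  have \<pi>lt: "\<pi> i < n" if "i < n" for i using permutes_in_image[OF \<pi>, of i] that by simp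
  have s\<pi>: "?s (\<pi> i) = \<pi> (dih n j b i)" for i using permutes_inverses[OF \<pi>] by simp
  have inj: "inj_on (cn \<circ> \<pi>) {..<n}" using permutes_inj[OF \<pi>] by (auto simp: inj_on_def dest: injD)
  have dim: "dih n j b ` {..<n} \<subseteq> {..<n}" using dih_lt by auto
  have lw: "leaf_weight n m d col ?s =
      orbprod (\<lambda>C. osign (\<lambda>i. int (m ((col \<circ> \<pi>) i))) C * psign (int d - 1)) (dih n j b) {..<n}"
  proof -
    have "orbprod (\<lambda>C. osign (\<lambda>i. int (m (col i))) C * psign (int d - 1)) ?s (\<pi> ` {..<n}) =
        orbprod (\<lambda>C. osign (\<lambda>i. int (m (col i))) (\<pi> ` C) * psign (int d - 1)) (dih n j b) {..<n}"
      by (rule orbprod_image[OF dim]) (use s\<pi> inj_on_subset[OF permutes_inj[OF \<pi>]] in auto)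
    then show ?thesis
      unfolding leaf_weight_def permutes_image[OF \<pi>] by (simp add: osign_def)
  qed
  have rcn: "ren ?s (cn (\<pi> i)) = cn (\<pi> (dih n j b i))" for i
    using s\<pi>[of i] by (simp add: ren_def)
  have c1: "orbprod (\<lambda>_. psign (int d)) (ren ?s) (cyc_nodes (fst ?x)) =
      orbprod (\<lambda>_. psign (int d)) (dih n j b) {..<n}"
    unfolding cycn by (rule orbprod_image[OF dim _ inj]) (use rcn in simp)
  let ?t = "dih n j b \<circ> (if b then rot n else id)"
  have tim: "?t ` {..<n} \<subseteq> {..<n}" using dih_lt by auto
  have am: "amap g ?x ((cn \<circ> \<pi>) i) = (cn \<circ> \<pi>) (?t i)" if i: "i < n" for i
    using rcn \<pi>lt[OF i] by (cases b) (simp_all add: amap_def g cyc_apply[OF \<pi>])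
  have c2: "orbprod (\<lambda>_. psign (int d - 1)) (amap g ?x) (cyc_nodes (fst ?x)) =
      orbprod (\<lambda>_. psign (int d - 1)) ?t {..<n}"
    unfolding cycn by (rule orbprod_image[OF tim _ inj]) (use am in simp)
  have c3: "int (card (aflip g ?x)) = of_bool b * int n"
    using card_image[OF inj] cycn by (simp add: aflip_def g cyc_nodes_def)
  have "weight m d col g ?x = leaf_weight n m d col ?s * cyc_weight d g ?x"
    using weight_formula[OF hed_canon(1)[OF \<pi>] g(2) fx, of m d] inner g(1)
    by (simp add: orbprod_def)
  also have "\<dots> = (leaf_weight n m d col ?s * orbprod (\<lambda>_. psign (int d)) (dih n j b) {..<n}) *
      orbprod (\<lambda>_. psign (int d - 1)) ?t {..<n} * psign (int d * (of_bool b * int n))"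
    unfolding cyc_weight_def c2 c3 using c1 g(1) by (simp add: mult.assoc)
  also have "leaf_weight n m d col ?s * orbprod (\<lambda>_. psign (int d)) (dih n j b) {..<n} =
      orbprod (\<lambda>C. - osign (\<lambda>i. int (m ((col \<circ> \<pi>) i))) C) (dih n j b) {..<n}"
  proof -
    have "psign (int d - 1) * psign (int d) = - 1" by (auto simp: psign_def)
    then show ?thesis unfolding lw orbprod_mult by (simp add: mult.assoc)
  qed
  finally show ?thesis unfolding dweight_def .
qed

text \<open>Transported to positions by \<open>\<pi>\<close>, an element fixing the hedgehog becomes
  a dihedral permutation, and preservation of colours becomes invariance of the word
  \<open>col \<circ> \<pi>\<close>. Pairs \<open>(j, b)\<close> are summed and not permutations: for
  \<open>n\<close> at most 2 a reflection coincides with a rotation as a permutation, but the two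
  are different elements of the group and carry different signs in general.\<close>

lemma fixed_hed_sum:
  assumes \<pi>: "\<pi> permutes {..<n}"
  shows "(\<Sum>g\<in>{g \<in> lgroup n col. cact g (hed n (cyc n \<pi>)) = hed n (cyc n \<pi>)}.
      weight m d col g (hed n (cyc n \<pi>))) =
    (\<Sum>(j, b)\<in>{(j, b). j < n \<and> (\<forall>i<n. (col \<circ> \<pi>) (dih n j b i) = (col \<circ> \<pi>) i)}.
      dweight n m d (col \<circ> \<pi>) j b)"
proof -
  let ?x = "hed n (cyc n \<pi>)"
  let ?A = "{g \<in> lgroup n col. cact g ?x = ?x}"
  let ?B = "{(j, b). j < n \<and> (\<forall>i<n. (col \<circ> \<pi>) (dih n j b i) = (col \<circ> \<pi>) i)}"
  let ?i = "\<lambda>(j, b). (\<pi> \<circ> dih n j b \<circ> inv \<pi>, b)"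
  let ?j = "\<lambda>g. (inv \<pi> (fst g (\<pi> 0)), snd g)"
  note c = cyc_permutes[OF \<pi>]
  have inv1: "inv \<pi> (\<pi> i) = i" and inv2: "\<pi> (inv \<pi> i) = i" for i using permutes_inverses[OF \<pi>] by auto
  have \<pi>lt: "\<pi> i < n \<longleftrightarrow> i < n" and ilt: "inv \<pi> i < n \<longleftrightarrow> i < n" for i
    using permutes_in_image[OF \<pi>, of i] permutes_in_image[OF permutes_inv[OF \<pi>], of i] by simp_all
  have conj: "cact g ?x = ?x \<longleftrightarrow>
      (\<forall>i<n. if snd g then rot n (\<rho> (rot n i)) = \<rho> i else \<rho> (rot n i) = rot n (\<rho> i))"
    if g: "fst g permutes {..<n}" "\<rho> = inv \<pi> \<circ> fst g \<circ> \<pi>" for g \<rho>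
  proof -
    let ?c = "cyc n \<pi>" and ?d = "if snd g then inv (cyc n \<pi>) else cyc n \<pi>"
    have d: "?d permutes {..<n}" by (cases "snd g") (simp_all add: c permutes_inv[OF c])
    have gd: "fst g \<circ> ?d \<circ> inv (fst g) permutes {..<n}"
      by (intro permutes_compose permutes_inv d g(1))
    have gp: "fst g (\<pi> i) = \<pi> (\<rho> i)" for i by (simp add: g(2) inv2)
    have rl: "\<rho> i < n" if "i < n" for i
      using that permutes_in_image[OF g(1), of "\<pi> i"] \<pi>lt ilt by (simp add: g(2))
    have "cact g ?x = ?x \<longleftrightarrow> fst g \<circ> ?d \<circ> inv (fst g) = ?c"
      unfolding cact_hed[OF g(1) c] using hed_inj[OF gd c] by auto
    also have "\<dots> \<longleftrightarrow> (\<forall>k. fst g (?d k) = ?c (fst g k))"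
    proof
      assume "fst g \<circ> ?d \<circ> inv (fst g) = ?c"
      then show "\<forall>k. fst g (?d k) = ?c (fst g k)"
        using permutes_inverses(2)[OF g(1)] by (metis comp_apply)
    next
      assume "\<forall>k. fst g (?d k) = ?c (fst g k)"
      then show "fst g \<circ> ?d \<circ> inv (fst g) = ?c"
        using permutes_inverses(1)[OF g(1)] by (simp add: fun_eq_iff)
    qed
    also have "\<dots> \<longleftrightarrow> (\<forall>k<n. fst g (?d k) = ?c (fst g k))"
    proof -
      have "fst g (?d k) = ?c (fst g k)" if "\<not> k < n" for k
      proof -
        have "?d k = k" "?c k = k" "fst g k = k"
          using that permutes_not_in[OF d, of k] permutes_not_in[OF c, of k] permutes_not_in[OF g(1), of k]
          by simp_all
        then show ?thesis by simp
      qed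
      then show ?thesis by blast
    qed
    also have "\<dots> \<longleftrightarrow> (\<forall>i<n. if snd g then rot n (\<rho> (rot n i)) = \<rho> i else \<rho> (rot n i) = rot n (\<rho> i))"
    proof (cases "snd g")
      case False
      have "fst g (?c (\<pi> i)) = ?c (fst g (\<pi> i)) \<longleftrightarrow> \<rho> (rot n i) = rot n (\<rho> i)" for i
        unfolding cyc_apply[OF \<pi>] gp using inj_eq[OF permutes_inj[OF \<pi>]] by simp
      then show ?thesis
        unfolding all_less_permutes[OF \<pi>, of "\<lambda>k. fst g (?d k) = ?c (fst g k)"] using False by simp
    next
      case True
      \<comment> \<open>For a reversal the condition is tested at \<open>?c (\<pi> i)\<close>, where
        the inverse of \<open>?c\<close> cancels.\<close>
      have "fst g (inv ?c (?c (\<pi> i))) = ?c (fst g (?c (\<pi> i))) \<longleftrightarrow> rot n (\<rho> (rot n i)) = \<rho> i" for i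
      proof -
        have "?c (fst g (?c (\<pi> i))) = \<pi> (rot n (\<rho> (rot n i)))"
          unfolding cyc_apply[OF \<pi>] gp ..
        then show ?thesis
          using gp inj_eq[OF permutes_inj[OF \<pi>]] permutes_inverses(2)[OF c] by auto
      qed
      then show ?thesis
        unfolding all_less_permutes[OF permutes_compose[OF \<pi> c], of "\<lambda>k. fst g (?d k) = ?c (fst g k)"]
        using True by simp
    qed
    finally show ?thesis .
  qed
  have inA: "?i (j, b) \<in> ?A" if B: "(j, b) \<in> ?B" for j b
  proof -
    let ?s = "\<pi> \<circ> dih n j b \<circ> inv \<pi>"
    have s: "?s permutes {..<n}" by (intro permutes_compose permutes_inv dih_permutes \<pi>)
    have "col (?s i) = col i" if i: "i < n" for i
    proof -
      have "col (\<pi> (dih n j b (inv \<pi> i))) = col (\<pi> (inv \<pi> i))" using B i by (simp add: ilt)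
      then show ?thesis by (simp add: inv2)
    qed
    then have G: "(?s, b) \<in> lgroup n col" using s by (simp add: lgroup_def)
    have "dih n j b = inv \<pi> \<circ> ?s \<circ> \<pi>" by (simp add: fun_eq_iff inv1)
    then have "cact (?s, b) ?x = ?x"
      using conj[of "(?s, b)" "dih n j b"] s dih_rot_False dih_rot_True by simp
    then show ?thesis using G by simp
  qed
  show ?thesis
  proof (rule sum.reindex_bij_witness[where i = ?i and j = ?j])
    fix g assume A: "g \<in> ?A"
    then have g: "fst g permutes {..<n}" and gc: "\<And>i. i < n \<Longrightarrow> col (fst g i) = col i" and fx: "cact g ?x = ?x"
      using lgroupD[of g n col] by auto
    let ?r = "inv \<pi> \<circ> fst g \<circ> \<pi>"
    have r: "?r permutes {..<n}" by (intro permutes_compose permutes_inv \<pi> g)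
    have "?r = dih n (?r 0) (snd g)"
      by (rule dih_unique[OF n_pos r]) (use conj[OF g refl] fx in blast)
    then have dr: "dih n (inv \<pi> (fst g (\<pi> 0))) (snd g) = ?r" by simp
    have "\<pi> \<circ> ?r \<circ> inv \<pi> = fst g" by (simp add: fun_eq_iff inv2)
    then show ig: "?i (?j g) = g" using dr by (simp add: prod_eq_iff)
    have "inv \<pi> (fst g (\<pi> 0)) < n" using permutes_in_image[OF r, of 0] n_pos by simp
    moreover have "(col \<circ> \<pi>) (?r i) = (col \<circ> \<pi>) i" if "i < n" for i
      using gc[of "\<pi> i"] \<pi>lt that by (simp add: inv2)
    ultimately show "?j g \<in> ?B" using dr by simp
    show "(case ?j g of (j, b) \<Rightarrow> dweight n m d (col \<circ> \<pi>) j b) = weight m d col g ?x"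
    proof -
      have "g = (\<pi> \<circ> dih n (inv \<pi> (fst g (\<pi> 0))) (snd g) \<circ> inv \<pi>, snd g)" using ig by simp
      then have "weight m d col g ?x = dweight n m d (col \<circ> \<pi>) (inv \<pi> (fst g (\<pi> 0))) (snd g)"
        by (rule weight_hed[OF \<pi> _ _ fx]) (use A in blast)
      then show ?thesis by simp
    qed
  next
    fix p assume p: "p \<in> ?B"
    obtain j b where jb: "p = (j, b)" by force
    show "?i p \<in> ?A" using inA p jb by simp
    show "?j (?i p) = p" using p n_pos by (simp add: jb inv1 dih_def)
  qed
qed

text \<open>Exchanging the two sums leaves, for each hedgehog, a sum over its stabilizer. Every
  hedgehog comes from exactly \<open>n\<close> permutations, one for each starting point on the
  cycle, whence the division by \<open>n\<close>.\<close>

lemma hed_sum: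
  "(\<Sum>g\<in>lgroup n col. \<Sum>x\<in>{x \<in> cstr n. cact g x = x \<and> beads (fst x) = {}}. weight m d col g x) =
   (\<Sum>\<pi>\<in>{\<pi>. \<pi> permutes {..<n}}.
     \<Sum>(j, b)\<in>{(j, b). j < n \<and> (\<forall>i<n. (col \<circ> \<pi>) (dih n j b i) = (col \<circ> \<pi>) i)}.
       dweight n m d (col \<circ> \<pi>) j b) / of_nat n"
proof -
  let ?H = "{x \<in> cstr n. beads (fst x) = {}}" and ?P = "{\<pi>. \<pi> permutes {..<n}}"
  let ?h = "\<lambda>\<pi>. hed n (cyc n \<pi>)"
  define F where "F x = (\<Sum>g\<in>{g \<in> lgroup n col. cact g x = x}. weight m d col g x)" for x
  have finP: "finite ?P" by (rule finite_permutations) simp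
  have finH: "finite ?H" using finite_cstr by simp
  have img: "?h ` ?P = ?H"
  proof (intro antisym subsetI)
    fix x assume "x \<in> ?h ` ?P"
    then show "x \<in> ?H" using hed_canon by auto
  next
    fix x assume x: "x \<in> ?H"
    interpret canon n "fst x" "snd x" using x by (simp add: cstr_def)
    obtain \<pi> where "\<pi> permutes {..<n}" "(fst x, snd x) = ?h \<pi>"
      using hedgehog_is_hed[OF n_pos] x by blast
    then show "x \<in> ?h ` ?P" by auto
  qed
  have fib: "card {\<pi>' \<in> ?P. ?h \<pi>' = ?h \<pi>} = n" if \<pi>: "\<pi> \<in> ?P" for \<pi>
  proof -
    have p: "\<pi> permutes {..<n}" using \<pi> by simp
    have "{\<pi>' \<in> ?P. ?h \<pi>' = ?h \<pi>} = {\<pi>' \<in> ?P. cyc n \<pi>' = cyc n \<pi>}"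
      using hed_inj[OF cyc_permutes cyc_permutes[OF p]] by auto
    also have "\<dots> = (\<lambda>j. \<pi> \<circ> dih n j False) ` {..<n}"
    proof -
      have "\<pi> \<circ> dih n j False \<in> ?P" for j using permutes_compose[OF dih_permutes p] by simp
      then show ?thesis using cyc_eq_iff[OF n_pos p] by auto
    qed
    also have "card \<dots> = n"
    proof (subst card_image)
      show "inj_on (\<lambda>j. \<pi> \<circ> dih n j False) {..<n}"
      proof (rule inj_onI)
        fix j j' assume j: "j \<in> {..<n}" "j' \<in> {..<n}" "\<pi> \<circ> dih n j False = \<pi> \<circ> dih n j' False"
        then have "\<pi> (dih n j False 0) = \<pi> (dih n j' False 0)" by (metis comp_apply)
        then have "dih n j False 0 = dih n j' False 0" using injD[OF permutes_inj[OF p]] by blast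
        then show "j = j'" using j n_pos by (simp add: dih_def)
      qed
    qed simp
    finally show ?thesis .
  qed
  have "(\<Sum>g\<in>lgroup n col. \<Sum>x\<in>{x \<in> cstr n. cact g x = x \<and> beads (fst x) = {}}. weight m d col g x) =
      (\<Sum>g\<in>lgroup n col. \<Sum>x\<in>?H. if cact g x = x then weight m d col g x else 0)"
    using finH by (intro sum.cong[OF refl]) (auto simp: sum.inter_filter[symmetric] intro!: sum.cong)
  also have "\<dots> = (\<Sum>x\<in>?H. \<Sum>g\<in>lgroup n col. if cact g x = x then weight m d col g x else 0)"
    by (rule sum.swap)
  also have "\<dots> = (\<Sum>x\<in>?H. F x)"
    unfolding F_def using finite_lgroup by (simp add: sum.inter_filter)
  finally have 1: "(\<Sum>g\<in>lgroup n col. \<Sum>x\<in>{x \<in> cstr n. cact g x = x \<and> beads (fst x) = {}}. weight m d col g x) =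
      (\<Sum>x\<in>?H. F x)" .
  have "(\<Sum>\<pi>\<in>?P. F (?h \<pi>)) = (\<Sum>x\<in>?h ` ?P. \<Sum>\<pi>\<in>{\<pi> \<in> ?P. ?h \<pi> = x}. F (?h \<pi>))"
    by (rule sum.image_gen[OF finP])
  also have "\<dots> = (\<Sum>x\<in>?h ` ?P. of_nat n * F x)"
  proof (rule sum.cong[OF refl])
    fix x assume "x \<in> ?h ` ?P"
    then obtain \<pi> where \<pi>: "\<pi> \<in> ?P" "x = ?h \<pi>" by blast
    have "(\<Sum>\<pi>\<in>{\<pi> \<in> ?P. ?h \<pi> = x}. F (?h \<pi>)) = (\<Sum>\<pi>\<in>{\<pi> \<in> ?P. ?h \<pi> = x}. F x)"
      by (rule sum.cong) auto
    then show "(\<Sum>\<pi>\<in>{\<pi> \<in> ?P. ?h \<pi> = x}. F (?h \<pi>)) = of_nat n * F x"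
      using fib[OF \<pi>(1)] \<pi>(2) by simp
  qed
  also have "\<dots> = of_nat n * (\<Sum>x\<in>?H. F x)" unfolding img by (simp add: sum_distrib_left)
  finally have "(\<Sum>x\<in>?H. F x) = (\<Sum>\<pi>\<in>?P. F (?h \<pi>)) / of_nat n" using n_pos by simp
  moreover have "(\<Sum>\<pi>\<in>?P. F (?h \<pi>)) = (\<Sum>\<pi>\<in>?P.
     \<Sum>(j, b)\<in>{(j, b). j < n \<and> (\<forall>i<n. (col \<circ> \<pi>) (dih n j b i) = (col \<circ> \<pi>) i)}.
       dweight n m d (col \<circ> \<pi>) j b)"
    unfolding F_def by (rule sum.cong) (use fixed_hed_sum in auto)
  ultimately show ?thesis unfolding 1 by simp
qed

end

section \<open>The Euler characteristic as a sum over coloured words\<close>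

text \<open>Extensional functions are used so that each word of length \<open>n\<close> is counted
  once.\<close>

definition words :: "nat \<Rightarrow> nat \<Rightarrow> (nat \<Rightarrow> nat) \<Rightarrow> (nat \<Rightarrow> nat) set" where
  "words n r s = {\<kappa> \<in> {..<n} \<rightarrow>\<^sub>E {1..r}. \<forall>i. card {a \<in> {..<n}. \<kappa> a = i} = s i}"

lemma finite_words: "finite (words n r s)"
  by (rule finite_subset[of _ "{..<n} \<rightarrow>\<^sub>E {1..r}"]) (auto simp: words_def intro: finite_PiE)

lemma dweight_cong:
  assumes "\<And>i. i < n \<Longrightarrow> \<kappa> i = \<kappa>' i"
  shows "dweight n m d \<kappa> j b = dweight n m d \<kappa>' j b"
proof -
  have im: "dih n j b ` {..<n} \<subseteq> {..<n}" using dih_lt by auto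
  have "orbprod (\<lambda>C. - osign (\<lambda>i. int (m (\<kappa> i))) C) (dih n j b) {..<n} =
      orbprod (\<lambda>C. - osign (\<lambda>i. int (m (\<kappa>' i))) C) (dih n j b) {..<n}"
  proof (rule orbprod_cong[OF im refl])
    fix C assume "C \<in> forb (dih n j b) ` {..<n}"
    then have "C \<subseteq> {..<n}" by (rule forb_sub[OF im])
    then have "\<forall>x\<in>C. \<kappa> x = \<kappa>' x" using assms by auto
    then show "- osign (\<lambda>i. int (m (\<kappa> i))) C = - osign (\<lambda>i. int (m (\<kappa>' i))) C"
      by (simp add: osign_def cong: bex_cong)
  qed
  then show ?thesis by (simp add: dweight_def)
qed

definition word_sum :: "nat \<Rightarrow> nat \<Rightarrow> (nat \<Rightarrow> nat) \<Rightarrow> nat \<Rightarrow> (nat \<Rightarrow> nat) \<Rightarrow> rat" where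
  "word_sum n r m d s = (\<Sum>\<kappa>\<in>words n r s.
     \<Sum>(j, b)\<in>{(j, b). j < n \<and> (\<forall>i<n. \<kappa> (dih n j b i) = \<kappa> i)}. dweight n m d \<kappa> j b)"

context colored
begin

text \<open>Every word with the right letter counts is \<open>col \<circ> \<pi>\<close> for as many
  permutations \<open>\<pi>\<close> as there are colour-preserving ones. The group is twice as large
  because of the reversal flag, which explains the 2.\<close>

lemma sum_permutations_words:
  fixes F :: "(nat \<Rightarrow> nat) \<Rightarrow> rat"
  assumes s: "\<And>i. s i = card {a \<in> {..<n}. col a = i}"
    and F: "\<And>\<kappa> \<kappa>'. (\<And>i. i < n \<Longrightarrow> \<kappa> i = \<kappa>' i) \<Longrightarrow> F \<kappa> = F \<kappa>'"
  shows "(\<Sum>\<pi>\<in>{\<pi>. \<pi> permutes {..<n}}. F (col \<circ> \<pi>)) =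
    of_nat (card (lgroup n col)) / 2 * (\<Sum>\<kappa>\<in>words n r s. F \<kappa>)"
proof -
  let ?P = "{\<pi>. \<pi> permutes {..<n}}"
  let ?S = "{\<sigma>. \<sigma> permutes {..<n} \<and> (\<forall>i<n. col (\<sigma> i) = col i)}"
  let ?w = "\<lambda>\<pi>. restrict (col \<circ> \<pi>) {..<n}"
  have finP: "finite ?P" by (rule finite_permutations) simp
  have cG: "card (lgroup n col) = 2 * card ?S"
    by (simp add: lgroup_def card_cartesian_product)
  have wK: "?w \<pi> \<in> words n r s" if \<pi>: "\<pi> permutes {..<n}" for \<pi>
  proof -
    have \<pi>lt: "\<pi> a < n" if "a < n" for a using permutes_in_image[OF \<pi>, of a] that by simp
    have "card {a \<in> {..<n}. ?w \<pi> a = i} = s i" for i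
    proof -
      have "bij_betw \<pi> {a \<in> {..<n}. ?w \<pi> a = i} {a \<in> {..<n}. col a = i}"
        unfolding bij_betw_def
      proof
        show "inj_on \<pi> {a \<in> {..<n}. ?w \<pi> a = i}"
          using permutes_inj[OF \<pi>] by (rule inj_on_subset) simp
        show "\<pi> ` {a \<in> {..<n}. ?w \<pi> a = i} = {a \<in> {..<n}. col a = i}"
        proof (intro antisym subsetI)
          fix b assume "b \<in> {a \<in> {..<n}. col a = i}"
          then have "inv \<pi> b \<in> {a \<in> {..<n}. ?w \<pi> a = i}" "b = \<pi> (inv \<pi> b)"
            using permutes_in_image[OF permutes_inv[OF \<pi>], of b] permutes_inverses(1)[OF \<pi>] by simp_all
          then show "b \<in> \<pi> ` {a \<in> {..<n}. ?w \<pi> a = i}" by blast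
        next
          fix b assume "b \<in> \<pi> ` {a \<in> {..<n}. ?w \<pi> a = i}"
          then obtain a where "a < n" "?w \<pi> a = i" "b = \<pi> a" by blast
          then show "b \<in> {a \<in> {..<n}. col a = i}" using \<pi>lt by simp
        qed
      qed
      then show ?thesis unfolding s by (rule bij_betw_same_card)
    qed
    moreover have "?w \<pi> \<in> {..<n} \<rightarrow>\<^sub>E {1..r}"
      using col_in \<pi>lt by (intro PiE_I) simp_all
    ultimately show ?thesis by (simp add: words_def)
  qed
  have fib: "card {\<pi> \<in> ?P. ?w \<pi> = \<kappa>} = card ?S" if \<kappa>: "\<kappa> \<in> words n r s" for \<kappa>
  proof -
    have kc: "card {a \<in> {..<n}. \<kappa> a = i} = card {a \<in> {..<n}. col a = i}" for i
      using \<kappa> s by (simp add: words_def)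
    obtain lab where lab: "inj_on lab {..<n}" "lab ` {..<n} = {..<n}"
      "\<And>i. i < n \<Longrightarrow> Some (col (lab i)) = Some (\<kappa> i)"
      by (rule color_matching[of "{..<n}" "\<lambda>v. Some (col v)" n \<kappa>]) (use kc in auto)
    define \<pi>0 where "\<pi>0 i = (if i < n then lab i else i)" for i
    have \<pi>0: "\<pi>0 permutes {..<n}"
    proof (rule bij_imp_permutes)
      show "bij_betw \<pi>0 {..<n} {..<n}"
        unfolding bij_betw_def
      proof
        show "inj_on \<pi>0 {..<n}" using lab(1) by (auto simp: inj_on_def \<pi>0_def)
        have "\<pi>0 ` {..<n} = lab ` {..<n}" by (rule image_cong) (simp_all add: \<pi>0_def)
        then show "\<pi>0 ` {..<n} = {..<n}" using lab(2) by simp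
      qed
    qed (simp add: \<pi>0_def)
    have c0: "col (\<pi>0 i) = \<kappa> i" if "i < n" for i using lab(3)[OF that] that by (simp add: \<pi>0_def)
    have kout: "\<kappa> i = undefined" if "\<not> i < n" for i using \<kappa> that by (auto simp: words_def PiE_def extensional_def)
    have weq: "?w \<pi> = \<kappa> \<longleftrightarrow> (\<forall>i<n. col (\<pi> i) = \<kappa> i)" for \<pi>
      using kout by (auto simp: fun_eq_iff)
    have "bij_betw (\<lambda>\<sigma>. \<sigma> \<circ> \<pi>0) ?S {\<pi> \<in> ?P. ?w \<pi> = \<kappa>}"
    proof (rule bij_betw_byWitness[where f' = "\<lambda>\<pi>. \<pi> \<circ> inv \<pi>0"])
      show "\<forall>\<sigma>\<in>?S. \<sigma> \<circ> \<pi>0 \<circ> inv \<pi>0 = \<sigma>" "\<forall>\<pi>\<in>{\<pi> \<in> ?P. ?w \<pi> = \<kappa>}. \<pi> \<circ> inv \<pi>0 \<circ> \<pi>0 = \<pi>"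
        using permutes_inverses[OF \<pi>0] by (simp_all add: fun_eq_iff)
      show "(\<lambda>\<sigma>. \<sigma> \<circ> \<pi>0) ` ?S \<subseteq> {\<pi> \<in> ?P. ?w \<pi> = \<kappa>}"
        unfolding weq using c0 permutes_in_image[OF \<pi>0] by (auto intro: permutes_compose[OF \<pi>0])
      show "(\<lambda>\<pi>. \<pi> \<circ> inv \<pi>0) ` {\<pi> \<in> ?P. ?w \<pi> = \<kappa>} \<subseteq> ?S"
      proof clarify
        fix \<pi> assume \<pi>: "\<pi> permutes {..<n}" and k: "\<kappa> = ?w \<pi>"
        have "col (\<pi> (inv \<pi>0 i)) = col i" if i: "i < n" for i
        proof -
          have l: "inv \<pi>0 i < n" using permutes_in_image[OF permutes_inv[OF \<pi>0], of i] i by simp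
          then have "col (\<pi> (inv \<pi>0 i)) = \<kappa> (inv \<pi>0 i)" using k by simp
          then show ?thesis using c0[OF l] permutes_inverses(1)[OF \<pi>0] by simp
        qed
        then show "\<pi> \<circ> inv \<pi>0 permutes {..<n} \<and> (\<forall>i<n. col ((\<pi> \<circ> inv \<pi>0) i) = col i)"
          using permutes_compose[OF permutes_inv[OF \<pi>0] \<pi>] by simp
      qed
    qed
    then show ?thesis by (simp add: bij_betw_same_card)
  qed
  have "(\<Sum>\<pi>\<in>?P. F (col \<circ> \<pi>)) = (\<Sum>\<pi>\<in>?P. F (?w \<pi>))" by (rule sum.cong[OF refl], rule F) simp
  also have "\<dots> = (\<Sum>\<kappa>\<in>words n r s. \<Sum>\<pi>\<in>{\<pi> \<in> ?P. ?w \<pi> = \<kappa>}. F (?w \<pi>))"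
    by (rule sum.group[symmetric, OF finP finite_words]) (use wK in auto)
  also have "\<dots> = (\<Sum>\<kappa>\<in>words n r s. of_nat (card ?S) * F \<kappa>)"
  proof (rule sum.cong[OF refl])
    fix \<kappa> assume \<kappa>: "\<kappa> \<in> words n r s"
    have "(\<Sum>\<pi>\<in>{\<pi> \<in> ?P. ?w \<pi> = \<kappa>}. F (?w \<pi>)) = (\<Sum>\<pi>\<in>{\<pi> \<in> ?P. ?w \<pi> = \<kappa>}. F \<kappa>)"
      by (rule sum.cong) auto
    then show "(\<Sum>\<pi>\<in>{\<pi> \<in> ?P. ?w \<pi> = \<kappa>}. F (?w \<pi>)) = of_nat (card ?S) * F \<kappa>" using fib[OF \<kappa>] by simp
  qed
  finally show ?thesis by (simp add: cG sum_distrib_left)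
qed

text \<open>The order of the group cancels. What remains is 1/n from the choice of a starting point
  on the cycle and 1/2 from the reversal flag, together the inverse of the order of the dihedral
  group.\<close>

lemma weight_sum:
  assumes s: "\<And>i. s i = card {a \<in> {..<n}. col a = i}"
  shows "(\<Sum>g\<in>lgroup n col. \<Sum>x\<in>{x \<in> cstr n. cact g x = x}. weight m d col g x) / of_nat (card (lgroup n col)) =
    word_sum n r m d s / (2 * of_nat n)"
proof -
  let ?F = "\<lambda>\<kappa>. \<Sum>(j, b)\<in>{(j, b). j < n \<and> (\<forall>i<n. \<kappa> (dih n j b i) = \<kappa> i)}. dweight n m d \<kappa> j b"
  have c: "card (lgroup n col) > 0"
    using finite_lgroup[of n col] id_lgroup by (auto simp: card_gt_0_iff)
  have "(\<Sum>g\<in>lgroup n col. \<Sum>x\<in>{x \<in> cstr n. cact g x = x}. weight m d col g x) =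
      (\<Sum>\<pi>\<in>{\<pi>. \<pi> permutes {..<n}}. ?F (col \<circ> \<pi>)) / of_nat n"
    unfolding hed_sum[symmetric] by (rule sum.cong[OF refl]) (rule weight_sum_hedgehogs)
  also have "(\<Sum>\<pi>\<in>{\<pi>. \<pi> permutes {..<n}}. ?F (col \<circ> \<pi>)) =
      of_nat (card (lgroup n col)) / 2 * (\<Sum>\<kappa>\<in>words n r s. ?F \<kappa>)"
  proof (rule sum_permutations_words[OF s])
    fix \<kappa> \<kappa>' :: "nat \<Rightarrow> nat" assume eq: "\<And>i. i < n \<Longrightarrow> \<kappa> i = \<kappa>' i"
    have "{(j, b). j < n \<and> (\<forall>i<n. \<kappa> (dih n j b i) = \<kappa> i)} =
        {(j, b). j < n \<and> (\<forall>i<n. \<kappa>' (dih n j b i) = \<kappa>' i)}"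
      using eq dih_lt by auto
    then show "?F \<kappa> = ?F \<kappa>'" using dweight_cong[OF eq] by (simp cong: sum.cong)
  qed
  also have "(\<Sum>\<kappa>\<in>words n r s. ?F \<kappa>) = word_sum n r m d s" by (simp add: word_sum_def)
  finally show ?thesis using c by simp
qed

end

section \<open>From weights of fixed graphs to the Euler characteristic of the complex\<close>

definition genus_one_graphs :: "nat \<Rightarrow> (nat \<Rightarrow> nat) \<Rightarrow> nat \<Rightarrow> (nat \<Rightarrow> nat) \<Rightarrow> nat \<Rightarrow> int \<Rightarrow> hairy_graph set" where
  "genus_one_graphs r m d s t j = {\<Gamma>. is_hairy_graph r \<Gamma> \<and> genus \<Gamma> = 1 \<and> hodge_degree \<Gamma> = s \<and>
     complexity \<Gamma> = t \<and> hdegree m d \<Gamma> = j}"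

lemma hairy_dim_eq:
  "hairy_dim r m d 1 s t j = dim_mod (hairy_relations r m d) (qvec.span (gvec ` genus_one_graphs r m d s t j))"
proof -
  have "{gvec \<Gamma> | \<Gamma>. is_hairy_graph r \<Gamma> \<and> genus \<Gamma> = 1 \<and> hodge_degree \<Gamma> = s \<and>
      complexity \<Gamma> = t \<and> hdegree m d \<Gamma> = j} = gvec ` genus_one_graphs r m d s t j"
    by (auto simp: genus_one_graphs_def)
  then show ?thesis by (simp add: hairy_dim_def)
qed

lemma genus_one_closed:
  assumes "\<Gamma> \<in> genus_one_graphs r m d s t j" "grel r m d \<Gamma> \<Gamma>' e"
  shows "\<Gamma>' \<in> genus_one_graphs r m d s t j"
proof -
  obtain \<alpha> \<beta> \<phi> where iso: "giso \<Gamma> \<Gamma>' \<alpha> \<beta> \<phi>" and h: "is_hairy_graph r \<Gamma>" "is_hairy_graph r \<Gamma>'"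
    using assms(2) by (auto simp: grel_def)
  note g = giso_cards[OF iso]
  have gen: "genus \<Gamma>' = 1"
    using assms(1) genus_one_iff[OF h(1)] genus_one_iff[OF h(2)] g(1,2) by (simp add: genus_one_graphs_def)
  have "complexity \<Gamma>' = complexity \<Gamma>"
    using assms(1) genus_one_complexity[OF h(1)] genus_one_complexity[OF h(2) gen] g(4)
    by (simp add: genus_one_graphs_def)
  then show ?thesis using assms(1) gen h(2) g(5) g(6)[of m d] by (simp add: genus_one_graphs_def)
qed

lemma neg_one_power: "(- 1) ^ nat \<bar>j\<bar> = psign j"
  by (cases "even j") (auto simp: psign_def even_nat_iff)

context colored
begin

text \<open>The dimension in degree \<open>j\<close> averages the signs of the fixed canonical
  graphs of this degree. Multiplying by the parity of \<open>j\<close> turns signs into weights, and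
  the sum over \<open>j\<close> removes the restriction on the degree.\<close>

lemma hairy_euler_colored:
  assumes s: "\<And>i. s i = card {a \<in> {..<n}. col a = i}"
  shows "of_int (hairy_euler r m d 1 s n) = word_sum n r m d s / (2 * of_nat n)"
proof -
  interpret R: signed_relation "grel r m d" "hairy_relations r m d" by (rule signed_relation_grel)
  let ?dim = "\<lambda>j. hairy_dim r m d 1 s n j" and ?D = "\<lambda>j. genus_one_graphs r m d s n j"
  let ?hd = "\<lambda>x. hdegree m d (rgraph col x)" and ?G = "lgroup n col"
  have inD: "rgraph col x \<in> ?D j \<longleftrightarrow> ?hd x = j" if "x \<in> cstr n" for x j
  proof -
    interpret canon n "fst x" "snd x" using that by (simp add: cstr_def)
    have "hodge_degree (rgraph col x) = s" using rgraph_hodge_degree[of col] s by (simp add: fun_eq_iff)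
    moreover have "genus (rgraph col x) = 1" "complexity (rgraph col x) = n"
      using rgraph_genus[of col r] n_pos col_in by auto
    ultimately show ?thesis using hairy[OF that] by (simp add: genus_one_graphs_def)
  qed
  have dim: "of_nat (?dim j) = (\<Sum>g\<in>?G. \<Sum>x\<in>{x \<in> cstr n. ?hd x = j \<and> cact g x = x}. csgn m d col g x) /
      of_nat (card ?G)" for j
  proof -
    have "of_nat (?dim j) = (\<Sum>g\<in>?G. \<Sum>x\<in>{x \<in> cstr n. rgraph col x \<in> ?D j \<and> cact g x = x}. csgn m d col g x) /
        of_nat (card ?G)"
      unfolding hairy_dim_eq
    proof (rule R.dim_mod_action[OF signed_action])
      show "grel r m d (rgraph col x) (rgraph col y) e \<longleftrightarrow>
          (\<exists>g\<in>?G. cact g x = y \<and> csgn m d col g x = e)" if "x \<in> cstr n" "y \<in> cstr n" for x y e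
        using that by (rule grel_rgraph_iff)
      show "grel r m d (rgraph col x) (rgraph col x) 1" if "x \<in> cstr n" for x
        unfolding grel_def using hairy[OF that] giso_id gsign_id[OF hairy[OF that]] by metis
      show "y \<in> ?D j" if "x \<in> ?D j" "grel r m d x y e" for x y e
        using that by (rule genus_one_closed)
      show "\<exists>\<xi>\<in>cstr n. \<exists>e. grel r m d (rgraph col \<xi>) x e" if "x \<in> ?D j" for x
        by (rule canonical_exists) (use that s in \<open>auto simp: genus_one_graphs_def\<close>)
    qed
    moreover have "{x \<in> cstr n. rgraph col x \<in> ?D j \<and> cact g x = x} =
        {x \<in> cstr n. ?hd x = j \<and> cact g x = x}" for g
      using inD by auto
    ultimately show ?thesis by simp
  qed
  let ?J = "?hd ` cstr n"
  have finJ: "finite ?J" using finite_cstr by simp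
  \<comment> \<open>Only the degrees of the finitely many canonical graphs can occur, so the
    defining sum ranges over a finite set.\<close>
  have sub: "{j. ?dim j \<noteq> 0} \<subseteq> ?J"
  proof
    fix j assume "j \<in> {j. ?dim j \<noteq> 0}"
    then have "of_nat (?dim j) \<noteq> (0::rat)" by simp
    then have "\<exists>g\<in>?G. {x \<in> cstr n. ?hd x = j \<and> cact g x = x} \<noteq> {}"
      unfolding dim by (metis (no_types, lifting) div_0 sum.empty sum.neutral)
    then show "j \<in> ?J" by blast
  qed
  have "(of_int (hairy_euler r m d 1 s n) :: rat) = (\<Sum>j | ?dim j \<noteq> 0. psign j * of_nat (?dim j))"
  proof -
    have "(of_int ((- 1) ^ nat \<bar>j\<bar>) :: rat) = psign j" for j by (simp add: neg_one_power)
    then show ?thesis unfolding hairy_euler_def by simp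
  qed
  also have "\<dots> = (\<Sum>j\<in>?J. psign j * of_nat (?dim j))"
    by (rule sum.mono_neutral_left[OF finJ sub]) auto
  also have "\<dots> = (\<Sum>j\<in>?J. \<Sum>g\<in>?G. \<Sum>x\<in>{x \<in> cstr n. ?hd x = j \<and> cact g x = x}. weight m d col g x) / of_nat (card ?G)"
    unfolding dim sum_divide_distrib[symmetric] times_divide_eq_right sum_distrib_left
    by (intro arg_cong2[where f = "(/)"] sum.cong refl) (auto simp: weight_def)
  also have "(\<Sum>j\<in>?J. \<Sum>g\<in>?G. \<Sum>x\<in>{x \<in> cstr n. ?hd x = j \<and> cact g x = x}. weight m d col g x) =
      (\<Sum>g\<in>?G. \<Sum>j\<in>?J. \<Sum>x\<in>{x \<in> {x \<in> cstr n. cact g x = x}. ?hd x = j}. weight m d col g x)"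
    by (subst sum.swap) (intro sum.cong refl; auto)
  also have "\<dots> = (\<Sum>g\<in>?G. \<Sum>x\<in>{x \<in> cstr n. cact g x = x}. weight m d col g x)"
    by (intro sum.cong refl sum.group finJ) (use finite_cstr in auto)
  finally show ?thesis unfolding weight_sum[OF s] .
qed

end

lemma genus_one_empty:
  assumes none: "words t r s = {} \<or> t = 0"
  shows "genus_one_graphs r m d s t j = {}"
proof (rule ccontr)
  assume "genus_one_graphs r m d s t j \<noteq> {}"
  then obtain \<Gamma> where h: "is_hairy_graph r \<Gamma>" and g: "genus \<Gamma> = 1" and s: "hodge_degree \<Gamma> = s"
    and t: "complexity \<Gamma> = t" by (auto simp: genus_one_graphs_def)
  let ?E = "external \<Gamma>"
  have finE: "finite ?E" using is_hairy_graphD(2)[OF h] by (simp add: external_def)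
  have cE: "card ?E = t" using genus_one_complexity[OF h g] t by simp
  have "?E \<noteq> {}" using h by (simp add: is_hairy_graph_def)
  then have "t \<noteq> 0" using cE finE by auto
  obtain b where b: "bij_betw b {..<t} ?E"
    using ex_bij_betw_nat_finite[OF finE] cE by (auto simp: atLeast0LessThan)
  define \<kappa> where "\<kappa> = restrict (\<lambda>a. the (color \<Gamma> (b a))) {..<t}"
  have cb: "color \<Gamma> (b a) = Some (\<kappa> a) \<and> \<kappa> a \<in> {1..r}" if "a < t" for a
  proof -
    have "b a \<in> ?E" using b that by (auto simp: bij_betw_def)
    then obtain i where "i \<in> {1..r}" "color \<Gamma> (b a) = Some i"
      using h by (auto simp: is_hairy_graph_def)
    then show ?thesis using that by (simp add: \<kappa>_def)
  qed
  have "card {a \<in> {..<t}. \<kappa> a = i} = s i" for i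
  proof -
    have "bij_betw b {a \<in> {..<t}. \<kappa> a = i} {v \<in> verts (shape \<Gamma>). color \<Gamma> v = Some i}"
    proof (rule bij_betw_subset[OF b])
      show "b ` {a \<in> {..<t}. \<kappa> a = i} = {v \<in> verts (shape \<Gamma>). color \<Gamma> v = Some i}"
      proof (intro antisym subsetI)
        fix v assume "v \<in> b ` {a \<in> {..<t}. \<kappa> a = i}"
        then obtain a where a: "a < t" "\<kappa> a = i" "v = b a" by auto
        then have "v \<in> ?E" using b by (auto simp: bij_betw_def)
        then show "v \<in> {v \<in> verts (shape \<Gamma>). color \<Gamma> v = Some i}" using cb[OF a(1)] a by (simp add: external_def)
      next
        fix v assume v: "v \<in> {v \<in> verts (shape \<Gamma>). color \<Gamma> v = Some i}"
        then have "v \<in> ?E" by (simp add: external_def)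
        then have "v \<in> b ` {..<t}" using b by (simp add: bij_betw_def)
        then obtain a where a: "a < t" "v = b a" by auto
        then have "\<kappa> a = i" using cb[OF a(1)] v by simp
        then show "v \<in> b ` {a \<in> {..<t}. \<kappa> a = i}" using a by blast
      qed
    qed auto
    then show ?thesis using s by (simp add: bij_betw_same_card hodge_degree_def[abs_def] fun_eq_iff)
  qed
  moreover have "\<kappa> \<in> {..<t} \<rightarrow>\<^sub>E {1..r}" using cb by (intro PiE_I) (auto simp: \<kappa>_def)
  ultimately have "\<kappa> \<in> words t r s" by (simp add: words_def)
  then show False using none \<open>t \<noteq> 0\<close> by blast
qed

text \<open>Numbering the hairs of a graph and recording their colours gives a word, so without
  words there are no graphs and both sides are zero. For \<open>t = 0\<close> the right side is zero
  as a division by zero, in agreement with the requirement that there be a hair.\<close>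

theorem hairy_euler_words:
  "of_int (hairy_euler r m d 1 s t) = word_sum t r m d s / (2 * of_nat t)"
proof (cases "words t r s = {} \<or> t = 0")
  case True
  interpret R: signed_relation "grel r m d" "hairy_relations r m d" by (rule signed_relation_grel)
  have "hairy_dim r m d 1 s t j = 0" for j
    unfolding hairy_dim_eq genus_one_empty[OF True] using R.dim_mod_reps[of "{}" "{}"] by simp
  then have "hairy_euler r m d 1 s t = 0" by (simp add: hairy_euler_def)
  then show ?thesis using True by (auto simp: word_sum_def)
next
  case False
  then obtain \<kappa> where \<kappa>: "\<kappa> \<in> words t r s" and t: "t > 0" by auto
  interpret colored t r \<kappa>
    by unfold_locales (use \<kappa> t in \<open>auto simp: words_def dest: PiE_mem\<close>)
  show ?thesis by (rule hairy_euler_colored) (use \<kappa> in \<open>simp add: words_def\<close>)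
qed

section \<open>Generating functions of invariant words\<close>

abbreviation cst :: "rat \<Rightarrow> qpoly" where "cst c \<equiv> Poly_Mapping.single 0 c"

lemma lookup_cst_mult: "Poly_Mapping.lookup (cst c * q) p = c * Poly_Mapping.lookup q p"
  by (simp add: mult_map_scale_conv_mult[symmetric] Poly_Mapping.map.rep_eq when_def)

lemma cst_mult: "cst (a * b) = cst a * cst b"
  by (simp add: mult_single)

lemma cst_power: "cst (c ^ k) = cst c ^ k"
  by (induction k) (simp_all add: cst_mult)

lemma cst_neg: "cst (- c) = - cst c"
  by (rule single_uminus)

lemma psign_of_nat: "psign (int k) = (- 1) ^ k"
  by (simp add: psign_def minus_one_power_iff)

lemma cst_psign: "cst (psign (int k)) = (- 1) ^ k"
  by (simp add: psign_of_nat cst_power cst_neg)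

definition pwr :: "nat \<Rightarrow> (nat \<Rightarrow> nat) \<Rightarrow> nat \<Rightarrow> qpoly" where
  "pwr r m l = (\<Sum>i=1..r. (- 1) ^ m i * xvar i ^ l)"

lemma xvar_power: "xvar i ^ l = Poly_Mapping.single (Poly_Mapping.single i l) 1"
  by (induction l) (simp_all add: xvar_def mult_single flip: single_add)

lemma pwr_single:
  "- pwr r m l = (\<Sum>i\<in>{1..r}. Poly_Mapping.single (Poly_Mapping.single i l) (- psign (int (m i))))"
  by (simp add: pwr_def xvar_power cst_psign[symmetric] mult_single single_uminus sum_negf)

lemma prod_single:
  "finite A \<Longrightarrow> (\<Prod>a\<in>A. Poly_Mapping.single (k a) (c a)) =
     (Poly_Mapping.single (\<Sum>a\<in>A. k a) (\<Prod>a\<in>A. c a) :: qpoly)"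
  by (induction A rule: finite_induct) (simp_all add: mult_single)

lemma permutes_orbit:
  assumes "\<rho> permutes A" "finite A" "C \<in> forb \<rho> ` A" "a \<in> C"
  shows "a \<in> A" "forb \<rho> a = C"
proof -
  obtain b where b: "b \<in> A" "C = forb \<rho> b" using assms(3) by blast
  show "a \<in> A" using forb_sub[OF _ assms(3)] assms(4) permutes_image[OF assms(1)] by blast
  show "forb \<rho> a = C" using forb_eq[OF assms(2) permutes_imp_bij[OF assms(1)] b(1)] b(2) assms(4) by blast
qed

lemma permutes_orbit_fibre:
  assumes "\<rho> permutes A" "finite A" "C \<in> forb \<rho> ` A"
  shows "{a \<in> A. forb \<rho> a = C} = C"
  using permutes_orbit[OF assms] forb_self by auto

text \<open>An invariant word chooses one letter for each orbit. Expanding the product of power sums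
  over the orbits makes the same choices: the letter i on an orbit C gives the monomial x_i to the
  power |C| with the sign -(-1)^(m_i).\<close>

lemma sum_words_invariant:
  assumes \<rho>: "\<rho> permutes {..<n}"
  shows "(\<Sum>\<kappa>\<in>{\<kappa> \<in> words n r (Poly_Mapping.lookup p). \<forall>i<n. \<kappa> (\<rho> i) = \<kappa> i}.
      orbprod (\<lambda>C. - osign (\<lambda>i. int (m (\<kappa> i))) C) \<rho> {..<n}) =
    Poly_Mapping.lookup (orbprod (\<lambda>C. - pwr r m (card C)) \<rho> {..<n}) p"
proof -
  let ?O = "forb \<rho> ` {..<n}"
  let ?E = "\<lambda>\<mu>. \<Sum>C\<in>?O. Poly_Mapping.single (\<mu> C) (card C)"
  let ?w = "\<lambda>\<mu>. \<Prod>C\<in>?O. - psign (int (m (\<mu> C)))"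
  let ?L = "{\<mu> \<in> ?O \<rightarrow>\<^sub>E {1..r}. ?E \<mu> = p}"
  let ?K = "{\<kappa> \<in> words n r (Poly_Mapping.lookup p). \<forall>i<n. \<kappa> (\<rho> i) = \<kappa> i}"
  let ?f = "\<lambda>\<mu>. restrict (\<lambda>a. \<mu> (forb \<rho> a)) {..<n}"
  let ?g = "\<lambda>\<kappa>. restrict (\<lambda>C. \<kappa> (SOME a. a \<in> C)) ?O"
  note orb = permutes_orbit[OF \<rho> finite_lessThan]
  have \<rho>lt: "\<rho> a < n" if "a < n" for a using permutes_in_image[OF \<rho>, of a] that by simp
  have some: "(SOME a. a \<in> C) \<in> C" if "C \<in> ?O" for C using forb_ne[OF that] by (simp add: some_in_eq)
  \<comment> \<open>The exponent of the monomial of a choice of letters is the number of positions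
    with that letter in the resulting word.\<close>
  have expo: "Poly_Mapping.lookup (?E \<mu>) i = card {a \<in> {..<n}. \<mu> (forb \<rho> a) = i}" for \<mu> i
  proof -
    have "card {a \<in> {..<n}. \<mu> (forb \<rho> a) = i} = (\<Sum>a\<in>{..<n}. if \<mu> (forb \<rho> a) = i then 1 else 0)"
      by (simp add: sum.If_cases Int_def)
    also have "\<dots> = (\<Sum>C\<in>?O. \<Sum>a\<in>{a \<in> {..<n}. forb \<rho> a = C}. if \<mu> (forb \<rho> a) = i then 1 else 0)"
      by (rule sum.group[symmetric]) auto
    also have "\<dots> = (\<Sum>C\<in>?O. \<Sum>a\<in>C. if \<mu> C = i then 1 else 0)"
    proof (rule sum.cong[OF refl])
      fix C assume C: "C \<in> ?O"
      show "(\<Sum>a\<in>{a \<in> {..<n}. forb \<rho> a = C}. if \<mu> (forb \<rho> a) = i then 1 else (0::nat)) =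
          (\<Sum>a\<in>C. if \<mu> C = i then 1 else 0)"
        unfolding permutes_orbit_fibre[OF \<rho> finite_lessThan C] using orb(2)[OF C] by (intro sum.cong) auto
    qed
    also have "\<dots> = Poly_Mapping.lookup (?E \<mu>) i"
      unfolding lookup_sum by (intro sum.cong refl) (auto simp: lookup_single when_def)
    finally show ?thesis by simp
  qed
  have "Poly_Mapping.lookup (orbprod (\<lambda>C. - pwr r m (card C)) \<rho> {..<n}) p =
      (\<Sum>\<mu>\<in>?O \<rightarrow>\<^sub>E {1..r}. if ?E \<mu> = p then ?w \<mu> else 0)"
    unfolding orbprod_def pwr_single
    by (subst prod_sum_PiE)
      (auto simp: prod_single lookup_sum lookup_single when_def intro!: sum.cong)
  also have "\<dots> = (\<Sum>\<mu>\<in>?L. ?w \<mu>)"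
    by (rule sum.inter_filter[symmetric]) (auto intro: finite_PiE)
  also have "\<dots> = (\<Sum>\<kappa>\<in>?K. orbprod (\<lambda>C. - osign (\<lambda>i. int (m (\<kappa> i))) C) \<rho> {..<n})"
  proof (rule sum.reindex_bij_witness[where i = ?g and j = ?f])
    fix \<mu> assume \<mu>: "\<mu> \<in> ?L"
    have \<mu>f: "?f \<mu> a = \<mu> C" if "C \<in> ?O" "a \<in> C" for C a using orb[OF that] by simp
    show "?g (?f \<mu>) = \<mu>"
    proof
      fix C show "?g (?f \<mu>) C = \<mu> C"
      proof (cases "C \<in> ?O")
        case True
        then show ?thesis using \<mu>f[OF True some[OF True]] by (simp del: restrict_apply add: restrict_apply'[OF True])
      next
        case False
        then show ?thesis using \<mu> by (auto simp: PiE_def extensional_def)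
      qed
    qed
    have "?f \<mu> \<in> words n r (Poly_Mapping.lookup p)"
    proof -
      have "card {a \<in> {..<n}. ?f \<mu> a = i} = Poly_Mapping.lookup p i" for i
      proof -
        have "{a \<in> {..<n}. ?f \<mu> a = i} = {a \<in> {..<n}. \<mu> (forb \<rho> a) = i}" by auto
        then show ?thesis using \<mu> expo[of \<mu> i] by simp
      qed
      moreover have "?f \<mu> \<in> {..<n} \<rightarrow>\<^sub>E {1..r}" using \<mu> by (intro PiE_I) (auto dest: PiE_mem)
      ultimately show ?thesis by (simp add: words_def)
    qed
    moreover have "?f \<mu> (\<rho> i) = ?f \<mu> i" if i: "i < n" for i
    proof -
      have "forb \<rho> (\<rho> i) = forb \<rho> i"
        by (rule orb(2)) (use i forb_step[OF forb_self] in auto)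
      then show ?thesis using i \<rho>lt by simp
    qed
    ultimately show "?f \<mu> \<in> ?K" by blast
    show "orbprod (\<lambda>C. - osign (\<lambda>i. int (m (?f \<mu> i))) C) \<rho> {..<n} = ?w \<mu>"
      unfolding orbprod_def
    proof (rule prod.cong[OF refl])
      fix C assume C: "C \<in> ?O"
      have "osign (\<lambda>i. int (m (?f \<mu> i))) C = osign (\<lambda>_. int (m (\<mu> C))) C"
        unfolding osign_def using \<mu>f[OF C] by (metis (no_types, lifting))
      then show "- osign (\<lambda>i. int (m (?f \<mu> i))) C = - psign (int (m (\<mu> C)))"
        using forb_ne[OF C] by (simp add: osign_const)
    qed
  next
    fix \<kappa> assume "\<kappa> \<in> ?K"
    then have kw: "\<kappa> \<in> words n r (Poly_Mapping.lookup p)" and inv: "\<And>i. i < n \<Longrightarrow> \<kappa> (\<rho> i) = \<kappa> i" by auto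
    have kpi: "\<kappa> \<in> {..<n} \<rightarrow>\<^sub>E {1..r}" and kc: "\<And>i. card {a \<in> {..<n}. \<kappa> a = i} = Poly_Mapping.lookup p i"
      using kw by (simp_all add: words_def)
    have const: "\<kappa> b = \<kappa> a" if "a < n" "b \<in> forb \<rho> a" for a b
    proof -
      have "(\<rho> ^^ k) a < n \<and> \<kappa> ((\<rho> ^^ k) a) = \<kappa> a" for k
        by (induction k) (use that \<rho>lt inv in auto)
      then show ?thesis using that(2) by (auto simp: forb_def)
    qed
    have gf: "?g \<kappa> (forb \<rho> a) = \<kappa> a" if "a < n" for a
      using const[OF that some[of "forb \<rho> a"]] that by simp
    show fg: "?f (?g \<kappa>) = \<kappa>"
    proof
      fix a show "?f (?g \<kappa>) a = \<kappa> a"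
        using gf[of a] kpi by (cases "a < n") (auto simp: PiE_def extensional_def)
    qed
    have "?E (?g \<kappa>) = p"
    proof (rule poly_mapping_eqI)
      fix i
      have "{a \<in> {..<n}. ?g \<kappa> (forb \<rho> a) = i} = {a \<in> {..<n}. \<kappa> a = i}" using gf by auto
      then show "Poly_Mapping.lookup (?E (?g \<kappa>)) i = Poly_Mapping.lookup p i" using expo[of "?g \<kappa>" i] kc by simp
    qed
    moreover have "?g \<kappa> \<in> ?O \<rightarrow>\<^sub>E {1..r}"
    proof (rule PiE_I)
      fix C assume "C \<in> ?O"
      then obtain a where "a < n" "C = forb \<rho> a" by auto
      then show "?g \<kappa> C \<in> {1..r}" using gf[of a] PiE_mem[OF kpi, of a] by simp
    qed simp
    ultimately show "?g \<kappa> \<in> ?L" by blast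
  qed
  finally show ?thesis by simp
qed

text \<open>The generating polynomial of the words fixed by the dihedral element
  \<open>(j, b)\<close>. The signs of the cycle edges do not depend on the word and are collected in
  the scalar.\<close>

definition dpoly :: "nat \<Rightarrow> nat \<Rightarrow> (nat \<Rightarrow> nat) \<Rightarrow> nat \<Rightarrow> nat \<Rightarrow> bool \<Rightarrow> qpoly" where
  "dpoly n r m d j b = cst (orbprod (\<lambda>_. psign (int d - 1)) (dih n j b \<circ> (if b then rot n else id)) {..<n} *
     psign (int d * (of_bool b * int n))) * orbprod (\<lambda>C. - pwr r m (card C)) (dih n j b) {..<n}"

lemma word_sum_lookup:
  "word_sum n r m d (Poly_Mapping.lookup p) =
    Poly_Mapping.lookup ((\<Sum>j<n. dpoly n r m d j False) + (\<Sum>j<n. dpoly n r m d j True)) p"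
proof -
  let ?W = "words n r (Poly_Mapping.lookup p)"
  let ?R = "\<lambda>\<kappa> x. \<forall>i<n. \<kappa> (dih n (fst x) (snd x) i) = \<kappa> i"
  let ?B = "{..<n} \<times> (UNIV :: bool set)"
  have "word_sum n r m d (Poly_Mapping.lookup p) =
      (\<Sum>\<kappa>\<in>?W. \<Sum>x\<in>{x \<in> ?B. ?R \<kappa> x}. dweight n m d \<kappa> (fst x) (snd x))"
    unfolding word_sum_def by (intro sum.cong refl) auto
  also have "\<dots> = (\<Sum>x\<in>?B. \<Sum>\<kappa>\<in>{\<kappa> \<in> ?W. ?R \<kappa> x}. dweight n m d \<kappa> (fst x) (snd x))"
    by (rule sum.swap_restrict) (auto simp: finite_words)
  also have "\<dots> = (\<Sum>x\<in>?B. Poly_Mapping.lookup (dpoly n r m d (fst x) (snd x)) p)"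
  proof (rule sum.cong[OF refl])
    fix x
    show "(\<Sum>\<kappa>\<in>{\<kappa> \<in> ?W. ?R \<kappa> x}. dweight n m d \<kappa> (fst x) (snd x)) =
        Poly_Mapping.lookup (dpoly n r m d (fst x) (snd x)) p"
      unfolding dpoly_def lookup_cst_mult sum_words_invariant[OF dih_permutes, symmetric]
        dweight_def sum_distrib_left
      by (intro sum.cong refl) (simp only: ac_simps)
  qed
  also have "\<dots> = (\<Sum>j<n. \<Sum>b\<in>UNIV. Poly_Mapping.lookup (dpoly n r m d j b) p)"
    unfolding sum.cartesian_product by (simp add: case_prod_unfold)
  also have "\<dots> = Poly_Mapping.lookup ((\<Sum>j<n. dpoly n r m d j False) + (\<Sum>j<n. dpoly n r m d j True)) p"
    by (simp add: UNIV_bool lookup_add lookup_sum sum.distrib)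
  finally show ?thesis .
qed

section \<open>Orbits of rotations and reflections\<close>

lemma rotation_iter: "i < n \<Longrightarrow> (dih n j False ^^ k) i = (i + j * k) mod n"
  by (induction k) (auto simp: dih_def mod_simps algebra_simps)

text \<open>The \<open>k\<close>-th iterate fixes a point when \<open>n\<close> divides
  \<open>j * k\<close>, that is, when \<open>n div gcd j n\<close> divides \<open>k\<close>. For
  \<open>j = 0\<close> the gcd is \<open>n\<close> and the orbits are single points.\<close>

lemma rotation_orbit:
  assumes i: "i < n"
  shows "card (forb (dih n j False) i) = n div gcd j n"
proof -
  let ?g = "gcd j n" and ?\<rho> = "dih n j False"
  have g: "?g > 0" using i by (simp add: gcd_pos_nat)
  have fix_iff: "(?\<rho> ^^ k) i = i \<longleftrightarrow> n div ?g dvd k" for k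
  proof -
    have "(?\<rho> ^^ k) i = i \<longleftrightarrow> [i + j * k = i + 0] (mod n)"
      using i by (simp add: rotation_iter cong_def)
    also have "\<dots> \<longleftrightarrow> n dvd j * k" by (simp only: cong_add_lcancel_nat cong_0_iff)
    also have "\<dots> \<longleftrightarrow> (n div ?g) * ?g dvd (j div ?g) * k * ?g"
      by (simp add: algebra_simps)
    also have "\<dots> \<longleftrightarrow> n div ?g dvd (j div ?g) * k" using g by (subst dvd_times_right_cancel_iff) auto
    also have "\<dots> \<longleftrightarrow> n div ?g dvd k"
    proof (rule coprime_dvd_mult_right_iff)
      show "coprime (n div ?g) (j div ?g)"
        using div_gcd_coprime[of j n] g i by (simp add: coprime_commute)
    qed
    finally show ?thesis .
  qed
  obtain k where k: "k > 0" "(?\<rho> ^^ k) i = i" "inj_on (\<lambda>l. (?\<rho> ^^ l) i) {..<k}"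
    "forb ?\<rho> i = (\<lambda>l. (?\<rho> ^^ l) i) ` {..<k}"
    by (rule forb_cyclic[OF finite_lessThan permutes_imp_bij[OF dih_permutes], of i n j False]) (use i in auto)
  have ng: "n div ?g > 0" using i g by (simp add: div_greater_zero_iff dvd_imp_le)
  have "n div ?g \<le> k" using fix_iff k(1,2) by (simp add: dvd_imp_le)
  moreover have "\<not> n div ?g < k"
  proof
    assume l: "n div ?g < k"
    have "(?\<rho> ^^ (n div ?g)) i = (?\<rho> ^^ 0) i" using fix_iff[of "n div ?g"] by simp
    then have "n div ?g = 0" using inj_onD[OF k(3)] l k(1) by (metis lessThan_iff)
    then show False using ng by simp
  qed
  ultimately have "k = n div ?g" by simp
  then show ?thesis using card_image[OF k(3)] k(4) by simp
qed

lemma orbprod_rotation: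
  assumes n: "n > 0"
  shows "orbprod (\<lambda>C. h (card C)) (dih n j False) {..<n} = h (n div gcd j n) ^ gcd j n"
proof -
  let ?\<rho> = "dih n j False" and ?g = "gcd j n"
  let ?O = "forb ?\<rho> ` {..<n}"
  have c: "card C = n div ?g" if "C \<in> ?O" for C using that rotation_orbit by auto
  have "n = (\<Sum>a<n. 1)" by simp
  also have "\<dots> = (\<Sum>C\<in>?O. \<Sum>a\<in>{a \<in> {..<n}. forb ?\<rho> a = C}. 1)"
    by (rule sum.group[symmetric]) auto
  also have "\<dots> = (\<Sum>C\<in>?O. n div ?g)"
    using permutes_orbit_fibre[OF dih_permutes finite_lessThan] c by (intro sum.cong) auto
  finally have "n = card ?O * (n div ?g)" by simp
  moreover have "n = ?g * (n div ?g)" by simp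
  moreover have "n div ?g > 0" using n by (simp add: div_greater_zero_iff dvd_imp_le)
  ultimately have "card ?O = ?g" by (metis mult_cancel2 not_gr_zero)
  then show ?thesis using c by (simp add: orbprod_def)
qed

text \<open>Orbits have one or two elements, and \<open>q\<close> counts those with two; the
  induction removes one orbit at a time.\<close>

lemma orbprod_involution:
  assumes "finite A" "\<rho> ` A \<subseteq> A" "\<And>a. a \<in> A \<Longrightarrow> \<rho> (\<rho> a) = a"
  shows "\<exists>q. card A = card {a \<in> A. \<rho> a = a} + 2 * q \<and>
    orbprod (\<lambda>C. h (card C)) \<rho> A = h 1 ^ card {a \<in> A. \<rho> a = a} * h 2 ^ q"
  using assms
proof (induction "card A" arbitrary: A rule: less_induct)
  case less
  show ?case
  proof (cases "A = {}")
    case True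
    then show ?thesis by (intro exI[of _ 0]) (simp add: orbprod_def)
  next
    case False
    then obtain a where a: "a \<in> A" by blast
    let ?C = "{a, \<rho> a}"
    have forbC: "forb \<rho> b = ?C" if "b \<in> ?C" for b
    proof
      show "forb \<rho> b \<subseteq> ?C" using that less.prems(3)[OF a] by (intro forb_subset) auto
      show "?C \<subseteq> forb \<rho> b" using that less.prems(3)[OF a] forb_self[of b \<rho>] forb_step[OF forb_self, of \<rho> b] by auto
    qed
    have CA: "?C \<subseteq> A" using a less.prems(2) by auto
    have inv: "\<rho> ` (A - ?C) \<subseteq> A - ?C"
    proof
      fix y assume "y \<in> \<rho> ` (A - ?C)"
      then obtain x where x: "x \<in> A" "x \<notin> ?C" "y = \<rho> x" by blast
      have "\<rho> y = x" using less.prems(3) x by simp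
      then show "y \<in> A - ?C" using x less.prems(2) less.prems(3)[OF a] by auto
    qed
    have "card (A - ?C) < card A"
      by (rule psubset_card_mono[OF less.prems(1)]) (use a in auto)
    from less.hyps[OF this _ inv] obtain q where q:
      "card (A - ?C) = card {x \<in> A - ?C. \<rho> x = x} + 2 * q"
      "orbprod (\<lambda>C. h (card C)) \<rho> (A - ?C) = h 1 ^ card {x \<in> A - ?C. \<rho> x = x} * h 2 ^ q"
      using less.prems by auto
    have "orbprod (\<lambda>C. h (card C)) \<rho> (?C \<union> (A - ?C)) =
        orbprod (\<lambda>C. h (card C)) \<rho> ?C * orbprod (\<lambda>C. h (card C)) \<rho> (A - ?C)"
      by (rule orbprod_Un) (use less.prems(1) inv less.prems(3)[OF a] in auto)
    moreover have "?C \<union> (A - ?C) = A" using CA by blast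
    moreover have "orbprod (\<lambda>C. h (card C)) \<rho> ?C = h (card ?C)"
    proof -
      have "forb \<rho> ` ?C = {?C}" using forbC by auto
      then show ?thesis by (simp add: orbprod_def)
    qed
    ultimately have op: "orbprod (\<lambda>C. h (card C)) \<rho> A =
        h (card ?C) * orbprod (\<lambda>C. h (card C)) \<rho> (A - ?C)" by simp
    have cA: "card A = card ?C + card (A - ?C)"
      using card_Diff_subset[of ?C A] CA card_mono[OF less.prems(1) CA] by simp
    show ?thesis
    proof (cases "\<rho> a = a")
      case True
      then have "{x \<in> A. \<rho> x = x} = insert a {x \<in> A - ?C. \<rho> x = x}" using a by auto
      then have "card {x \<in> A. \<rho> x = x} = Suc (card {x \<in> A - ?C. \<rho> x = x})"
        using less.prems(1) by simp
      then show ?thesis using True q op cA by (intro exI[of _ q]) (simp add: ac_simps)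
    next
      case False
      then have "{x \<in> A. \<rho> x = x} = {x \<in> A - ?C. \<rho> x = x}" using less.prems(3)[OF a] by auto
      then show ?thesis using False q op cA by (intro exI[of _ "Suc q"]) (simp add: numeral_2_eq_2 ac_simps)
    qed
  qed
qed

text \<open>The condition is that \<open>2 * i\<close> be congruent to \<open>j\<close> modulo
  \<open>n\<close>, and \<open>2 * i\<close> stays below \<open>2 * n\<close>.\<close>

lemma reflection_fixed:
  assumes "i < n" "j < n"
  shows "dih n j True i = i \<longleftrightarrow> 2 * i = j \<or> 2 * i = j + n"
proof (cases "j < i")
  case True
  then have "j + (n - i) < n" using assms by linarith
  then show ?thesis using assms True by (simp add: dih_def) linarith
next
  case False
  then have e: "j + (n - i) = (j - i) + n" and l: "j - i < n" using assms by linarith+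
  have "dih n j True i = j - i" using assms(1) l by (simp add: dih_def e)
  then show ?thesis using assms False by linarith
qed

text \<open>For odd \<open>n\<close> exactly one of \<open>j\<close> and \<open>j + n\<close> is
  even. For even \<open>n\<close> both have the parity of \<open>j\<close>, so the axis passes
  through two vertices or through none.\<close>

lemma card_reflection_fixed:
  assumes "j < n"
  shows "card {i \<in> {..<n}. dih n j True i = i} = (if odd n then 1 else if even j then 2 else 0)"
proof -
  have eq: "{i \<in> {..<n}. dih n j True i = i} = {i. i < n \<and> (2 * i = j \<or> 2 * i = j + n)}"
    using reflection_fixed[OF _ assms] by auto
  consider "odd n" "even j" | "odd n" "odd j" | "even n" "even j" | "even n" "odd j" by blast
  then show ?thesis
  proof cases
    case 1
    then obtain a where "j = 2 * a" by blast
    then have "{i. i < n \<and> (2 * i = j \<or> 2 * i = j + n)} = {a}" using 1 assms by auto presburger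
    then show ?thesis using 1 eq by simp
  next
    case 2
    then have "even (j + n)" by simp
    then obtain a where a: "j + n = 2 * a" by blast
    then have "{i. i < n \<and> (2 * i = j \<or> 2 * i = j + n)} = {a}" using 2 assms by auto
    then show ?thesis using 2 eq by simp
  next
    case 3
    then obtain a k where ak: "j = 2 * a" "n = 2 * k" by blast
    then have "{i. i < n \<and> (2 * i = j \<or> 2 * i = j + n)} = {a, a + k}" using assms by auto
    then show ?thesis using 3 eq ak assms by simp
  next
    case 4
    then have "{i. i < n \<and> (2 * i = j \<or> 2 * i = j + n)} = {}" by auto presburger+
    then show ?thesis using 4 eq by simp
  qed
qed

lemma reflection_involution: "i < n \<Longrightarrow> dih n j True (dih n j True i) = i"
proof -
  assume i: "i < n"
  let ?a = "(j + (n - i)) mod n"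
  have a: "?a < n" using i by simp
  have "[j + (n - ?a) + ?a = i + ?a] (mod n)"
  proof -
    have "[i + ?a = i + (j + (n - i))] (mod n)" by (intro cong_add cong_refl) (simp add: cong_def)
    also have "i + (j + (n - i)) = j + n" using i by simp
    finally show ?thesis using a by (simp add: cong_sym)
  qed
  then have "[j + (n - ?a) = i] (mod n)" by (simp only: cong_add_rcancel_nat)
  then show ?thesis using i a by (simp add: dih_def cong_def)
qed

lemma orbprod_reflection:
  assumes "j < n"
  shows "orbprod (\<lambda>C. h (card C)) (dih n j True) {..<n} =
    (if odd n then h 1 * h 2 ^ (n div 2)
     else if even j then h 1 ^ 2 * h 2 ^ (n div 2 - 1) else h 2 ^ (n div 2))"
proof -
  let ?F = "{i \<in> {..<n}. dih n j True i = i}"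
  have im: "dih n j True ` {..<n} \<subseteq> {..<n}" using dih_lt by auto
  have "\<exists>q. card {..<n} = card ?F + 2 * q \<and>
      orbprod (\<lambda>C. h (card C)) (dih n j True) {..<n} = h 1 ^ card ?F * h 2 ^ q"
    by (rule orbprod_involution[OF finite_lessThan im]) (simp add: reflection_involution)
  then obtain q where q: "n = card ?F + 2 * q"
    "orbprod (\<lambda>C. h (card C)) (dih n j True) {..<n} = h 1 ^ card ?F * h 2 ^ q"
    unfolding card_lessThan by blast
  note c = card_reflection_fixed[OF assms]
  show ?thesis
  proof (cases "odd n")
    case True
    then have "q = n div 2" using q(1) c by simp
    then show ?thesis using q(2) c True by simp
  next
    case False
    then have "q = (if even j then n div 2 - 1 else n div 2)" using q(1) c by auto
    then show ?thesis using q(2) c False by simp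
  qed
qed

text \<open>The product of a reflection with one rotation step is the reflection with
  \<open>j\<close> lowered by one, written with \<open>n - 1\<close> to stay in the natural numbers.
  This is how a reflection acts on the edges of the cycle.\<close>

lemma reflection_rot:
  assumes "i < n"
  shows "(dih n j True \<circ> rot n) i = dih n ((j + (n - 1)) mod n) True i"
proof -
  have r: "dih n ((j + (n - 1)) mod n) True i = (j + (n - 1) + (n - i)) mod n"
    unfolding dih_def using assms by (simp only: if_True mod_add_left_eq)
  show ?thesis
  proof (cases "Suc i < n")
    case True
    have "j + (n - Suc i) + n = j + (n - 1) + (n - i)" using True by linarith
    then have "(j + (n - Suc i)) mod n = (j + (n - 1) + (n - i)) mod n"
      by (metis mod_add_self2)
    moreover have "(dih n j True \<circ> rot n) i = (j + (n - Suc i)) mod n" using True by (simp add: dih_def)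
    ultimately show ?thesis using r by simp
  next
    case False
    then have n: "n = Suc i" using assms by simp
    have "(dih n j True \<circ> rot n) i = (j + n) mod n" using n by (simp add: dih_def)
    moreover have "j + (n - 1) + (n - i) = j + n" using n by simp
    ultimately show ?thesis unfolding r by (simp only:)
  qed
qed

section \<open>The sums over the rotations and over the reflections\<close>

text \<open>Rotations permute vertices and edges of the cycle alike. For each of the
  \<open>gcd j n\<close> orbits the edges give -(-1)^d and the hairs minus a power sum, so the two
  minus signs cancel.\<close>

lemma dpoly_rotation:
  assumes n: "n > 0"
  shows "dpoly n r m d j False = ((- 1) ^ d * pwr r m (n div gcd j n)) ^ gcd j n"
proof -
  have s: "psign (int d - 1) = - psign (int d)" by (simp add: psign_def)
  have "orbprod (\<lambda>_. psign (int d - 1)) (dih n j False \<circ> id) {..<n} = psign (int d - 1) ^ gcd j n"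
    using orbprod_rotation[OF n, of "\<lambda>_. psign (int d - 1)" j] by simp
  moreover have "psign (int d * (of_bool False * int n)) = 1" by (simp add: psign_def)
  ultimately have "dpoly n r m d j False =
      (- cst (psign (int d))) ^ gcd j n * (- pwr r m (n div gcd j n)) ^ gcd j n"
    unfolding dpoly_def if_False orbprod_rotation[OF n, of "\<lambda>l. - pwr r m l"]
    by (simp only: s cst_power cst_neg mult_1_right)
  also have "\<dots> = ((- 1) ^ d * pwr r m (n div gcd j n)) ^ gcd j n"
    by (simp only: power_mult_distrib[symmetric] minus_mult_minus cst_psign)
  finally show ?thesis .
qed

text \<open>Here the totient enters: the residues modulo \<open>n\<close> whose gcd with
  \<open>n\<close> is \<open>n div l\<close> are the rotations of order \<open>l\<close>, and there
  are as many as the totient of \<open>l\<close>.\<close>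

lemma sum_gcd:
  fixes f :: "nat \<Rightarrow> 'a::comm_semiring_1"
  assumes n: "n > 0"
  shows "(\<Sum>j<n. f (gcd j n)) = (\<Sum>l | l dvd n. of_nat (totient l) * f (n div l))"
proof -
  \<comment> \<open>The residue 0 is represented by \<open>n\<close>, which has the same gcd with
    \<open>n\<close>, to obtain the range in which the totient counts.\<close>
  have "(\<Sum>j<n. f (gcd j n)) = (\<Sum>j\<in>{0<..n}. f (gcd j n))"
    by (rule sum.reindex_bij_witness[where i = "\<lambda>j. if j = n then 0 else j" and j = "\<lambda>j. if j = 0 then n else j"])
      (use n in \<open>auto split: if_splits\<close>)
  also have "\<dots> = (\<Sum>g | g dvd n. \<Sum>j\<in>{j \<in> {0<..n}. gcd j n = g}. f (gcd j n))"
    by (rule sum.group[symmetric]) (use n in auto)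
  also have "\<dots> = (\<Sum>g | g dvd n. of_nat (totient (n div g)) * f g)"
    using card_gcd_eq_totient[OF n] by (intro sum.cong) auto
  also have "\<dots> = (\<Sum>l | l dvd n. of_nat (totient l) * f (n div l))"
    by (rule sum.reindex_bij_witness[where i = "\<lambda>l. n div l" and j = "\<lambda>l. n div l"])
      (use n in \<open>auto simp: div_dvd_iff_mult elim!: dvdE\<close>)
  finally show ?thesis .
qed

lemma sum_dpoly_rotation:
  assumes "n > 0"
  shows "(\<Sum>j<n. dpoly n r m d j False) =
    (\<Sum>l | l dvd n. of_nat (totient l) * ((- 1) ^ d * pwr r m l) ^ (n div l))"
proof -
  have "(\<Sum>j<n. dpoly n r m d j False) =
      (\<Sum>l | l dvd n. of_nat (totient l) * ((- 1) ^ d * pwr r m (n div (n div l))) ^ (n div l))"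
    unfolding dpoly_rotation[OF assms] by (rule sum_gcd[OF assms])
  also have "\<dots> = (\<Sum>l | l dvd n. of_nat (totient l) * ((- 1) ^ d * pwr r m l) ^ (n div l))"
    using assms by (intro sum.cong refl) (auto elim!: dvdE)
  finally show ?thesis .
qed

text \<open>On an even cycle a reflection whose axis passes through two vertices fixes no edge, and
  conversely. This is the shift by one between vertices and edges seen modulo 2.\<close>

lemma reflection_parity:
  fixes j n :: nat
  assumes "j < n" "even n"
  shows "even ((j + (n - 1)) mod n) \<longleftrightarrow> odd j"
proof -
  have "even ((j + (n - 1)) mod n) \<longleftrightarrow> even (j + (n - 1))"
    using assms(2) by (rule dvd_mod_iff)
  moreover have "even (j + (n - 1)) \<longleftrightarrow> odd j" using assms by presburger
  ultimately show ?thesis by blast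
qed

text \<open>Pairs of hairs exchanged by the reflection give the second power sum, fixed ones the
  first. For odd \<open>n\<close> vertices and edges have the same orbit lengths, and the factor
  (-1)^(dn) from the reversed edges removes the sign of the fixed edge. For even \<open>n\<close>
  the two kinds of elements have different numbers of orbits, which leaves -(-1)^d.\<close>

lemma dpoly_reflection:
  assumes j: "j < n"
  shows "dpoly n r m d j True = (if odd n then pwr r m 1 * ((- 1) ^ d * pwr r m 2) ^ (n div 2)
     else if even j then - ((- 1) ^ d) * (pwr r m 1)\<^sup>2 * ((- 1) ^ d * pwr r m 2) ^ (n div 2 - 1)
     else - ((- 1) ^ d) * ((- 1) ^ d * pwr r m 2) ^ (n div 2))"
proof -
  let ?s = "psign (int d - 1)" and ?j = "(j + (n - 1)) mod n"
  have j': "?j < n" using j by simp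
  have im: "dih n ?j True ` {..<n} \<subseteq> {..<n}" using dih_lt by auto
  have "orbprod (\<lambda>_. ?s) (dih n j True \<circ> rot n) {..<n} = orbprod (\<lambda>_. ?s) (dih n ?j True) {..<n}"
    by (rule orbprod_cong[OF im]) (use reflection_rot in auto)
  also have "\<dots> = (if odd n then ?s * ?s ^ (n div 2)
     else if even ?j then ?s ^ 2 * ?s ^ (n div 2 - 1) else ?s ^ (n div 2))"
    by (rule orbprod_reflection[OF j'])
  finally have D: "dpoly n r m d j True =
      cst ((if odd n then ?s * ?s ^ (n div 2)
        else if even ?j then ?s ^ 2 * ?s ^ (n div 2 - 1) else ?s ^ (n div 2)) * psign (int d * int n)) *
      (if odd n then - pwr r m 1 * (- pwr r m 2) ^ (n div 2)
       else if even j then (- pwr r m 1) ^ 2 * (- pwr r m 2) ^ (n div 2 - 1) else (- pwr r m 2) ^ (n div 2))"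
    unfolding dpoly_def orbprod_reflection[OF j, of "\<lambda>l. - pwr r m l"] by simp
  let ?e = "(- 1) ^ d :: qpoly" and ?p = "pwr r m 1" and ?q = "pwr r m 2"
  have s: "cst ?s = - ?e"
  proof -
    have "?s = - psign (int d)" by (simp add: psign_def)
    then show ?thesis by (simp only: cst_neg cst_psign)
  qed
  have e: "?e * ?e = 1" by (simp flip: power_mult_distrib)
  have uv: "(- ?e) ^ k * (- ?q) ^ k = (?e * ?q) ^ k" for k
    by (simp only: power_mult_distrib[symmetric] minus_mult_minus)
  show ?thesis
  proof (cases "odd n")
    case True
    have gen: "(- e) * u * e * (- p * v) = (e * e) * p * (u * v)" for e p u v :: qpoly
      by (simp add: algebra_simps)
    have "psign (int d * int n) = psign (int d)" using True by (simp add: psign_def)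
    then have "dpoly n r m d j True = (- ?e) * (- ?e) ^ (n div 2) * ?e * (- ?p * (- ?q) ^ (n div 2))"
      unfolding D using True by (simp only: if_True not_False_eq_True cst_mult cst_power s cst_psign)
    then show ?thesis unfolding gen e uv using True by simp
  next
    case ev: False
    then obtain k where k: "n div 2 = Suc k" using j by (cases "n div 2") auto
    have p: "psign (int d * int n) = 1" using ev by (simp add: psign_def)
    have par: "even ?j \<longleftrightarrow> odd j" by (rule reflection_parity[OF j]) (use ev in simp)
    show ?thesis
    proof (cases "even j")
      case True
      have gen: "(- e) * u * ((- p) ^ 2 * v) = (- e) * p\<^sup>2 * (u * v)" for e p u v :: qpoly
        by (simp add: algebra_simps)
      have "dpoly n r m d j True = (- ?e) * (- ?e) ^ k * ((- ?p) ^ 2 * (- ?q) ^ k)"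
        unfolding D p k using par ev True
        by (simp only: if_True if_False not_False_eq_True not_True_eq_False cst_mult cst_power s single_one
            mult_1_right power_Suc diff_Suc_1)
      then show ?thesis unfolding gen uv using ev True k by simp
    next
      case False
      have gen: "(- e) ^ 2 * u * (- q * v) = (- e) * (e * q * (u * v))" for e q u v :: qpoly
        by (simp add: algebra_simps power2_eq_square)
      have "dpoly n r m d j True = (- ?e) ^ 2 * (- ?e) ^ k * (- ?q * (- ?q) ^ k)"
        unfolding D p k using par ev False
        by (simp only: if_True if_False not_False_eq_True not_True_eq_False cst_mult cst_power s single_one
            mult_1_right power_Suc diff_Suc_1)
      then show ?thesis unfolding gen uv using ev False k by simp
    qed
  qed
qed

text \<open>For odd \<open>n\<close> all reflections contribute equally. For even \<open>n\<close>
  the two kinds occur \<open>n / 2\<close> times each, and their average brings in the factor 1/2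
  and the sum of the squared first power sum with the second one.\<close>

lemma sum_dpoly_reflection:
  assumes n: "n > 0"
  shows "(\<Sum>j<n. dpoly n r m d j True) = of_nat n *
    (if odd n then pwr r m 1 * ((- 1) ^ d * pwr r m 2) ^ (n div 2)
     else - cst (1 / 2) * (- 1) ^ d * ((pwr r m 1)\<^sup>2 + (- 1) ^ d * pwr r m 2) *
       ((- 1) ^ d * pwr r m 2) ^ (n div 2 - 1))"
proof (cases "odd n")
  case True
  then show ?thesis by (simp add: dpoly_reflection)
next
  case ev: False
  then obtain k where k: "n = 2 * Suc k" using n by (metis evenE mult_0_right not0_implies_Suc not_less_zero)
  let ?a = "- ((- 1) ^ d) * (pwr r m 1)\<^sup>2 * ((- 1) ^ d * pwr r m 2) ^ k :: qpoly"
  let ?b = "- ((- 1) ^ d) * ((- 1) ^ d * pwr r m 2) ^ Suc k :: qpoly"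
  have split: "(\<Sum>j<2 * l. if even j then a else b) = of_nat l * (a + b)" for l and a b :: qpoly
    by (induction l) (simp_all add: algebra_simps)
  have half: "of_nat n * cst (1 / 2) = of_nat (Suc k)"
  proof -
    have "of_nat n * cst (1 / 2) = cst (of_nat n * (1 / 2))"
      by (simp only: single_of_nat[symmetric] cst_mult)
    also have "of_nat n * (1 / 2 :: rat) = of_nat (Suc k)" unfolding k by simp
    finally show ?thesis by (simp only: single_of_nat)
  qed
  have "(\<Sum>j<n. dpoly n r m d j True) = (\<Sum>j<n. if even j then ?a else ?b)"
    using ev k by (intro sum.cong refl) (simp add: dpoly_reflection)
  also have "\<dots> = of_nat n * cst (1 / 2) * (?a + ?b)"
    unfolding half unfolding k by (rule split)
  also have "\<dots> = of_nat n * (- cst (1 / 2) * (- 1) ^ d * ((pwr r m 1)\<^sup>2 + (- 1) ^ d * pwr r m 2) *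
       ((- 1) ^ d * pwr r m 2) ^ k)"
    by (simp add: algebra_simps)
  also have "k = n div 2 - 1" using k by simp
  finally show ?thesis using ev by simp
qed

section \<open>The coefficients of the generating function\<close>

text \<open>Substituting a constant times the \<open>l\<close>-th power of the variable spreads the
  coefficients out over the multiples of \<open>l\<close>.\<close>

lemma fps_compose_monom_nth:
  fixes a :: "'a::comm_ring_1"
  assumes l: "l > 0"
  shows "fps_nth (f oo (fps_const a * fps_X ^ l)) n =
    (if l dvd n then fps_nth f (n div l) * a ^ (n div l) else 0)"
proof -
  have pw: "fps_nth ((fps_const a * fps_X ^ l) ^ i) n = (if n = l * i then a ^ i else 0)" for i
    by (simp add: power_mult_distrib flip: power_mult)
  have "fps_nth (f oo (fps_const a * fps_X ^ l)) n = (\<Sum>i\<in>{0..n}. if n = l * i then fps_nth f i * a ^ i else 0)"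
    unfolding fps_compose_nth pw by (intro sum.cong) auto
  also have "\<dots> = (\<Sum>i\<in>{0..n}. if i = n div l \<and> l dvd n then fps_nth f i * a ^ i else 0)"
    using l by (intro sum.cong refl if_cong) auto
  also have "\<dots> = (if l dvd n then fps_nth f (n div l) * a ^ (n div l) else 0)"
    by (cases "l dvd n") simp_all
  finally show ?thesis .
qed

lemma fps_neg_one_power: "(- 1 :: 'a::comm_ring_1 fps) ^ d = fps_const ((- 1) ^ d)"
proof -
  have "(- 1 :: 'a fps) = fps_const (- 1)" by (simp flip: fps_const_neg)
  then show ?thesis by simp
qed

lemma psum_pwr: "psum r m l = fps_const (pwr r m l)"
  by (simp only: psum_def pwr_def)

lemma fps_ln_1_minus_nth:
  assumes l: "l > 0"
  shows "fps_nth (fps_ln_1_minus ((- 1) ^ d * fps_X ^ l * psum r m l)) n =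
    (if l dvd n \<and> n > 0 then - (cst (1 / of_nat (n div l)) * ((- 1) ^ d * pwr r m l) ^ (n div l)) else 0)"
proof -
  let ?a = "(- 1) ^ d * pwr r m l" and ?k = "n div l"
  have w: "- ((- 1) ^ d * fps_X ^ l * psum r m l) = fps_const (- ?a) * fps_X ^ l"
    by (simp add: psum_pwr fps_neg_one_power ac_simps flip: fps_const_neg fps_const_mult)
  have "cst (fps_nth (fps_ln 1) ?k) * (- ?a) ^ ?k = - (cst (1 / of_nat ?k) * ?a ^ ?k)" if pos: "?k > 0"
  proof -
    obtain i where i: "?k = Suc i" using gr0_implies_Suc[OF pos] by blast
    have "fps_nth (fps_ln 1) ?k = (- 1) ^ i * (1 / of_nat ?k :: rat)" unfolding i fps_ln_nth by simp
    then have "cst (fps_nth (fps_ln 1) ?k) = (- 1) ^ i * cst (1 / of_nat ?k)"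
      by (simp only: cst_mult cst_power cst_neg single_one)
    moreover have "(- ?a) ^ ?k = (- 1) ^ ?k * ?a ^ ?k" by (rule power_minus)
    moreover have "(x * c) * (y * b) = (x * y) * (c * b)" for x y b c :: qpoly by (simp only: ac_simps)
    moreover have "(- 1 :: qpoly) ^ i * (- 1) ^ ?k = - 1" unfolding i by (simp flip: power_mult_distrib)
    ultimately show ?thesis by (simp only: mult_minus_left mult_1_left)
  qed
  moreover have "?k > 0 \<longleftrightarrow> n > 0" if "l dvd n" using that l by (auto elim!: dvdE)
  ultimately show ?thesis
    unfolding fps_ln_1_minus_def w fps_compose_monom_nth[OF l] by auto
qed

lemma fps_geom_nth:
  "fps_nth (fps_geom ((- 1) ^ d * fps_X\<^sup>2 * psum r m 2)) n =
    (if even n then ((- 1) ^ d * pwr r m 2) ^ (n div 2) else 0)"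
proof -
  have w: "(- 1) ^ d * fps_X\<^sup>2 * psum r m 2 = fps_const ((- 1) ^ d * pwr r m 2) * fps_X ^ 2"
    by (simp add: psum_pwr fps_neg_one_power ac_simps flip: fps_const_mult)
  show ?thesis unfolding fps_geom_def w by (subst fps_compose_monom_nth) simp_all
qed

text \<open>A divisor \<open>l\<close> of \<open>n\<close> meets the coefficient of the logarithm at
  \<open>n div l\<close>, and the product of 1/l and 1/(n/l) is 1/n for every such \<open>l\<close>.
  Only the terms with \<open>l\<close> dividing \<open>n\<close> reach the coefficient, so the
  infinite sum is finite in each degree.\<close>

lemma log_series_nth:
  "fps_nth (suminf (\<lambda>k. let l = Suc k in qconst (of_nat (totient l) / of_nat l) *
      fps_ln_1_minus ((- 1) ^ d * fps_X ^ l * psum r m l))) n =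
    - (\<Sum>l | l dvd n \<and> n > 0. cst (of_nat (totient l) / of_nat n) * ((- 1) ^ d * pwr r m l) ^ (n div l))"
proof -
  define T where "T k = (let l = Suc k in qconst (of_nat (totient l) / of_nat l) *
      fps_ln_1_minus ((- 1) ^ d * fps_X ^ l * psum r m l))" for k
  have T: "fps_nth (T k) n = (if Suc k dvd n \<and> n > 0 then
      - (cst (of_nat (totient (Suc k)) / of_nat n) * ((- 1) ^ d * pwr r m (Suc k)) ^ (n div Suc k)) else 0)" for k n
  proof -
    have "of_nat (totient (Suc k)) / of_nat (Suc k) * (1 / of_nat (n div Suc k)) =
        (of_nat (totient (Suc k)) / of_nat n :: rat)" if "Suc k dvd n"
    proof -
      have "of_nat (Suc k) * of_nat (n div Suc k) = (of_nat n :: rat)"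
        using that by (simp only: of_nat_mult[symmetric] dvd_mult_div_cancel)
      then show ?thesis by (simp only: times_divide_times_eq mult_1_right)
    qed
    then have H: "cst (of_nat (totient (Suc k)) / of_nat (Suc k)) * (cst (1 / of_nat (n div Suc k)) * q) =
        cst (of_nat (totient (Suc k)) / of_nat n) * q" if "Suc k dvd n" for q
      using that by (simp only: mult.assoc[symmetric] cst_mult[symmetric])
    then show ?thesis
      unfolding T_def Let_def qconst_def fps_mult_left_const_nth fps_ln_1_minus_nth[OF zero_less_Suc]
      by (cases "Suc k dvd n \<and> n > 0") (simp_all only: simp_thms if_True if_False mult_minus_right mult_zero_right H)
  qed
  have "T sums Abs_fps (\<lambda>n. \<Sum>l\<le>n. fps_nth (T l) n)"
    by (rule fps_sums_subdegree) (auto simp: T dest: dvd_imp_le)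
  then have "fps_nth (suminf T) n = (\<Sum>k\<le>n. fps_nth (T k) n)" by (simp add: sums_iff)
  also have "\<dots> = - (\<Sum>l | l dvd n \<and> n > 0. cst (of_nat (totient l) / of_nat n) * ((- 1) ^ d * pwr r m l) ^ (n div l))"
  proof (cases "n > 0")
    case True
    have "(\<Sum>k\<le>n. fps_nth (T k) n) = (\<Sum>k\<in>{k. Suc k dvd n}. fps_nth (T k) n)"
      by (rule sum.mono_neutral_right) (auto simp: T dest: dvd_imp_le[OF _ True])
    also have "\<dots> = (\<Sum>l | l dvd n. - (cst (of_nat (totient l) / of_nat n) * ((- 1) ^ d * pwr r m l) ^ (n div l)))"
    proof (rule sum.reindex_bij_witness[where i = "\<lambda>l. l - 1" and j = Suc])
      show "Suc (l - 1) = l" "l - 1 \<in> {k. Suc k dvd n}" if "l \<in> {l. l dvd n}" for l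
        using that True by (cases l; simp)+
    qed (use True in \<open>auto simp: T\<close>)
    finally show ?thesis using True by (simp add: sum_negf)
  qed (simp add: T)
  finally show ?thesis unfolding T_def .
qed

text \<open>The geometric series is even in u, so the term linear in u produces the odd coefficients
  and the quadratic terms the even ones. In the linear term the sign squares to 1 and 2/4 is the 1/2
  common to all reflections; in the quadratic terms 1/4 splits into this 1/2 and the 1/2 from the
  two kinds of reflections.\<close>

lemma rational_part_nth:
  "fps_nth ((- 1) ^ (d + 1) * qconst (1 / 4) *
     (fps_X\<^sup>2 * (psum r m 1)\<^sup>2 + (- 1) ^ d * fps_X\<^sup>2 * psum r m 2 - 2 * (- 1) ^ d * fps_X * psum r m 1) *
     fps_geom ((- 1) ^ d * fps_X\<^sup>2 * psum r m 2)) n =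
   (if n = 0 then 0 else cst (1 / 2) *
    (if odd n then pwr r m 1 * ((- 1) ^ d * pwr r m 2) ^ (n div 2)
     else - cst (1 / 2) * (- 1) ^ d * ((pwr r m 1)\<^sup>2 + (- 1) ^ d * pwr r m 2) *
       ((- 1) ^ d * pwr r m 2) ^ (n div 2 - 1)))"
proof -
  let ?e = "(- 1) ^ d :: qpoly"
  let ?G = "fps_geom ((- 1) ^ d * fps_X\<^sup>2 * psum r m 2)"
  let ?A = "- (?e * cst (1 / 4)) * ((pwr r m 1)\<^sup>2 + ?e * pwr r m 2)" and ?B = "cst (1 / 2) * pwr r m 1"
  have c: "2 * cst (1 / 4) = cst (1 / 2)"
  proof -
    have "2 * cst (1 / 4) = cst (2 * (1 / 4))" by (simp only: cst_mult single_numeral)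
    then show ?thesis by simp
  qed
  have e: "?e * ?e = 1" by (simp flip: power_mult_distrib)
  have "(- 1) ^ (d + 1) * qconst (1 / 4) *
     (fps_X\<^sup>2 * (psum r m 1)\<^sup>2 + (- 1) ^ d * fps_X\<^sup>2 * psum r m 2 - 2 * (- 1) ^ d * fps_X * psum r m 1) * ?G =
     fps_X ^ 2 * (fps_const ?A * ?G) + fps_X * (fps_const ?B * ?G)"
  proof -
    have B: "fps_const ?B = fps_const ?e * fps_const ?e * 2 * fps_const (cst (1 / 4)) * fps_const (pwr r m 1)"
      unfolding c[symmetric] numeral_fps_const by (simp add: e)
    have A: "fps_const ?A = - (fps_const ?e * fps_const (cst (1 / 4))) *
        ((fps_const (pwr r m 1))\<^sup>2 + fps_const ?e * fps_const (pwr r m 2))"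
      by simp
    show ?thesis unfolding A B psum_pwr qconst_def fps_neg_one_power power_add power_one_right
      by (simp add: algebra_simps power2_eq_square del: fps_const_mult fps_const_neg fps_const_add fps_const_sub fps_const_power)
  qed
  then have "fps_nth ((- 1) ^ (d + 1) * qconst (1 / 4) *
     (fps_X\<^sup>2 * (psum r m 1)\<^sup>2 + (- 1) ^ d * fps_X\<^sup>2 * psum r m 2 - 2 * (- 1) ^ d * fps_X * psum r m 1) * ?G) n =
     (if n < 2 then 0 else ?A * fps_nth ?G (n - 2)) + (if n = 0 then 0 else ?B * fps_nth ?G (n - 1))"
    by (simp only: fps_add_nth fps_X_power_mult_nth fps_X_mult_nth fps_mult_left_const_nth)
  also have "\<dots> = (if n = 0 then 0 else cst (1 / 2) *
    (if odd n then pwr r m 1 * (?e * pwr r m 2) ^ (n div 2)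
     else - cst (1 / 2) * ?e * ((pwr r m 1)\<^sup>2 + ?e * pwr r m 2) * (?e * pwr r m 2) ^ (n div 2 - 1)))"
  proof -
    consider "n = 0" | k where "n = 2 * k + 1" | k where "n = 2 * Suc k"
      by (metis evenE mult_0_right not0_implies_Suc oddE)
    then show ?thesis
    proof cases
      case 3
      have q: "cst (1 / 2) * cst (1 / 2) = cst (1 / 4)" by (simp flip: cst_mult)
      have A: "?A = cst (1 / 2) * (- cst (1 / 2) * ?e * ((pwr r m 1)\<^sup>2 + ?e * pwr r m 2))"
        unfolding q[symmetric] by (simp only: mult_minus_left mult_minus_right mult.assoc mult.commute mult.left_commute)
      have n: "n \<noteq> 0" "\<not> n < 2" "even n" "n div 2 - 1 = k" using 3 by simp_all
      have g: "fps_nth ?G (n - 2) = (?e * pwr r m 2) ^ k" "fps_nth ?G (n - 1) = 0"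
        using 3 by (simp_all add: fps_geom_nth)
      show ?thesis unfolding g A using n
        by (simp only: if_False not_True_eq_False mult_zero_right add_0_right mult.assoc)
    next
      case 2
      have z: "(if n < 2 then 0 else ?A * fps_nth ?G (n - 2)) = 0"
      proof (cases k)
        case (Suc i)
        then have "fps_nth ?G (n - 2) = 0" using 2 by (simp add: fps_geom_nth)
        then show ?thesis by (simp only: mult_zero_right if_cancel)
      qed (use 2 in simp)
      have g: "fps_nth ?G (n - 1) = (?e * pwr r m 2) ^ k" using 2 by (simp add: fps_geom_nth)
      show ?thesis unfolding z g using 2 by (simp add: mult.assoc)
    qed simp
  qed
  finally show ?thesis .
qed

theorem theorem2p8:
  fixes r d :: nat and m :: "nat \<Rightarrow> nat"
  assumes "r \<ge> 1" and "\<forall>i\<in>{1..r}. m i \<ge> 1" and "d \<ge> 2"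
  shows "is_gen_fun (\<lambda>s t. hairy_euler r m d 1 s t)
    (- qconst (1 / 2) *
       suminf (\<lambda>k. let l = Suc k in
          qconst (of_nat (totient l) / of_nat l) *
          fps_ln_1_minus ((- 1) ^ d * fps_X ^ l * psum r m l))
     + (- 1) ^ (d + 1) * qconst (1 / 4) *
       (fps_X\<^sup>2 * (psum r m 1)\<^sup>2 + (- 1) ^ d * fps_X\<^sup>2 * psum r m 2
        - 2 * (- 1) ^ d * fps_X * psum r m 1) *
       fps_geom ((- 1) ^ d * fps_X\<^sup>2 * psum r m 2))"
    (is "is_gen_fun _ (- _ * ?S + ?R)")
  unfolding is_gen_fun_def
proof (intro allI)
  fix s t
  let ?L = "\<Sum>l | l dvd t. of_nat (totient l) * ((- 1) ^ d * pwr r m l) ^ (t div l) :: qpoly"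
  show "Poly_Mapping.lookup (fps_nth (- qconst (1 / 2) * ?S + ?R) t) s =
      of_int (hairy_euler r m d 1 (Poly_Mapping.lookup s) t)"
  \<comment> \<open>Without hairs both sides vanish: the series has no constant term, and the other
    side is a division by zero.\<close>
  proof (cases "t = 0")
    case True
    have "fps_nth (- qconst (1 / 2) * ?S + ?R) 0 = 0"
      unfolding qconst_def fps_const_neg fps_add_nth fps_mult_left_const_nth rational_part_nth[unfolded qconst_def]
        log_series_nth[unfolded qconst_def] by simp
    then show ?thesis unfolding hairy_euler_words True by (simp only: of_nat_0 mult_zero_right div_0 lookup_zero division_ring_divide_zero)
  next
    case False
    then have pos: "t > 0" by simp
    \<comment> \<open>There are \<open>t\<close> reflections, so 1/(2t) leaves the common factor 1/2
      of the rational part.\<close>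
    have cf: "cst (1 / of_nat (2 * t)) * of_nat t = cst (1 / 2)"
      using False by (simp only: single_of_nat[symmetric] cst_mult[symmetric]) simp
    \<comment> \<open>For the rotations the 1/t is already contained in the coefficients of the
      logarithms, and the 1/2 in front completes it to 1/(2t).\<close>
    have lp: "cst (1 / 2) * (cst (of_nat (totient l) / of_nat t) * q) =
        cst (1 / of_nat (2 * t)) * (of_nat (totient l) * q)" for l q
    proof -
      have "cst (1 / 2) * cst (of_nat (totient l) / of_nat t) = cst (1 / of_nat (2 * t)) * of_nat (totient l)"
        by (simp only: single_of_nat[symmetric] cst_mult[symmetric]) simp
      then show ?thesis by (simp only: mult.assoc[symmetric])
    qed
    have "fps_nth (- qconst (1 / 2) * ?S + ?R) t = cst (1 / of_nat (2 * t)) *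
        ((\<Sum>j<t. dpoly t r m d j False) + (\<Sum>j<t. dpoly t r m d j True))"
    proof -
      have "fps_nth (- qconst (1 / 2) * ?S) t = cst (1 / of_nat (2 * t)) * ?L"
        unfolding qconst_def fps_const_neg fps_mult_left_const_nth log_series_nth[unfolded qconst_def]
        using False by (simp add: sum_distrib_left lp sum_negf)
      then show ?thesis
        unfolding fps_add_nth rational_part_nth sum_dpoly_rotation[OF pos]
          sum_dpoly_reflection[OF pos] distrib_left mult.assoc[symmetric] cf
        using False by simp
    qed
    then show ?thesis unfolding hairy_euler_words word_sum_lookup
      by (simp only: lookup_cst_mult of_nat_mult of_nat_numeral times_divide_eq_left mult_1_left)
  qed
qed

end
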